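(* Let $\gamma\in(0,1)$ and consider on $\mathbb{R}^2$ with the Euclidean metric the magnetic potential $$A=-\frac{y}{(1+\rho)^\gamma}\,dx+\frac{x}{(1+\rho)^\gamma}\,dy,\qquad \rho=\rho(x,y)=(x^2+y^2)^{1/2}.$$ Then the magnetic Dirac operator $D_A=D+\mathrm{i}A\cdot$ has pure point spectrum which is dense in $\mathbb{R}$.
   Context: $D$ is the classical Dirac operator on $\mathbb{R}^2$ acting on $\mathbb{C}^2$-valued functions (spinors), $D\phi=e_1\cdot\partial_x\phi+e_2\cdot\partial_y\phi$, where $e_1\cdot,e_2\cdot$ are skew-Hermitian $2\times2$ complex matrices satisfying $e_i\cdot e_j\cdot+e_j\cdot e_i\cdot=-2\delta_{ij}$ and normalized so that $\mathrm{i}\,e_1\cdot e_2\cdot=\operatorname{diag}(1,-1)$. A one-form $A=A_1\,dx+A_2\,dy$ acts by Clifford multiplication as $A\cdot\phi=A_1e_1\cdot\phi+A_2e_2\cdot\phi$. $D_A$ is regarded as a self-adjoint operator in $L^2(\mathbb{R}^2,\mathbb{C}^2)$, namely the closure of $D+\mathrm{i}A\cdot$ on $C_c^\infty(\mathbb{R}^2,\mathbb{C}^2)$. "Pure point spectrum which is dense in $\mathbb{R}$" means that $L^2(\mathbb{R}^2,\mathbb{C}^2)$ has an orthonormal basis of eigenfunctions of $D_A$ and that the set of eigenvalues of $D_A$ is dense in $\mathbb{R}$. *)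

theory Defs
  imports "HOL-Analysis.Analysis"
begin

type_synonym spinor_field = "real^2 \<Rightarrow> complex^2"

section \<open>The Hilbert space of square integrable spinor fields\<close>

text \<open>Elements of the Hilbert space are represented by functions; two functions represent the same
  element iff they agree almost everywhere, i.e. iff their difference has \<open>l2_norm\<close> zero.\<close>

definition l2_space :: "spinor_field set" where
  "l2_space = {\<psi>. \<psi> \<in> borel_measurable lborel \<and> integrable lborel (\<lambda>p. (norm (\<psi> p))\<^sup>2)}"

definition l2_inner :: "spinor_field \<Rightarrow> spinor_field \<Rightarrow> complex" where
  "l2_inner \<phi> \<psi> = (LINT p|lborel. (\<Sum>i\<in>UNIV. \<phi> p $ i * cnj (\<psi> p $ i)))"

definition l2_norm :: "spinor_field \<Rightarrow> real" where
  "l2_norm \<psi> = sqrt (LINT p|lborel. (norm (\<psi> p))\<^sup>2)"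

definition l2_tendsto :: "(nat \<Rightarrow> spinor_field) \<Rightarrow> spinor_field \<Rightarrow> bool" where
  "l2_tendsto \<phi> \<psi> \<longleftrightarrow> (\<forall>n. \<phi> n \<in> l2_space) \<and> \<psi> \<in> l2_space \<and>
     (\<lambda>n. l2_norm (\<lambda>p. \<phi> n p - \<psi> p)) \<longlonglongrightarrow> 0"

text \<open>Distinct members of \<open>B\<close> are orthogonal unit vectors, so \<open>B\<close> contains at most one
  representative of each element of the Hilbert space. Completeness says that the complex linear
  span of \<open>B\<close> is dense.\<close>

definition l2_orthonormal_basis :: "spinor_field set \<Rightarrow> bool" where
  "l2_orthonormal_basis B \<longleftrightarrow>
     B \<subseteq> l2_space \<and>
     (\<forall>\<phi>\<in>B. \<forall>\<psi>\<in>B. l2_inner \<phi> \<psi> = (if \<phi> = \<psi> then 1 else 0)) \<and>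
     (\<forall>\<psi>\<in>l2_space. \<forall>\<epsilon>>0. \<exists>F c. finite F \<and> F \<subseteq> B \<and>
        l2_norm (\<lambda>p. \<psi> p - (\<Sum>\<phi>\<in>F. c \<phi> *s \<phi> p)) < \<epsilon>)"

section \<open>Unbounded operators, given by their graphs\<close>

type_synonym l2_operator = "(spinor_field \<times> spinor_field) set"

definition l2_graph_closure :: "l2_operator \<Rightarrow> l2_operator" where
  "l2_graph_closure T = {(\<psi>, \<eta>). \<exists>X Y. (\<forall>n. (X n, Y n) \<in> T) \<and> l2_tendsto X \<psi> \<and> l2_tendsto Y \<eta>}"

definition eigenfunction :: "l2_operator \<Rightarrow> complex \<Rightarrow> spinor_field \<Rightarrow> bool" where
  "eigenfunction T z \<psi> \<longleftrightarrow> \<psi> \<in> l2_space \<and> l2_norm \<psi> \<noteq> 0 \<and> (\<psi>, \<lambda>p. z *s \<psi> p) \<in> T"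

definition eigenvalues :: "l2_operator \<Rightarrow> complex set" where
  "eigenvalues T = {z. \<exists>\<psi>. eigenfunction T z \<psi>}"

definition has_pure_point_spectrum :: "l2_operator \<Rightarrow> bool" where
  "has_pure_point_spectrum T \<longleftrightarrow>
     (\<exists>B. l2_orthonormal_basis B \<and> (\<forall>\<psi>\<in>B. \<exists>z. eigenfunction T z \<psi>))"

section \<open>Smooth compactly supported spinor fields\<close>

definition partial_deriv :: "2 \<Rightarrow> spinor_field \<Rightarrow> spinor_field" where
  "partial_deriv i \<phi> p = frechet_derivative \<phi> (at p) (axis i 1)"

fun continuously_differentiable :: "nat \<Rightarrow> spinor_field \<Rightarrow> bool" where
  "continuously_differentiable 0 \<phi> \<longleftrightarrow> continuous_on UNIV \<phi>"
| "continuously_differentiable (Suc k) \<phi> \<longleftrightarrow>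
     \<phi> differentiable_on UNIV \<and> (\<forall>i. continuously_differentiable k (partial_deriv i \<phi>))"

definition test_spinors :: "spinor_field set" where
  "test_spinors = {\<phi>. (\<forall>k. continuously_differentiable k \<phi>) \<and> compact (closure {p. \<phi> p \<noteq> 0})}"

section \<open>Magnetic Dirac operators\<close>

text \<open>\<open>e 1\<close> and \<open>e 2\<close> are the matrices of Clifford multiplication by the standard basis vectors.
  In the index type \<open>2\<close> the numerals \<open>1\<close> and \<open>2\<close> denote its two distinct elements.\<close>

definition clifford_matrices :: "(2 \<Rightarrow> complex^2^2) \<Rightarrow> bool" where
  "clifford_matrices e \<longleftrightarrow>
     (\<forall>i. (\<chi> j k. cnj (e i $ k $ j)) = - e i) \<and>
     (\<forall>i j. e i ** e j + e j ** e i = mat (if i = j then - 2 else 0)) \<and>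
     (\<chi> j k. \<i> * (e 1 ** e 2) $ j $ k) = vector [vector [1, 0], vector [0, - 1]]"

lemma clifford_matrices_exist: "\<exists>e. clifford_matrices e"
proof
  define e :: "2 \<Rightarrow> complex^2^2" where
    "e = (\<lambda>i. if i = 1 then vector [vector [0, \<i>], vector [\<i>, 0]]
              else vector [vector [0, 1], vector [- 1, 0]])"
  show "clifford_matrices e"
    unfolding clifford_matrices_def e_def
    by (auto simp: vec_eq_iff forall_2 matrix_matrix_mult_def sum_2 mat_def)
qed

definition clifford_mult :: "(2 \<Rightarrow> complex^2^2) \<Rightarrow> real^2 \<Rightarrow> complex^2 \<Rightarrow> complex^2" where
  "clifford_mult e a s = a $ 1 *\<^sub>R (e 1 *v s) + a $ 2 *\<^sub>R (e 2 *v s)"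

definition dirac :: "(2 \<Rightarrow> complex^2^2) \<Rightarrow> spinor_field \<Rightarrow> spinor_field" where
  "dirac e \<phi> p = e 1 *v partial_deriv 1 \<phi> p + e 2 *v partial_deriv 2 \<phi> p"

text \<open>A one-form is given by its coefficient vector with respect to \<open>dx\<close>, \<open>dy\<close>.\<close>

definition magnetic_dirac ::
    "(2 \<Rightarrow> complex^2^2) \<Rightarrow> (real^2 \<Rightarrow> real^2) \<Rightarrow> spinor_field \<Rightarrow> spinor_field" where
  "magnetic_dirac e A \<phi> p = dirac e \<phi> p + \<i> *s clifford_mult e (A p) (\<phi> p)"

definition magnetic_dirac_operator ::
    "(2 \<Rightarrow> complex^2^2) \<Rightarrow> (real^2 \<Rightarrow> real^2) \<Rightarrow> l2_operator" where
  "magnetic_dirac_operator e A = l2_graph_closure {(\<phi>, magnetic_dirac e A \<phi>) |\<phi>. \<phi> \<in> test_spinors}"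

definition potential :: "real \<Rightarrow> real^2 \<Rightarrow> real^2" where
  "potential \<gamma> p =
     (let x = p $ 1; y = p $ 2; \<rho> = sqrt (x\<^sup>2 + y\<^sup>2)
      in vector [- (y / (1 + \<rho>) powr \<gamma>), x / (1 + \<rho>) powr \<gamma>])"

end

theory Submission
  imports Defs "HOL-Complex_Analysis.Complex_Analysis" "HOL-Computational_Algebra.Polynomial"
begin

text \<open>The Dirac operator commutes with rotations, so it is reduced by the angular momentum sectors;
  in a sector it acts on pairs \<open>(\<alpha>, \<beta>)\<close> of radial functions of \<open>t = r\<^sup>2\<close> and sends them to
  first-order expressions \<open>(d\<^sub>1 \<beta>, d\<^sub>2 \<alpha>)\<close>. Both \<open>d\<^sub>1\<close> and \<open>d\<^sub>2\<close> can be inverted explicitly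
  with the help of \<open>exp (\<plusminus> H)\<close>, where \<open>H' = (1 + \<surd>t) powr (- \<gamma>) / 2\<close>; hence range and kernel together
  are dense in the sector. An energy identity bounds the derivatives and a weight growing like
  \<open>r powr (2 - 2 * \<gamma>)\<close>, which makes the restriction to the sector have compact resolvent (this uses
  \<open>\<gamma> < 1\<close>). So each sector is spanned by eigenfunctions. On the other hand, the field tends to zero at
  infinity (this uses \<open>\<gamma> > 0\<close>). Choosing the angular momentum so that it cancels the flux through a disc
  of large radius \<open>L\<close>, the operator looks like \<open>\<plusminus> d / dr\<close> on a long interval around \<open>L\<close>; plane waves
  there are approximate eigenfunctions for any prescribed real number, so the eigenvalues are dense.\<close>

section \<open>Closed symmetric relations on real Hilbert spaces\<close>

text \<open>The kernel is infinite dimensional: for every \<open>k\<close> the sector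
  \<open>False\<close> has the zero mode \<open>exp (- H)\<close>. Compactness can therefore hold
  only sector by sector. The equation \<open>d\<^sub>2 \<alpha> = G\<close> always has a compactly
  supported solution, but \<open>d\<^sub>1 \<beta> = F\<close> imposes one linear condition: the
  moment of \<open>F\<close> with weight \<open>t ^ k * exp (\<plusminus> H)\<close> vanishes. For
  one sign this moment is an unbounded functional, for the other it is the pairing with the zero
  mode, so neither leaves room for such a vector. Radial functions are real, so a sector is only a
  real subspace and the spectral argument runs over the reals; multiplication by the imaginary unit
  is an isometry commuting with the operator, restored when the eigenbasis is chosen. Density rests
  on the flux \<open>2 * pi * r^2 * (1 + r) powr (- \<gamma>)\<close>: its variation over a fixed
  width, divided by \<open>r\<close>, tends to 0, so one angular momentum cancels the potential on a
  whole interval.\<close>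

lemma subspace_closure:
  fixes M :: "'h::real_normed_vector set"
  assumes "subspace M"
  shows "subspace (closure M)"
proof (rule subspaceI)
  show "0 \<in> closure M" using assms closure_subset subspace_0 by blast
next
  fix x y assume "x \<in> closure M" "y \<in> closure M"
  then obtain f g where "\<forall>n. f n \<in> M" "f \<longlonglongrightarrow> x" "\<forall>n. g n \<in> M" "g \<longlonglongrightarrow> y"
    unfolding closure_sequential by blast
  then show "x + y \<in> closure M"
    unfolding closure_sequential
    by (intro exI[of _ "\<lambda>n. f n + g n"]) (auto intro: tendsto_add subspace_add[OF assms])
next
  fix c :: real and x assume "x \<in> closure M"
  then obtain f where "\<forall>n. f n \<in> M" "f \<longlonglongrightarrow> x"
    unfolding closure_sequential by blast
  then show "c *\<^sub>R x \<in> closure M"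
    unfolding closure_sequential
    by (intro exI[of _ "\<lambda>n. c *\<^sub>R f n"]) (auto intro!: tendsto_intros subspace_scale[OF assms])
qed

lemma orthogonal_closure:
  fixes x :: "'h::real_inner"
  assumes "\<And>y. y \<in> M \<Longrightarrow> x \<bullet> y = 0" "y \<in> closure M"
  shows "x \<bullet> y = 0"
proof -
  have "closed {y. x \<bullet> y = 0}" by (intro closed_Collect_eq continuous_intros)
  then show ?thesis using assms closure_minimal[of M "{y. x \<bullet> y = 0}"] by auto
qed

text \<open>A minimizing sequence for the distance to \<open>M\<close> is Cauchy by the
  parallelogram identity (\<open>par\<close>), and its limit is the nearest point. Orthogonality is
  the first-order condition at the minimum: moving from \<open>m\<close> along \<open>y\<close> by
  the optimal amount \<open>s\<close> cannot shorten the distance.\<close>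

lemma orthogonal_projection:
  fixes M :: "'h::{real_inner,complete_space} set"
  assumes sub: "subspace M" and "closed M"
  obtains m where "m \<in> M" "\<And>y. y \<in> M \<Longrightarrow> (x - m) \<bullet> y = 0"
proof -
  define d where "d = (INF y\<in>M. (norm (x - y))\<^sup>2)"
  have bdd: "bdd_below ((\<lambda>y. (norm (x - y))\<^sup>2) ` M)" by (auto intro: bdd_belowI[of _ 0])
  have ne: "M \<noteq> {}" using sub subspace_0 by blast
  have dle: "d \<le> (norm (x - y))\<^sup>2" if "y \<in> M" for y
    unfolding d_def by (rule cINF_lower[OF bdd that])
  have "\<exists>y\<in>M. (norm (x - y))\<^sup>2 < d + inverse (real (Suc n))" for n
  proof (rule ccontr)
    assume "\<not> ?thesis"
    then have "d + inverse (real (Suc n)) \<le> (norm (x - y))\<^sup>2" if "y \<in> M" for y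
      using that not_less by blast
    then have "d + inverse (real (Suc n)) \<le> d"
      unfolding d_def by (intro cINF_greatest ne) (auto simp: d_def)
    then show False by simp
  qed
  then obtain Y where Y: "\<And>n. Y n \<in> M" "\<And>n. (norm (x - Y n))\<^sup>2 < d + inverse (real (Suc n))"
    by metis
  have par: "(norm (Y m - Y n))\<^sup>2 \<le> 2 * inverse (real (Suc m)) + 2 * inverse (real (Suc n))" for m n
  proof -
    have "(1/2) *\<^sub>R (Y m + Y n) \<in> M" using Y sub by (intro subspace_scale subspace_add)
    then have "d \<le> (norm (x - (1/2) *\<^sub>R (Y m + Y n)))\<^sup>2" by (rule dle)
    moreover have "(norm (Y m - Y n))\<^sup>2 + 4 * (norm (x - (1/2) *\<^sub>R (Y m + Y n)))\<^sup>2
       = 2 * (norm (x - Y m))\<^sup>2 + 2 * (norm (x - Y n))\<^sup>2"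
      by (simp add: power2_norm_eq_inner inner_diff_left inner_diff_right inner_add_left
          inner_add_right inner_commute algebra_simps)
    ultimately show ?thesis using Y(2)[of m] Y(2)[of n] by linarith
  qed
  have "Cauchy Y"
  proof (rule CauchyI)
    fix e :: real assume "0 < e"
    then obtain N where N: "inverse (real (Suc N)) < e\<^sup>2 / 4"
      using reals_Archimedean[of "e\<^sup>2 / 4"] by auto
    have "norm (Y m - Y n) < e" if "m \<ge> N" "n \<ge> N" for m n
    proof -
      have "inverse (real (Suc m)) \<le> inverse (real (Suc N))" "inverse (real (Suc n)) \<le> inverse (real (Suc N))"
        using that by (auto intro!: le_imp_inverse_le)
      then have "(norm (Y m - Y n))\<^sup>2 < e\<^sup>2" using par[of m n] N by linarith
      then show ?thesis using \<open>0 < e\<close> by (simp add: power_less_imp_less_base)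
    qed
    then show "\<exists>M. \<forall>m\<ge>M. \<forall>n\<ge>M. norm (Y m - Y n) < e" by blast
  qed
  then obtain m where m: "Y \<longlonglongrightarrow> m" using Cauchy_convergent convergent_def by blast
  have mM: "m \<in> M" using \<open>closed M\<close> Y(1) m closed_sequentially by blast
  have "(\<lambda>n. (norm (x - Y n))\<^sup>2) \<longlonglongrightarrow> (norm (x - m))\<^sup>2" by (intro tendsto_intros m)
  moreover have "(\<lambda>n. d + inverse (real (Suc n))) \<longlonglongrightarrow> d + 0"
    by (intro tendsto_intros LIMSEQ_inverse_real_of_nat)
  ultimately have md: "(norm (x - m))\<^sup>2 \<le> d"
    using LIMSEQ_le[of "\<lambda>n. (norm (x - Y n))\<^sup>2" _ "\<lambda>n. d + inverse (real (Suc n))"] Y(2) less_imp_le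
    by (metis (no_types, lifting) add.right_neutral)
  show ?thesis
  proof
    show "m \<in> M" by (rule mM)
    fix y assume y: "y \<in> M"
    show "(x - m) \<bullet> y = 0"
    proof (cases "y = 0")
      case False
      define s where "s = ((x - m) \<bullet> y) / (y \<bullet> y)"
      have yy: "y \<bullet> y > 0" using False by simp
      have "(norm (x - m))\<^sup>2 \<le> (norm (x - (m + s *\<^sub>R y)))\<^sup>2"
        using md dle[of "m + s *\<^sub>R y"] mM y sub subspace_add subspace_scale order_trans by blast
      also have "(norm (x - (m + s *\<^sub>R y)))\<^sup>2 = (norm (x - m))\<^sup>2 - 2 * s * ((x - m) \<bullet> y) + s\<^sup>2 * (y \<bullet> y)"
        unfolding power2_norm_eq_inner
        by (simp add: inner_diff_left inner_diff_right inner_add_left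
          inner_add_right inner_commute algebra_simps power2_eq_square[of s])
      also have "\<dots> = (norm (x - m))\<^sup>2 - ((x - m) \<bullet> y)\<^sup>2 / (y \<bullet> y)"
        using yy by (simp add: s_def field_simps power2_eq_square)
      finally have "((x - m) \<bullet> y)\<^sup>2 / (y \<bullet> y) \<le> 0" by linarith
      then show ?thesis using yy
        by (metis divide_le_0_iff not_le power2_eq_iff_nonneg power_zero_numeral zero_le_power2 zero_less_power2)
    qed simp
  qed
qed

lemma norm_diff_scaleR_power2:
  fixes a b :: "'h::real_inner"
  shows "(norm (a - t *\<^sub>R b))\<^sup>2 = (norm a)\<^sup>2 - 2 * t * (a \<bullet> b) + t\<^sup>2 * (norm b)\<^sup>2"
  unfolding power2_norm_eq_inner
  by (simp add: inner_diff_left inner_diff_right inner_commute algebra_simps power2_eq_square[of t])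

text \<open>Along a maximizing sequence for \<open>norm (K x)\<close> on the unit ball of
  \<open>V\<close>, the vectors \<open>K (K x) - c^2 x\<close> tend to 0, and compactness produces
  \<open>w\<close> with \<open>K (K w) = c^2 w\<close>. Factoring
  \<open>K^2 - c^2 = (K - c) (K + c)\<close> gives the eigenvalue \<open>c\<close> or
  \<open>- c\<close>. The square of \<open>K\<close> is convenient because its quadratic form is the
  square of \<open>norm (K x)\<close>, so \<open>c\<close> need not be related to the form of
  \<open>K\<close> itself. Linearity and symmetry are stated relative to \<open>V\<close>, since
  \<open>K\<close> will be an inverse defined there.\<close>

lemma compact_symmetric_eigenvector:
  fixes K :: "'h::real_inner \<Rightarrow> 'h"
  assumes V: "subspace V" "closed V" and KV: "\<And>x. x \<in> V \<Longrightarrow> K x \<in> V"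
    and add: "\<And>x y. x \<in> V \<Longrightarrow> y \<in> V \<Longrightarrow> K (x + y) = K x + K y"
    and scale: "\<And>c x. x \<in> V \<Longrightarrow> K (c *\<^sub>R x) = c *\<^sub>R K x"
    and sym: "\<And>x y. x \<in> V \<Longrightarrow> y \<in> V \<Longrightarrow> K x \<bullet> y = x \<bullet> K y"
    and cpt: "\<And>X :: nat \<Rightarrow> 'h. (\<And>n. X n \<in> V \<and> norm (X n) \<le> 1) \<Longrightarrow>
                \<exists>r l. strict_mono (r :: nat \<Rightarrow> nat) \<and> (\<lambda>n. K (X (r n))) \<longlonglongrightarrow> l"
    and nz: "v \<in> V" "K v \<noteq> 0"
  obtains e \<mu> where "e \<in> V" "e \<noteq> 0" "\<mu> \<noteq> 0" "K e = \<mu> *\<^sub>R e"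
proof -
  let ?U = "{x \<in> V. norm x \<le> 1}"
  have "\<exists>B. \<forall>x\<in>?U. norm (K x) \<le> B"
  proof (rule ccontr)
    assume "\<not> ?thesis"
    then have "\<forall>n::nat. \<exists>x. x \<in> V \<and> norm x \<le> 1 \<and> norm (K x) > real n" by (auto simp: not_le)
    then obtain X where X: "\<And>n. X n \<in> V \<and> norm (X n) \<le> 1" "\<And>n. norm (K (X n)) > real n" by metis
    obtain r l where r: "strict_mono (r :: nat \<Rightarrow> nat)" "(\<lambda>n. K (X (r n))) \<longlonglongrightarrow> l" using cpt[of X] X(1) by blast
    then have "Bseq (\<lambda>n. K (X (r n)))" by (simp add: convergentI convergent_imp_Bseq)
    then obtain B where B: "\<And>n. norm (K (X (r n))) \<le> B" by (auto simp: Bseq_def)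
    obtain n where "real n > B" using reals_Archimedean2 by blast
    moreover have "n \<le> r n" using r(1) by (rule seq_suble)
    ultimately have "real (r n) > B" by linarith
    then show False using X(2)[of "r n"] B[of n] by linarith
  qed
  then obtain B where B: "\<And>x. x \<in> V \<Longrightarrow> norm x \<le> 1 \<Longrightarrow> norm (K x) \<le> B" by auto
  define c where "c = (SUP x\<in>?U. norm (K x))"
  have bdd: "bdd_above ((\<lambda>x. norm (K x)) ` ?U)" using B by (auto intro!: bdd_aboveI)
  have cU: "norm (K x) \<le> c" if "x \<in> V" "norm x \<le> 1" for x
    unfolding c_def using that by (intro cSUP_upper bdd) auto
  have v0: "v \<noteq> 0" using nz scale[of v 0] by auto
  have Kb: "norm (K x) \<le> c * norm x" if "x \<in> V" for x
  proof (cases "x = 0")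
    case True then show ?thesis using scale[OF that, of 0] by simp
  next
    case False
    have "norm (K ((1 / norm x) *\<^sub>R x)) \<le> c"
      using False that V by (intro cU) (auto intro: subspace_scale)
    then show ?thesis using scale[OF that] False by (simp add: field_simps)
  qed
  have c0: "c > 0"
    using Kb[OF nz(1)] nz v0 by (smt (verit) mult_nonneg_nonneg mult_nonpos_nonneg norm_ge_zero norm_eq_zero zero_less_norm_iff)
  have "\<exists>x\<in>?U. norm (K x) > c - inverse (real (Suc n))" for n
  proof (rule ccontr)
    assume "\<not> ?thesis"
    then have "c \<le> c - inverse (real (Suc n))"
      unfolding c_def using subspace_0[OF V(1)] by (intro cSUP_least) (auto simp: not_less intro: exI[of _ 0])
    then show False by simp
  qed
  then obtain X where X: "\<And>n. X n \<in> V" "\<And>n. norm (X n) \<le> 1" "\<And>n. norm (K (X n)) > c - inverse (real (Suc n))"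
    by (simp add: Bex_def) metis
  obtain r y where r: "strict_mono (r :: nat \<Rightarrow> nat)" "(\<lambda>n. K (X (r n))) \<longlonglongrightarrow> y"
    using cpt[of X] X by blast
  define x where "x n = X (r n)" for n
  have xV: "x n \<in> V" "norm (x n) \<le> 1" for n by (auto simp: x_def X)
  have Kx: "(\<lambda>n. K (x n)) \<longlonglongrightarrow> y" using r by (simp add: x_def)
  have yV: "y \<in> V" using closed_sequentially[OF V(2) _ Kx] KV xV by blast
  have Kdiff: "K (a - b) = K a - K b" if "a \<in> V" "b \<in> V" for a b
    using add[of a "(-1) *\<^sub>R b"] scale[of b "-1"] that V subspace_scale[of V b "-1"] by auto
  have nK: "(\<lambda>n. norm (K (x n))) \<longlonglongrightarrow> c"
  proof (rule tendsto_sandwich)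
    show "\<forall>\<^sub>F n in sequentially. c - inverse (real (Suc (r n))) \<le> norm (K (x n))"
      using X(3) by (intro always_eventually) (auto simp: x_def less_imp_le)
    show "\<forall>\<^sub>F n in sequentially. norm (K (x n)) \<le> c" using cU xV by (intro always_eventually) auto
    have "(\<lambda>n. c - inverse (real (Suc n))) \<longlonglongrightarrow> c - 0" by (intro tendsto_intros LIMSEQ_inverse_real_of_nat)
    from LIMSEQ_subseq_LIMSEQ[OF this r(1)]
    show "(\<lambda>n. c - inverse (real (Suc (r n)))) \<longlonglongrightarrow> c" by (simp add: o_def)
  qed simp
  have ny: "norm y = c" using tendsto_norm[OF Kx] nK LIMSEQ_unique by blast
  have "(\<lambda>n. (norm (K (K (x n)) - (c\<^sup>2) *\<^sub>R x n))\<^sup>2) \<longlonglongrightarrow> 0"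
  proof (rule tendsto_sandwich[of "\<lambda>_. 0"])
    \<comment> \<open>Expand the square: by symmetry the cross term is the square of
      \<open>norm (K x)\<close>, and the other two terms are bounded through
      \<open>c\<close>.\<close>
    have "(norm (K (K (x n)) - (c\<^sup>2) *\<^sub>R x n))\<^sup>2 \<le> c\<^sup>2 * (c\<^sup>2 - (norm (K (x n)))\<^sup>2)" for n
    proof -
      have "K (K (x n)) \<bullet> x n = (norm (K (x n)))\<^sup>2"
        using sym[of "K (x n)" "x n"] KV xV by (simp add: power2_norm_eq_inner)
      then have "(norm (K (K (x n)) - (c\<^sup>2) *\<^sub>R x n))\<^sup>2
         = (norm (K (K (x n))))\<^sup>2 - 2 * c\<^sup>2 * (norm (K (x n)))\<^sup>2 + c^4 * (norm (x n))\<^sup>2"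
        using norm_diff_scaleR_power2[of "K (K (x n))" "c\<^sup>2" "x n"] by (simp flip: power_mult)
      moreover have "(norm (K (K (x n))))\<^sup>2 \<le> (c * norm (K (x n)))\<^sup>2"
        using Kb KV xV by (intro power_mono) auto
      moreover have "(norm (x n))\<^sup>2 \<le> 1" using xV by (simp add: power_le_one)
      then have "c^4 * (norm (x n))\<^sup>2 \<le> c^4" using c0 by (simp add: mult_left_le)
      ultimately show ?thesis by (simp add: power_mult_distrib algebra_simps power4_eq_xxxx power2_eq_square)
    qed
    then show "\<forall>\<^sub>F n in sequentially. (norm (K (K (x n)) - (c\<^sup>2) *\<^sub>R x n))\<^sup>2 \<le> c\<^sup>2 * (c\<^sup>2 - (norm (K (x n)))\<^sup>2)" by simp
    have "(\<lambda>n. c\<^sup>2 * (c\<^sup>2 - (norm (K (x n)))\<^sup>2)) \<longlonglongrightarrow> c\<^sup>2 * (c\<^sup>2 - c\<^sup>2)" by (intro tendsto_intros nK)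
    then show "(\<lambda>n. c\<^sup>2 * (c\<^sup>2 - (norm (K (x n)))\<^sup>2)) \<longlonglongrightarrow> 0" by simp
  qed auto
  then have "(\<lambda>n. norm (K (K (x n)) - (c\<^sup>2) *\<^sub>R x n)) \<longlonglongrightarrow> 0"
    using tendsto_real_sqrt[of "\<lambda>n. (norm (K (K (x n)) - (c\<^sup>2) *\<^sub>R x n))\<^sup>2" 0] by simp
  then have d0: "(\<lambda>n. K (K (x n)) - (c\<^sup>2) *\<^sub>R x n) \<longlonglongrightarrow> 0" using tendsto_norm_zero_iff by blast
  have KK: "(\<lambda>n. K (a n)) \<longlonglongrightarrow> K b" if "a \<longlonglongrightarrow> b" "\<And>n. a n \<in> V" "b \<in> V" for a b
  proof -
    have "norm (K (a n) - K b) \<le> c * norm (a n - b)" for n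
      using Kb[of "a n - b"] Kdiff[of "a n" b] that V by (simp add: subspace_diff)
    then have ev: "\<forall>\<^sub>F n in sequentially. norm (K (a n) - K b) \<le> c * norm (a n - b)" by simp
    have "(\<lambda>n. c * norm (a n - b)) \<longlonglongrightarrow> c * norm (b - b)" by (intro tendsto_intros that)
    then have "(\<lambda>n. c * norm (a n - b)) \<longlonglongrightarrow> 0" by simp
    then have "(\<lambda>n. K (a n) - K b) \<longlonglongrightarrow> 0" by (rule Lim_null_comparison[OF ev])
    then show ?thesis by (simp add: LIM_zero_iff)
  qed
  define w where "w = (1 / c\<^sup>2) *\<^sub>R K y"
  have wV: "w \<in> V" using KV yV V by (auto simp: w_def intro: subspace_scale)
  have "(\<lambda>n. (1 / c\<^sup>2) *\<^sub>R (K (K (x n)) - (K (K (x n)) - (c\<^sup>2) *\<^sub>R x n))) \<longlonglongrightarrow> (1 / c\<^sup>2) *\<^sub>R (K y - 0)"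
    using KV xV yV by (intro tendsto_intros d0 KK Kx) auto
  then have xw: "x \<longlonglongrightarrow> w" using c0 by (simp add: w_def)
  have Kw: "K w = y" using LIMSEQ_unique[OF KK[OF xw xV(1) wV] Kx] .
  have KKw: "K y = c\<^sup>2 *\<^sub>R w" using c0 by (simp add: w_def)
  have w0: "w \<noteq> 0" using Kw ny c0 scale[OF wV, of 0] by auto
  show thesis
  \<comment> \<open>Here \<open>y = K w\<close>. Either \<open>K w = - c w\<close>, or
    \<open>(K + c) w\<close> is nonzero and is an eigenvector for \<open>c\<close>.\<close>
  proof (cases "y + c *\<^sub>R w = 0")
    case True
    then have "K w = (- c) *\<^sub>R w" using Kw by (simp add: add_eq_0_iff2)
    then show ?thesis using that[of w "- c"] wV w0 c0 by auto
  next
    case False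
    have "K (y + c *\<^sub>R w) = c *\<^sub>R (y + c *\<^sub>R w)"
      using add[of y "c *\<^sub>R w"] scale[OF wV] yV wV V KKw Kw
      by (simp add: subspace_scale algebra_simps power2_eq_square)
    then show ?thesis using that[of "y + c *\<^sub>R w" c] False c0 V yV wV by (auto intro: subspace_add subspace_scale)
  qed
qed

text \<open>The zero vector is included as soon as \<open>(0, 0) \<in> T\<close>, which is harmless
  for spans and for unit vectors.\<close>

definition eigenvectors :: "('h::real_vector \<times> 'h) set \<Rightarrow> 'h set" where
  "eigenvectors T = {x. \<exists>\<mu>::real. (x, \<mu> *\<^sub>R x) \<in> T}"

text \<open>Working with relations avoids domains, and \<open>ran\<close>, which replaces self-adjointness, only has to be
  checked on dense sets. The inverse of \<open>T\<close> on the complement of its kernel is compact by \<open>cpt\<close>.\<close>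

theorem symmetric_relation_spectral:
  fixes T :: "('h::{real_inner,complete_space} \<times> 'h) set"
  assumes T: "subspace T" "closed T" and S: "subspace S" "closed S" and TS: "T \<subseteq> S \<times> S"
    and sym: "\<And>x y x' y'. (x, y) \<in> T \<Longrightarrow> (x', y') \<in> T \<Longrightarrow> y \<bullet> x' = x \<bullet> y'"
    and cpt: "\<And>X Y :: nat \<Rightarrow> 'h. (\<And>n. (X n, Y n) \<in> T \<and> norm (X n) \<le> 1 \<and> norm (Y n) \<le> 1) \<Longrightarrow>
                \<exists>r l. strict_mono (r :: nat \<Rightarrow> nat) \<and> (\<lambda>n. X (r n)) \<longlonglongrightarrow> l"
    and dom: "S \<subseteq> closure (Domain T)"
    and ran: "S \<subseteq> closure {y + z |x y z. (x, y) \<in> T \<and> (z, 0) \<in> T}"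
  shows "S \<subseteq> closure (span (eigenvectors T))"
proof -
  let ?E = "eigenvectors T"
  \<comment> \<open>The part of \<open>S\<close> that the eigenvectors miss. On it \<open>T\<close>
    is inverted by a compact symmetric \<open>K\<close>; a nonzero \<open>V\<close> would contain an
    eigenvector of \<open>K\<close>, hence one of \<open>T\<close>.\<close>
  define V where "V = {v \<in> S. \<forall>e\<in>?E. v \<bullet> e = 0}"
  define N where "N = {x. (x, 0) \<in> T}"
  have Tadd: "(x + x', y + y') \<in> T" if "(x, y) \<in> T" "(x', y') \<in> T" for x y x' y'
    using subspace_add[OF T(1) that] by simp
  have Tdiff: "(x - x', y - y') \<in> T" if "(x, y) \<in> T" "(x', y') \<in> T" for x y x' y'
    using subspace_diff[OF T(1) that] by simp
  have Tscale: "(c *\<^sub>R x, c *\<^sub>R y) \<in> T" if "(x, y) \<in> T" for x y and c :: real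
    using subspace_scale[OF T(1) that, of c] by simp
  have Tlim: "(x, y) \<in> T" if "X \<longlonglongrightarrow> x" "Y \<longlonglongrightarrow> y" "\<And>n. (X n, Y n) \<in> T" for X Y :: "nat \<Rightarrow> 'h" and x y
    using closed_sequentially[OF T(2) _ tendsto_Pair[OF that(1,2)]] that(3) by blast
  have NE: "N \<subseteq> ?E" unfolding N_def eigenvectors_def by (auto intro: exI[of _ 0])
  have ES: "?E \<subseteq> S" using TS by (auto simp: eigenvectors_def)
  have Vsub: "subspace V"
    using S by (auto simp: V_def subspace_def inner_add_left)
  have Vcl: "closed V"
  proof -
    have "closed {v. v \<bullet> e = 0}" for e :: 'h by (intro closed_Collect_eq continuous_intros)
    then have "closed (S \<inter> (\<Inter>e\<in>?E. {v. v \<bullet> e = 0}))" using S by blast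
    moreover have "S \<inter> (\<Inter>e\<in>?E. {v. v \<bullet> e = 0}) = V" by (auto simp: V_def)
    ultimately show ?thesis by simp
  qed
  have Nsub: "subspace N" using Tadd Tscale subspace_0[OF T(1)]
    by (auto simp: N_def subspace_def zero_prod_def) (metis add_0 scaleR_zero_right)+
  have Ncl: "closed N"
    unfolding closed_sequential_limits N_def using Tlim[of _ _ "\<lambda>_. 0" 0] by auto
  have VN: "v \<bullet> z = 0" if "v \<in> V" "z \<in> N" for v z using that NE by (auto simp: V_def)
  \<comment> \<open>A gap at 0: otherwise normalized counterexamples \<open>U\<close>, whose images
    \<open>W\<close> tend to 0, would converge along a subsequence to a unit vector that lies in
    \<open>N\<close> and is orthogonal to \<open>N\<close>.\<close>
  obtain C where C: "\<And>x y. (x, y) \<in> T \<Longrightarrow> (\<And>z. z \<in> N \<Longrightarrow> x \<bullet> z = 0) \<Longrightarrow> norm x \<le> C * norm y"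
  proof (rule ccontr)
    assume "\<not> thesis"
    then have "\<forall>n::nat. \<exists>x y. (x, y) \<in> T \<and> (\<forall>z\<in>N. x \<bullet> z = 0) \<and> norm x > real (Suc n) * norm y"
      using that by (metis not_le)
    then obtain X Y where XY: "\<And>n. (X n, Y n) \<in> T" "\<And>n z. z \<in> N \<Longrightarrow> X n \<bullet> z = 0"
        "\<And>n. norm (X n) > real (Suc n) * norm (Y n)" by metis
    define U W where "U n = (1 / norm (X n)) *\<^sub>R X n" and "W n = (1 / norm (X n)) *\<^sub>R Y n" for n
    have nX: "norm (X n) > 0" for n
      using XY(3)[of n] by (meson le_less_trans mult_nonneg_nonneg norm_ge_zero of_nat_0_le_iff)
    have UW: "(U n, W n) \<in> T" for n unfolding U_def W_def by (intro Tscale XY)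
    have nU: "norm (U n) = 1" for n using nX[of n] by (simp add: U_def)
    have nW: "norm (W n) \<le> inverse (real (Suc n))" for n
      using nX[of n] XY(3)[of n] by (simp add: W_def field_simps)
    have "norm (W n) \<le> 1" for n using nW[of n] by (rule order_trans) (simp add: field_simps)
    then obtain r u where r: "strict_mono (r :: nat \<Rightarrow> nat)" "(\<lambda>n. U (r n)) \<longlonglongrightarrow> u" using cpt[of U W] UW nU
      by (metis order_refl)
    have "W \<longlonglongrightarrow> 0" by (rule Lim_null_comparison[OF _ LIMSEQ_inverse_real_of_nat]) (rule always_eventually, rule allI, rule nW)
    then have "(\<lambda>n. W (r n)) \<longlonglongrightarrow> 0" using r(1) LIMSEQ_subseq_LIMSEQ[of W 0 r] by (simp add: o_def)
    then have "u \<in> N" using Tlim[OF r(2)] UW by (auto simp: N_def)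
    have "(\<lambda>n. U (r n) \<bullet> u) \<longlonglongrightarrow> u \<bullet> u" by (intro tendsto_intros r)
    moreover have "U n \<bullet> u = 0" for n using XY(2)[OF \<open>u \<in> N\<close>] by (simp add: U_def)
    ultimately have "u \<bullet> u = 0" by (simp add: LIMSEQ_const_iff)
    moreover have "norm u = 1" using tendsto_norm[OF r(2)] nU by (simp add: LIMSEQ_const_iff)
    ultimately show False by simp
  qed
  \<comment> \<open>Density of range plus kernel is upgraded to surjectivity onto \<open>V\<close>:
    approximate \<open>f\<close> by \<open>y n + z n\<close>, replace the preimages by their
    components orthogonal to \<open>N\<close>, and let the gap constant \<open>C\<close> make these
    converge.\<close>
  have ex: "\<exists>x\<in>V. (x, f) \<in> T" if f: "f \<in> V" for f
  proof -
    have "f \<in> closure {y + z |x y z. (x, y) \<in> T \<and> (z, 0) \<in> T}" using ran f by (auto simp: V_def)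
    then obtain g where g: "\<forall>n. g n \<in> {y + z |x y z. (x, y) \<in> T \<and> (z, 0) \<in> T}" "g \<longlonglongrightarrow> f"
      unfolding closure_sequential by blast
    have "\<forall>n. \<exists>x y z. g n = y + z \<and> (x, y) \<in> T \<and> (z, 0) \<in> T" using g(1) by blast
    then obtain x y z where xyz: "\<And>n. g n = y n + z n" "\<And>n. (x n, y n) \<in> T" "\<And>n. (z n, 0) \<in> T" by metis
    have "\<forall>n. \<exists>p\<in>N. \<forall>w\<in>N. (x n - p) \<bullet> w = 0" using orthogonal_projection[OF Nsub Ncl] by metis
    then obtain p where p: "\<And>n. p n \<in> N" "\<And>n w. w \<in> N \<Longrightarrow> (x n - p n) \<bullet> w = 0" by metis
    define X where "X n = x n - p n" for n
    have XT: "(X n, y n) \<in> T" for n using Tdiff[OF xyz(2)[of n], of "p n" 0] p(1)[of n] by (simp add: X_def N_def)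
    have yf: "y \<longlonglongrightarrow> f"
    proof -
      have "norm (y n - f) \<le> norm (g n - f)" for n
      proof -
        \<comment> \<open>Both \<open>y n\<close> (by symmetry) and \<open>f\<close> are orthogonal
          to the kernel, so by Pythagoras the kernel parts \<open>z n\<close> can only increase the
          distance and may be dropped.\<close>
        have 1: "y n \<bullet> z n = 0" using sym[OF xyz(2) xyz(3)] by simp
        have 2: "f \<bullet> z n = 0" using VN f xyz(3) by (simp add: N_def)
        have "(norm (g n - f))\<^sup>2 = (norm (y n - f))\<^sup>2 + (norm (z n))\<^sup>2"
          using 1 2 by (simp add: xyz(1) power2_norm_eq_inner inner_add_left inner_add_right inner_diff_left inner_diff_right inner_commute)
        then have "(norm (y n - f))\<^sup>2 \<le> (norm (g n - f))\<^sup>2" by simp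
        then show ?thesis by (rule power2_le_imp_le) simp
      qed
      then have ev: "\<forall>\<^sub>F n in sequentially. norm (y n - f) \<le> norm (g n - f)" by simp
      have "(\<lambda>n. norm (g n - f)) \<longlonglongrightarrow> 0" by (intro tendsto_norm_zero LIM_zero g(2))
      then have "(\<lambda>n. y n - f) \<longlonglongrightarrow> 0" by (rule Lim_null_comparison[OF ev])
      then show ?thesis by (rule LIM_zero_cancel)
    qed
    have dX: "norm (X m - X n) \<le> C * norm (y m - y n)" for m n
      using p(2) by (intro C Tdiff XT) (auto simp: X_def inner_diff_left)
    have "Cauchy X"
    proof (rule CauchyI)
      fix e :: real assume e: "0 < e"
      have "Cauchy y" using yf convergent_Cauchy convergent_def by blast
      then obtain M where M: "\<And>m n. m \<ge> M \<Longrightarrow> n \<ge> M \<Longrightarrow> norm (y m - y n) < e / (\<bar>C\<bar> + 1)"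
        using e CauchyD[of y "e / (\<bar>C\<bar> + 1)"] by auto
      have "norm (X m - X n) < e" if "m \<ge> M" "n \<ge> M" for m n
      proof -
        have "C * norm (y m - y n) \<le> (\<bar>C\<bar> + 1) * norm (y m - y n)" by (intro mult_right_mono) auto
        then have "norm (X m - X n) \<le> (\<bar>C\<bar> + 1) * norm (y m - y n)" using dX[of m n] by linarith
        also have "\<dots> < e" using M[OF that] by (simp add: field_simps add_pos_nonneg)
        finally show ?thesis .
      qed
      then show "\<exists>M. \<forall>m\<ge>M. \<forall>n\<ge>M. norm (X m - X n) < e" by blast
    qed
    then obtain u where u: "X \<longlonglongrightarrow> u" using Cauchy_convergent convergent_def by blast
    have uT: "(u, f) \<in> T" using Tlim[OF u yf XT] .
    have uN: "u \<bullet> w = 0" if "w \<in> N" for w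
    proof -
      have "(\<lambda>n. X n \<bullet> w) \<longlonglongrightarrow> u \<bullet> w" by (intro tendsto_intros u)
      then show ?thesis using p(2)[OF that] by (simp add: X_def LIMSEQ_const_iff)
    qed
    have "u \<bullet> e = 0" if "e \<in> ?E" for e
    proof -
      obtain \<mu> :: real where \<mu>: "(e, \<mu> *\<^sub>R e) \<in> T" using \<open>e \<in> ?E\<close> by (auto simp: eigenvectors_def)
      show ?thesis
      proof (cases "\<mu> = 0")
        case True then show ?thesis using uN \<mu> by (simp add: N_def)
      next
        case False
        then show ?thesis using sym[OF uT \<mu>] f that by (simp add: V_def)
      qed
    qed
    moreover have "u \<in> S" using uT TS by auto
    ultimately show ?thesis using uT by (auto simp: V_def)
  qed
  have uniq: "x = x'" if "x \<in> V" "(x, f) \<in> T" "x' \<in> V" "(x', f) \<in> T" for x x' f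
  proof -
    have "x - x' \<in> N" using Tdiff[OF that(2,4)] by (simp add: N_def)
    moreover have "x - x' \<in> V" using Vsub that subspace_diff by blast
    ultimately have "(x - x') \<bullet> (x - x') = 0" using VN by blast
    then show ?thesis by simp
  qed
  define K where "K f = (THE x. x \<in> V \<and> (x, f) \<in> T)" for f
  have K: "K f \<in> V" "(K f, f) \<in> T" if "f \<in> V" for f
  proof -
    have "\<exists>!x. x \<in> V \<and> (x, f) \<in> T" using ex[OF that] uniq by blast
    from theI'[OF this] show "K f \<in> V" "(K f, f) \<in> T" by (auto simp: K_def)
  qed
  have V0: "v = 0" if v: "v \<in> V" for v
  proof (rule ccontr)
    assume "v \<noteq> 0"
    \<comment> \<open>By symmetry a vector \<open>v\<close> with \<open>(0, v) \<in> T\<close> is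
      orthogonal to the domain, which is dense in \<open>S\<close>.\<close>
    have Kv: "K v \<noteq> 0"
    proof
      assume "K v = 0"
      then have "(0, v) \<in> T" using K[OF v] by simp
      then have "v \<bullet> x = 0" if "x \<in> Domain T" for x using that sym[of 0 v] by auto
      then have "v \<bullet> v = 0" using orthogonal_closure[of "Domain T" v v] dom v by (auto simp: V_def)
      then show False using \<open>v \<noteq> 0\<close> by simp
    qed
    have Kcpt: "\<exists>r l. strict_mono (r :: nat \<Rightarrow> nat) \<and> (\<lambda>n. K (X (r n))) \<longlonglongrightarrow> l"
      if X: "\<And>n. X n \<in> V \<and> norm (X n) \<le> 1" for X :: "nat \<Rightarrow> 'h"
    proof -
      \<comment> \<open>Dividing by \<open>D\<close> brings both \<open>K (X n)\<close> and
        \<open>X n\<close> below norm 1, as \<open>cpt\<close> requires.\<close>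
      define D where "D = \<bar>C\<bar> + 1"
      have D: "D \<ge> 1" "C \<le> D" by (auto simp: D_def)
      have b: "norm (K (X n)) \<le> D" for n
      proof -
        have "norm (K (X n)) \<le> C * norm (X n)" using K X VN by (intro C) auto
        also have "\<dots> \<le> D * 1" using D X by (intro mult_mono) auto
        finally show ?thesis by simp
      qed
      have "((1 / D) *\<^sub>R K (X n), (1 / D) *\<^sub>R X n) \<in> T \<and> norm ((1 / D) *\<^sub>R K (X n)) \<le> 1 \<and> norm ((1 / D) *\<^sub>R X n) \<le> 1" for n
        using D b[of n] X[of n] K(2)[of "X n"] by (auto intro!: Tscale simp: field_simps)
      from cpt[of "\<lambda>n. (1 / D) *\<^sub>R K (X n)" "\<lambda>n. (1 / D) *\<^sub>R X n", OF this]
      obtain r l where r: "strict_mono (r :: nat \<Rightarrow> nat)" "(\<lambda>n. (1 / D) *\<^sub>R K (X (r n))) \<longlonglongrightarrow> l" by blast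
      have "(\<lambda>n. D *\<^sub>R ((1 / D) *\<^sub>R K (X (r n)))) \<longlonglongrightarrow> D *\<^sub>R l" by (intro tendsto_intros r)
      then show ?thesis using r(1) D by auto
    qed
    obtain e \<mu> where e: "e \<in> V" "e \<noteq> 0" "\<mu> \<noteq> 0" "K e = \<mu> *\<^sub>R e"
    proof (rule compact_symmetric_eigenvector[of V K v])
      fix x y assume "x \<in> V" "y \<in> V"
      then show "K (x + y) = K x + K y" using K Tadd Vsub
        by (intro uniq[of _ "x + y"]) (auto intro: subspace_add)
    next
      fix c :: real and x assume "x \<in> V"
      then show "K (c *\<^sub>R x) = c *\<^sub>R K x" using K Tscale Vsub
        by (intro uniq[of _ "c *\<^sub>R x"]) (auto intro: subspace_scale)
    next
      fix x y assume "x \<in> V" "y \<in> V"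
      then show "K x \<bullet> y = x \<bullet> K y" using sym[OF K(2)[of x] K(2)[of y]] by simp
    qed (use Vsub Vcl K v Kv Kcpt in auto)
    have "((1 / \<mu>) *\<^sub>R K e, (1 / \<mu>) *\<^sub>R e) \<in> T" using Tscale K(2) e(1) by blast
    then have "e \<in> ?E" using e by (auto simp: eigenvectors_def)
    then have "e \<bullet> e = 0" using e(1) by (auto simp: V_def)
    then show False using e by simp
  qed
  show ?thesis
  proof
    fix x assume x: "x \<in> S"
    let ?M = "closure (span ?E)"
    have "subspace ?M" by (intro subspace_closure subspace_span)
    then obtain m where m: "m \<in> ?M" "\<And>y. y \<in> ?M \<Longrightarrow> (x - m) \<bullet> y = 0"
      using orthogonal_projection[of ?M] closed_closure by blast
    have "?M \<subseteq> S" using ES S by (intro closure_minimal span_minimal)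
    then have "x - m \<in> S" using m x S subspace_diff by blast
    moreover have "(x - m) \<bullet> e = 0" if "e \<in> ?E" for e using m(2) that span_base closure_subset by (meson subsetD)
    ultimately have "x - m \<in> V" by (auto simp: V_def)
    then have "x = m" using V0 by force
    then show "x \<in> ?M" using m by simp
  qed
qed


section \<open>Eigenbases compatible with a complex structure\<close>

text \<open>Real orthogonality to both \<open>b'\<close> and \<open>J b'\<close> is orthogonality
  for the complex inner product, so a maximal family in \<open>A\<close>, given by Zorn's lemma,
  plays the role of a complex orthonormal basis. Maximality is tested inside one eigenspace
  \<open>W\<close> at a time: the component of \<open>e\<close> orthogonal to the vectors already
  chosen could be normalized and added.\<close>

theorem complex_orthonormal_eigenbasis:
  fixes T :: "('h::{real_inner,complete_space} \<times> 'h) set"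
  assumes T: "subspace T" "closed T"
    and sym: "\<And>x y x' y'. (x, y) \<in> T \<Longrightarrow> (x', y') \<in> T \<Longrightarrow> y \<bullet> x' = x \<bullet> y'"
    and J: "linear J" and JJ: "\<And>x. J (J x) = - x" and iso: "\<And>x y. J x \<bullet> J y = x \<bullet> y"
    and JT: "\<And>x y. (x, y) \<in> T \<Longrightarrow> (J x, J y) \<in> T"
    and dense: "closure (span (eigenvectors T)) = UNIV"
  obtains B where "B \<subseteq> eigenvectors T" "\<And>b. b \<in> B \<Longrightarrow> norm b = 1"
    "\<And>b b'. b \<in> B \<Longrightarrow> b' \<in> B \<Longrightarrow> b \<noteq> b' \<Longrightarrow> b \<bullet> b' = 0 \<and> b \<bullet> J b' = 0"
    "closure (span (B \<union> J ` B)) = UNIV"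
proof -
  let ?E = "eigenvectors T"
  define A where "A = {B. B \<subseteq> ?E \<and> (\<forall>b\<in>B. norm b = 1) \<and> (\<forall>b\<in>B. \<forall>b'\<in>B. b \<noteq> b' \<longrightarrow> b \<bullet> b' = 0 \<and> b \<bullet> J b' = 0)}"
  have "\<exists>M\<in>A. \<forall>X\<in>A. M \<subseteq> X \<longrightarrow> X = M"
  proof (rule subset_Zorn')
    fix C assume C: "subset.chain A C"
    show "\<Union> C \<in> A"
      unfolding A_def
    proof (intro CollectI conjI ballI impI)
      show "\<Union> C \<subseteq> ?E" using C by (auto simp: subset.chain_def A_def)
      fix b assume b: "b \<in> \<Union> C"
      then show "norm b = 1" using C by (auto simp: subset.chain_def A_def)
      fix b' assume "b' \<in> \<Union> C" and ne: "b \<noteq> b'"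
      then obtain X\<^sub>1 X\<^sub>2 where X12: "X\<^sub>1 \<in> C" "b \<in> X\<^sub>1" "X\<^sub>2 \<in> C" "b' \<in> X\<^sub>2" using b by blast
      then have "X\<^sub>1 \<subseteq> X\<^sub>2 \<or> X\<^sub>2 \<subseteq> X\<^sub>1" using C by (auto simp: subset.chain_def)
      then obtain X where "X \<in> C" "b \<in> X" "b' \<in> X" using X12 by blast
      then show "b \<bullet> b' = 0" "b \<bullet> J b' = 0" using C ne by (auto simp: subset.chain_def A_def)
    qed
  qed
  then obtain B where B: "B \<in> A" "\<And>X. X \<in> A \<Longrightarrow> B \<subseteq> X \<Longrightarrow> X = B" by blast
  have B': "B \<subseteq> ?E" "\<And>b. b \<in> B \<Longrightarrow> norm b = 1"
    "\<And>b b'. b \<in> B \<Longrightarrow> b' \<in> B \<Longrightarrow> b \<noteq> b' \<Longrightarrow> b \<bullet> b' = 0 \<and> b \<bullet> J b' = 0"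
    using B(1) by (auto simp: A_def)
  have "e \<in> closure (span (B \<union> J ` B))" if "e \<in> ?E" for e
  proof -
    obtain \<mu> :: real where \<mu>: "(e, \<mu> *\<^sub>R e) \<in> T" using \<open>e \<in> ?E\<close> by (auto simp: eigenvectors_def)
    define W where "W = {x. (x, \<mu> *\<^sub>R x) \<in> T}"
    define B\<^sub>0 where "B\<^sub>0 = B \<inter> W"
    define M where "M = closure (span (B\<^sub>0 \<union> J ` B\<^sub>0))"
    have Wsub: "subspace W"
    proof (rule subspaceI)
      show "0 \<in> W" using subspace_0[OF T(1)] by (simp add: W_def zero_prod_def)
      show "x + y \<in> W" if "x \<in> W" "y \<in> W" for x y
        using that subspace_add[OF T(1), of "(x, \<mu> *\<^sub>R x)" "(y, \<mu> *\<^sub>R y)"] by (simp add: W_def scaleR_add_right)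
      show "c *\<^sub>R x \<in> W" if "x \<in> W" for c x
        using that subspace_scale[OF T(1), of "(x, \<mu> *\<^sub>R x)" c] by (simp add: W_def mult.commute)
    qed
    have Wcl: "closed W"
    proof -
      have "closed ((\<lambda>x. (x, \<mu> *\<^sub>R x)) -` T)" by (intro continuous_closed_vimage T continuous_intros)
      then show ?thesis by (simp add: W_def vimage_def)
    qed
    have JW: "J x \<in> W" if "x \<in> W" for x
      using JT[of x "\<mu> *\<^sub>R x"] that linear_scale[OF J] by (simp add: W_def)
    have MW: "M \<subseteq> W" unfolding M_def using Wcl Wsub JW by (intro closure_minimal span_minimal) (auto simp: B\<^sub>0_def)
    obtain p where p: "p \<in> M" "\<And>y. y \<in> M \<Longrightarrow> (e - p) \<bullet> y = 0"
      using orthogonal_projection[of M] unfolding M_def using closed_closure subspace_closure subspace_span by metis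
    define e' where "e' = e - p"
    have e'W: "e' \<in> W" unfolding e'_def using subspace_diff[OF Wsub, of e p] \<mu> p(1) MW by (auto simp: W_def)
    have inM: "b \<in> M" if "b \<in> B\<^sub>0 \<union> J ` B\<^sub>0" for b
      unfolding M_def by (rule subsetD[OF closure_subset], rule span_base, rule that)
    \<comment> \<open>Chosen vectors in \<open>W\<close> lie in \<open>M\<close>, and
      \<open>e'\<close> is orthogonal to \<open>M\<close>. Any other chosen vector has a different
      eigenvalue, which it shares with its image under \<open>J\<close>, and symmetry separates the
      eigenvalues.\<close>
    have orth: "e' \<bullet> b = 0 \<and> e' \<bullet> J b = 0" if b: "b \<in> B" for b
    proof (cases "b \<in> W")
      case True
      then show ?thesis using b p(2) inM by (auto simp: e'_def B\<^sub>0_def)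
    next
      case False
      obtain \<nu> :: real where \<nu>: "(b, \<nu> *\<^sub>R b) \<in> T" using b B'(1) by (auto simp: eigenvectors_def)
      have ne: "\<mu> \<noteq> \<nu>" using False \<nu> by (auto simp: W_def)
      have "(J b, \<nu> *\<^sub>R J b) \<in> T" using JT[OF \<nu>] linear_scale[OF J] by simp
      then have "\<mu> * (e' \<bullet> J b) = \<nu> * (e' \<bullet> J b)" using sym[of e' "\<mu> *\<^sub>R e'" "J b"] e'W by (simp add: W_def)
      moreover have "\<mu> * (e' \<bullet> b) = \<nu> * (e' \<bullet> b)" using sym[of e' "\<mu> *\<^sub>R e'" "b"] \<nu> e'W by (simp add: W_def)
      ultimately show ?thesis using ne by simp
    qed
    have "e' = 0"
    proof (rule ccontr)
      assume ne: "e' \<noteq> 0"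
      define b\<^sub>0 where "b\<^sub>0 = (1 / norm e') *\<^sub>R e'"
      have b0W: "b\<^sub>0 \<in> W" unfolding b\<^sub>0_def by (intro subspace_scale[OF Wsub] e'W)
      have o: "b\<^sub>0 \<bullet> b = 0" "b\<^sub>0 \<bullet> J b = 0" "b \<bullet> b\<^sub>0 = 0" "b \<bullet> J b\<^sub>0 = 0" if "b \<in> B" for b
      proof -
        show 1: "b\<^sub>0 \<bullet> b = 0" "b\<^sub>0 \<bullet> J b = 0" using orth[OF that] by (auto simp: b\<^sub>0_def)
        then show "b \<bullet> b\<^sub>0 = 0" by (simp add: inner_commute)
        have "b \<bullet> J b\<^sub>0 = J b \<bullet> J (J b\<^sub>0)" by (simp add: iso)
        then show "b \<bullet> J b\<^sub>0 = 0" using 1 by (simp add: JJ inner_commute)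
      qed
      have n1: "norm b\<^sub>0 = 1" using ne by (simp add: b\<^sub>0_def)
      have "insert b\<^sub>0 B \<in> A" unfolding A_def
      proof (intro CollectI conjI ballI impI)
        show "insert b\<^sub>0 B \<subseteq> ?E" using b0W B' by (auto simp: W_def eigenvectors_def)
      next
        fix b assume "b \<in> insert b\<^sub>0 B" then show "norm b = 1" using n1 B' by auto
      next
        fix b b' assume "b \<in> insert b\<^sub>0 B" "b' \<in> insert b\<^sub>0 B" "b \<noteq> b'"
        then show "b \<bullet> b' = 0" "b \<bullet> J b' = 0" using o B'(3) by auto
      qed
      then have "b\<^sub>0 \<in> B" using B(2)[of "insert b\<^sub>0 B"] by auto
      then have "b\<^sub>0 \<bullet> b\<^sub>0 = 0" using o by blast
      then show False using n1 by simp
    qed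
    then have "e \<in> M" using p(1) by (simp add: e'_def)
    also have "M \<subseteq> closure (span (B \<union> J ` B))"
      unfolding M_def by (intro closure_mono span_mono) (auto simp: B\<^sub>0_def)
    finally show ?thesis .
  qed
  then have "closure (span ?E) \<subseteq> closure (span (B \<union> J ` B))"
    by (intro closure_minimal span_minimal subspace_closure subspace_span) auto
  then have "closure (span (B \<union> J ` B)) = UNIV" using dense by auto
  then show thesis using that[of B] B' by blast
qed

section \<open>Orthonormal expansions and approximate eigenvalues\<close>

text \<open>Complete the square in each coefficient. With \<open>c b = x \<bullet> b\<close> this
  contains Bessel's inequality; with arbitrary \<open>c\<close> it says that a good approximation
  forces the Fourier sum to be nearly the whole squared norm. Both uses occur below.\<close>

lemma norm_diff_orthonormal_sum:
  fixes x :: "'h::real_inner"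
  assumes "finite F" "\<And>u v. u \<in> F \<Longrightarrow> v \<in> F \<Longrightarrow> u \<bullet> v = (if u = v then 1 else 0)"
  shows "(norm (x - (\<Sum>b\<in>F. c b *\<^sub>R b)))\<^sup>2
    = (norm x)\<^sup>2 - (\<Sum>b\<in>F. (x \<bullet> b)\<^sup>2) + (\<Sum>b\<in>F. (c b - x \<bullet> b)\<^sup>2)"
proof -
  have 1: "(\<Sum>b\<in>F. c b *\<^sub>R b) \<bullet> (\<Sum>b\<in>F. c b *\<^sub>R b) = (\<Sum>b\<in>F. (c b)\<^sup>2)"
  proof -
    have "(\<Sum>b\<in>F. c b *\<^sub>R b) \<bullet> (\<Sum>b\<in>F. c b *\<^sub>R b) = (\<Sum>u\<in>F. \<Sum>v\<in>F. c u * c v * (u \<bullet> v))"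
      by (simp add: inner_sum_left inner_sum_right sum_distrib_left ac_simps inner_commute)
    also have "\<dots> = (\<Sum>u\<in>F. \<Sum>v\<in>F. if u = v then c u * c v else 0)"
      by (intro sum.cong refl) (auto simp: assms(2))
    also have "\<dots> = (\<Sum>b\<in>F. (c b)\<^sup>2)"
      using assms(1) by (simp add: sum.delta' power2_eq_square)
    finally show ?thesis .
  qed
  have 2: "x \<bullet> (\<Sum>b\<in>F. c b *\<^sub>R b) = (\<Sum>b\<in>F. c b * (x \<bullet> b))" by (simp add: inner_sum_right)
  have "(norm (x - (\<Sum>b\<in>F. c b *\<^sub>R b)))\<^sup>2
     = (norm x)\<^sup>2 - 2 * (x \<bullet> (\<Sum>b\<in>F. c b *\<^sub>R b)) + (\<Sum>b\<in>F. c b *\<^sub>R b) \<bullet> (\<Sum>b\<in>F. c b *\<^sub>R b)"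
    by (simp only: power2_norm_eq_inner inner_diff_left inner_diff_right inner_commute)
  also have "\<dots> = (norm x)\<^sup>2 - (\<Sum>b\<in>F. (x \<bullet> b)\<^sup>2) + (\<Sum>b\<in>F. (c b - x \<bullet> b)\<^sup>2)"
    unfolding 1 2 by (simp add: power2_diff sum.distrib sum_subtractf sum_distrib_left algebra_simps)
  finally show ?thesis .
qed

text \<open>The coefficient of \<open>y - \<kappa> x\<close> at an eigenvector \<open>b\<close> is
  \<open>\<mu> - \<kappa>\<close> times that of \<open>x\<close>. If all eigenvalues had distance at
  least \<open>\<epsilon>\<close> from \<open>\<kappa>\<close>, Bessel's inequality would give
  \<open>norm (y - \<kappa> x) >= \<epsilon> norm x\<close>.\<close>

theorem approximate_eigenvalue:
  fixes T :: "('h::real_inner \<times> 'h) set"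
  assumes sym: "\<And>x y x' y'. (x, y) \<in> T \<Longrightarrow> (x', y') \<in> T \<Longrightarrow> y \<bullet> x' = x \<bullet> y'"
    and Q: "Q \<subseteq> eigenvectors T" "\<And>u v. u \<in> Q \<Longrightarrow> v \<in> Q \<Longrightarrow> u \<bullet> v = (if u = v then 1 else 0)"
    and dense: "closure (span Q) = UNIV"
    and x: "(x, y) \<in> T" "norm (y - \<kappa> *\<^sub>R x) < \<epsilon> * norm x"
  shows "\<exists>e \<mu>. e \<noteq> 0 \<and> (e, \<mu> *\<^sub>R e) \<in> T \<and> \<bar>\<mu> - \<kappa>\<bar> < \<epsilon>"
proof (rule ccontr)
  assume "\<not> ?thesis"
  then have far: "\<epsilon> \<le> \<bar>\<mu> - \<kappa>\<bar>" if "e \<noteq> 0" "(e, \<mu> *\<^sub>R e) \<in> T" for e \<mu>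
    using that by (metis not_le)
  have pos: "0 < \<epsilon> * norm x" using x(2) norm_ge_zero le_less_trans by blast
  then have e0: "\<epsilon> > 0" "norm x > 0" by (auto simp: zero_less_mult_iff dest: not_less[THEN iffD2])
  \<comment> \<open>The slack in the strict hypothesis: it lets a finite partial expansion of
    \<open>x\<close> replace Parseval's identity.\<close>
  define d where "d = (norm x)\<^sup>2 - (norm (y - \<kappa> *\<^sub>R x))\<^sup>2 / \<epsilon>\<^sup>2"
  have "(norm (y - \<kappa> *\<^sub>R x))\<^sup>2 < (\<epsilon> * norm x)\<^sup>2" using x(2) by (intro power_strict_mono) auto
  then have d: "d > 0" using e0 by (simp add: d_def field_simps power_mult_distrib)
  have "x \<in> closure (span Q)" using dense by simp
  then have "\<forall>e>0. \<exists>u\<in>span Q. dist u x < e" by (simp add: closure_approachable)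
  then obtain u where u: "u \<in> span Q" "dist u x < sqrt d" using d by (meson real_sqrt_gt_0_iff)
  obtain F c where F: "finite F" "F \<subseteq> Q" "u = (\<Sum>b\<in>F. c b *\<^sub>R b)"
    using u(1) unfolding span_explicit by blast
  have on: "\<And>u v. u \<in> F \<Longrightarrow> v \<in> F \<Longrightarrow> u \<bullet> v = (if u = v then 1 else 0)" using F Q by blast
  have "(norm (x - u))\<^sup>2 < (sqrt d)\<^sup>2" using u(2) by (intro power_strict_mono) (auto simp: dist_norm norm_minus_commute)
  then have "(norm (x - u))\<^sup>2 < d" using d by simp
  then have "(norm x)\<^sup>2 - (\<Sum>b\<in>F. (x \<bullet> b)\<^sup>2) < d"
    using norm_diff_orthonormal_sum[OF F(1) on, of x c] sum_nonneg[of F "\<lambda>b. (c b - x \<bullet> b)\<^sup>2"]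
    unfolding F(3) by simp
  then have "(norm (y - \<kappa> *\<^sub>R x))\<^sup>2 < \<epsilon>\<^sup>2 * (\<Sum>b\<in>F. (x \<bullet> b)\<^sup>2)" using e0 by (simp add: d_def field_simps)
  also have "\<dots> \<le> (\<Sum>b\<in>F. ((y - \<kappa> *\<^sub>R x) \<bullet> b)\<^sup>2)"
    unfolding sum_distrib_left
  proof (rule sum_mono)
    fix b assume b: "b \<in> F"
    then obtain \<mu> :: real where \<mu>: "(b, \<mu> *\<^sub>R b) \<in> T" using F Q by (auto simp: eigenvectors_def)
    have "b \<noteq> 0" using on[OF b b] by auto
    then have "\<epsilon> \<le> \<bar>\<mu> - \<kappa>\<bar>" using far \<mu> by blast
    then have "\<epsilon>\<^sup>2 \<le> (\<mu> - \<kappa>)\<^sup>2" using e0 by (metis abs_le_square_iff abs_of_pos)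
    moreover have "(y - \<kappa> *\<^sub>R x) \<bullet> b = (\<mu> - \<kappa>) * (x \<bullet> b)"
      using sym[OF x(1) \<mu>] by (simp add: inner_diff_left algebra_simps)
    ultimately show "\<epsilon>\<^sup>2 * (x \<bullet> b)\<^sup>2 \<le> ((y - \<kappa> *\<^sub>R x) \<bullet> b)\<^sup>2"
      by (simp add: power_mult_distrib mult_right_mono)
  qed
  also have "\<dots> \<le> (norm (y - \<kappa> *\<^sub>R x))\<^sup>2"
    using norm_diff_orthonormal_sum[OF F(1) on, of "y - \<kappa> *\<^sub>R x" "\<lambda>b. (y - \<kappa> *\<^sub>R x) \<bullet> b"]
      zero_le_power2[of "norm (y - \<kappa> *\<^sub>R x - (\<Sum>b\<in>F. ((y - \<kappa> *\<^sub>R x) \<bullet> b) *\<^sub>R b))"] by simp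
  finally show False by simp
qed

lemma orthogonal_complement_trivial_dense:
  fixes R S :: "'h::{real_inner,complete_space} set"
  assumes S: "subspace S" "closed S" and R: "subspace R" "R \<subseteq> S"
    and orth: "\<And>v. v \<in> S \<Longrightarrow> (\<And>y. y \<in> R \<Longrightarrow> v \<bullet> y = 0) \<Longrightarrow> v = 0"
  shows "S \<subseteq> closure R"
proof
  fix f assume f: "f \<in> S"
  obtain m where m: "m \<in> closure R" "\<And>y. y \<in> closure R \<Longrightarrow> (f - m) \<bullet> y = 0"
    using orthogonal_projection[OF subspace_closure[OF R(1)] closed_closure] by blast
  have "m \<in> S" using m(1) closure_minimal[OF R(2) S(2)] by auto
  then have "f - m = 0"
    using f m(2) closure_subset[of R] subspace_diff[OF S(1)] by (intro orth) auto
  then show "f \<in> closure R" using m by simp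
qed

section \<open>The real Hilbert space of square integrable spinor fields\<close>

lemma l2_spaceD:
  assumes "f \<in> l2_space"
  shows "f \<in> borel_measurable lborel" "integrable lborel (\<lambda>p. (norm (f p))\<^sup>2)"
  using assms by (auto simp: l2_space_def)

lemma l2_space_borel: "f \<in> l2_space \<Longrightarrow> f \<in> borel_measurable borel"
  using l2_spaceD(1)[of f] by simp

lemma l2_spaceI_bound:
  assumes "f \<in> borel_measurable lborel" "integrable lborel g" "\<And>p. (norm (f p))\<^sup>2 \<le> g p"
  shows "f \<in> l2_space"
proof -
  have "integrable lborel (\<lambda>p. (norm (f p))\<^sup>2)"
    using assms by (intro Bochner_Integration.integrable_bound[OF assms(2)] AE_I2)
      (auto intro: order_trans[OF _ abs_ge_self])
  then show ?thesis using assms by (simp add: l2_space_def)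
qed

lemma l2_space_zero [simp]: "(\<lambda>p. 0) \<in> l2_space"
  by (simp add: l2_space_def)

lemma l2_space_add:
  assumes "f \<in> l2_space" "g \<in> l2_space"
  shows "(\<lambda>p. f p + g p) \<in> l2_space"
proof (rule l2_spaceI_bound)
  show "(\<lambda>p. f p + g p) \<in> borel_measurable lborel" using assms by (intro borel_measurable_add l2_spaceD)
  show "integrable lborel (\<lambda>p. 2 * (norm (f p))\<^sup>2 + 2 * (norm (g p))\<^sup>2)"
    using assms by (intro Bochner_Integration.integrable_add integrable_mult_right l2_spaceD)
  fix p
  have "(norm (f p + g p))\<^sup>2 \<le> (norm (f p) + norm (g p))\<^sup>2" by (intro power_mono norm_triangle_ineq) auto
  also have "\<dots> \<le> 2 * (norm (f p))\<^sup>2 + 2 * (norm (g p))\<^sup>2"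
    using sum_squares_bound[of "norm (f p)" "norm (g p)"] by (simp add: power2_sum)
  finally show "(norm (f p + g p))\<^sup>2 \<le> 2 * (norm (f p))\<^sup>2 + 2 * (norm (g p))\<^sup>2" .
qed

lemma norm_vector_scalar_mult: "norm (c *s v) = norm c * norm (v :: complex^'n)"
  by (simp add: norm_vec_def L2_set_def norm_mult power_mult_distrib sum_distrib_left[symmetric] real_sqrt_mult)

lemma scaleR_eq_vector_scalar_mult: "r *\<^sub>R v = complex_of_real r *s (v :: complex^'n)"
  by (simp add: vec_eq_iff complex_eq_iff)

lemma scaleR_vector_scalar_mult: "c *s (r *\<^sub>R v) = r *\<^sub>R (c *s (v :: complex^'n))"
  by (simp add: vec_eq_iff)

lemma bounded_linear_vector_scalar_mult: "bounded_linear (\<lambda>v :: complex^'n. c *s v)"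
  by (rule bounded_linear_intro[where K = "norm c"])
    (auto simp: vec_eq_iff algebra_simps norm_vector_scalar_mult)

lemma l2_space_mult:
  assumes "f \<in> l2_space"
  shows "(\<lambda>p. c *s f p) \<in> l2_space"
proof (rule l2_spaceI_bound)
  show "(\<lambda>p. c *s f p) \<in> borel_measurable lborel"
    by (rule measurable_compose[OF l2_spaceD(1)[OF assms]])
      (intro borel_measurable_continuous_onI linear_continuous_on bounded_linear_vector_scalar_mult)
  show "integrable lborel (\<lambda>p. (norm c)\<^sup>2 * (norm (f p))\<^sup>2)"
    using assms by (intro integrable_mult_right l2_spaceD)
qed (simp add: norm_vector_scalar_mult power_mult_distrib)

lemma l2_space_scaleR: "f \<in> l2_space \<Longrightarrow> (\<lambda>p. r *\<^sub>R f p) \<in> l2_space"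
  unfolding scaleR_eq_vector_scalar_mult by (rule l2_space_mult)

lemma l2_space_uminus: "f \<in> l2_space \<Longrightarrow> (\<lambda>p. - f p) \<in> l2_space"
  using l2_space_scaleR[of f "-1"] by simp

lemma l2_space_diff: "f \<in> l2_space \<Longrightarrow> g \<in> l2_space \<Longrightarrow> (\<lambda>p. f p - g p) \<in> l2_space"
  using l2_space_add[OF _ l2_space_uminus, of f g] by simp

lemma l2_inner_integrable:
  assumes "f \<in> l2_space" "g \<in> l2_space"
  shows "integrable lborel (\<lambda>p. f p \<bullet> g p)"
proof (rule Bochner_Integration.integrable_bound)
  show "integrable lborel (\<lambda>p. (norm (f p))\<^sup>2 + (norm (g p))\<^sup>2)"
    using assms by (intro Bochner_Integration.integrable_add l2_spaceD)
  show "(\<lambda>p. f p \<bullet> g p) \<in> borel_measurable lborel"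
    using assms by (intro borel_measurable_inner l2_spaceD)
  have "\<bar>f p \<bullet> g p\<bar> \<le> (norm (f p))\<^sup>2 + (norm (g p))\<^sup>2" for p
  proof -
    have "\<bar>f p \<bullet> g p\<bar> \<le> norm (f p) * norm (g p)" by (rule Cauchy_Schwarz_ineq2)
    also have "\<dots> \<le> (norm (f p))\<^sup>2 + (norm (g p))\<^sup>2"
      using sum_squares_bound[of "norm (f p)" "norm (g p)"]
        mult_nonneg_nonneg[OF norm_ge_zero[of "f p"] norm_ge_zero[of "g p"]]
      by linarith
    finally show ?thesis .
  qed
  then show "AE p in lborel. norm (f p \<bullet> g p) \<le> norm ((norm (f p))\<^sup>2 + (norm (g p))\<^sup>2)" by simp
qed

section \<open>The quotient by equality almost everywhere\<close>

text \<open>A partial equivalence: it relates square integrable fields only, so the quotient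
  contains no classes of other functions.\<close>

definition l2_rel :: "spinor_field \<Rightarrow> spinor_field \<Rightarrow> bool" where
  "l2_rel f g \<longleftrightarrow> f \<in> l2_space \<and> g \<in> l2_space \<and> (AE p in lborel. f p = g p)"

lemma part_equivp_l2_rel: "part_equivp l2_rel"
proof (rule part_equivpI)
  show "\<exists>f. l2_rel f f" by (rule exI[of _ "\<lambda>p. 0"]) (simp add: l2_rel_def)
  show "symp l2_rel" by (auto simp: symp_def l2_rel_def eq_commute)
  show "transp l2_rel" by (auto simp: transp_def l2_rel_def)
qed

quotient_type l2 = spinor_field / partial: l2_rel
  morphisms rep_l2 cls
  by (rule part_equivp_l2_rel)

lemma l2_rel_self: "l2_rel f f \<longleftrightarrow> f \<in> l2_space"
  by (auto simp: l2_rel_def)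

lemma cls_eq_iff: "f \<in> l2_space \<Longrightarrow> g \<in> l2_space \<Longrightarrow> cls f = cls g \<longleftrightarrow> (AE p in lborel. f p = g p)"
  using Quotient_rel[OF Quotient_l2, of f g] by (simp add: l2_rel_def)

lemma l2_cases:
  obtains f where "f \<in> l2_space" "x = cls f"
  using Quotient_abs_rep[OF Quotient_l2, of x] Quotient_rep_reflp[OF Quotient_l2, of x]
  by (metis l2_rel_self)

lemma l2_rel_integral_cong:
  assumes "l2_rel f f'" "l2_rel g g'"
  shows "(LINT p|lborel. f p \<bullet> g p) = (LINT p|lborel. f' p \<bullet> g' p)"
proof (rule integral_cong_AE)
  show "AE p in lborel. f p \<bullet> g p = f' p \<bullet> g' p"
    using assms by (auto simp: l2_rel_def)
qed (use assms in \<open>auto intro!: borel_measurable_inner l2_space_borel simp: l2_rel_def\<close>)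

text \<open>The inner product is the real part of \<open>l2_inner\<close>. The imaginary part is
  recovered by applying \<open>mult_i\<close> to the second argument, see
  \<open>l2_inner_cls\<close>.\<close>

instantiation l2 :: real_inner
begin

lift_definition zero_l2 :: l2 is "\<lambda>p. 0" by (simp add: l2_rel_def)
lift_definition plus_l2 :: "l2 \<Rightarrow> l2 \<Rightarrow> l2" is "\<lambda>f g p. f p + g p"
  by (auto simp: l2_rel_def l2_space_add)
lift_definition minus_l2 :: "l2 \<Rightarrow> l2 \<Rightarrow> l2" is "\<lambda>f g p. f p - g p"
  by (auto simp: l2_rel_def l2_space_diff)
lift_definition uminus_l2 :: "l2 \<Rightarrow> l2" is "\<lambda>f p. - f p"
  by (auto simp: l2_rel_def l2_space_uminus)
lift_definition scaleR_l2 :: "real \<Rightarrow> l2 \<Rightarrow> l2" is "\<lambda>r f p. r *\<^sub>R f p"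
  by (auto simp: l2_rel_def l2_space_scaleR)
lift_definition inner_l2 :: "l2 \<Rightarrow> l2 \<Rightarrow> real" is "\<lambda>f g. LINT p|lborel. f p \<bullet> g p"
  by (rule l2_rel_integral_cong)

definition norm_l2 :: "l2 \<Rightarrow> real" where "norm_l2 x = sqrt (x \<bullet> x)"
definition dist_l2 :: "l2 \<Rightarrow> l2 \<Rightarrow> real" where "dist_l2 x y = norm (x - y)"
definition sgn_l2 :: "l2 \<Rightarrow> l2" where "sgn_l2 x = inverse (norm x) *\<^sub>R x"
definition uniformity_l2 :: "(l2 \<times> l2) filter" where
  "uniformity_l2 = (INF e\<in>{0<..}. principal {(x, y). dist x y < e})"
definition open_l2 :: "l2 set \<Rightarrow> bool" where
  "open_l2 U \<longleftrightarrow> (\<forall>x\<in>U. eventually (\<lambda>(x', y). x' = x \<longrightarrow> y \<in> U) uniformity)"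

lemma cls_ops:
  shows "f \<in> l2_space \<Longrightarrow> g \<in> l2_space \<Longrightarrow> cls f + cls g = cls (\<lambda>p. f p + g p)"
    "f \<in> l2_space \<Longrightarrow> g \<in> l2_space \<Longrightarrow> cls f - cls g = cls (\<lambda>p. f p - g p)"
    "f \<in> l2_space \<Longrightarrow> - cls f = cls (\<lambda>p. - f p)"
    "f \<in> l2_space \<Longrightarrow> r *\<^sub>R cls f = cls (\<lambda>p. r *\<^sub>R f p)"
    "f \<in> l2_space \<Longrightarrow> g \<in> l2_space \<Longrightarrow> cls f \<bullet> cls g = (LINT p|lborel. f p \<bullet> g p)"
  by (auto simp: plus_l2.abs_eq minus_l2.abs_eq uminus_l2.abs_eq scaleR_l2.abs_eq
      inner_l2.abs_eq l2_rel_self)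

instance
proof
  note sp = l2_space_add l2_space_diff l2_space_scaleR l2_space_uminus l2_space_mult
  note ops = cls_ops zero_l2_def
  fix x y z :: l2 and a b r :: real
  obtain f g h where f: "f \<in> l2_space" "x = cls f" and g: "g \<in> l2_space" "y = cls g" and h: "h \<in> l2_space" "z = cls h"
    by (metis l2_cases)
  note fgh = f g h
  show "x + y + z = x + (y + z)" by (simp add: fgh ops sp add.assoc)
  show "x + y = y + x" by (simp add: fgh ops sp add.commute)
  show "0 + x = x" by (simp add: fgh ops sp)
  show "- x + x = 0" by (simp add: fgh ops sp)
  show "x - y = x + - y" by (simp add: fgh ops sp)
  show "a *\<^sub>R (x + y) = a *\<^sub>R x + a *\<^sub>R y" by (simp add: fgh ops sp scaleR_add_right)
  show "(a + b) *\<^sub>R x = a *\<^sub>R x + b *\<^sub>R x" by (simp add: fgh ops sp scaleR_add_left)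
  show "a *\<^sub>R b *\<^sub>R x = (a * b) *\<^sub>R x" by (simp add: fgh ops sp)
  show "1 *\<^sub>R x = x" by (simp add: fgh ops sp)
  show "dist x y = norm (x - y)" by (simp add: dist_l2_def)
  show "sgn x = inverse (norm x) *\<^sub>R x" by (simp add: sgn_l2_def)
  show "uniformity = (INF e\<in>{0<..}. principal {(x :: l2, y). dist x y < e})" by (simp add: uniformity_l2_def)
  show "open U \<longleftrightarrow> (\<forall>x\<in>U. eventually (\<lambda>(x', y). x' = x \<longrightarrow> y \<in> U) uniformity)" for U :: "l2 set"
    by (simp add: open_l2_def)
  show "x \<bullet> y = y \<bullet> x" by (simp add: fgh ops sp inner_commute)
  show "(x + y) \<bullet> z = x \<bullet> z + y \<bullet> z"
    by (simp add: fgh ops sp inner_add_left l2_inner_integrable)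
  show "(r *\<^sub>R x) \<bullet> y = r * (x \<bullet> y)" by (simp add: fgh ops sp)
  show "0 \<le> x \<bullet> x" by (simp add: fgh ops sp)
  show "x \<bullet> x = 0 \<longleftrightarrow> x = 0"
  proof -
    have "(LINT p|lborel. f p \<bullet> f p) = 0 \<longleftrightarrow> (AE p in lborel. f p \<bullet> f p = 0)"
      using f by (intro integral_nonneg_eq_0_iff_AE l2_inner_integrable) auto
    then show ?thesis by (simp add: fgh ops cls_eq_iff)
  qed
  show "norm x = sqrt (x \<bullet> x)" by (simp add: norm_l2_def)
qed

end

lemma norm_cls: "f \<in> l2_space \<Longrightarrow> norm (cls f) = l2_norm f"
  by (simp add: norm_l2_def cls_ops l2_norm_def power2_norm_eq_inner)

lemma norm_cls_power2: "f \<in> l2_space \<Longrightarrow> (norm (cls f))\<^sup>2 = (LINT p|lborel. (norm (f p))\<^sup>2)"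
  by (simp add: norm_cls l2_norm_def)

lemma nn_integral_norm_cls:
  "f \<in> l2_space \<Longrightarrow> (\<integral>\<^sup>+p. ennreal ((norm (f p))\<^sup>2) \<partial>lborel) = ennreal ((norm (cls f))\<^sup>2)"
  by (simp add: norm_cls_power2 nn_integral_eq_integral l2_spaceD)

lift_definition mult_i :: "l2 \<Rightarrow> l2" is "\<lambda>f p. \<i> *s f p"
  by (auto simp: l2_rel_def l2_space_mult)

lemma mult_i_cls: "f \<in> l2_space \<Longrightarrow> mult_i (cls f) = cls (\<lambda>p. \<i> *s f p)"
  by (simp add: mult_i.abs_eq l2_rel_self)

lemma inner_mult_i: "(\<i> *s v) \<bullet> (\<i> *s w) = v \<bullet> (w :: complex^'n)"
  by (simp add: inner_vec_def inner_complex_def algebra_simps)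

lemma linear_mult_i: "linear mult_i"
proof (rule linearI)
  fix x y :: l2 and r :: real
  obtain f g where fg: "f \<in> l2_space" "x = cls f" "g \<in> l2_space" "y = cls g" by (metis l2_cases)
  show "mult_i (x + y) = mult_i x + mult_i y"
    by (simp add: fg mult_i_cls cls_ops l2_space_mult l2_space_add vector_add_ldistrib)
  show "mult_i (r *\<^sub>R x) = r *\<^sub>R mult_i x"
    by (simp add: fg mult_i_cls cls_ops l2_space_mult l2_space_scaleR scaleR_vector_scalar_mult)
qed

lemma mult_i_mult_i: "mult_i (mult_i x) = - x"
proof -
  obtain f where f: "f \<in> l2_space" "x = cls f" by (metis l2_cases)
  show ?thesis by (simp add: f mult_i_cls cls_ops l2_space_mult)
qed

lemma mult_i_inner: "mult_i x \<bullet> mult_i y = x \<bullet> y"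
proof -
  obtain f g where fg: "f \<in> l2_space" "x = cls f" "g \<in> l2_space" "y = cls g" by (metis l2_cases)
  show ?thesis by (simp add: fg mult_i_cls cls_ops l2_space_mult inner_mult_i)
qed

lemma l2_inner_cls:
  assumes "f \<in> l2_space" "g \<in> l2_space"
  shows "l2_inner f g = Complex (cls f \<bullet> cls g) (cls f \<bullet> mult_i (cls g))"
proof -
  have eq: "(\<Sum>i\<in>UNIV. f p $ i * cnj (g p $ i)) = of_real (f p \<bullet> g p) + \<i> * of_real (f p \<bullet> (\<i> *s g p))" for p
    by (simp add: complex_eq_iff inner_vec_def inner_complex_def algebra_simps)
  have "l2_inner f g = (LINT p|lborel. of_real (f p \<bullet> g p) + \<i> * of_real (f p \<bullet> (\<i> *s g p)))"
    by (simp add: l2_inner_def eq)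
  also have "\<dots> = of_real (LINT p|lborel. f p \<bullet> g p) + \<i> * of_real (LINT p|lborel. f p \<bullet> (\<i> *s g p))"
    using assms by (simp add: l2_inner_integrable l2_space_mult)
  also have "\<dots> = Complex (cls f \<bullet> cls g) (cls f \<bullet> mult_i (cls g))"
    using assms by (simp add: cls_ops mult_i_cls l2_space_mult complex_eq_iff)
  finally show ?thesis .
qed

text \<open>Riesz-Fischer: a subsequence with increments below \<open>(1/2)^n\<close> converges
  almost everywhere, and Fatou's lemma identifies the pointwise limit as the limit in norm. A Cauchy
  sequence follows its subsequence.\<close>

instance l2 :: complete_space
proof
  fix X :: "nat \<Rightarrow> l2" assume X: "Cauchy X"
  have ex: "\<exists>N. \<forall>i\<ge>N. \<forall>j\<ge>N. dist (X i) (X j) < (1/2)^n" for n :: nat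
    using X unfolding Cauchy_def by (meson zero_less_power half_gt_zero_iff zero_less_one)
  have "\<exists>r :: nat \<Rightarrow> nat. \<forall>n. (\<forall>i\<ge>r n. \<forall>j\<ge>r n. dist (X i) (X j) < (1/2)^n) \<and> r n < r (Suc n)"
  proof (rule dependent_nat_choice)
    show "\<exists>x. \<forall>i\<ge>x. \<forall>j\<ge>x. dist (X i) (X j) < (1/2)^0" using ex[of 0] .
    fix x n :: nat
    obtain N where "\<forall>i\<ge>N. \<forall>j\<ge>N. dist (X i) (X j) < (1/2)^Suc n" using ex by blast
    then show "\<exists>y. (\<forall>i\<ge>y. \<forall>j\<ge>y. dist (X i) (X j) < (1/2)^Suc n) \<and> x < y"
      by (intro exI[of _ "max N (Suc x)"]) auto
  qed
  then obtain r :: "nat \<Rightarrow> nat" where r: "\<And>n i j. i \<ge> r n \<Longrightarrow> j \<ge> r n \<Longrightarrow> dist (X i) (X j) < (1/2)^n"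
      "\<And>n. r n < r (Suc n)" by blast
  have mono: "strict_mono r" using r(2) by (simp add: strict_mono_Suc_iff)
  have "\<forall>n. \<exists>f. f \<in> l2_space \<and> X (r n) = cls f" by (metis l2_cases)
  then obtain f where f: "\<And>n. f n \<in> l2_space" "\<And>n. X (r n) = cls (f n)" by metis
  have fm [measurable]: "f n \<in> borel_measurable borel" for n using f by (simp add: l2_space_borel)
  have fd: "(\<lambda>p. f m p - f n p) \<in> l2_space" for m n using f by (simp add: l2_space_diff)
  have dle: "(\<integral>\<^sup>+p. ennreal ((norm (f m p - f n p))\<^sup>2) \<partial>lborel) \<le> ennreal ((1/4)^n)" if "m \<ge> n" for m n
  proof -
    have "norm (X (r m) - X (r n)) \<le> (1/2)^n"
      using r(1)[of n "r m" "r n"] that strict_mono_leD[OF mono that] by (simp add: dist_norm less_imp_le)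
    then have "(norm (X (r m) - X (r n)))\<^sup>2 \<le> ((1/2)^n)\<^sup>2" by (intro power_mono) auto
    also have "((1/2)^n)\<^sup>2 = ((1/4)^n :: real)" by (simp add: power2_eq_square flip: power_mult_distrib)
    finally have "(norm (cls (\<lambda>p. f m p - f n p)))\<^sup>2 \<le> (1/4)^n" by (simp add: f cls_ops)
    then show ?thesis by (subst nn_integral_norm_cls[OF fd]) (rule ennreal_leI)
  qed
  \<comment> \<open>The factor \<open>2^n\<close> still leaves integrals bounded by
    \<open>(1/2)^n\<close>, and where the sum is finite it makes the increments decay like
    \<open>sqrt (1/2) ^ n\<close>, which is summable.\<close>
  define G where "G n p = ennreal (2^n * (norm (f (Suc n) p - f n p))\<^sup>2)" for n p
  have "(\<integral>\<^sup>+p. (\<Sum>n. G n p) \<partial>lborel) = (\<Sum>n. \<integral>\<^sup>+p. G n p \<partial>lborel)"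
    unfolding G_def by (intro nn_integral_suminf) measurable
  also have "\<dots> \<le> (\<Sum>n. ennreal ((1/2)^n))"
  proof (intro suminf_le allI)
    fix n
    have "(\<integral>\<^sup>+p. G n p \<partial>lborel) = ennreal (2^n) * (\<integral>\<^sup>+p. ennreal ((norm (f (Suc n) p - f n p))\<^sup>2) \<partial>lborel)"
      unfolding G_def by (subst nn_integral_cmult[symmetric]) (auto simp: ennreal_mult)
    also have "\<dots> \<le> ennreal (2^n) * ennreal ((1/4)^n)" by (intro mult_left_mono dle) auto
    also have "\<dots> = ennreal ((1/2)^n)" by (simp add: ennreal_mult[symmetric] flip: power_mult_distrib)
    finally show "(\<integral>\<^sup>+p. G n p \<partial>lborel) \<le> ennreal ((1/2)^n)" .
  qed auto
  also have "\<dots> = ennreal (\<Sum>n. (1/2)^n)" by (intro suminf_ennreal2 summable_geometric) auto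
  also have "\<dots> < \<infinity>" by simp
  finally have "(\<integral>\<^sup>+p. (\<Sum>n. G n p) \<partial>lborel) \<noteq> \<infinity>" by simp
  then have "AE p in lborel. (\<Sum>n. G n p) \<noteq> \<infinity>"
    by (intro nn_integral_noteq_infinite) (auto simp: G_def)
  then have AEc: "AE p in lborel. convergent (\<lambda>n. f n p)"
  proof eventually_elim
    fix p assume fin: "(\<Sum>n. G n p) \<noteq> \<infinity>"
    define C where "C = enn2real (\<Sum>n. G n p)"
    have "norm (f (Suc n) p - f n p) \<le> sqrt C * (sqrt (1/2))^n" for n
    proof -
      have "G n p \<le> (\<Sum>n. G n p)" using sum_le_suminf[of "\<lambda>n. G n p" "{n}"] by simp
      also have "\<dots> = ennreal C" using fin by (simp add: C_def less_top)
      finally have "2^n * (norm (f (Suc n) p - f n p))\<^sup>2 \<le> C"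
        by (simp add: G_def C_def)
      then have "(norm (f (Suc n) p - f n p))\<^sup>2 \<le> C * (1/2)^n" by (simp add: field_simps power_divide)
      then have "sqrt ((norm (f (Suc n) p - f n p))\<^sup>2) \<le> sqrt (C * (1/2)^n)" by (rule real_sqrt_le_mono)
      then show ?thesis by (simp add: real_sqrt_mult real_sqrt_power)
    qed
    then have le: "norm (norm (f (Suc n) p - f n p)) \<le> sqrt C * (sqrt (1/2))^n" for n by simp
    have "summable (\<lambda>n. sqrt C * (sqrt (1/2))^n)"
      by (intro summable_mult summable_geometric) (simp add: real_sqrt_divide)
    then have "summable (\<lambda>n. norm (f (Suc n) p - f n p))"
      by (rule summable_comparison_test'[where N = 0]) (rule le)
    then have "summable (\<lambda>n. f (Suc n) p - f n p)" by (rule summable_norm_cancel)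
    then have "convergent (\<lambda>n. (\<Sum>i<n. f (Suc i) p - f i p) + f 0 p)"
      by (intro convergent_add convergent_const) (simp add: summable_iff_convergent)
    then show "convergent (\<lambda>n. f n p)" by (simp add: sum_lessThan_telescope[of "\<lambda>i. f i p"])
  qed
  define F where "F p = lim (\<lambda>n. f n p)" for p
  have Fm [measurable]: "F \<in> borel_measurable lborel" unfolding F_def by measurable
  have lim: "AE p in lborel. (\<lambda>n. f n p) \<longlonglongrightarrow> F p" using AEc
    by eventually_elim (simp add: F_def convergent_LIMSEQ_iff)
  \<comment> \<open>Fatou's lemma, with \<open>m\<close> tending to infinity, carries the bound on
    \<open>f m - f n\<close> over to the pointwise limit.\<close>
  have Fle: "(\<integral>\<^sup>+p. ennreal ((norm (F p - f n p))\<^sup>2) \<partial>lborel) \<le> ennreal ((1/4)^n)" for n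
  proof -
    have "(\<integral>\<^sup>+p. ennreal ((norm (F p - f n p))\<^sup>2) \<partial>lborel) = (\<integral>\<^sup>+p. liminf (\<lambda>m. ennreal ((norm (f m p - f n p))\<^sup>2)) \<partial>lborel)"
    proof (rule nn_integral_cong_AE)
      show "AE p in lborel. ennreal ((norm (F p - f n p))\<^sup>2) = liminf (\<lambda>m. ennreal ((norm (f m p - f n p))\<^sup>2))"
        using lim
      proof eventually_elim
        fix p assume "(\<lambda>n. f n p) \<longlonglongrightarrow> F p"
        then have "(\<lambda>m. ennreal ((norm (f m p - f n p))\<^sup>2)) \<longlonglongrightarrow> ennreal ((norm (F p - f n p))\<^sup>2)"
          by (intro tendsto_intros)
        then show "ennreal ((norm (F p - f n p))\<^sup>2) = liminf (\<lambda>m. ennreal ((norm (f m p - f n p))\<^sup>2))"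
          by (intro lim_imp_Liminf[symmetric]) simp_all
      qed
    qed
    also have "\<dots> \<le> liminf (\<lambda>m. \<integral>\<^sup>+p. ennreal ((norm (f m p - f n p))\<^sup>2) \<partial>lborel)"
      by (intro nn_integral_liminf) measurable
    also have "\<dots> \<le> ennreal ((1/4)^n)"
    proof -
      have "liminf (\<lambda>m. \<integral>\<^sup>+p. ennreal ((norm (f m p - f n p))\<^sup>2) \<partial>lborel) \<le> liminf (\<lambda>m. ennreal ((1/4)^n))"
        by (intro Liminf_mono eventually_sequentiallyI[of n] dle)
      then show ?thesis by (simp add: Liminf_const)
    qed
    finally show ?thesis .
  qed
  have Fd: "(\<lambda>p. F p - f n p) \<in> l2_space" for n
    unfolding l2_space_def using Fle[of n]
    by (auto intro!: integrableI_nonneg simp: less_top[symmetric] top_unique)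
  have Fl2: "F \<in> l2_space" using l2_space_add[OF Fd[of 0] f(1)[of 0]] by simp
  have "(\<lambda>n. X (r n)) \<longlonglongrightarrow> cls F"
  proof -
    have "norm (X (r n) - cls F) \<le> (1/2)^n" for n
    proof -
      have "ennreal ((norm (cls (\<lambda>p. F p - f n p)))\<^sup>2) \<le> ennreal ((1/4)^n)" using Fle[of n] nn_integral_norm_cls[OF Fd] by simp
      then have "(norm (cls F - X (r n)))\<^sup>2 \<le> (1/4)^n" by (simp add: f cls_ops Fl2)
      also have "((1/4)^n :: real) = ((1/2)^n)\<^sup>2" by (simp add: power2_eq_square flip: power_mult_distrib)
      finally have "norm (cls F - X (r n)) \<le> (1/2)^n" by (rule power2_le_imp_le) simp
      then show ?thesis by (simp add: norm_minus_commute)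
    qed
    then have ev: "\<forall>\<^sub>F n in sequentially. norm (X (r n) - cls F) \<le> (1/2)^n" by simp
    have "(\<lambda>n. (1/2 :: real)^n) \<longlonglongrightarrow> 0" by (intro LIMSEQ_power_zero) simp
    then have "(\<lambda>n. X (r n) - cls F) \<longlonglongrightarrow> 0" by (rule Lim_null_comparison[OF ev])
    then show ?thesis by (rule LIM_zero_cancel)
  qed
  then have "X \<longlonglongrightarrow> cls F" using Cauchy_converges_subseq[OF X mono, of "cls F"] by (simp add: o_def)
  then show "convergent X" by (rule convergentI)
qed

section \<open>From graphs of functions to relations on the Hilbert space\<close>

definition cls_graph :: "l2_operator \<Rightarrow> (l2 \<times> l2) set" where
  "cls_graph T = (\<lambda>(f, g). (cls f, cls g)) ` T"

lemma l2_tendsto_cls: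
  assumes "\<And>n. X n \<in> l2_space" "f \<in> l2_space"
  shows "l2_tendsto X f \<longleftrightarrow> (\<lambda>n. cls (X n)) \<longlonglongrightarrow> cls f"
proof -
  have "l2_tendsto X f \<longleftrightarrow> (\<lambda>n. norm (cls (X n) - cls f)) \<longlonglongrightarrow> 0"
    using assms by (simp add: l2_tendsto_def cls_ops norm_cls l2_space_diff)
  then show ?thesis by (simp add: tendsto_norm_zero_iff LIM_zero_iff)
qed

text \<open>Limits in the sense of \<open>l2_tendsto\<close> depend on classes alone, and a sequence
  in \<open>cls_graph T\<close> lifts to one in \<open>T\<close> by choosing representatives. So the
  closure may be taken in the Hilbert space.\<close>

lemma mem_l2_graph_closure:
  assumes T: "T \<subseteq> l2_space \<times> l2_space" and f: "f \<in> l2_space" and g: "g \<in> l2_space"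
  shows "(f, g) \<in> l2_graph_closure T \<longleftrightarrow> (cls f, cls g) \<in> closure (cls_graph T)"
proof
  assume "(f, g) \<in> l2_graph_closure T"
  then obtain X Y where XY: "\<And>n. (X n, Y n) \<in> T" "l2_tendsto X f" "l2_tendsto Y g"
    by (auto simp: l2_graph_closure_def)
  have XY_in: "X n \<in> l2_space" "Y n \<in> l2_space" for n using XY(1) T by auto
  have "(\<lambda>n. cls (X n)) \<longlonglongrightarrow> cls f" "(\<lambda>n. cls (Y n)) \<longlonglongrightarrow> cls g"
    using XY f g XY_in by (simp_all add: l2_tendsto_cls)
  then show "(cls f, cls g) \<in> closure (cls_graph T)"
    unfolding closure_sequential using XY(1)
    by (intro exI[of _ "\<lambda>n. (cls (X n), cls (Y n))"]) (auto simp: cls_graph_def intro!: tendsto_Pair)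
next
  assume "(cls f, cls g) \<in> closure (cls_graph T)"
  then obtain S where S: "\<And>n. S n \<in> cls_graph T" "S \<longlonglongrightarrow> (cls f, cls g)"
    unfolding closure_sequential by blast
  have "\<forall>n. \<exists>x y. (x, y) \<in> T \<and> S n = (cls x, cls y)"
    using S(1) unfolding cls_graph_def image_iff by fastforce
  then obtain X Y where XY: "\<And>n. (X n, Y n) \<in> T" "\<And>n. S n = (cls (X n), cls (Y n))" by metis
  have "(\<lambda>n. cls (X n)) \<longlonglongrightarrow> cls f" "(\<lambda>n. cls (Y n)) \<longlonglongrightarrow> cls g"
    using tendsto_fst[OF S(2)] tendsto_snd[OF S(2)] by (simp_all add: XY(2))
  moreover have "X n \<in> l2_space" "Y n \<in> l2_space" for n using XY(1) T by auto
  ultimately have "l2_tendsto X f" "l2_tendsto Y g" using f g by (simp_all add: l2_tendsto_cls)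
  then show "(f, g) \<in> l2_graph_closure T" using XY(1) by (auto simp: l2_graph_closure_def)
qed

lemma closure_symmetric_relation:
  fixes T :: "('h::real_inner \<times> 'h) set"
  assumes "\<And>x y x' y'. (x, y) \<in> T \<Longrightarrow> (x', y') \<in> T \<Longrightarrow> y \<bullet> x' = x \<bullet> y'"
    and xy: "(x, y) \<in> closure T" "(x', y') \<in> closure T"
  shows "y \<bullet> x' = x \<bullet> y'"
proof -
  obtain X X' where X: "\<And>n. X n \<in> T" "X \<longlonglongrightarrow> (x, y)" and X': "\<And>n. X' n \<in> T" "X' \<longlonglongrightarrow> (x', y')"
    using xy unfolding closure_sequential by metis
  have 1: "(\<lambda>n. snd (X n) \<bullet> fst (X' n)) \<longlonglongrightarrow> y \<bullet> x'"
    using tendsto_inner[OF tendsto_snd[OF X(2)] tendsto_fst[OF X'(2)]] by simp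
  have 2: "(\<lambda>n. fst (X n) \<bullet> snd (X' n)) \<longlonglongrightarrow> x \<bullet> y'"
    using tendsto_inner[OF tendsto_fst[OF X(2)] tendsto_snd[OF X'(2)]] by simp
  have "snd (X n) \<bullet> fst (X' n) = fst (X n) \<bullet> snd (X' n)" for n
    using assms(1)[of "fst (X n)" "snd (X n)" "fst (X' n)" "snd (X' n)"] X(1)[of n] X'(1)[of n] by simp
  then show ?thesis using LIMSEQ_unique[OF 1] 2 by simp
qed

lemma cls_mult_complex:
  assumes "f \<in> l2_space"
  shows "cls (\<lambda>p. z *s f p) = Re z *\<^sub>R cls f + Im z *\<^sub>R mult_i (cls f)"
proof -
  have "z *s v = Re z *\<^sub>R v + Im z *\<^sub>R (\<i> *s v)" for v :: "complex^2"
    by (simp add: vec_eq_iff complex_eq_iff)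
  then show ?thesis using assms
    by (simp add: mult_i_cls cls_ops l2_space_mult l2_space_scaleR)
qed

lemma cls_sum:
  assumes "finite F" "\<And>b. b \<in> F \<Longrightarrow> f b \<in> l2_space"
  shows "(\<lambda>p. \<Sum>b\<in>F. f b p) \<in> l2_space \<and> cls (\<lambda>p. \<Sum>b\<in>F. f b p) = (\<Sum>b\<in>F. cls (f b))"
  using assms
proof (induction rule: finite_induct)
  case empty
  then show ?case by (simp add: zero_l2_def)
next
  case (insert b F)
  then show ?case by (simp add: l2_space_add cls_ops[symmetric])
qed

text \<open>Real coefficients of \<open>b\<close> and \<open>J b\<close> are merged into the real
  and imaginary part of one complex coefficient, the shape in which
  \<open>l2_orthonormal_basis\<close> asks for completeness.\<close>

lemma span_complex:
  fixes J :: "'h::real_vector \<Rightarrow> 'h"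
  assumes "u \<in> span (B \<union> J ` B)"
  obtains F and c :: "'h \<Rightarrow> complex" where "finite F" "F \<subseteq> B" "u = (\<Sum>b\<in>F. Re (c b) *\<^sub>R b + Im (c b) *\<^sub>R J b)"
proof -
  have "\<exists>F c. finite F \<and> F \<subseteq> B \<and> u = (\<Sum>b\<in>F. Re (c b) *\<^sub>R b + Im (c b) *\<^sub>R J b)"
    using assms
  proof (induction rule: span_induct_alt)
    case base
    show ?case by (rule exI[of _ "{}"]) auto
  next
    case (step r v u)
    then obtain F and c :: "'h \<Rightarrow> complex" where F: "finite F" "F \<subseteq> B" "u = (\<Sum>b\<in>F. Re (c b) *\<^sub>R b + Im (c b) *\<^sub>R J b)"
      by blast
    obtain b z where b: "b \<in> B" "r *\<^sub>R v = Re z *\<^sub>R b + Im z *\<^sub>R J b"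
    proof (cases "v \<in> B")
      case True then show ?thesis using that[of v "of_real r"] by simp
    next
      case False
      then obtain b where "b \<in> B" "v = J b" using step by auto
      then show ?thesis using that[of b "\<i> * of_real r"] by simp
    qed
    define c' where "c' x = (if x \<in> F then c x else 0) + (if x = b then z else 0)" for x
    have "(\<Sum>x\<in>insert b F. Re (c' x) *\<^sub>R x + Im (c' x) *\<^sub>R J x)
      = (\<Sum>x\<in>insert b F. (if x \<in> F then Re (c x) *\<^sub>R x + Im (c x) *\<^sub>R J x else 0)
          + (if x = b then Re z *\<^sub>R x + Im z *\<^sub>R J x else 0))"
      by (intro sum.cong refl) (auto simp: c'_def scaleR_add_left)
    also have "\<dots> = u + r *\<^sub>R v"
    proof -
      have "insert b F \<inter> F = F" "F \<inter> insert b F = F" by auto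
      then show ?thesis using F b by (simp add: sum.distrib sum.If_cases)
    qed
    finally show ?case using F b by (intro exI[of _ "insert b F"] exI[of _ c']) (auto simp: add.commute)
  qed
  then show thesis using that by blast
qed

lemma continuous_on_mult_i: "continuous_on S mult_i"
proof (rule linear_continuous_on, rule bounded_linear_intro[where K = 1])
  show "norm (mult_i x) \<le> norm x * 1" for x by (simp add: norm_eq_sqrt_inner mult_i_inner)
qed (use linear_mult_i in \<open>auto simp: linear_iff\<close>)

lemma closure_mult_i:
  assumes "\<And>x y. (x, y) \<in> T \<Longrightarrow> (mult_i x, mult_i y) \<in> T" "(x, y) \<in> closure T"
  shows "(mult_i x, mult_i y) \<in> closure T"
proof -
  have "(\<lambda>x. (mult_i (fst x), mult_i (snd x))) ` closure T \<subseteq> closure T"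
  proof (rule image_closure_subset[OF _ closed_closure])
    show "continuous_on (closure T) (\<lambda>x. (mult_i (fst x), mult_i (snd x)))"
      by (intro continuous_intros continuous_on_compose2[OF continuous_on_mult_i[of UNIV]]) auto
    show "(\<lambda>x. (mult_i (fst x), mult_i (snd x))) ` T \<subseteq> closure T"
      using assms(1) by (auto intro!: subsetD[OF closure_subset])
  qed
  then show ?thesis using assms(2) by fastforce
qed

text \<open>Reduces the claim to facts about the real relation \<open>cls_graph T0\<close>. Symmetry
  passes to the closure; the basis comes from \<open>complex_orthonormal_eigenbasis\<close>; density
  comes from \<open>approximate_eigenvalue\<close>, applied to the real orthonormal family formed by
  \<open>B\<close> and its image under \<open>mult_i\<close>.\<close>

theorem pure_point_dense_criterion:
  assumes T0: "T0 \<subseteq> l2_space \<times> l2_space"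
    and sub: "subspace (cls_graph T0)"
    and Ji: "\<And>x y. (x, y) \<in> cls_graph T0 \<Longrightarrow> (mult_i x, mult_i y) \<in> cls_graph T0"
    and sym: "\<And>x y x' y'. (x, y) \<in> cls_graph T0 \<Longrightarrow> (x', y') \<in> cls_graph T0 \<Longrightarrow> y \<bullet> x' = x \<bullet> y'"
    and dense: "closure (span (eigenvectors (closure (cls_graph T0)))) = UNIV"
    and approx: "\<And>\<kappa> \<epsilon>. \<epsilon> > 0 \<Longrightarrow> \<exists>x y. (x, y) \<in> closure (cls_graph T0) \<and> norm (y - \<kappa> *\<^sub>R x) < \<epsilon> * norm x"
  shows "has_pure_point_spectrum (l2_graph_closure T0) \<and> closure (eigenvalues (l2_graph_closure T0)) = \<real>"
proof -
  let ?T = "closure (cls_graph T0)"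
  have Tsub: "subspace ?T" by (rule subspace_closure[OF sub])
  have Tsym: "y \<bullet> x' = x \<bullet> y'" if "(x, y) \<in> ?T" "(x', y') \<in> ?T" for x y x' y'
    using closure_symmetric_relation[OF sym that] .
  have TJ: "(mult_i x, mult_i y) \<in> ?T" if "(x, y) \<in> ?T" for x y
    by (rule closure_mult_i[OF _ that]) (rule Ji)
  obtain B where B: "B \<subseteq> eigenvectors ?T" "\<And>b. b \<in> B \<Longrightarrow> norm b = 1"
    "\<And>b b'. b \<in> B \<Longrightarrow> b' \<in> B \<Longrightarrow> b \<noteq> b' \<Longrightarrow> b \<bullet> b' = 0 \<and> b \<bullet> mult_i b' = 0"
    "closure (span (B \<union> mult_i ` B)) = UNIV"
    using complex_orthonormal_eigenbasis[OF Tsub closed_closure Tsym linear_mult_i mult_i_mult_i mult_i_inner TJ dense]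
    by blast
  have ii: "b \<bullet> mult_i b = 0" for b
    using mult_i_inner[of b "mult_i b"] by (simp add: mult_i_mult_i inner_commute)
  \<comment> \<open>One representative per class, since an orthonormal set of functions may not
    contain two fields that agree almost everywhere.\<close>
  define rp where "rp x = (SOME f. f \<in> l2_space \<and> cls f = x)" for x
  have rp: "rp x \<in> l2_space" "cls (rp x) = x" for x
    using someI_ex[of "\<lambda>f. f \<in> l2_space \<and> cls f = x"] l2_cases[of x] by (auto simp: rp_def)
  have inj: "rp x = rp y \<longleftrightarrow> x = y" for x y using rp(2) by metis
  have eig: "eigenfunction (l2_graph_closure T0) z f \<longleftrightarrow>
      f \<in> l2_space \<and> cls f \<noteq> 0 \<and> (cls f, Re z *\<^sub>R cls f + Im z *\<^sub>R mult_i (cls f)) \<in> ?T" for z f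
    using mem_l2_graph_closure[OF T0, of f "\<lambda>p. z *s f p"]
    by (auto simp: eigenfunction_def norm_cls[symmetric] cls_mult_complex l2_space_mult)
  have "l2_orthonormal_basis (rp ` B)"
    unfolding l2_orthonormal_basis_def
  proof (intro conjI ballI allI impI)
    show "rp ` B \<subseteq> l2_space" using rp by auto
  next
    fix f g assume "f \<in> rp ` B" "g \<in> rp ` B"
    then obtain b b' where b: "b \<in> B" "f = rp b" "b' \<in> B" "g = rp b'" by auto
    have "b \<bullet> b = 1" using B(2)[OF b(1)] by (simp add: norm_eq_1)
    then show "l2_inner f g = (if f = g then 1 else 0)"
      using b B(3)[of b b'] by (cases "b = b'") (auto simp: l2_inner_cls rp inj ii complex_eq_iff)
  next
    fix f \<epsilon> assume f: "f \<in> l2_space" "(\<epsilon> :: real) > 0"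
    have "cls f \<in> closure (span (B \<union> mult_i ` B))" using B(4) by simp
    then obtain u where u: "u \<in> span (B \<union> mult_i ` B)" "dist u (cls f) < \<epsilon>"
      using f(2) unfolding closure_approachable by blast
    obtain F and c :: "l2 \<Rightarrow> complex" where F: "finite F" "F \<subseteq> B" "u = (\<Sum>b\<in>F. Re (c b) *\<^sub>R b + Im (c b) *\<^sub>R mult_i b)"
      using span_complex[OF u(1)] by metis
    have injF: "inj_on rp F" by (auto simp: inj_on_def inj)
    have s: "(\<lambda>p. \<Sum>b\<in>F. c b *s rp b p) \<in> l2_space" "cls (\<lambda>p. \<Sum>b\<in>F. c b *s rp b p) = u"
      using cls_sum[OF F(1), of "\<lambda>b p. c b *s rp b p"] by (simp_all add: l2_space_mult rp cls_mult_complex F(3))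
    have "l2_norm (\<lambda>p. f p - (\<Sum>b\<in>F. c b *s rp b p)) = norm (cls f - u)"
      using f s by (simp add: norm_cls[symmetric] l2_space_diff s(2)[symmetric] cls_ops)
    also have "\<dots> < \<epsilon>" using u(2) by (simp add: dist_norm norm_minus_commute)
    finally have "l2_norm (\<lambda>p. f p - (\<Sum>b\<in>F. c b *s rp b p)) < \<epsilon>" .
    moreover have "(\<Sum>g\<in>rp ` F. c (cls g) *s g p) = (\<Sum>b\<in>F. c b *s rp b p)" for p
      by (simp add: sum.reindex[OF injF] rp)
    ultimately show "\<exists>F c. finite F \<and> F \<subseteq> rp ` B \<and> l2_norm (\<lambda>p. f p - (\<Sum>\<phi>\<in>F. c \<phi> *s \<phi> p)) < \<epsilon>"
      using F by (intro exI[of _ "rp ` F"] exI[of _ "\<lambda>g. c (cls g)"]) auto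
  qed
  moreover have "\<forall>f\<in>rp ` B. \<exists>z. eigenfunction (l2_graph_closure T0) z f"
  proof
    fix f assume "f \<in> rp ` B"
    then obtain b where b: "b \<in> B" "f = rp b" by auto
    obtain \<mu> :: real where "(b, \<mu> *\<^sub>R b) \<in> ?T" using B(1) b by (auto simp: eigenvectors_def)
    then have "eigenfunction (l2_graph_closure T0) (of_real \<mu>) f"
      using b B(2)[OF b(1)] by (auto simp: eig rp)
    then show "\<exists>z. eigenfunction (l2_graph_closure T0) z f" by blast
  qed
  ultimately have pp: "has_pure_point_spectrum (l2_graph_closure T0)" by (auto simp: has_pure_point_spectrum_def)
  have ev: "eigenvalues (l2_graph_closure T0) = of_real ` {\<mu>. \<exists>x. x \<noteq> 0 \<and> (x, \<mu> *\<^sub>R x) \<in> ?T}" (is "_ = of_real ` ?M")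
  proof (intro equalityI subsetI)
    fix z assume "z \<in> eigenvalues (l2_graph_closure T0)"
    then obtain x where x: "x \<noteq> 0" "(x, Re z *\<^sub>R x + Im z *\<^sub>R mult_i x) \<in> ?T"
      by (auto simp: eigenvalues_def eig)
    \<comment> \<open>Eigenvalues are real: in the symmetry relation between \<open>x\<close> and
      \<open>mult_i x\<close> only the imaginary part of \<open>z\<close> survives.\<close>
    have "Im z * (x \<bullet> x) = 0"
    proof -
      have "(Re z *\<^sub>R x + Im z *\<^sub>R mult_i x) \<bullet> mult_i x = x \<bullet> mult_i (Re z *\<^sub>R x + Im z *\<^sub>R mult_i x)"
        using Tsym[OF x(2) TJ[OF x(2)]] .
      then show ?thesis
        using ii by (simp add: linear_add[OF linear_mult_i] linear_scale[OF linear_mult_i] mult_i_mult_i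
            inner_add_left inner_add_right inner_diff_right mult_i_inner inner_commute)
    qed
    then have "Im z = 0" using x by simp
    then show "z \<in> of_real ` ?M" using x by (intro image_eqI[of _ _ "Re z"]) (auto simp: complex_eq_iff)
  next
    fix z :: complex assume "z \<in> of_real ` ?M"
    then obtain \<mu> x where "z = of_real \<mu>" "x \<noteq> 0" "(x, \<mu> *\<^sub>R x) \<in> ?T" by auto
    then have "eigenfunction (l2_graph_closure T0) z (rp x)" by (simp add: eig rp)
    then show "z \<in> eigenvalues (l2_graph_closure T0)" by (auto simp: eigenvalues_def)
  qed
  have "closure (eigenvalues (l2_graph_closure T0)) = \<real>"
  proof
    show "closure (eigenvalues (l2_graph_closure T0)) \<subseteq> \<real>"
      unfolding ev by (intro closure_minimal closed_complex_Reals) auto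
    show "\<real> \<subseteq> closure (eigenvalues (l2_graph_closure T0))"
    proof
      fix w :: complex assume "w \<in> \<real>"
      then obtain \<kappa> where \<kappa>: "w = of_real \<kappa>" by (auto elim: Reals_cases)
      have on: "u \<bullet> v = (if u = v then 1 else 0)" if "u \<in> B \<union> mult_i ` B" "v \<in> B \<union> mult_i ` B" for u v
      proof -
        have 1: "b \<bullet> b' = (if b = b' then 1 else 0)" "b \<bullet> mult_i b' = 0" if "b \<in> B" "b' \<in> B" for b b'
          using B(2)[OF that(1)] B(3)[OF that] ii by (auto simp: norm_eq_1)
        have 2: "mult_i b \<bullet> b' = 0" if "b \<in> B" "b' \<in> B" for b b'
          using 1(2)[OF that(2,1)] by (simp add: inner_commute)
        have 3: "mult_i b = mult_i b' \<longleftrightarrow> b = b'" for b b' by (metis mult_i_mult_i minus_equation_iff)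
        have 4: "b \<noteq> mult_i b'" if "b \<in> B" "b' \<in> B" for b b'
          using 1(1)[OF that(1,1)] 1(2)[OF that] by auto
        show ?thesis using that 1 2 3 4 by (auto simp: mult_i_inner)
      qed
      have BE: "B \<union> mult_i ` B \<subseteq> eigenvectors ?T"
      proof -
        have "mult_i b \<in> eigenvectors ?T" if "b \<in> eigenvectors ?T" for b
          using that TJ by (auto simp: eigenvectors_def) (metis linear_mult_i linear_scale)
        then show ?thesis using B(1) by auto
      qed
      show "w \<in> closure (eigenvalues (l2_graph_closure T0))"
        unfolding closure_approachable
      proof (intro allI impI)
        fix \<epsilon> :: real assume "\<epsilon> > 0"
        then obtain x y where "(x, y) \<in> ?T" "norm (y - \<kappa> *\<^sub>R x) < \<epsilon> * norm x" using approx by blast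
        from approximate_eigenvalue[OF Tsym BE on B(4) this]
        obtain e \<mu> where "e \<noteq> 0" "(e, \<mu> *\<^sub>R e) \<in> ?T" "\<bar>\<mu> - \<kappa>\<bar> < \<epsilon>" by blast
        then show "\<exists>z\<in>eigenvalues (l2_graph_closure T0). dist z w < \<epsilon>"
          unfolding ev \<kappa> by (intro bexI[of _ "of_real \<mu>"]) (auto simp: dist_norm simp flip: of_real_diff)
      qed
    qed
  qed
  then show ?thesis using pp by blast
qed

section \<open>Radial integrals\<close>

text \<open>The disc \<open>|p|^2 <= x\<close> has area \<open>pi * x\<close>, so in the variable
  \<open>t = |p|^2\<close> area becomes a constant multiple of Lebesgue measure on the half line.
  This is the reason for using \<open>t\<close> rather than the radius: no Jacobian appears.\<close>

lemma distr_norm_power2: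
  "distr lborel borel (\<lambda>p::real^2. (norm p)\<^sup>2) = density lborel (\<lambda>t. ennreal pi * indicator {0<..} t)"
  (is "?M = ?N")
proof (rule measure_eqI_generator_eq)
  let ?E = "range (\<lambda>a::real. {..a})"
  show "Int_stable ?E" by (auto simp: Int_stable_def)
  show "?E \<subseteq> Pow UNIV" by simp
  show "sets ?M = sigma_sets UNIV ?E" "sets ?N = sigma_sets UNIV ?E"
    by (simp_all add: borel_eq_atMost)
  show "range (\<lambda>i::nat. {..real i}) \<subseteq> ?E" "(\<Union>i::nat. {..real i}) = UNIV"
    by (auto simp: real_arch_simple)
  have M: "emeasure ?M {..x} = ennreal (pi * max 0 x)" for x
  proof (cases "x \<ge> 0")
    case True
    have "emeasure ?M {..x} = emeasure lborel ((\<lambda>p::real^2. (norm p)\<^sup>2) -` {..x} \<inter> space lborel)"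
      by (rule emeasure_distr) auto
    also have "(\<lambda>p::real^2. (norm p)\<^sup>2) -` {..x} \<inter> space lborel = cball 0 (sqrt x)"
      by auto (metis abs_norm_cancel real_sqrt_abs real_sqrt_le_iff)+
    also have "emeasure lborel (cball (0::real^2) (sqrt x)) = ennreal (pi * x)"
      using True by (simp add: emeasure_cball unit_ball_vol_2)
    finally show ?thesis using True by simp
  next
    case False
    have "(\<lambda>p::real^2. (norm p)\<^sup>2) -` {..x} \<inter> space lborel = {}"
      using False by (auto simp: not_le dest: order_trans[OF zero_le_power2])
    then show ?thesis using False by (simp add: emeasure_distr)
  qed
  have N: "emeasure ?N {..x} = ennreal (pi * max 0 x)" for x
  proof -
    have "emeasure ?N {..x} = (\<integral>\<^sup>+t. ennreal pi * indicator {0<..} t * indicator {..x} t \<partial>lborel)"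
      by (subst emeasure_density) auto
    also have "\<dots> = (\<integral>\<^sup>+t. ennreal pi * indicator {0<..x} t \<partial>lborel)"
      by (intro nn_integral_cong) (auto split: split_indicator)
    also have "\<dots> = ennreal pi * emeasure lborel {0<..x}" by (simp add: nn_integral_cmult_indicator)
    also have "\<dots> = ennreal (pi * max 0 x)"
      by (cases "x \<ge> 0") (auto simp: ennreal_mult max_def)
    finally show ?thesis .
  qed
  show "emeasure ?M X = emeasure ?N X" if "X \<in> ?E" for X using that M N by auto
  show "emeasure ?M {..real i} \<noteq> \<infinity>" for i by (simp add: M)
qed

lemma nn_integral_radial:
  assumes [measurable]: "F \<in> borel_measurable borel"
  shows "(\<integral>\<^sup>+p. F ((norm (p::real^2))\<^sup>2) \<partial>lborel) = ennreal pi * (\<integral>\<^sup>+t. indicator {0<..} t * F t \<partial>lborel)"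
proof -
  have "(\<integral>\<^sup>+p. F ((norm (p::real^2))\<^sup>2) \<partial>lborel) = (\<integral>\<^sup>+t. F t \<partial>distr lborel borel (\<lambda>p::real^2. (norm p)\<^sup>2))"
    by (subst nn_integral_distr) auto
  also have "\<dots> = (\<integral>\<^sup>+t. ennreal pi * indicator {0<..} t * F t \<partial>lborel)"
    unfolding distr_norm_power2 by (subst nn_integral_density) auto
  also have "\<dots> = ennreal pi * (\<integral>\<^sup>+t. indicator {0<..} t * F t \<partial>lborel)"
    by (subst nn_integral_cmult[symmetric]) (auto simp: mult.assoc)
  finally show ?thesis .
qed

text \<open>Profiles are evaluated at \<open>|p|^2\<close>, so nothing is asked of negative
  arguments; vanishing for all large \<open>t\<close> is compact support on the half line.\<close>

definition ccont :: "(real \<Rightarrow> real) \<Rightarrow> bool" where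
  "ccont f \<longleftrightarrow> continuous_on {0..} f \<and> (\<exists>R. \<forall>t\<ge>R. f t = 0)"

lemma ccontD: "ccont f \<Longrightarrow> continuous_on {0..} f"
  by (simp add: ccont_def)

lemma ccont_bound:
  assumes "ccont f"
  obtains R where "R > 0" "\<And>t. t \<ge> R \<Longrightarrow> f t = 0"
proof -
  obtain R where "\<forall>t\<ge>R. f t = 0" using assms by (auto simp: ccont_def)
  then show thesis by (intro that[of "max R 1"]) auto
qed

lemma ccont_add: "ccont f \<Longrightarrow> ccont g \<Longrightarrow> ccont (\<lambda>t. f t + g t)"
proof -
  assume f: "ccont f" and g: "ccont g"
  obtain R S where "\<And>t. t \<ge> R \<Longrightarrow> f t = 0" "\<And>t. t \<ge> S \<Longrightarrow> g t = 0"
    using ccont_bound[OF f] ccont_bound[OF g] by metis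
  then have "\<forall>t\<ge>max R S. f t + g t = 0" by auto
  then show ?thesis using f g unfolding ccont_def by (blast intro: continuous_on_add)
qed

lemma ccont_mult: "continuous_on {0..} g \<Longrightarrow> ccont f \<Longrightarrow> ccont (\<lambda>t. g t * f t)"
  unfolding ccont_def by (auto intro!: continuous_on_mult)

lemma ccont_cmult: "ccont f \<Longrightarrow> ccont (\<lambda>t. c * f t)"
  by (rule ccont_mult) auto

lemma ccont_uminus: "ccont f \<Longrightarrow> ccont (\<lambda>t. - f t)"
  using ccont_cmult[of f "-1"] by simp

lemma ccont_diff: "ccont f \<Longrightarrow> ccont g \<Longrightarrow> ccont (\<lambda>t. f t - g t)"
  using ccont_add[OF _ ccont_uminus, of f g] by simp

lemma ccont_0 [simp]: "ccont (\<lambda>t. 0)"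
  by (auto simp: ccont_def)

lemma ccont_power2: "ccont f \<Longrightarrow> ccont (\<lambda>t. (f t)\<^sup>2)"
  using ccont_mult[of f f] by (simp add: ccontD power2_eq_square)

lemma ccont_has_integral:
  assumes "ccont f" "R \<ge> 0" "\<And>t. t \<ge> R \<Longrightarrow> f t = 0"
  shows "(f has_integral integral {0..R} f) {0..}"
proof -
  let ?g = "\<lambda>t. if 0 \<le> t then f t else 0"
  have "(f has_integral integral {0..R} f) {0..R}"
    using continuous_on_subset[OF ccontD[OF assms(1)], of "{0..R}"]
    by (intro integrable_integral integrable_continuous_interval) auto
  then have "(?g has_integral integral {0..R} f) {0..R}" by (rule has_integral_eq[rotated]) auto
  then have "(?g has_integral integral {0..R} f) {0..}"
    by (rule has_integral_on_superset) (use assms in auto)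
  then show ?thesis by (rule has_integral_eq[rotated]) auto
qed

lemma ccont_integrable: "ccont f \<Longrightarrow> f integrable_on {0..}"
  using ccont_has_integral ccont_bound by (metis has_integral_integrable less_imp_le)

lemma ccont_integral_eq:
  assumes "ccont f" "R \<ge> 0" "\<And>t. t \<ge> R \<Longrightarrow> f t = 0"
  shows "integral {0..} f = integral {0..R} f"
  using ccont_has_integral[OF assms] by (rule integral_unique)

lemma continuous_on_comp_norm_power2:
  assumes "continuous_on {0..} f"
  shows "continuous_on UNIV (\<lambda>p::real^2. f ((norm p)\<^sup>2))"
  by (rule continuous_on_compose2[OF assms]) (auto intro!: continuous_intros)

lemma l2_radial:
  assumes f: "f \<in> borel_measurable borel" and G: "ccont G" "\<And>t. t \<ge> 0 \<Longrightarrow> G t \<ge> 0"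
    and fG: "\<And>p. (norm (f p))\<^sup>2 = G ((norm p)\<^sup>2)"
  shows "f \<in> l2_space" "(norm (cls f))\<^sup>2 = pi * integral {0..} G"
proof -
  \<comment> \<open>\<open>G\<close> is controlled on the half line only; composition with
    \<open>max 0\<close> yields a Borel function on the line that agrees with it there.\<close>
  let ?G = "\<lambda>t. G (max 0 t)"
  have [measurable]: "?G \<in> borel_measurable borel"
    by (intro borel_measurable_continuous_onI continuous_on_compose2[OF ccontD[OF G(1)]])
      (auto intro!: continuous_intros)
  have hi: "(?G has_integral integral {0..} G) {0..}"
    using integrable_integral[OF ccont_integrable[OF G(1)]]
    by (rule has_integral_eq[rotated]) auto
  have ge0: "integral {0..} G \<ge> 0" using G by (intro integral_nonneg ccont_integrable) auto
  have "(\<integral>\<^sup>+t. indicator {0<..} t * ennreal (?G t) \<partial>lborel) = (\<integral>\<^sup>+t. ennreal (indicator {0..} t * ?G t) \<partial>lborel)"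
  proof (rule nn_integral_cong_AE)
    show "AE t in lborel. indicator {0<..} t * ennreal (?G t) = ennreal (indicator {0..} t * ?G t)"
      using AE_lborel_singleton[of "0::real"] by eventually_elim (auto split: split_indicator)
  qed
  also have "\<dots> = ennreal (integral {0..} G)"
  proof (rule nn_integral_has_integral_lborel)
    have "((\<lambda>t. if t \<in> {0..} then ?G t else 0) has_integral integral {0..} G) UNIV"
      using hi by (subst has_integral_restrict_UNIV)
    then show "((\<lambda>t. indicator {0..} t * ?G t) has_integral integral {0..} G) UNIV"
      by (rule has_integral_eq[rotated]) auto
  qed (use G in auto)
  finally have *: "(\<integral>\<^sup>+t. indicator {0<..} t * ennreal (?G t) \<partial>lborel) = ennreal (integral {0..} G)" .
  have "(\<integral>\<^sup>+p. ennreal ((norm (f p))\<^sup>2) \<partial>lborel) = (\<integral>\<^sup>+p. ennreal (?G ((norm (p::real^2))\<^sup>2)) \<partial>lborel)"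
    by (simp add: fG max_absorb2)
  also have "\<dots> = ennreal pi * ennreal (integral {0..} G)" by (subst nn_integral_radial) (auto simp: *)
  also have "\<dots> = ennreal (pi * integral {0..} G)" using ge0 by (simp add: ennreal_mult)
  finally have **: "(\<integral>\<^sup>+p. ennreal ((norm (f p))\<^sup>2) \<partial>lborel) = ennreal (pi * integral {0..} G)" .
  show fl2: "f \<in> l2_space" unfolding l2_space_def using f **
    by (auto intro!: integrableI_nonneg)
  show "(norm (cls f))\<^sup>2 = pi * integral {0..} G"
    using ** nn_integral_norm_cls[OF fl2] ge0 by simp
qed

section \<open>Rotationally symmetric sectors\<close>

definition zc :: "real^2 \<Rightarrow> complex" where
  "zc p = Complex (p $ 1) (p $ 2)"

lemma norm_real2: "norm (p :: real^2) = sqrt ((p $ 1)\<^sup>2 + (p $ 2)\<^sup>2)"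
  by (simp add: norm_vec_def L2_set_def sum_2)

lemma cmod_zc: "cmod (zc p) = norm p"
  by (simp add: zc_def norm_real2 cmod_def)

lemma zc_mult_cnj: "zc p * cnj (zc p) = of_real ((norm p)\<^sup>2)"
  by (simp add: complex_norm_square[symmetric] cmod_zc)

lemma bounded_linear_zc: "bounded_linear zc"
  by (rule bounded_linear_intro[where K = 1]) (auto simp: zc_def complex_eq_iff cmod_zc[unfolded zc_def])

definition sgn_sector :: "bool \<Rightarrow> real" where
  "sgn_sector s = (if s then 1 else - 1)"

text \<open>The radial functions are functions of \<open>t = |p|\<^sup>2\<close>. The sectors \<open>True\<close> and \<open>False\<close> carry positive and
  negative half-integral total angular momentum \<open>\<plusminus> (k + 1/2)\<close>; the phase \<open>c\<close> is that of the Clifford matrices.\<close>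

definition sector :: "complex \<Rightarrow> bool \<Rightarrow> nat \<Rightarrow> (real \<Rightarrow> real) \<Rightarrow> (real \<Rightarrow> real) \<Rightarrow> spinor_field" where
  "sector c s k \<alpha> \<beta> p = (let t = (norm p)\<^sup>2 in
     if s then vector [zc p ^ k * of_real (\<alpha> t), c * zc p ^ (k + 1) * of_real (\<beta> t)]
     else vector [cnj (zc p) ^ (k + 1) * of_real (\<beta> t), c * cnj (zc p) ^ k * of_real (\<alpha> t)])"

lemma sector_nth:
  "sector c s k \<alpha> \<beta> p $ 1 = (if s then zc p ^ k * of_real (\<alpha> ((norm p)\<^sup>2)) else cnj (zc p) ^ (k + 1) * of_real (\<beta> ((norm p)\<^sup>2)))"
  "sector c s k \<alpha> \<beta> p $ 2 = (if s then c * zc p ^ (k + 1) * of_real (\<beta> ((norm p)\<^sup>2)) else c * cnj (zc p) ^ k * of_real (\<alpha> ((norm p)\<^sup>2)))"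
  by (simp_all add: sector_def Let_def)

lemma norm_complex2_power2: "(norm (v :: complex^2))\<^sup>2 = (cmod (v $ 1))\<^sup>2 + (cmod (v $ 2))\<^sup>2"
  by (simp add: norm_vec_def L2_set_def sum_2)

lemma norm_sector_power2:
  assumes "cmod c = 1"
  shows "(norm (sector c s k \<alpha> \<beta> p))\<^sup>2 = (let t = (norm p)\<^sup>2 in t ^ k * (\<alpha> t)\<^sup>2 + t ^ (k + 1) * (\<beta> t)\<^sup>2)"
  using assms
  by (simp add: norm_complex2_power2 sector_nth Let_def norm_mult norm_power cmod_zc power_mult_distrib
      flip: power_mult) (simp add: mult.commute)

lemma sector_add: "sector c s k \<alpha> \<beta> p + sector c s k \<alpha>' \<beta>' p = sector c s k (\<lambda>t. \<alpha> t + \<alpha>' t) (\<lambda>t. \<beta> t + \<beta>' t) p"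
  by (simp add: vec_eq_iff forall_2 sector_nth distrib_left)

lemma sector_diff: "sector c s k \<alpha> \<beta> p - sector c s k \<alpha>' \<beta>' p = sector c s k (\<lambda>t. \<alpha> t - \<alpha>' t) (\<lambda>t. \<beta> t - \<beta>' t) p"
  by (simp add: vec_eq_iff forall_2 sector_nth right_diff_distrib)

lemma sector_scaleR: "r *\<^sub>R sector c s k \<alpha> \<beta> p = sector c s k (\<lambda>t. r * \<alpha> t) (\<lambda>t. r * \<beta> t) p"
  by (simp add: vec_eq_iff forall_2 sector_nth scaleR_conv_of_real[where 'a = complex])

lemma continuous_on_complex2:
  fixes f :: "'a::topological_space \<Rightarrow> complex^2"
  assumes "continuous_on S (\<lambda>p. f p $ 1)" "continuous_on S (\<lambda>p. f p $ 2)"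
  shows "continuous_on S f"
proof -
  have "continuous_on S (\<lambda>p. \<chi> i. f p $ i)"
    by (rule continuous_on_vec_lambda) (metis assms exhaust_2)
  then show ?thesis by simp
qed

lemma continuous_on_sector:
  assumes "continuous_on {0..} \<alpha>" "continuous_on {0..} \<beta>"
  shows "continuous_on UNIV (sector c s k \<alpha> \<beta>)"
proof (rule continuous_on_complex2)
  note [continuous_intros] = continuous_on_comp_norm_power2[OF assms(1)] continuous_on_comp_norm_power2[OF assms(2)]
    linear_continuous_on[OF bounded_linear_zc]
  show "continuous_on UNIV (\<lambda>p. sector c s k \<alpha> \<beta> p $ 1)" "continuous_on UNIV (\<lambda>p. sector c s k \<alpha> \<beta> p $ 2)"
    unfolding sector_nth by (cases s; simp; intro continuous_intros)+
qed

lemma sector_l2: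
  assumes c: "cmod c = 1" and "ccont \<alpha>" "ccont \<beta>"
  shows "sector c s k \<alpha> \<beta> \<in> l2_space"
    "(norm (cls (sector c s k \<alpha> \<beta>)))\<^sup>2 = pi * integral {0..} (\<lambda>t. t ^ k * (\<alpha> t)\<^sup>2 + t ^ (k + 1) * (\<beta> t)\<^sup>2)"
proof -
  have "sector c s k \<alpha> \<beta> \<in> borel_measurable borel"
    using assms by (intro borel_measurable_continuous_onI continuous_on_sector ccontD)
  note * = l2_radial[OF this _ _ norm_sector_power2[OF c, unfolded Let_def]]
  have "ccont (\<lambda>t. t ^ k * (\<alpha> t)\<^sup>2 + t ^ (k + 1) * (\<beta> t)\<^sup>2)"
    using assms by (intro ccont_add ccont_mult ccont_power2 continuous_intros)
  note ** = *[OF this]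
  show "sector c s k \<alpha> \<beta> \<in> l2_space" by (rule **) auto
  show "(norm (cls (sector c s k \<alpha> \<beta>)))\<^sup>2 = pi * integral {0..} (\<lambda>t. t ^ k * (\<alpha> t)\<^sup>2 + t ^ (k + 1) * (\<beta> t)\<^sup>2)"
    by (rule **) auto
qed

section \<open>The shape of the Clifford matrices\<close>

text \<open>The Clifford relations and the normalization of \<open>\<i> e\<^sub>1 e\<^sub>2\<close> leave only a phase \<open>c\<close> undetermined.\<close>

locale magnetic_dirac_setting =
  fixes \<gamma> :: real and e :: "2 \<Rightarrow> complex^2^2" and c :: complex
  assumes \<gamma>: "0 < \<gamma>" "\<gamma> < 1" and c: "cmod c = 1"
    and e1: "\<And>v. e 1 *v v = vector [- (cnj c * v $ 2), c * v $ 1]"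
    and e2: "\<And>v. e 2 *v v = vector [\<i> * cnj c * v $ 2, \<i> * c * v $ 1]"

text \<open>Since \<open>e 1\<close> squares to \<open>-1\<close> and the product
  \<open>e 1 ** e 2\<close> is prescribed, \<open>e 2\<close> is determined by \<open>e 1\<close>
  (facts \<open>E\<close> and \<open>F\<close>). Anticommutation then removes the diagonal entries,
  the skew-Hermitian condition links the two off-diagonal ones, and the square of \<open>e 1\<close>
  gives them modulus one.\<close>

lemma clifford_matrices_setting:
  assumes "clifford_matrices e" "0 < \<gamma>" "\<gamma> < 1"
  shows "\<exists>c. magnetic_dirac_setting \<gamma> e c"
proof -
  obtain a b c d where e1: "e 1 $ 1 $ 1 = a" "e 1 $ 1 $ 2 = b" "e 1 $ 2 $ 1 = c" "e 1 $ 2 $ 2 = d" by blast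
  obtain a' b' c' d' where e2: "e 2 $ 1 $ 1 = a'" "e 2 $ 1 $ 2 = b'" "e 2 $ 2 $ 1 = c'" "e 2 $ 2 $ 2 = d'" by blast
  have A: "(\<chi> j k. cnj (e i $ k $ j)) $ m $ n = (- e i) $ m $ n" for i m n
    using assms(1) by (simp add: clifford_matrices_def)
  have B: "(e i ** e j + e j ** e i) $ m $ n = (mat (if i = j then - 2 else 0) :: complex^2^2) $ m $ n" for i j m n
    using assms(1) by (simp add: clifford_matrices_def)
  have C: "(\<chi> j k. \<i> * (e 1 ** e 2) $ j $ k) $ m $ n = (vector [vector [1, 0], vector [0, - 1]] :: complex^2^2) $ m $ n" for m n
    using assms(1) by (simp add: clifford_matrices_def)
  have c1: "\<i> * (a * a' + b * c') = 1" "a * b' + b * d' = 0" "c * a' + d * c' = 0" "\<i> * (c * b' + d * d') = - 1"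
    using C[of 1 1] C[of 1 2] C[of 2 1] C[of 2 2] by (simp_all add: matrix_matrix_mult_def sum_2 e1 e2)
  have half: "x + x = - 2 \<Longrightarrow> x = - 1" "x + x = 0 \<Longrightarrow> x = 0" for x :: complex
    by (simp_all add: complex_eq_iff)
  have b1: "a * a + b * c = - 1" "a * b + b * d = 0" "c * a + d * c = 0" "c * b + d * d = - 1"
  proof -
    note d = matrix_matrix_mult_def sum_2 e1 e2 mat_def
    show "a * a + b * c = - 1" by (rule half(1), use B[of 1 1 1 1] in \<open>simp add: d\<close>)
    show "a * b + b * d = 0" by (rule half(2), use B[of 1 1 1 2] in \<open>simp add: d\<close>)
    show "c * a + d * c = 0" by (rule half(2), use B[of 1 1 2 1] in \<open>simp add: d algebra_simps\<close>)
    show "c * b + d * d = - 1" by (rule half(1), use B[of 1 1 2 2] in \<open>simp add: d algebra_simps\<close>)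
  qed
  have a1: "cnj a = - a" "cnj c = - b" "cnj b = - c" "cnj d = - d"
    using A[of 1 1 1] A[of 1 1 2] A[of 1 2 1] A[of 1 2 2] by (simp_all add: e1)
  have E: "a * (a * a' + b * c') + b * (c * a' + d * c') = - a'" "a * (a * b' + b * d') + b * (c * b' + d * d') = - b'"
     "c * (a * a' + b * c') + d * (c * a' + d * c') = - c'" "c * (a * b' + b * d') + d * (c * b' + d * d') = - d'"
    using b1 by algebra+
  have X: "a * a' + b * c' = - \<i>" "c * b' + d * d' = \<i>"
    using c1(1,4) by (simp_all add: complex_eq_iff)
  have F: "a' = \<i> * a" "b' = - \<i> * b" "c' = \<i> * c" "d' = - \<i> * d"
  proof -
    have "a * (- \<i>) = - a'" "b * \<i> = - b'" "c * (- \<i>) = - c'" "d * \<i> = - d'"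
      using E unfolding X c1(2,3) by simp_all
    then have "a' = a * \<i>" "b' = - (b * \<i>)" "c' = c * \<i>" "d' = - (d * \<i>)"
      by (simp_all add: minus_equation_iff)
    then show "a' = \<i> * a" "b' = - \<i> * b" "c' = \<i> * c" "d' = - \<i> * d" by (simp_all add: mult.commute)
  qed
  have anti: "a * a' + b * c' + (a' * a + b' * c) = 0"
    using B[of 1 2 1 1] by (simp add: matrix_matrix_mult_def sum_2 e1 e2 mat_def)
  have "a = 0" using anti F by (simp add: algebra_simps)
  have anti2: "c * b' + d * d' + (c' * b + d' * d) = 0"
    using B[of 1 2 2 2] by (simp add: matrix_matrix_mult_def sum_2 e1 e2 mat_def)
  have "d = 0" using anti2 F by (simp add: algebra_simps)
  have bc: "b = - cnj c" using a1 by simp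
  have "cnj c * c = 1" using b1(1) \<open>a = 0\<close> bc by simp
  then have "(cmod c)\<^sup>2 = 1" by (metis complex_norm_square mult.commute of_real_eq_1_iff of_real_power)
  then have "cmod c = 1" by (simp add: power2_eq_1_iff) (metis norm_ge_zero le_minus_one_simps(3))
  then have "magnetic_dirac_setting \<gamma> e c"
    unfolding magnetic_dirac_setting_def
    using assms F bc \<open>a = 0\<close> \<open>d = 0\<close>
    by (auto simp: vec_eq_iff forall_2 matrix_vector_mult_def sum_2 e1 e2)
  then show ?thesis by blast
qed

section \<open>Test spinors and symmetry of the Dirac operator\<close>

lemma partial_deriv_eqI: "(f has_derivative f') (at p) \<Longrightarrow> partial_deriv i f p = f' (axis i 1)"
  unfolding partial_deriv_def by (drule frechet_derivative_at) simp

lemma partial_deriv_works: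
  assumes "f differentiable_on UNIV"
  shows "\<exists>f'. (f has_derivative f') (at p) \<and> (\<forall>i. partial_deriv i f p = f' (axis i 1))"
  using assms partial_deriv_eqI unfolding differentiable_on_def differentiable_def by blast

lemma partial_deriv_add:
  assumes "f differentiable_on UNIV" "g differentiable_on UNIV"
  shows "partial_deriv i (\<lambda>p. f p + g p) = (\<lambda>p. partial_deriv i f p + partial_deriv i g p)"
proof
  fix p
  obtain f' g' where f: "(f has_derivative f') (at p)" "\<forall>i. partial_deriv i f p = f' (axis i 1)"
    and g: "(g has_derivative g') (at p)" "\<forall>i. partial_deriv i g p = g' (axis i 1)"
    using partial_deriv_works assms by metis
  show "partial_deriv i (\<lambda>p. f p + g p) p = partial_deriv i f p + partial_deriv i g p"
    using partial_deriv_eqI[OF has_derivative_add[OF f(1) g(1)]] f g by simp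
qed

lemma has_derivative_vector_scalar_mult:
  fixes f :: "'a::real_normed_vector \<Rightarrow> complex^'n"
  assumes "(f has_derivative f') F"
  shows "((\<lambda>p. z *s f p) has_derivative (\<lambda>h. z *s f' h)) F"
  using bounded_linear.has_derivative[OF bounded_linear_vector_scalar_mult assms] .

lemma partial_deriv_mult:
  assumes "f differentiable_on UNIV"
  shows "partial_deriv i (\<lambda>p. z *s f p) = (\<lambda>p. z *s partial_deriv i f p)"
proof
  fix p
  obtain f' where f: "(f has_derivative f') (at p)" "\<forall>i. partial_deriv i f p = f' (axis i 1)"
    using partial_deriv_works assms by metis
  show "partial_deriv i (\<lambda>p. z *s f p) p = z *s partial_deriv i f p"
    using partial_deriv_eqI[OF has_derivative_vector_scalar_mult[OF f(1)]] f by simp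
qed

lemma differentiable_on_vector_scalar_mult:
  fixes f :: "'a::real_normed_vector \<Rightarrow> complex^'n"
  shows "f differentiable_on S \<Longrightarrow> (\<lambda>p. z *s f p) differentiable_on S"
  unfolding differentiable_on_def differentiable_def using has_derivative_vector_scalar_mult by blast

lemma continuously_differentiable_add:
  "continuously_differentiable k f \<Longrightarrow> continuously_differentiable k g \<Longrightarrow> continuously_differentiable k (\<lambda>p. f p + g p)"
  by (induction k arbitrary: f g) (auto intro!: continuous_on_add differentiable_on_add simp: partial_deriv_add)

lemma continuous_on_vector_scalar_mult:
  fixes f :: "'a::topological_space \<Rightarrow> complex^'n"
  shows "continuous_on S f \<Longrightarrow> continuous_on S (\<lambda>p. z *s f p)"
  by (rule continuous_on_compose2[OF linear_continuous_on[OF bounded_linear_vector_scalar_mult, of UNIV]]) auto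

lemma continuously_differentiable_mult:
  "continuously_differentiable k f \<Longrightarrow> continuously_differentiable k (\<lambda>p. z *s f p)"
  by (induction k arbitrary: f)
    (auto intro!: continuous_on_vector_scalar_mult differentiable_on_vector_scalar_mult simp: partial_deriv_mult)

lemma test_spinors_alt: "\<phi> \<in> test_spinors \<longleftrightarrow> (\<forall>k. continuously_differentiable k \<phi>) \<and> bounded {p. \<phi> p \<noteq> 0}"
  by (simp add: test_spinors_def)

lemma test_spinors_add:
  assumes "f \<in> test_spinors" "g \<in> test_spinors"
  shows "(\<lambda>p. f p + g p) \<in> test_spinors"
proof -
  have "bounded ({p. f p \<noteq> 0} \<union> {p. g p \<noteq> 0})" using assms by (simp add: test_spinors_alt)
  then have "bounded {p. f p + g p \<noteq> 0}" by (rule bounded_subset) auto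
  then show ?thesis using assms by (auto simp: test_spinors_alt continuously_differentiable_add)
qed

lemma test_spinors_mult:
  assumes "f \<in> test_spinors"
  shows "(\<lambda>p. z *s f p) \<in> test_spinors"
proof -
  have "bounded {p. f p \<noteq> 0}" using assms by (simp add: test_spinors_alt)
  then have "bounded {p. z *s f p \<noteq> 0}" by (rule bounded_subset) auto
  then show ?thesis using assms by (auto simp: test_spinors_alt continuously_differentiable_mult)
qed

lemma test_spinorsD:
  assumes "f \<in> test_spinors"
  shows "continuous_on UNIV f" "f differentiable_on UNIV" "continuous_on UNIV (partial_deriv i f)"
    "bounded {p. f p \<noteq> 0}"
proof -
  have "continuously_differentiable 0 f" "continuously_differentiable (Suc 0) f"
    using assms unfolding test_spinors_alt by blast+
  then show "continuous_on UNIV f" "f differentiable_on UNIV" "continuous_on UNIV (partial_deriv i f)" by auto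
  show "bounded {p. f p \<noteq> 0}" using assms by (simp add: test_spinors_alt)
qed

lemma zero_mem_test_spinors: "(\<lambda>p. 0) \<in> test_spinors"
proof -
  have "continuously_differentiable k (\<lambda>p. 0)" for k
  proof (induction k)
    case (Suc k)
    have "partial_deriv i (\<lambda>p. 0) = (\<lambda>p. 0)" for i
      using partial_deriv_eqI[OF has_derivative_const] by blast
    then show ?case using Suc by simp
  qed simp
  then show ?thesis by (simp add: test_spinors_alt)
qed

lemma partial_deriv_zero_outside:
  assumes "p \<notin> closure {p. f p \<noteq> 0}"
  shows "partial_deriv i f p = 0"
proof -
  have "(f has_derivative (\<lambda>h. 0)) (at p)"
  proof (rule has_derivative_transform_within_open)
    show "((\<lambda>p. 0) has_derivative (\<lambda>h. 0)) (at p)" by (rule has_derivative_const)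
    show "open (- closure {p. f p \<noteq> 0})" by auto
    show "p \<in> - closure {p. f p \<noteq> 0}" using assms by simp
    fix x assume "x \<in> - closure {p. f p \<noteq> 0}"
    then show "0 = f x" using closure_subset[of "{p. f p \<noteq> 0}"] by auto
  qed
  then show ?thesis using partial_deriv_eqI by blast
qed

lemma continuous_bounded_support_l2:
  assumes "continuous_on UNIV f" "bounded {p. f p \<noteq> 0}"
  shows "f \<in> l2_space"
proof -
  obtain R where R: "\<And>p. f p \<noteq> 0 \<Longrightarrow> norm p \<le> R" using assms(2) by (auto simp: bounded_iff)
  have "bounded (f ` cball 0 R)"
    by (intro compact_imp_bounded compact_continuous_image continuous_on_subset[OF assms(1)]) auto
  then obtain M where M: "\<And>p. p \<in> cball 0 R \<Longrightarrow> norm (f p) \<le> M"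
    unfolding bounded_iff by blast
  show ?thesis
  proof (rule l2_spaceI_bound)
    show "f \<in> borel_measurable lborel" using borel_measurable_continuous_onI[OF assms(1)] by simp
    show "integrable lborel (\<lambda>p. M\<^sup>2 * indicator (cball 0 R) (p :: real^2) :: real)"
      using emeasure_lborel_cball_finite[of "0::real^2" R]
      by (intro integrable_mult_right integrable_real_indicator) auto
    fix p
    show "(norm (f p))\<^sup>2 \<le> M\<^sup>2 * indicator (cball 0 R) p"
      using M[of p] R[of p] by (cases "p \<in> cball 0 R") (auto intro: power_mono)
  qed
qed

section \<open>Integration by parts on the plane\<close>

text \<open>Difference quotients in direction \<open>v\<close> integrate to 0 by translation
  invariance. The mean value theorem along the line bounds them by \<open>M\<close> on a fixed ball,
  so dominated convergence passes to the derivative.\<close>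

lemma integral_directional_derivative_zero:
  fixes F :: "real^2 \<Rightarrow> real"
  assumes F': "\<And>p. (F has_derivative F' p) (at p)" and cont: "continuous_on UNIV (\<lambda>p. F' p v)"
    and supp: "bounded {p. F p \<noteq> 0}"
  shows "(LINT p|lborel. F' p v) = 0"
proof -
  have cF: "continuous_on UNIV F" using has_derivative_continuous[OF F'] by (intro continuous_at_imp_continuous_on) blast
  obtain R where R: "\<And>p. F p \<noteq> 0 \<Longrightarrow> norm p < R" "R > 0"
  proof -
    obtain R where "\<And>p. F p \<noteq> 0 \<Longrightarrow> norm p \<le> R" using supp by (auto simp: bounded_iff)
    then show ?thesis by (intro that[of "\<bar>R\<bar> + 1"]) force+
  qed
  have F'0: "F' p v = 0" if "norm p \<ge> R + 1" for p
  proof -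
    have "(F has_derivative (\<lambda>h. 0)) (at p)"
    proof (rule has_derivative_transform_within_open)
      show "((\<lambda>p. 0) has_derivative (\<lambda>h. 0)) (at p)" by (rule has_derivative_const)
      show "open (- cball (0::real^2) R)" by auto
      show "p \<in> - cball 0 R" using that by auto
      show "0 = F x" if "x \<in> - cball 0 R" for x using that R(1)[of x] by force
    qed
    then show ?thesis using has_derivative_unique[OF F'[of p]] by metis
  qed
  have "bounded ((\<lambda>p. F' p v) ` cball 0 (R + 1))"
    by (intro compact_imp_bounded compact_continuous_image continuous_on_subset[OF cont]) auto
  then obtain M where M: "\<And>p. p \<in> cball 0 (R + 1) \<Longrightarrow> norm (F' p v) \<le> M"
    unfolding bounded_iff by blast
  have M0: "M \<ge> 0" using M[of 0] R(2) by (auto intro: order_trans[OF norm_ge_zero])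
  have M': "\<bar>F' p v\<bar> \<le> M" for p using M[of p] F'0[of p] M0 by (cases "norm p \<le> R + 1") auto
  define h where "h n = inverse (real (Suc n))" for n
  have h: "h n > 0" "h n \<le> 1" for n by (auto simp: h_def field_simps)
  define g where "g n p = (F (p + h n *\<^sub>R v) - F p) / h n" for n p
  have slice: "((\<lambda>s. F (p + s *\<^sub>R v)) has_real_derivative F' (p + s *\<^sub>R v) v) (at s)" for p s
  proof -
    have "((\<lambda>s. p + s *\<^sub>R v) has_derivative (\<lambda>s. s *\<^sub>R v)) (at s)"
      by (auto intro!: derivative_eq_intros)
    from has_derivative_compose[OF this F'[of "p + s *\<^sub>R v"]]
    have "((\<lambda>s. F (p + s *\<^sub>R v)) has_derivative (\<lambda>r. F' (p + s *\<^sub>R v) (r *\<^sub>R v))) (at s)" .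
    moreover have "F' (p + s *\<^sub>R v) (r *\<^sub>R v) = F' (p + s *\<^sub>R v) v * r" for r
      using linear_scale[OF has_derivative_linear[OF F'[of "p + s *\<^sub>R v"]]] by simp
    ultimately show ?thesis by (simp add: has_field_derivative_def)
  qed
  have gb: "\<bar>g n p\<bar> \<le> M * indicator (cball 0 (R + 1 + norm v)) p" for n p
  proof -
    obtain \<xi> where xi: "0 < \<xi>" "\<xi> < h n" "F (p + h n *\<^sub>R v) - F (p + 0 *\<^sub>R v) = (h n - 0) * F' (p + \<xi> *\<^sub>R v) v"
      using MVT2[of 0 "h n" "\<lambda>s. F (p + s *\<^sub>R v)" "\<lambda>s. F' (p + s *\<^sub>R v) v"] h slice by blast
    then have eq: "g n p = F' (p + \<xi> *\<^sub>R v) v" using h[of n] by (simp add: g_def field_simps)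
    show ?thesis
    proof (cases "p \<in> cball 0 (R + 1 + norm v)")
      case True then show ?thesis using eq M' by simp
    next
      case False
      have "norm (\<xi> *\<^sub>R v) \<le> 1 * norm v" using xi h[of n] mult_right_mono[of \<xi> 1 "norm v"] by simp
      moreover have "norm p \<le> norm (p + \<xi> *\<^sub>R v) + norm (\<xi> *\<^sub>R v)" by (metis norm_triangle_sub add.commute add_diff_cancel_left' norm_minus_commute)
      ultimately have "norm (p + \<xi> *\<^sub>R v) \<ge> R + 1" using False by auto
      then show ?thesis using eq F'0 False by simp
    qed
  qed
  obtain K where K: "\<And>p. p \<in> cball 0 R \<Longrightarrow> norm (F p) \<le> K"
    using compact_imp_bounded[OF compact_continuous_image[OF continuous_on_subset[OF cF] compact_cball], of 0 R]
    unfolding bounded_iff by blast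
  have intF: "integrable lborel F"
  proof (rule Bochner_Integration.integrable_bound)
    show "integrable lborel (\<lambda>p. K * indicator (cball 0 R) (p :: real^2) :: real)"
      using emeasure_lborel_cball_finite[of "0::real^2" R]
      by (intro integrable_mult_right integrable_real_indicator) auto
    show "F \<in> borel_measurable lborel" using borel_measurable_continuous_onI[OF cF] by simp
    have "norm (F p) \<le> norm (K * indicator (cball 0 R) p)" for p
      using K[of p] R(1)[of p] by (cases "p \<in> cball 0 R") auto
    then show "AE p in lborel. norm (F p) \<le> norm (K * indicator (cball 0 R) p)" by simp
  qed
  have ig: "(LINT p|lborel. g n p) = 0" for n
  proof -
    have d: "distr lborel borel (\<lambda>p. p + h n *\<^sub>R v) = lborel"
      using lborel_distr_plus[of "h n *\<^sub>R v"] by (simp add: add.commute[of _ "h n *\<^sub>R v"])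
    have m: "(\<lambda>p. p + h n *\<^sub>R v) \<in> measurable lborel borel" by simp
    have Fm: "F \<in> borel_measurable borel" using borel_measurable_continuous_onI[OF cF] .
    have 1: "(LINT p|lborel. F (p + h n *\<^sub>R v)) = (LINT p|lborel. F p)"
      using integral_distr[OF m Fm] by (simp add: d)
    have 2: "integrable lborel (\<lambda>p. F (p + h n *\<^sub>R v))"
      using integrable_distr_eq[OF m Fm] intF by (simp add: d)
    show ?thesis unfolding g_def using 1 2 intF h[of n] by simp
  qed
  have "(\<lambda>n. LINT p|lborel. g n p) \<longlonglongrightarrow> (LINT p|lborel. F' p v)"
  proof (rule integral_dominated_convergence)
    show "(\<lambda>p. F' p v) \<in> borel_measurable lborel" using borel_measurable_continuous_onI[OF cont] by simp
    have "continuous_on UNIV (\<lambda>p. g n p)" for n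
      unfolding g_def using h[of n]
      by (intro continuous_intros continuous_on_compose2[OF cF]) auto
    then show "g n \<in> borel_measurable lborel" for n
      using borel_measurable_continuous_onI[of "g n"] by simp
    show "integrable lborel (\<lambda>p. M * indicator (cball 0 (R + 1 + norm v)) (p :: real^2) :: real)"
      using emeasure_lborel_cball_finite[of "0::real^2" "R + 1 + norm v"]
      by (intro integrable_mult_right integrable_real_indicator) auto
    show "AE p in lborel. norm (g n p) \<le> M * indicator (cball 0 (R + 1 + norm v)) p" for n using gb by simp
    have "(\<lambda>n. g n p) \<longlonglongrightarrow> F' p v" for p
    proof -
      have "((\<lambda>s. (F (p + s *\<^sub>R v) - F (p + 0 *\<^sub>R v)) / (s - 0)) \<longlongrightarrow> F' (p + 0 *\<^sub>R v) v) (at 0)"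
        using slice[of p 0] by (simp add: has_field_derivative_iff)
      moreover have "filterlim h (at 0) sequentially"
        using LIMSEQ_inverse_real_of_nat h by (simp add: filterlim_at h_def[abs_def] less_imp_neq[symmetric])
      ultimately have "(\<lambda>n. (F (p + h n *\<^sub>R v) - F (p + 0 *\<^sub>R v)) / (h n - 0)) \<longlonglongrightarrow> F' (p + 0 *\<^sub>R v) v"
        by (rule filterlim_compose)
      then show ?thesis by (simp add: g_def)
    qed
    then show "AE p in lborel. (\<lambda>n. g n p) \<longlonglongrightarrow> F' p v" by simp
  qed
  then show ?thesis using ig by (simp add: LIMSEQ_const_iff)
qed

text \<open>Not the magnetic field itself but the factor \<open>a\<close> in
  \<open>A = a (- y dx + x dy)\<close>, as a function of \<open>t = r^2\<close>. The field is
  \<open>2 a + 2 t a'\<close>, with the derivative taken in \<open>t\<close>.\<close>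

definition field_strength :: "real \<Rightarrow> real \<Rightarrow> real" where
  "field_strength \<gamma> t = (1 + sqrt t) powr (- \<gamma>)"

lemma potential_nth:
  "potential \<gamma> p $ 1 = - (p $ 2) * field_strength \<gamma> ((norm p)\<^sup>2)"
  "potential \<gamma> p $ 2 = p $ 1 * field_strength \<gamma> ((norm p)\<^sup>2)"
  by (simp_all add: potential_def Let_def field_strength_def norm_real2 powr_minus divide_inverse)

lemma continuous_on_field_strength: "continuous_on {0..} (field_strength \<gamma>)"
  unfolding field_strength_def by (intro continuous_intros) (auto simp: add_nonneg_eq_0_iff)

context magnetic_dirac_setting
begin

abbreviation "A \<equiv> potential \<gamma>"

definition dirac_graph :: l2_operator where
  "dirac_graph = {(\<phi>, magnetic_dirac e A \<phi>) |\<phi>. \<phi> \<in> test_spinors}"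

lemma e_add: "e i *v (v + w) = e i *v v + e i *v w" and e_mult: "e i *v (z *s v) = z *s (e i *v v)"
  by (simp_all add: matrix_vector_right_distrib vector_scalar_commute)

lemma e_linear: "bounded_linear (\<lambda>v. e i *v v)"
proof (intro linear_conv_bounded_linear[THEN iffD1] linearI)
  show "e i *v (r *\<^sub>R v) = r *\<^sub>R (e i *v v)" for r v
    by (simp add: scaleR_eq_vector_scalar_mult e_mult)
qed (rule e_add)

lemma e_skew: "(e i *v v) \<bullet> w = - (v \<bullet> (e i *v w))"
proof -
  have "(e 1 *v v) \<bullet> w = - (v \<bullet> (e 1 *v w))" "(e 2 *v v) \<bullet> w = - (v \<bullet> (e 2 *v w))"
    by (simp_all add: e1 e2 inner_vec_def sum_2 inner_complex_def algebra_simps)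
  then show ?thesis using exhaust_2[of i] by auto
qed

lemma magnetic_dirac_add:
  assumes "f \<in> test_spinors" "g \<in> test_spinors"
  shows "magnetic_dirac e A (\<lambda>p. f p + g p) = (\<lambda>p. magnetic_dirac e A f p + magnetic_dirac e A g p)"
  using test_spinorsD[OF assms(1)] test_spinorsD[OF assms(2)]
  by (simp add: fun_eq_iff magnetic_dirac_def dirac_def clifford_mult_def partial_deriv_add e_add
      scaleR_add_right vector_add_ldistrib algebra_simps)

lemma magnetic_dirac_mult:
  assumes "f \<in> test_spinors"
  shows "magnetic_dirac e A (\<lambda>p. z *s f p) = (\<lambda>p. z *s magnetic_dirac e A f p)"
proof
  fix p
  have "a *\<^sub>R (z *s v) = z *s (a *\<^sub>R v)" for a and v :: "complex^2" by (simp add: scaleR_vector_scalar_mult)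
  then show "magnetic_dirac e A (\<lambda>p. z *s f p) p = z *s magnetic_dirac e A f p"
    using test_spinorsD[OF assms]
    by (simp add: magnetic_dirac_def dirac_def clifford_mult_def partial_deriv_mult e_mult
        vector_add_ldistrib mult.commute)
qed

lemma continuous_on_potential: "continuous_on UNIV A"
proof -
  have "continuous_on UNIV (\<lambda>p. \<chi> i. A p $ i)"
  proof (rule continuous_on_vec_lambda)
    fix i :: 2
    have "continuous_on UNIV (\<lambda>p. A p $ 1)" "continuous_on UNIV (\<lambda>p. A p $ 2)"
      unfolding potential_nth
      by (intro continuous_intros continuous_on_comp_norm_power2[OF continuous_on_field_strength])+
    then show "continuous_on UNIV (\<lambda>p. A p $ i)" using exhaust_2[of i] by auto
  qed
  then show ?thesis by simp
qed

lemma magnetic_dirac_l2: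
  assumes "f \<in> test_spinors"
  shows "magnetic_dirac e A f \<in> l2_space"
proof (rule continuous_bounded_support_l2)
  note ce = continuous_on_compose2[OF linear_continuous_on[OF e_linear, of UNIV], simplified]
  show "continuous_on UNIV (magnetic_dirac e A f)"
    unfolding magnetic_dirac_def[abs_def] dirac_def[abs_def] clifford_mult_def
    by (intro continuous_intros continuous_on_vector_scalar_mult ce test_spinorsD[OF assms] continuous_on_potential)
  have bd: "bounded (closure {p. f p \<noteq> 0})" using test_spinorsD[OF assms] by (intro bounded_closure)
  show "bounded {p. magnetic_dirac e A f p \<noteq> 0}"
  proof (rule bounded_subset[OF bd], rule subsetI, rule ccontr)
    fix p assume p: "p \<in> {p. magnetic_dirac e A f p \<noteq> 0}" "p \<notin> closure {p. f p \<noteq> 0}"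
    then have "f p = 0" using closure_subset[of "{p. f p \<noteq> 0}"] by auto
    then have "magnetic_dirac e A f p = 0"
      using p(2) by (simp add: magnetic_dirac_def dirac_def clifford_mult_def partial_deriv_zero_outside)
    then show False using p by simp
  qed
qed

lemma test_spinors_l2: "f \<in> test_spinors \<Longrightarrow> f \<in> l2_space"
  by (intro continuous_bounded_support_l2 test_spinorsD)

lemma dirac_graph_l2: "dirac_graph \<subseteq> l2_space \<times> l2_space"
  by (auto simp: dirac_graph_def test_spinors_l2 magnetic_dirac_l2)

lemma mem_cls_graph_dirac:
  "(x, y) \<in> cls_graph dirac_graph \<longleftrightarrow> (\<exists>\<phi>\<in>test_spinors. x = cls \<phi> \<and> y = cls (magnetic_dirac e A \<phi>))"
  by (auto simp: cls_graph_def dirac_graph_def)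

lemma dirac_graph_subspace: "subspace (cls_graph dirac_graph)"
proof (rule subspaceI)
  show "0 \<in> cls_graph dirac_graph"
    unfolding zero_prod_def mem_cls_graph_dirac
  proof (intro bexI[of _ "\<lambda>p. 0"] conjI zero_mem_test_spinors)
    have "magnetic_dirac e A (\<lambda>p. 0) = (\<lambda>p. 0)"
      using magnetic_dirac_mult[OF zero_mem_test_spinors, of 0] by simp
    then show "0 = cls (\<lambda>p. 0)" "0 = cls (magnetic_dirac e A (\<lambda>p. 0))" by (simp_all add: zero_l2_def)
  qed
next
  fix a b assume "a \<in> cls_graph dirac_graph" "b \<in> cls_graph dirac_graph"
  then obtain \<phi> \<psi> where "\<phi> \<in> test_spinors" "a = (cls \<phi>, cls (magnetic_dirac e A \<phi>))"
      "\<psi> \<in> test_spinors" "b = (cls \<psi>, cls (magnetic_dirac e A \<psi>))"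
    by (cases a; cases b) (auto simp: mem_cls_graph_dirac)
  then show "a + b \<in> cls_graph dirac_graph"
    by (simp add: mem_cls_graph_dirac)
      (intro bexI[of _ "\<lambda>p. \<phi> p + \<psi> p"]; simp add: cls_ops test_spinors_l2 magnetic_dirac_l2 magnetic_dirac_add test_spinors_add)
next
  fix r :: real and a assume "a \<in> cls_graph dirac_graph"
  then obtain \<phi> where "\<phi> \<in> test_spinors" "a = (cls \<phi>, cls (magnetic_dirac e A \<phi>))"
    by (cases a) (auto simp: mem_cls_graph_dirac)
  then show "r *\<^sub>R a \<in> cls_graph dirac_graph"
    by (simp add: mem_cls_graph_dirac)
      (intro bexI[of _ "\<lambda>p. of_real r *s \<phi> p"]; simp add: cls_ops test_spinors_l2 magnetic_dirac_l2
        magnetic_dirac_mult test_spinors_mult scaleR_eq_vector_scalar_mult)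
qed

lemma dirac_graph_mult_i:
  assumes "(x, y) \<in> cls_graph dirac_graph"
  shows "(mult_i x, mult_i y) \<in> cls_graph dirac_graph"
proof -
  obtain \<phi> where "\<phi> \<in> test_spinors" "x = cls \<phi>" "y = cls (magnetic_dirac e A \<phi>)"
    using assms by (auto simp: mem_cls_graph_dirac)
  then show ?thesis unfolding mem_cls_graph_dirac
    by (intro bexI[of _ "\<lambda>p. \<i> *s \<phi> p"])
      (simp_all add: mult_i_cls test_spinors_l2 magnetic_dirac_l2 magnetic_dirac_mult test_spinors_mult)
qed

lemma clifford_symmetric:
  "(\<i> *s clifford_mult e a v) \<bullet> w = v \<bullet> (\<i> *s clifford_mult e a w)"
proof -
  have i: "(\<i> *s x) \<bullet> y = - (x \<bullet> (\<i> *s y))" for x y :: "complex^2"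
    by (simp add: inner_vec_def sum_2 inner_complex_def algebra_simps)
  show ?thesis
    by (simp add: clifford_mult_def vector_add_ldistrib inner_add_left inner_add_right i scaleR_vector_scalar_mult
        e_skew e_mult)
qed

text \<open>Because \<open>e i\<close> is skew, the difference of the two derivative terms for
  direction \<open>i\<close> is the partial derivative of \<open>(e i *v f) \<bullet> g\<close> and
  integrates to 0. The potential term is symmetric at each point, being the imaginary unit times a
  real combination of skew matrices.\<close>

lemma magnetic_dirac_symmetric:
  assumes f: "f \<in> test_spinors" and g: "g \<in> test_spinors"
  shows "(LINT p|lborel. magnetic_dirac e A f p \<bullet> g p) = (LINT p|lborel. f p \<bullet> magnetic_dirac e A g p)"
proof -
  note Df = test_spinorsD[OF f] and Dg = test_spinorsD[OF g]
  have "\<forall>p. \<exists>f'. (f has_derivative f') (at p) \<and> (\<forall>i. partial_deriv i f p = f' (axis i 1))"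
    using partial_deriv_works Df by blast
  then obtain f' where f': "\<And>p. (f has_derivative f' p) (at p)" "\<And>p i. partial_deriv i f p = f' p (axis i 1)" by metis
  have "\<forall>p. \<exists>g'. (g has_derivative g') (at p) \<and> (\<forall>i. partial_deriv i g p = g' (axis i 1))"
    using partial_deriv_works Dg by blast
  then obtain g' where g': "\<And>p. (g has_derivative g' p) (at p)" "\<And>p i. partial_deriv i g p = g' p (axis i 1)" by metis
  note ce = continuous_on_compose2[OF linear_continuous_on[OF e_linear, of UNIV], simplified]
  have parts: "(LINT p|lborel. (e i *v partial_deriv i f p) \<bullet> g p - f p \<bullet> (e i *v partial_deriv i g p)) = 0" for i
  proof -
    let ?F' = "\<lambda>p h. (e i *v f p) \<bullet> g' p h + (e i *v f' p h) \<bullet> g p"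
    have "((\<lambda>p. (e i *v f p) \<bullet> g p) has_derivative ?F' p) (at p)" for p
      by (intro has_derivative_inner bounded_linear.has_derivative[OF e_linear] f' g')
    moreover have "continuous_on UNIV (\<lambda>p. ?F' p (axis i 1))"
      unfolding f'(2)[symmetric] g'(2)[symmetric] by (intro continuous_intros ce Df Dg)
    moreover have "bounded {p. (e i *v f p) \<bullet> g p \<noteq> 0}"
      by (rule bounded_subset[OF Dg(4)]) auto
    ultimately have "(LINT p|lborel. ?F' p (axis i 1)) = 0"
      by (rule integral_directional_derivative_zero)
    moreover have "?F' p (axis i 1) = (e i *v partial_deriv i f p) \<bullet> g p - f p \<bullet> (e i *v partial_deriv i g p)" for p
      by (simp add: f' g' e_skew)
    ultimately show ?thesis by simp
  qed
  have split: "magnetic_dirac e A f p \<bullet> g p - f p \<bullet> magnetic_dirac e A g p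
     = ((e 1 *v partial_deriv 1 f p) \<bullet> g p - f p \<bullet> (e 1 *v partial_deriv 1 g p))
     + ((e 2 *v partial_deriv 2 f p) \<bullet> g p - f p \<bullet> (e 2 *v partial_deriv 2 g p))" for p
    by (simp add: magnetic_dirac_def dirac_def inner_add_left inner_add_right clifford_symmetric)
  have l2: "(\<lambda>p. e i *v partial_deriv i h p) \<in> l2_space" if h: "h \<in> test_spinors" for i h
  proof (rule continuous_bounded_support_l2)
    show "continuous_on UNIV (\<lambda>p. e i *v partial_deriv i h p)" by (intro ce test_spinorsD[OF h])
    have "bounded (closure {p. h p \<noteq> 0})" using test_spinorsD[OF h] by (intro bounded_closure)
    then show "bounded {p. e i *v partial_deriv i h p \<noteq> 0}"
      by (rule bounded_subset) (use partial_deriv_zero_outside in fastforce)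
  qed
  have int: "integrable lborel (\<lambda>p. (e i *v partial_deriv i f p) \<bullet> g p - f p \<bullet> (e i *v partial_deriv i g p))" for i
    by (intro Bochner_Integration.integrable_diff l2_inner_integrable l2 f g test_spinors_l2)
  have "(LINT p|lborel. magnetic_dirac e A f p \<bullet> g p) - (LINT p|lborel. f p \<bullet> magnetic_dirac e A g p)
    = (LINT p|lborel. magnetic_dirac e A f p \<bullet> g p - f p \<bullet> magnetic_dirac e A g p)"
    by (intro Bochner_Integration.integral_diff[symmetric] l2_inner_integrable f g test_spinors_l2 magnetic_dirac_l2)
  also have "\<dots> = 0" unfolding split by (simp add: int parts)
  finally show ?thesis by simp
qed

lemma dirac_graph_symmetric:
  assumes "(x, y) \<in> cls_graph dirac_graph" "(x', y') \<in> cls_graph dirac_graph"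
  shows "y \<bullet> x' = x \<bullet> y'"
  using assms magnetic_dirac_symmetric
  by (auto simp: mem_cls_graph_dirac cls_ops test_spinors_l2 magnetic_dirac_l2)

end

section \<open>A smooth cutoff\<close>

text \<open>The \<open>n\<close>-th derivative of \<open>exp (- 1 / x)\<close> is \<open>P\<^sub>n (1 / x) exp (- 1 / x)\<close> with the polynomials below.\<close>

primrec bump_poly :: "nat \<Rightarrow> real poly" where
  "bump_poly 0 = 1"
| "bump_poly (Suc n) = [:0, 0, 1:] * (bump_poly n - pderiv (bump_poly n))"

definition bump :: "nat \<Rightarrow> real \<Rightarrow> real" where
  "bump n x = (if x > 0 then poly (bump_poly n) (1 / x) * exp (- 1 / x) else 0)"

lemma poly_times_exp_tendsto_0: "((\<lambda>y. poly p y * exp (- y)) \<longlongrightarrow> (0::real)) at_top"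
proof -
  have "((\<lambda>y. \<Sum>i\<le>degree p. coeff p i * (y ^ i / exp y)) \<longlongrightarrow> (\<Sum>i\<le>degree p. coeff p i * 0)) at_top"
    by (intro tendsto_intros tendsto_power_div_exp_0)
  moreover have "(\<Sum>i\<le>degree p. coeff p i * (y ^ i / exp y)) = poly p y * exp (- y)" for y
    by (simp add: poly_altdef sum_distrib_right exp_minus field_simps sum_divide_distrib)
  ultimately show ?thesis by simp
qed

lemma bump_deriv: "(bump n has_real_derivative bump (Suc n) x) (at x)"
proof -
  consider "x > 0" | "x < 0" | "x = 0" by linarith
  then show ?thesis
  proof cases
    case 1
    have "((\<lambda>x. poly (bump_poly n) (1 / x) * exp (- 1 / x)) has_real_derivative bump (Suc n) x) (at x)"
      using 1 by (auto intro!: derivative_eq_intros DERIV_chain'[OF _ poly_DERIV] simp: bump_def field_simps power2_eq_square)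
    then show ?thesis
    proof (rule has_field_derivative_transform_within_open)
      show "open {0::real<..}" "x \<in> {0<..}" using 1 by auto
    qed (simp add: bump_def)
  next
    case 2
    have "((\<lambda>x. 0) has_real_derivative bump (Suc n) x) (at x)" using 2 by (simp add: bump_def)
    then show ?thesis
    proof (rule has_field_derivative_transform_within_open)
      show "open {..<0::real}" "x \<in> {..<0}" using 2 by auto
    qed (simp add: bump_def)
  next
    case 3
    \<comment> \<open>At 0 the right difference quotient is
      \<open>y * poly (bump_poly n) y * exp (- y)\<close> with \<open>y = 1 / h\<close>, and the
      exponential wins.\<close>
    have "((\<lambda>y. poly ([:0, 1:] * bump_poly n) y * exp (- y)) \<longlongrightarrow> 0) at_top" by (rule poly_times_exp_tendsto_0)
    then have "((\<lambda>h. poly ([:0, 1:] * bump_poly n) (inverse h) * exp (- inverse h)) \<longlongrightarrow> 0) (at_right 0)"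
      by (rule filterlim_compose[OF _ filterlim_inverse_at_top_right])
    then have "((\<lambda>h. bump n h / h) \<longlongrightarrow> 0) (at_right 0)"
    proof (rule Lim_transform_eventually)
      show "\<forall>\<^sub>F h in at_right 0. poly ([:0, 1:] * bump_poly n) (inverse h) * exp (- inverse h) = bump n h / h"
        using eventually_at_right_less[of "0::real"]
        by eventually_elim (simp add: bump_def field_simps)
    qed
    moreover have "((\<lambda>h. bump n h / h) \<longlongrightarrow> 0) (at_left 0)"
    proof (rule Lim_transform_eventually[OF tendsto_const])
      show "\<forall>\<^sub>F h in at_left 0. 0 = bump n h / h"
        using eventually_at_left_real[of "-1" "0::real"] by (auto elim!: eventually_mono simp: bump_def)
    qed
    ultimately have "((\<lambda>h. bump n h / h) \<longlongrightarrow> 0) (at 0)"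
      by (simp add: filterlim_split_at)
    then show ?thesis using 3 by (simp add: has_field_derivative_iff bump_def)
  qed
qed

lemma bump_0_pos: "x > 0 \<Longrightarrow> bump 0 x > 0"
  by (simp add: bump_def)

lemma bump_nonpos: "x \<le> 0 \<Longrightarrow> bump n x = 0"
  by (simp add: bump_def)

lemma continuous_on_bump: "continuous_on S (bump n)"
  using bump_deriv DERIV_isCont by (intro continuous_at_imp_continuous_on) blast

text \<open>An algebra of functions that is closed under partial derivatives; this yields smoothness by induction
  on the order.\<close>

inductive_set smooth_algebra :: "real \<Rightarrow> (real^2 \<Rightarrow> complex) set" for R where
  const: "(\<lambda>p. z) \<in> smooth_algebra R"
| coord: "(\<lambda>p. of_real (p $ i)) \<in> smooth_algebra R"
| bump: "(\<lambda>p. of_real (bump n (R - (norm p)\<^sup>2))) \<in> smooth_algebra R"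
| add: "f \<in> smooth_algebra R \<Longrightarrow> g \<in> smooth_algebra R \<Longrightarrow> (\<lambda>p. f p + g p) \<in> smooth_algebra R"
| mult: "f \<in> smooth_algebra R \<Longrightarrow> g \<in> smooth_algebra R \<Longrightarrow> (\<lambda>p. f p * g p) \<in> smooth_algebra R"

lemma smooth_algebra_power: "f \<in> smooth_algebra R \<Longrightarrow> (\<lambda>p. f p ^ n) \<in> smooth_algebra R"
  by (induction n) (auto intro: smooth_algebra.intros)

lemma smooth_algebra_sum: "(\<And>i. i \<in> I \<Longrightarrow> f i \<in> smooth_algebra R) \<Longrightarrow> (\<lambda>p. \<Sum>i\<in>I. f i p) \<in> smooth_algebra R"
  by (induction I rule: infinite_finite_induct) (auto intro: smooth_algebra.intros)

lemma norm_power2_eq: "(norm (p :: real^2))\<^sup>2 = (p $ 1)\<^sup>2 + (p $ 2)\<^sup>2"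
  by (simp add: norm_real2)

lemma has_derivative_norm_power2:
  "((\<lambda>p::real^2. (norm p)\<^sup>2) has_derivative (\<lambda>h. 2 * (p \<bullet> h))) (at p)"
  unfolding power2_norm_eq_inner
  by (auto intro!: derivative_eq_intros simp: inner_commute)

lemma has_derivative_radial:
  fixes f :: "real \<Rightarrow> real"
  assumes "(f has_real_derivative d) (at ((norm p)\<^sup>2))"
  shows "((\<lambda>p::real^2. complex_of_real (f ((norm p)\<^sup>2))) has_derivative (\<lambda>h. of_real (d * (2 * (p \<bullet> h))))) (at p)"
  using has_derivative_compose[OF has_derivative_norm_power2[of p] assms[unfolded has_field_derivative_def]]
  by (rule has_derivative_of_real)

text \<open>Differentiating \<open>bump n\<close> of the squared radius produces
  \<open>bump (Suc n)\<close> times a coordinate; this is why all the \<open>bump n\<close>, and not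
  just the cutoff \<open>bump 0\<close>, are generators.\<close>

lemma smooth_algebra_deriv:
  assumes "f \<in> smooth_algebra R"
  shows "\<exists>f'. (\<forall>p. (f has_derivative f' p) (at p)) \<and> (\<forall>i. (\<lambda>p. f' p (axis i 1)) \<in> smooth_algebra R)"
  using assms
proof induction
  case (const z)
  show ?case by (rule exI[of _ "\<lambda>p h. 0"]) (auto intro: smooth_algebra.const)
next
  case (coord i)
  have "((\<lambda>p::real^2. complex_of_real (p $ i)) has_derivative (\<lambda>h. of_real (h $ i))) (at p)" for p
    by (intro has_derivative_of_real bounded_linear_imp_has_derivative bounded_linear_vec_nth)
  then show ?case by (intro exI[of _ "\<lambda>p h. of_real (h $ i)"]) (auto intro: smooth_algebra.const)
next
  case (bump n)
  have 1: "((\<lambda>p::real^2. complex_of_real (bump n (R - (norm p)\<^sup>2))) has_derivative (\<lambda>h. of_real (- bump (Suc n) (R - (norm p)\<^sup>2) * (2 * (p \<bullet> h))))) (at p)" for p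
  proof (rule has_derivative_radial[of "\<lambda>t. bump n (R - t)"])
    have "((\<lambda>t. R - t) has_real_derivative - 1) (at ((norm p)\<^sup>2))" by (auto intro!: derivative_eq_intros)
    from DERIV_chain2[OF bump_deriv this, of n]
    show "((\<lambda>t. bump n (R - t)) has_real_derivative - bump (Suc n) (R - (norm p)\<^sup>2)) (at ((norm p)\<^sup>2))" by simp
  qed
  have "(\<lambda>p. complex_of_real (- bump (Suc n) (R - (norm p)\<^sup>2) * (2 * (p \<bullet> axis i 1)))) \<in> smooth_algebra R" for i :: 2
  proof -
    have "(\<lambda>p. ((- 2) * of_real (bump (Suc n) (R - (norm p)\<^sup>2))) * of_real (p $ i)) \<in> smooth_algebra R"
      by (intro smooth_algebra.intros)
    then show ?thesis by (simp add: inner_axis mult.assoc mult.left_commute)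
  qed
  with 1 show ?case
    by (intro exI[of _ "\<lambda>p h. of_real (- bump (Suc n) (R - (norm p)\<^sup>2) * (2 * (p \<bullet> h)))"]) auto
next
  case (add f g)
  then obtain f' g' where f: "\<And>p. (f has_derivative f' p) (at p)" "\<And>i. (\<lambda>p. f' p (axis i 1)) \<in> smooth_algebra R"
    and g: "\<And>p. (g has_derivative g' p) (at p)" "\<And>i. (\<lambda>p. g' p (axis i 1)) \<in> smooth_algebra R" by metis
  show ?case by (rule exI[of _ "\<lambda>p h. f' p h + g' p h"]) (use f g in \<open>auto intro: has_derivative_add smooth_algebra.add\<close>)
next
  case (mult f g)
  then obtain f' g' where f: "\<And>p. (f has_derivative f' p) (at p)" "\<And>i. (\<lambda>p. f' p (axis i 1)) \<in> smooth_algebra R"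
    and g: "\<And>p. (g has_derivative g' p) (at p)" "\<And>i. (\<lambda>p. g' p (axis i 1)) \<in> smooth_algebra R" by metis
  show ?case by (rule exI[of _ "\<lambda>p h. f p * g' p h + f' p h * g p"])
    (use f g mult in \<open>auto intro!: has_derivative_mult smooth_algebra.add smooth_algebra.mult\<close>)
qed

lemma has_derivative_complex2:
  fixes u v :: "'a::real_normed_vector \<Rightarrow> complex"
  assumes "(u has_derivative u') F" "(v has_derivative v') F"
  shows "((\<lambda>p. vector [u p, v p] :: complex^2) has_derivative (\<lambda>h. vector [u' h, v' h])) F"
proof -
  have eq: "vector [a, b] = axis 1 a + (axis 2 b :: complex^2)" for a b
    by (simp add: vec_eq_iff forall_2 axis_def)
  have bl: "bounded_linear (axis i :: complex \<Rightarrow> complex^2)" for i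
    by (rule bounded_linear_intro[where K = 1]) (auto simp: axis_eq_axis vec_eq_iff axis_def norm_axis_1 norm_complex2_power2 norm_vec_def L2_set_def if_distrib[of norm] if_distrib[of "\<lambda>x. x ^ 2"] cong: if_cong)
  show ?thesis unfolding eq
    by (intro has_derivative_add bounded_linear.has_derivative[OF bl] assms)
qed

lemma smooth_algebra_continuously_differentiable:
  "u \<in> smooth_algebra R \<Longrightarrow> v \<in> smooth_algebra R \<Longrightarrow> continuously_differentiable k (\<lambda>p. vector [u p, v p])"
proof (induction k arbitrary: u v)
  case 0
  obtain u' v' where "\<And>p. (u has_derivative u' p) (at p)" "\<And>p. (v has_derivative v' p) (at p)"
    using smooth_algebra_deriv[OF 0(1)] smooth_algebra_deriv[OF 0(2)] by metis
  then have "((\<lambda>p. vector [u p, v p] :: complex^2) has_derivative (\<lambda>h. vector [u' p h, v' p h])) (at p)" for p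
    by (intro has_derivative_complex2)
  then show ?case using has_derivative_continuous
    by (simp add: continuous_on_eq_continuous_at) blast
next
  case (Suc k)
  obtain u' v' where u: "\<And>p. (u has_derivative u' p) (at p)" "\<And>i. (\<lambda>p. u' p (axis i 1)) \<in> smooth_algebra R"
    and v: "\<And>p. (v has_derivative v' p) (at p)" "\<And>i. (\<lambda>p. v' p (axis i 1)) \<in> smooth_algebra R"
    using smooth_algebra_deriv[OF Suc(2)] smooth_algebra_deriv[OF Suc(3)] by metis
  have d: "((\<lambda>p. vector [u p, v p] :: complex^2) has_derivative (\<lambda>h. vector [u' p h, v' p h])) (at p)" for p
    by (intro has_derivative_complex2 u v)
  have "partial_deriv i (\<lambda>p. vector [u p, v p]) = (\<lambda>p. vector [u' p (axis i 1), v' p (axis i 1)])" for i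
    using partial_deriv_eqI[OF d] by blast
  then show ?case using d Suc(1)[OF u(2) v(2)]
    by (auto simp: differentiable_on_def differentiable_def)
qed

section \<open>The Dirac operator on sectors\<close>

lemma zc_smooth: "zc \<in> smooth_algebra R" "(\<lambda>p. cnj (zc p)) \<in> smooth_algebra R"
proof -
  have "(\<lambda>p. of_real (p $ 1) + \<i> * of_real (p $ 2)) \<in> smooth_algebra R"
    "(\<lambda>p. of_real (p $ 1) + (- \<i>) * of_real (p $ 2)) \<in> smooth_algebra R"
    by (intro smooth_algebra.intros)+
  moreover have "zc = (\<lambda>p. of_real (p $ 1) + \<i> * of_real (p $ 2))" "(\<lambda>p. cnj (zc p)) = (\<lambda>p. of_real (p $ 1) + (- \<i>) * of_real (p $ 2))"
    by (auto simp: fun_eq_iff zc_def complex_eq_iff)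
  ultimately show "zc \<in> smooth_algebra R" "(\<lambda>p. cnj (zc p)) \<in> smooth_algebra R" by simp_all
qed

lemma radial_poly_smooth:
  assumes "real_polynomial_function q"
  shows "(\<lambda>p. complex_of_real (q ((norm p)\<^sup>2))) \<in> smooth_algebra R"
proof -
  obtain a n where q: "q = (\<lambda>x. \<Sum>i\<le>n. a i * x ^ i)" using assms real_polynomial_function_iff_sum by auto
  have "(\<lambda>p. \<Sum>i\<le>n. of_real (a i) * (of_real (p $ 1) ^ 2 + of_real (p $ 2) ^ 2) ^ i) \<in> smooth_algebra R"
    by (intro smooth_algebra_sum smooth_algebra.mult smooth_algebra.const smooth_algebra_power
        smooth_algebra.add smooth_algebra.coord)
  then show ?thesis by (simp add: q norm_power2_eq)
qed

text \<open>These fields form the smooth core of a sector: a power of \<open>zc\<close> or its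
  conjugate, a polynomial in \<open>|p|^2\<close>, and a smooth cutoff all lie in
  \<open>smooth_algebra\<close>. Other sector fields are approximated by them.\<close>

lemma sector_test_spinor:
  assumes "real_polynomial_function q" "real_polynomial_function q'"
  shows "sector c s k (\<lambda>t. q t * bump 0 (R - t)) (\<lambda>t. q' t * bump 0 (R - t)) \<in> test_spinors"
  (is "?f \<in> _")
proof -
  note I = smooth_algebra.intros smooth_algebra_power zc_smooth radial_poly_smooth
  have "continuously_differentiable n ?f" for n
  proof (cases s)
    case True
    have "continuously_differentiable n (\<lambda>p. vector [zc p ^ k * (of_real (q ((norm p)\<^sup>2)) * of_real (bump 0 (R - (norm p)\<^sup>2))),
       c * zc p ^ (k + 1) * (of_real (q' ((norm p)\<^sup>2)) * of_real (bump 0 (R - (norm p)\<^sup>2)))])"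
      by (rule smooth_algebra_continuously_differentiable[of _ R]) (intro I assms)+
    then show ?thesis using True by (simp add: sector_def[abs_def] Let_def)
  next
    case False
    have "continuously_differentiable n (\<lambda>p. vector [cnj (zc p) ^ (k + 1) * (of_real (q' ((norm p)\<^sup>2)) * of_real (bump 0 (R - (norm p)\<^sup>2))),
       c * cnj (zc p) ^ k * (of_real (q ((norm p)\<^sup>2)) * of_real (bump 0 (R - (norm p)\<^sup>2)))])"
      by (rule smooth_algebra_continuously_differentiable[of _ R]) (intro I assms)+
    then show ?thesis using False by (simp add: sector_def[abs_def] Let_def)
  qed
  moreover have "bounded {p. ?f p \<noteq> 0}"
  proof (rule bounded_subset[OF bounded_cball[of 0 "sqrt \<bar>R\<bar>"]], rule subsetI, rule ccontr)
    fix p assume p: "p \<in> {p. ?f p \<noteq> 0}" "p \<notin> cball 0 (sqrt \<bar>R\<bar>)"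
    then have "sqrt \<bar>R\<bar> < norm p" by simp
    then have "(sqrt \<bar>R\<bar>)\<^sup>2 < (norm p)\<^sup>2" by (intro power_strict_mono) auto
    then have "R - (norm p)\<^sup>2 \<le> 0" by simp
    then have "?f p = 0" by (simp add: vec_eq_iff forall_2 sector_nth bump_nonpos)
    then show False using p by simp
  qed
  ultimately show ?thesis by (simp add: test_spinors_alt)
qed

text \<open>With \<open>\<sigma> = sgn_sector s\<close> and \<open>H' = field_strength / 2\<close>
  this is \<open>-2 \<sigma> t^(-k) exp (- \<sigma> H)\<close> times the derivative of
  \<open>t^(k+1) exp (\<sigma> H) \<beta>\<close>. The derivative \<open>\<beta>'\<close> is a
  separate argument because at 0 profiles are differentiated from the right.\<close>

definition sector_dirac1 :: "real \<Rightarrow> bool \<Rightarrow> nat \<Rightarrow> (real \<Rightarrow> real) \<Rightarrow> (real \<Rightarrow> real) \<Rightarrow> real \<Rightarrow> real" where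
  "sector_dirac1 \<gamma> s k \<beta> \<beta>' t =
     - sgn_sector s * (2 * (real k + 1) * \<beta> t + 2 * t * \<beta>' t) - field_strength \<gamma> t * t * \<beta> t"

text \<open>Equal to \<open>2 \<sigma> exp (\<sigma> H)\<close> times the derivative of
  \<open>exp (- \<sigma> H) \<alpha>\<close>.\<close>

definition sector_dirac2 :: "real \<Rightarrow> bool \<Rightarrow> (real \<Rightarrow> real) \<Rightarrow> (real \<Rightarrow> real) \<Rightarrow> real \<Rightarrow> real" where
  "sector_dirac2 \<gamma> s \<alpha> \<alpha>' t = 2 * sgn_sector s * \<alpha>' t - field_strength \<gamma> t * \<alpha> t"

lemma has_derivative_zc: "(zc has_derivative zc) (at p)" "((\<lambda>p. cnj (zc p)) has_derivative (\<lambda>h. cnj (zc h))) (at p)"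
proof -
  show 1: "(zc has_derivative zc) (at p)" by (rule bounded_linear_imp_has_derivative[OF bounded_linear_zc])
  show "((\<lambda>p. cnj (zc p)) has_derivative (\<lambda>h. cnj (zc h))) (at p)"
    by (rule bounded_linear.has_derivative[OF bounded_linear_cnj 1])
qed

lemma zc_axis: "zc (axis 1 1) = 1" "zc (axis 2 1) = \<i>"
  by (simp_all add: zc_def axis_def complex_eq_iff)

lemma monomial_radial_derivs:
  fixes w :: "real^2 \<Rightarrow> complex" and f :: "real \<Rightarrow> real"
  assumes w: "\<And>p. (w has_derivative w') (at p)" and f: "(f has_real_derivative d) (at ((norm p)\<^sup>2))"
  shows "((\<lambda>p. w p ^ n * of_real (f ((norm p)\<^sup>2))) has_derivative
    (\<lambda>h. w p ^ n * of_real (d * (2 * (p \<bullet> h))) + of_nat n * w' h * w p ^ (n - 1) * of_real (f ((norm p)\<^sup>2)))) (at p)"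
  using has_derivative_mult[OF has_derivative_power[OF w] has_derivative_radial[OF f], of n] by simp

context magnetic_dirac_setting
begin

text \<open>In complex notation the operator is off-diagonal, built from
  \<open>d/dx - i d/dy\<close> and \<open>d/dx + i d/dy\<close>, and the potential enters as
  multiplication by the conjugate of \<open>zc\<close> or by \<open>zc\<close>.\<close>

lemma dirac_components:
  assumes u: "(u has_derivative u') (at p)" and v: "(v has_derivative v') (at p)"
    and \<phi>: "\<phi> = (\<lambda>p. vector [u p, v p])"
  shows "magnetic_dirac e A \<phi> p =
    vector [- cnj c * (v' (axis 1 1) - \<i> * v' (axis 2 1) + of_real (field_strength \<gamma> ((norm p)\<^sup>2)) * cnj (zc p) * v p),
            c * (u' (axis 1 1) + \<i> * u' (axis 2 1) - of_real (field_strength \<gamma> ((norm p)\<^sup>2)) * zc p * u p)]"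
proof -
  have d: "partial_deriv i \<phi> p = vector [u' (axis i 1), v' (axis i 1)]" for i
    unfolding \<phi> by (rule partial_deriv_eqI[OF has_derivative_complex2[OF u v]])
  have z: "zc p = of_real (p $ 1) + \<i> * of_real (p $ 2)" by (simp add: zc_def complex_eq_iff)
  have i2: "\<i> * (\<i> * x) = - x" for x by (simp add: mult.assoc[symmetric])
  show ?thesis
    by (simp add: magnetic_dirac_def dirac_def clifford_mult_def d[unfolded \<phi>] e1 e2 vec_eq_iff forall_2 potential_nth
        \<phi> z scaleR_conv_of_real[where 'a = complex] algebra_simps i2)
qed

text \<open>The operator \<open>d/dx + i d/dy\<close> annihilates powers of \<open>z = zc p\<close>
  and takes a radial factor \<open>f\<close> to \<open>2 z f'\<close>, so it raises the power by
  one; \<open>d/dx - i d/dy\<close> lowers it by one. Hence the two components exchange their powers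
  and the sector is preserved. For \<open>s = False\<close> the two operators change roles.\<close>

lemma magnetic_dirac_sector:
  assumes \<alpha>: "(\<alpha> has_real_derivative \<alpha>' ((norm p)\<^sup>2)) (at ((norm p)\<^sup>2))"
    and \<beta>: "(\<beta> has_real_derivative \<beta>' ((norm p)\<^sup>2)) (at ((norm p)\<^sup>2))"
  shows "magnetic_dirac e A (sector c s k \<alpha> \<beta>) p = sector c s k (sector_dirac1 \<gamma> s k \<beta> \<beta>') (sector_dirac2 \<gamma> s \<alpha> \<alpha>') p"
proof -
  define t where "t = (norm p)\<^sup>2"
  have cc: "c * cnj c = 1" "cnj c * c = 1" using c by (simp_all add: complex_norm_square[symmetric] mult.commute[of "cnj c"])
  have cx: "cnj c * (c * x) = x" "c * (cnj c * x) = x" for x by (simp_all add: mult.assoc[symmetric] cc)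
  have ip: "p \<bullet> axis 1 1 = Re (zc p)" "p \<bullet> axis 2 1 = Im (zc p)" by (simp_all add: inner_axis zc_def)
  define z where "z = zc p"
  have zt: "z * cnj z = of_real t" by (simp add: z_def t_def zc_mult_cnj)
  have ct: "c * (z * (cnj c * cnj z)) = of_real t"
  proof -
    have "c * (z * (cnj c * cnj z)) = (c * cnj c) * (z * cnj z)" by (simp only: ac_simps)
    then show ?thesis by (simp add: cc zt)
  qed
  have re: "of_real (Re z) + \<i> * of_real (Im z) = z" by (simp add: complex_eq_iff)
  have re': "of_real (Re z) - \<i> * of_real (Im z) = cnj z" by (simp add: complex_eq_iff)
  note D = monomial_radial_derivs[OF has_derivative_zc(1)] monomial_radial_derivs[OF has_derivative_zc(2)]
  show ?thesis
  proof (cases s)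
    case True
    let ?u' = "\<lambda>h. zc p ^ k * of_real (\<alpha>' t * (2 * (p \<bullet> h))) + of_nat k * zc h * zc p ^ (k - 1) * of_real (\<alpha> t)"
    let ?v' = "\<lambda>h. c * (zc p ^ (k + 1) * of_real (\<beta>' t * (2 * (p \<bullet> h))) + of_nat (k + 1) * zc h * zc p ^ (k + 1 - 1) * of_real (\<beta> t))"
    have u: "((\<lambda>p. zc p ^ k * of_real (\<alpha> ((norm p)\<^sup>2))) has_derivative ?u') (at p)"
      using D(1)[OF \<alpha>, of k] by (simp add: t_def)
    have v: "((\<lambda>p. c * (zc p ^ (k + 1) * of_real (\<beta> ((norm p)\<^sup>2)))) has_derivative ?v') (at p)"
      using has_derivative_mult_right[OF D(1)[OF \<beta>, of "k + 1"], of c] by (simp add: t_def)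
    have \<phi>: "sector c s k \<alpha> \<beta> = (\<lambda>p. vector [zc p ^ k * of_real (\<alpha> ((norm p)\<^sup>2)), c * (zc p ^ (k + 1) * of_real (\<beta> ((norm p)\<^sup>2)))])"
      using True by (simp add: fun_eq_iff sector_def Let_def mult.assoc)
    have U: "?u' (axis 1 1) + \<i> * ?u' (axis 2 1) = 2 * of_real (\<alpha>' t) * z ^ (k + 1)"
    proof -
      have "?u' (axis 1 1) + \<i> * ?u' (axis 2 1) = 2 * of_real (\<alpha>' t) * z ^ k * (of_real (Re z) + \<i> * of_real (Im z))"
        by (simp add: ip zc_axis z_def algebra_simps)
      then show ?thesis by (simp add: re mult.commute)
    qed
    have V: "?v' (axis 1 1) - \<i> * ?v' (axis 2 1) = c * (z ^ k * (2 * of_real (t * \<beta>' t) + 2 * of_nat (k + 1) * of_real (\<beta> t)))"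
    proof -
      have "?v' (axis 1 1) - \<i> * ?v' (axis 2 1) = c * (2 * of_real (\<beta>' t) * z ^ (k + 1) * (of_real (Re z) - \<i> * of_real (Im z)) + 2 * of_nat (k + 1) * z ^ k * of_real (\<beta> t))"
        by (simp add: ip zc_axis z_def algebra_simps)
      also have "z ^ (k + 1) * (of_real (Re z) - \<i> * of_real (Im z)) = z ^ k * of_real t"
        by (simp add: re' zt mult.assoc mult.left_commute[of z])
      then have "2 * of_real (\<beta>' t) * z ^ (k + 1) * (of_real (Re z) - \<i> * of_real (Im z)) = 2 * of_real (\<beta>' t) * (z ^ k * of_real t)"
        by (simp add: mult.assoc)
      finally show ?thesis by (simp add: algebra_simps)
    qed
    have zz: "cnj z * (c * (z ^ (k + 1) * x)) = c * (z ^ k * (of_real t * x))" for x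
      using zt by (simp add: algebra_simps)
    show ?thesis
      unfolding dirac_components[OF u v \<phi>] unfolding U V unfolding t_def[symmetric] z_def[symmetric]
      using True
      by (simp add: vec_eq_iff forall_2 sector_nth sector_dirac1_def sector_dirac2_def sgn_sector_def
          t_def[symmetric] z_def[symmetric] mult.assoc zz[simplified] )
        (simp add: algebra_simps cx ct zt)
  next
    case False
    let ?u' = "\<lambda>h. cnj (zc p) ^ (k + 1) * of_real (\<beta>' t * (2 * (p \<bullet> h))) + of_nat (k + 1) * cnj (zc h) * cnj (zc p) ^ (k + 1 - 1) * of_real (\<beta> t)"
    let ?v' = "\<lambda>h. c * (cnj (zc p) ^ k * of_real (\<alpha>' t * (2 * (p \<bullet> h))) + of_nat k * cnj (zc h) * cnj (zc p) ^ (k - 1) * of_real (\<alpha> t))"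
    have u: "((\<lambda>p. cnj (zc p) ^ (k + 1) * of_real (\<beta> ((norm p)\<^sup>2))) has_derivative ?u') (at p)"
      using D(2)[OF \<beta>, of "k + 1"] by (simp add: t_def)
    have v: "((\<lambda>p. c * (cnj (zc p) ^ k * of_real (\<alpha> ((norm p)\<^sup>2)))) has_derivative ?v') (at p)"
      using has_derivative_mult_right[OF D(2)[OF \<alpha>, of k], of c] by (simp add: t_def)
    have \<phi>: "sector c s k \<alpha> \<beta> = (\<lambda>p. vector [cnj (zc p) ^ (k + 1) * of_real (\<beta> ((norm p)\<^sup>2)), c * (cnj (zc p) ^ k * of_real (\<alpha> ((norm p)\<^sup>2)))])"
      using False by (simp add: fun_eq_iff sector_def Let_def mult.assoc)
    have V: "?v' (axis 1 1) - \<i> * ?v' (axis 2 1) = c * (2 * of_real (\<alpha>' t) * cnj z ^ (k + 1))"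
    proof -
      have "?v' (axis 1 1) - \<i> * ?v' (axis 2 1) = c * (2 * of_real (\<alpha>' t) * cnj z ^ k * (of_real (Re z) - \<i> * of_real (Im z)))"
        by (simp add: ip zc_axis z_def algebra_simps)
      then show ?thesis by (simp add: re' mult.commute)
    qed
    have U: "?u' (axis 1 1) + \<i> * ?u' (axis 2 1) = cnj z ^ k * (2 * of_real (t * \<beta>' t) + 2 * of_nat (k + 1) * of_real (\<beta> t))"
    proof -
      have "?u' (axis 1 1) + \<i> * ?u' (axis 2 1) = 2 * of_real (\<beta>' t) * cnj z ^ (k + 1) * (of_real (Re z) + \<i> * of_real (Im z)) + 2 * of_nat (k + 1) * cnj z ^ k * of_real (\<beta> t)"
        by (simp add: ip zc_axis z_def algebra_simps)
      also have "cnj z ^ (k + 1) * (of_real (Re z) + \<i> * of_real (Im z)) = cnj z ^ k * of_real t"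
        using zt by (simp add: re mult.assoc mult.left_commute[of "cnj z"] mult.commute)
      then have "2 * of_real (\<beta>' t) * cnj z ^ (k + 1) * (of_real (Re z) + \<i> * of_real (Im z)) = 2 * of_real (\<beta>' t) * (cnj z ^ k * of_real t)"
        by (simp add: mult.assoc)
      finally show ?thesis by (simp add: algebra_simps)
    qed
    have zz: "z * (cnj z ^ (k + 1) * x) = cnj z ^ k * (of_real t * x)" for x
      using zt by (simp add: algebra_simps)
    show ?thesis
      unfolding dirac_components[OF u v \<phi>] unfolding U V unfolding t_def[symmetric] z_def[symmetric]
      using False
      by (simp add: vec_eq_iff forall_2 sector_nth sector_dirac1_def sector_dirac2_def sgn_sector_def
          t_def[symmetric] z_def[symmetric] mult.assoc zz[simplified])
        (simp add: algebra_simps cx ct zt)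
  qed
qed

end

section \<open>Continuously differentiable sector fields belong to the closure\<close>

text \<open>The derivative is an explicit partner, one-sided at 0. Solving the radial equations
  gives this regularity and in general no more, as \<open>field_strength\<close> is not
  differentiable at 0.\<close>

definition c1 :: "(real \<Rightarrow> real) \<Rightarrow> (real \<Rightarrow> real) \<Rightarrow> bool" where
  "c1 f f' \<longleftrightarrow> (\<forall>t\<ge>0. (f has_real_derivative f' t) (at t within {0..})) \<and> ccont f \<and> ccont f'"

lemma c1D:
  assumes "c1 f f'"
  shows "\<And>t. t \<ge> 0 \<Longrightarrow> (f has_real_derivative f' t) (at t within {0..})" "ccont f" "ccont f'"
  using assms by (auto simp: c1_def)

lemma c1D_at: "c1 f f' \<Longrightarrow> t > 0 \<Longrightarrow> (f has_real_derivative f' t) (at t)"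
  using c1D(1)[of f f' t] at_within_interior[of t "{0..}"] by (simp add: interior_real_atLeast)

lemma c1_0 [simp]: "c1 (\<lambda>t. 0) (\<lambda>t. 0)"
  by (simp add: c1_def)

lemma c1_add: "c1 f f' \<Longrightarrow> c1 g g' \<Longrightarrow> c1 (\<lambda>t. f t + g t) (\<lambda>t. f' t + g' t)"
  by (auto simp: c1_def intro: ccont_add DERIV_add)

lemma c1_cmult: "c1 f f' \<Longrightarrow> c1 (\<lambda>t. z * f t) (\<lambda>t. z * f' t)"
  by (auto simp: c1_def intro: ccont_cmult DERIV_cmult)

lemma c1_bound:
  assumes "c1 f f'"
  obtains R where "R > 0" "\<And>t. t \<ge> R \<Longrightarrow> f t = 0" "\<And>t. t \<ge> R \<Longrightarrow> f' t = 0"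
proof -
  obtain R R' where "R > 0" "\<And>t. t \<ge> R \<Longrightarrow> f t = 0" "\<And>t. t \<ge> R' \<Longrightarrow> f' t = 0"
    using ccont_bound[OF c1D(2)[OF assms]] ccont_bound[OF c1D(3)[OF assms]] by metis
  then show thesis by (intro that[of "max R R'"]) auto
qed

section \<open>Approximation by polynomials times a cutoff\<close>

text \<open>Beyond \<open>R\<close> the numerator vanishes, so zeros of \<open>g\<close> there do no
  harm, and the two closed pieces are glued at \<open>R\<close>.\<close>

lemma continuous_on_quotient_cutoff:
  fixes f g :: "real \<Rightarrow> real"
  assumes f: "continuous_on {0..} f" and z: "\<And>t. t \<ge> R \<Longrightarrow> f t = 0" and R: "0 \<le> R"
    and g: "continuous_on {0..} g" "\<And>t. 0 \<le> t \<Longrightarrow> t \<le> R \<Longrightarrow> g t \<noteq> 0"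
  shows "continuous_on {0..} (\<lambda>t. f t / g t)"
proof -
  have 1: "continuous_on {0..R} (\<lambda>t. f t / g t)"
    using g by (intro continuous_intros continuous_on_subset[OF f] continuous_on_subset[OF g(1)]) auto
  have "continuous_on {R..} (\<lambda>t. f t / g t) \<longleftrightarrow> continuous_on {R..} (\<lambda>t. 0 :: real)"
    by (rule continuous_on_cong) (auto simp: z)
  then have 2: "continuous_on {R..} (\<lambda>t. f t / g t)" by simp
  have "{0..} = {0..R} \<union> {R..}" using R by auto
  then show ?thesis using continuous_on_closed_Un[OF _ _ 1 2] by simp
qed

text \<open>Positive up to \<open>R + 1\<close> and 0 from there on. The extra unit keeps it nonzero
  on the support \<open>t <= R\<close> of a profile, where it serves as a divisor.\<close>

definition cutoff :: "real \<Rightarrow> real \<Rightarrow> real" where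
  "cutoff R t = bump 0 (R + 1 - t)"

definition cutoff' :: "real \<Rightarrow> real \<Rightarrow> real" where
  "cutoff' R t = - bump 1 (R + 1 - t)"

lemma cutoff_deriv: "(cutoff R has_real_derivative cutoff' R t) (at t within S)"
proof -
  have "((\<lambda>t. R + 1 - t) has_real_derivative - 1) (at t)" by (auto intro!: derivative_eq_intros)
  from DERIV_chain2[OF bump_deriv this, of 0]
  have "(cutoff R has_real_derivative cutoff' R t) (at t)" by (simp add: cutoff_def[abs_def] cutoff'_def)
  then show ?thesis by (rule has_field_derivative_at_within)
qed

lemma cutoff_props:
  "t < R + 1 \<Longrightarrow> cutoff R t > 0" "t \<ge> R + 1 \<Longrightarrow> cutoff R t = 0" "t \<ge> R + 1 \<Longrightarrow> cutoff' R t = 0"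
  by (simp_all add: cutoff_def cutoff'_def bump_0_pos bump_nonpos)

lemma continuous_on_cutoff: "continuous_on S (cutoff R)" "continuous_on S (cutoff' R)"
  unfolding cutoff_def[abs_def] cutoff'_def[abs_def]
  by (intro continuous_intros continuous_on_compose2[OF continuous_on_bump[of UNIV]]; simp)+

lemma c1_poly_cutoff:
  assumes "real_polynomial_function q" "\<And>t. (q has_real_derivative q' t) (at t)" "continuous_on UNIV q'"
  shows "c1 (\<lambda>t. q t * cutoff R t) (\<lambda>t. q' t * cutoff R t + q t * cutoff' R t)"
proof -
  have cq: "continuous_on {0..} q" using assms(2) DERIV_isCont by (intro continuous_at_imp_continuous_on) blast
  have cq': "continuous_on {0..} q'" using assms(3) by (rule continuous_on_subset) auto
  have z: "ccont (cutoff R)" "ccont (cutoff' R)" unfolding ccont_def using continuous_on_cutoff cutoff_props by blast+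
  have "((\<lambda>t. q t * cutoff R t) has_real_derivative q' t * cutoff R t + q t * cutoff' R t) (at t within {0..})" for t
    using DERIV_mult[OF has_field_derivative_at_within[OF assms(2)[of t]] cutoff_deriv[of R t]] by (simp add: add.commute mult.commute)
  then show ?thesis unfolding c1_def
    using ccont_mult[OF cq z(1)] ccont_add[OF ccont_mult[OF cq' z(1)] ccont_mult[OF cq z(2)]] by simp
qed

lemma polynomial_antiderivative:
  assumes "real_polynomial_function (P :: real \<Rightarrow> real)"
  obtains Q where "real_polynomial_function Q" "\<And>t. (Q has_real_derivative P t) (at t)" "Q 0 = z"
proof -
  obtain a n where P: "P = (\<lambda>x. \<Sum>i\<le>n. a i * x ^ i)" using assms real_polynomial_function_iff_sum by auto
  define Q where "Q x = z + (\<Sum>i\<le>n. (a i / (real i + 1)) * x ^ (i + 1))" for x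
  have "real_polynomial_function Q"
    unfolding Q_def[abs_def]
    by (intro real_polynomial_function.intros real_polynomial_function_sum real_polynomial_function_power)
      (auto intro: real_polynomial_function.intros)
  moreover have "(Q has_real_derivative P t) (at t)" for t
    unfolding Q_def[abs_def] P
    by (rule derivative_eq_intros refl)+ (auto intro!: sum.cong simp: field_simps)
  moreover have "Q 0 = z" by (simp add: Q_def)
  ultimately show thesis using that by blast
qed

lemma polynomial_continuous: "real_polynomial_function (q :: real \<Rightarrow> real) \<Longrightarrow> continuous_on S q"
  by (intro continuous_on_polymonial_function) (simp add: real_polynomial_function_eq[symmetric])

text \<open>Weierstrass is applied to \<open>f / cutoff\<close> and the cutoff is multiplied back,
  which gives approximants that are smooth and supported in a fixed disc.\<close>

lemma ccont_poly_approx: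
  assumes f: "ccont f" and z: "\<And>t. t \<ge> R \<Longrightarrow> f t = 0" and R: "0 \<le> R" and \<epsilon>: "\<epsilon> > 0"
  obtains q where "real_polynomial_function q" "\<And>t. 0 \<le> t \<Longrightarrow> \<bar>f t - q t * cutoff R t\<bar> \<le> \<epsilon>"
proof -
  define g where "g t = f t / cutoff R t" for t
  have nz: "cutoff R t \<noteq> 0" if "t \<le> R" for t using cutoff_props(1)[of t R] that by force
  have gc: "continuous_on {0..} g" unfolding g_def
    using R nz by (intro continuous_on_quotient_cutoff[OF ccontD[OF f] z] continuous_on_cutoff) auto
  have "bounded (cutoff R ` {0..R+1})" by (intro compact_imp_bounded compact_continuous_image continuous_on_cutoff) auto
  then obtain M where M: "\<And>t. 0 \<le> t \<Longrightarrow> t \<le> R + 1 \<Longrightarrow> \<bar>cutoff R t\<bar> \<le> M"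
    unfolding bounded_iff by (metis atLeastAtMost_iff imageI real_norm_def)
  have M0: "M \<ge> 0" using M[of 0] R by linarith
  obtain q where q: "real_polynomial_function q" "\<And>t. t \<in> {0..R+1} \<Longrightarrow> \<bar>g t - q t\<bar> < \<epsilon> / (M + 1)"
    using Stone_Weierstrass_real_polynomial_function[of "{0..R+1}" g "\<epsilon> / (M + 1)"]
      continuous_on_subset[OF gc, of "{0..R+1}"] \<epsilon> M0 by auto
  have "\<bar>f t - q t * cutoff R t\<bar> \<le> \<epsilon>" if "0 \<le> t" for t
  proof (cases "t < R + 1")
    case True
    then have "f t = g t * cutoff R t" using cutoff_props(1)[OF True] by (simp add: g_def)
    then have "\<bar>f t - q t * cutoff R t\<bar> = \<bar>g t - q t\<bar> * \<bar>cutoff R t\<bar>" by (simp add: algebra_simps flip: abs_mult)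
    also have "\<dots> \<le> \<epsilon> / (M + 1) * M" using q(2)[of t] M[of t] that True M0 \<epsilon> by (intro mult_mono) auto
    also have "\<dots> \<le> \<epsilon>" using M0 \<epsilon> by (simp add: field_simps)
    finally show ?thesis .
  qed (use z[of t] cutoff_props(2)[of R t] \<epsilon> in auto)
  then show thesis using that q by blast
qed

text \<open>Approximating \<open>f\<close> alone would not control \<open>f'\<close>. Instead the
  derivative \<open>G\<close> of \<open>g = f / cutoff\<close> is approximated by a polynomial
  \<open>P\<close>; its antiderivative \<open>Q\<close> starting at \<open>g 0\<close> is then close
  to \<open>g\<close>, and the product rule returns to \<open>f\<close> and
  \<open>f'\<close>.\<close>

lemma c1_poly_approx:
  assumes f: "c1 f f'" and z: "\<And>t. t \<ge> R \<Longrightarrow> f t = 0" "\<And>t. t \<ge> R \<Longrightarrow> f' t = 0" and R: "0 \<le> R" and \<epsilon>: "\<epsilon> > 0"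
  obtains q q' where "real_polynomial_function q" "\<And>t. (q has_real_derivative q' t) (at t)" "continuous_on UNIV q'"
    "\<And>t. 0 \<le> t \<Longrightarrow> \<bar>f t - q t * cutoff R t\<bar> \<le> \<epsilon>"
    "\<And>t. 0 \<le> t \<Longrightarrow> \<bar>f' t - (q' t * cutoff R t + q t * cutoff' R t)\<bar> \<le> \<epsilon>"
proof -
  let ?c = "cutoff R" and ?c' = "cutoff' R"
  define g where "g t = f t / ?c t" for t
  define G where "G t = (f' t * ?c t - f t * ?c' t) / (?c t * ?c t)" for t
  have nz: "?c t \<noteq> 0" if "t \<le> R" for t using cutoff_props(1)[of t R] that by force
  note cf = ccontD[OF c1D(2)[OF f]] and cf' = ccontD[OF c1D(3)[OF f]]
  have gc: "continuous_on {0..} g" unfolding g_def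
    using R nz by (intro continuous_on_quotient_cutoff[OF cf z(1)] continuous_on_cutoff) auto
  have Gc: "continuous_on {0..} G" unfolding G_def
    using R nz z by (intro continuous_on_quotient_cutoff[where R = R] continuous_intros continuous_on_cutoff cf cf') auto
  have "bounded (?c ` {0..R+1})" "bounded (?c' ` {0..R+1})"
    by (intro compact_imp_bounded compact_continuous_image continuous_on_cutoff; simp)+
  then obtain M1 M2 where M12: "\<And>t. 0 \<le> t \<Longrightarrow> t \<le> R + 1 \<Longrightarrow> \<bar>?c t\<bar> \<le> M1" "\<And>t. 0 \<le> t \<Longrightarrow> t \<le> R + 1 \<Longrightarrow> \<bar>?c' t\<bar> \<le> M2"
    unfolding bounded_iff by (metis atLeastAtMost_iff imageI real_norm_def)
  define M where "M = max 1 (max M1 M2)"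
  have M: "\<bar>?c t\<bar> \<le> M" "\<bar>?c' t\<bar> \<le> M" if "0 \<le> t" "t \<le> R + 1" for t using M12[OF that] by (auto simp: M_def)
  have M0: "M \<ge> 1" by (simp add: M_def)
  \<comment> \<open>Integrating an error \<open>\<delta>\<close> over at most \<open>R + 1\<close>
    gives \<open>\<delta> * (R + 1)\<close>; with the error of the derivative itself the product
    rule costs \<open>\<delta> * (R + 2) * M\<close>.\<close>
  define \<delta> where "\<delta> = \<epsilon> / (M * (R + 2))"
  have \<delta>: "\<delta> > 0" using \<epsilon> M0 R by (simp add: \<delta>_def)
  obtain P where P: "real_polynomial_function P" "\<And>t. t \<in> {0..R+1} \<Longrightarrow> \<bar>G t - P t\<bar> < \<delta>"
    using Stone_Weierstrass_real_polynomial_function[of "{0..R+1}" G \<delta>]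
      continuous_on_subset[OF Gc, of "{0..R+1}"] \<delta> by auto
  obtain Q where Q: "real_polynomial_function Q" "\<And>t. (Q has_real_derivative P t) (at t)" "Q 0 = g 0"
    using polynomial_antiderivative[OF P(1)] by metis
  have gQ: "\<bar>g t - Q t\<bar> \<le> \<delta> * (R + 1)" if t: "0 \<le> t" "t \<le> R + 1" for t
  proof (cases "t = 0")
    case True then show ?thesis using Q(3) \<delta> R by simp
  next
    case False
    then have t0: "0 < t" using t by simp
    have d: "((\<lambda>u. g u - Q u) has_real_derivative G u - P u) (at u)" if "0 < u" "u < t" for u
    proof -
      have "?c u \<noteq> 0" using cutoff_props(1)[of u R] that t by simp
      then have "(g has_real_derivative G u) (at u)"
        unfolding g_def[abs_def] G_def using DERIV_divide[OF c1D_at[OF f \<open>0 < u\<close>] cutoff_deriv[of R u UNIV]] by simp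
      then show ?thesis by (intro DERIV_diff Q)
    qed
    have "continuous_on {0..t} (\<lambda>u. g u - Q u)"
      by (intro continuous_intros continuous_on_subset[OF gc] polynomial_continuous Q) auto
    then obtain l \<xi> where xi: "0 < \<xi>" "\<xi> < t" "((\<lambda>u. g u - Q u) has_real_derivative l) (at \<xi>)"
        "(g t - Q t) - (g 0 - Q 0) = (t - 0) * l"
      using MVT[OF t0, of "\<lambda>u. g u - Q u"] d real_differentiable_def by blast
    have "l = G \<xi> - P \<xi>" using DERIV_unique[OF xi(3) d[OF xi(1,2)]] .
    then have "\<bar>l\<bar> \<le> \<delta>" using P(2)[of \<xi>] xi t by force
    then have "t * \<bar>l\<bar> \<le> (R + 1) * \<delta>" using t \<delta> R by (intro mult_mono) auto
    then show ?thesis using xi(4) Q(3) t0 by (simp add: abs_mult mult.commute)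
  qed
  have b1: "\<bar>f t - Q t * ?c t\<bar> \<le> \<epsilon>" and b2: "\<bar>f' t - (P t * ?c t + Q t * ?c' t)\<bar> \<le> \<epsilon>" if "0 \<le> t" for t
  proof -
    show "\<bar>f t - Q t * ?c t\<bar> \<le> \<epsilon>"
    proof (cases "t < R + 1")
      case True
      then have "f t = g t * ?c t" using cutoff_props(1)[OF True] by (simp add: g_def)
      then have "\<bar>f t - Q t * ?c t\<bar> = \<bar>g t - Q t\<bar> * \<bar>?c t\<bar>" by (simp add: algebra_simps flip: abs_mult)
      also have "\<dots> \<le> (\<delta> * (R + 1)) * M" using gQ[of t] M[of t] that True M0 \<delta> R by (intro mult_mono) auto
      also have "\<dots> \<le> \<delta> * (R + 2) * M" using \<delta> M0 R by (intro mult_right_mono) auto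
      also have "\<dots> = \<epsilon>" using M0 R by (simp add: \<delta>_def)
      finally show ?thesis .
    qed (use z(1)[of t] cutoff_props(2)[of R t] \<epsilon> in auto)
    show "\<bar>f' t - (P t * ?c t + Q t * ?c' t)\<bar> \<le> \<epsilon>"
    proof (cases "t < R + 1")
      case True
      then have "f' t = G t * ?c t + g t * ?c' t" using cutoff_props(1)[OF True] by (simp add: g_def G_def field_simps)
      then have "\<bar>f' t - (P t * ?c t + Q t * ?c' t)\<bar> = \<bar>(G t - P t) * ?c t + (g t - Q t) * ?c' t\<bar>" by (simp add: algebra_simps)
      also have "\<dots> \<le> \<bar>G t - P t\<bar> * \<bar>?c t\<bar> + \<bar>g t - Q t\<bar> * \<bar>?c' t\<bar>" by (simp add: abs_triangle_ineq flip: abs_mult)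
      also have "\<dots> \<le> \<delta> * M + (\<delta> * (R + 1)) * M" using gQ[of t] P(2)[of t] M[of t] that True M0 \<delta> R
        by (intro add_mono mult_mono) auto
      also have "\<dots> = \<delta> * (M * (R + 2))" by (simp add: algebra_simps)
      also have "\<dots> = \<epsilon>" using M0 R by (simp add: \<delta>_def)
      finally show ?thesis .
    qed (use z(2)[of t] cutoff_props(2,3)[of R t] \<epsilon> in auto)
  qed
  show thesis using that[OF Q(1,2) polynomial_continuous[OF P(1)] b1 b2] by blast
qed

lemma sector_norm_bound:
  assumes c: "cmod c = 1" and cc: "ccont \<alpha>" "ccont \<beta>" and R: "0 \<le> R" "\<And>t. t \<ge> R \<Longrightarrow> \<alpha> t = 0" "\<And>t. t \<ge> R \<Longrightarrow> \<beta> t = 0"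
    and \<epsilon>: "\<epsilon> \<ge> 0" "\<And>t. 0 \<le> t \<Longrightarrow> t \<le> R \<Longrightarrow> \<bar>\<alpha> t\<bar> \<le> \<epsilon>" "\<And>t. 0 \<le> t \<Longrightarrow> t \<le> R \<Longrightarrow> \<bar>\<beta> t\<bar> \<le> \<epsilon>"
  shows "norm (cls (sector c s k \<alpha> \<beta>)) \<le> sqrt (pi * (R * (R ^ k + R ^ (k + 1)))) * \<epsilon>"
proof -
  let ?f = "\<lambda>t. t ^ k * (\<alpha> t)\<^sup>2 + t ^ (k + 1) * (\<beta> t)\<^sup>2"
  have fc: "ccont ?f" using cc by (intro ccont_add ccont_mult ccont_power2 continuous_intros)
  have "integral {0..} ?f = integral {0..R} ?f" using R by (intro ccont_integral_eq[OF fc]) auto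
  also have "\<dots> \<le> integral {0..R} (\<lambda>t. (R ^ k + R ^ (k + 1)) * \<epsilon>\<^sup>2)"
  proof (rule integral_le)
    show "?f integrable_on {0..R}"
      by (intro integrable_continuous_interval continuous_on_subset[OF ccontD[OF fc]]) auto
    fix t assume t: "t \<in> {0..R}"
    have "(\<alpha> t)\<^sup>2 \<le> \<epsilon>\<^sup>2" "(\<beta> t)\<^sup>2 \<le> \<epsilon>\<^sup>2" using \<epsilon>(2)[of t] \<epsilon>(3)[of t] t
      by (metis abs_le_square_iff abs_of_nonneg \<epsilon>(1) atLeastAtMost_iff)+
    moreover have "t ^ k \<le> R ^ k" "t ^ (k + 1) \<le> R ^ (k + 1)" using t by (intro power_mono; simp)+
    ultimately have "?f t \<le> R ^ k * \<epsilon>\<^sup>2 + R ^ (k + 1) * \<epsilon>\<^sup>2" using t R by (intro add_mono mult_mono) auto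
    then show "?f t \<le> (R ^ k + R ^ (k + 1)) * \<epsilon>\<^sup>2" by (simp add: algebra_simps)
  qed auto
  also have "\<dots> = R * (R ^ k + R ^ (k + 1)) * \<epsilon>\<^sup>2" using R by (simp add: algebra_simps)
  finally have "(norm (cls (sector c s k \<alpha> \<beta>)))\<^sup>2 \<le> pi * (R * (R ^ k + R ^ (k + 1)) * \<epsilon>\<^sup>2)"
    using sector_l2(2)[OF c cc] by simp
  also have "\<dots> = (sqrt (pi * (R * (R ^ k + R ^ (k + 1)))) * \<epsilon>)\<^sup>2" using R by (simp add: power_mult_distrib)
  finally show ?thesis by (rule power2_le_imp_le) (use R \<epsilon> in auto)
qed

lemma tendsto_of_norm_le_inverse:
  fixes X :: "nat \<Rightarrow> 'a::real_normed_vector"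
  assumes "\<And>n. norm (x - X n) \<le> K * inverse (real (Suc n))"
  shows "X \<longlonglongrightarrow> x"
proof -
  have "(\<lambda>n. K * inverse (real (Suc n))) \<longlonglongrightarrow> K * 0" by (intro tendsto_intros LIMSEQ_inverse_real_of_nat)
  then have 0: "(\<lambda>n. K * inverse (real (Suc n))) \<longlonglongrightarrow> 0" by simp
  have "\<forall>\<^sub>F n in sequentially. norm (X n - x) \<le> K * inverse (real (Suc n))"
    using assms by (simp only: norm_minus_commute) simp
  from Lim_null_comparison[OF this 0] show ?thesis by (rule LIM_zero_cancel)
qed

lemma field_strength_bounds: "\<gamma> > 0 \<Longrightarrow> t \<ge> 0 \<Longrightarrow> 0 < field_strength \<gamma> t \<and> field_strength \<gamma> t \<le> 1"
proof -
  assume a: "\<gamma> > 0" "t \<ge> 0"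
  then have "1 + sqrt t > 0" by (simp add: add_pos_nonneg)
  then show ?thesis using powr_mono[of "- \<gamma>" 0 "1 + sqrt t"] a by (simp add: field_strength_def)
qed

lemma ccont_sector_dirac1: "ccont \<beta> \<Longrightarrow> ccont \<beta>' \<Longrightarrow> ccont (sector_dirac1 \<gamma> s k \<beta> \<beta>')"
  unfolding sector_dirac1_def[abs_def]
  by (intro ccont_diff ccont_mult[OF continuous_on_const] ccont_add ccont_mult continuous_intros continuous_on_field_strength)

lemma ccont_sector_dirac2: "ccont \<alpha> \<Longrightarrow> ccont \<alpha>' \<Longrightarrow> ccont (sector_dirac2 \<gamma> s \<alpha> \<alpha>')"
  unfolding sector_dirac2_def[abs_def]
  by (intro ccont_diff ccont_mult continuous_intros continuous_on_field_strength)

context magnetic_dirac_setting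
begin

abbreviation "\<T> \<equiv> closure (cls_graph dirac_graph)"

abbreviation "sec s k \<alpha> \<beta> \<equiv> cls (sector c s k \<alpha> \<beta>)"

lemma sec_diff:
  assumes "ccont \<alpha>" "ccont \<beta>" "ccont \<alpha>'" "ccont \<beta>'"
  shows "sec s k \<alpha> \<beta> - sec s k \<alpha>' \<beta>' = sec s k (\<lambda>t. \<alpha> t - \<alpha>' t) (\<lambda>t. \<beta> t - \<beta>' t)"
  using assms by (simp add: cls_ops sector_l2 c sector_diff)

lemma sec_add:
  assumes "ccont \<alpha>" "ccont \<beta>" "ccont \<alpha>'" "ccont \<beta>'"
  shows "sec s k \<alpha> \<beta> + sec s k \<alpha>' \<beta>' = sec s k (\<lambda>t. \<alpha> t + \<alpha>' t) (\<lambda>t. \<beta> t + \<beta>' t)"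
  using assms by (simp add: cls_ops sector_l2 c sector_add)

lemma sec_scaleR:
  assumes "ccont \<alpha>" "ccont \<beta>"
  shows "r *\<^sub>R sec s k \<alpha> \<beta> = sec s k (\<lambda>t. r * \<alpha> t) (\<lambda>t. r * \<beta> t)"
  using assms by (simp add: cls_ops sector_l2 c sector_scaleR)

lemma sec_cong:
  assumes "\<And>t. t \<ge> 0 \<Longrightarrow> \<alpha> t = \<alpha>' t" "\<And>t. t \<ge> 0 \<Longrightarrow> \<beta> t = \<beta>' t"
  shows "sec s k \<alpha> \<beta> = sec s k \<alpha>' \<beta>'"
proof -
  have "sector c s k \<alpha> \<beta> = sector c s k \<alpha>' \<beta>'" using assms by (simp add: fun_eq_iff sector_def Let_def)
  then show ?thesis by simp
qed

lemma sec_norm: "ccont \<alpha> \<Longrightarrow> ccont \<beta> \<Longrightarrow>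
  (norm (sec s k \<alpha> \<beta>))\<^sup>2 = pi * integral {0..} (\<lambda>t. t ^ k * (\<alpha> t)\<^sup>2 + t ^ (k + 1) * (\<beta> t)\<^sup>2)"
  by (rule sector_l2(2)[OF c])

text \<open>Profiles of the form polynomial times cutoff give test spinors. By
  \<open>c1_poly_approx\<close> they converge uniformly together with their derivatives, all
  supports staying in \<open>t <= R + 1\<close>, so the fields and their images under the operator
  converge in norm.\<close>

lemma sector_mem_closure:
  assumes \<alpha>: "c1 \<alpha> \<alpha>'" and \<beta>: "c1 \<beta> \<beta>'"
  shows "(sec s k \<alpha> \<beta>, sec s k (sector_dirac1 \<gamma> s k \<beta> \<beta>') (sector_dirac2 \<gamma> s \<alpha> \<alpha>')) \<in> \<T>"
proof -
  obtain R1 R2 where R12: "R1 > 0" "\<And>t. t \<ge> R1 \<Longrightarrow> \<alpha> t = 0" "\<And>t. t \<ge> R1 \<Longrightarrow> \<alpha>' t = 0"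
      "R2 > 0" "\<And>t. t \<ge> R2 \<Longrightarrow> \<beta> t = 0" "\<And>t. t \<ge> R2 \<Longrightarrow> \<beta>' t = 0"
    using c1_bound[OF \<alpha>] c1_bound[OF \<beta>] by metis
  define R where "R = max R1 R2"
  have R: "R \<ge> 0" "\<And>t. t \<ge> R \<Longrightarrow> \<alpha> t = 0" "\<And>t. t \<ge> R \<Longrightarrow> \<alpha>' t = 0" "\<And>t. t \<ge> R \<Longrightarrow> \<beta> t = 0" "\<And>t. t \<ge> R \<Longrightarrow> \<beta>' t = 0"
    using R12 by (auto simp: R_def)
  define \<epsilon> where "\<epsilon> n = inverse (real (Suc n))" for n
  have \<epsilon>: "\<epsilon> n > 0" for n by (simp add: \<epsilon>_def)
  have "\<forall>n. \<exists>q q'. real_polynomial_function q \<and> (\<forall>t. (q has_real_derivative q' t) (at t)) \<and> continuous_on UNIV q' \<and>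
      (\<forall>t\<ge>0. \<bar>\<alpha> t - q t * cutoff R t\<bar> \<le> \<epsilon> n) \<and> (\<forall>t\<ge>0. \<bar>\<alpha>' t - (q' t * cutoff R t + q t * cutoff' R t)\<bar> \<le> \<epsilon> n)"
    using c1_poly_approx[OF \<alpha> R(2,3,1) \<epsilon>] by metis
  then obtain q q' where q: "\<And>n. real_polynomial_function (q n)" "\<And>n t. (q n has_real_derivative q' n t) (at t)" "\<And>n. continuous_on UNIV (q' n)"
      "\<And>n t. t \<ge> 0 \<Longrightarrow> \<bar>\<alpha> t - q n t * cutoff R t\<bar> \<le> \<epsilon> n"
      "\<And>n t. t \<ge> 0 \<Longrightarrow> \<bar>\<alpha>' t - (q' n t * cutoff R t + q n t * cutoff' R t)\<bar> \<le> \<epsilon> n" by metis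
  have "\<forall>n. \<exists>q q'. real_polynomial_function q \<and> (\<forall>t. (q has_real_derivative q' t) (at t)) \<and> continuous_on UNIV q' \<and>
      (\<forall>t\<ge>0. \<bar>\<beta> t - q t * cutoff R t\<bar> \<le> \<epsilon> n) \<and> (\<forall>t\<ge>0. \<bar>\<beta>' t - (q' t * cutoff R t + q t * cutoff' R t)\<bar> \<le> \<epsilon> n)"
    using c1_poly_approx[OF \<beta> R(4,5,1) \<epsilon>] by metis
  then obtain r r' where r: "\<And>n. real_polynomial_function (r n)" "\<And>n t. (r n has_real_derivative r' n t) (at t)" "\<And>n. continuous_on UNIV (r' n)"
      "\<And>n t. t \<ge> 0 \<Longrightarrow> \<bar>\<beta> t - r n t * cutoff R t\<bar> \<le> \<epsilon> n"
      "\<And>n t. t \<ge> 0 \<Longrightarrow> \<bar>\<beta>' t - (r' n t * cutoff R t + r n t * cutoff' R t)\<bar> \<le> \<epsilon> n" by metis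
  define \<alpha>n \<alpha>n' \<beta>n \<beta>n' where "\<alpha>n n t = q n t * cutoff R t" and "\<alpha>n' n t = q' n t * cutoff R t + q n t * cutoff' R t"
    and "\<beta>n n t = r n t * cutoff R t" and "\<beta>n' n t = r' n t * cutoff R t + r n t * cutoff' R t" for n t
  have c1n: "c1 (\<alpha>n n) (\<alpha>n' n)" "c1 (\<beta>n n) (\<beta>n' n)" for n
    unfolding \<alpha>n_def[abs_def] \<alpha>n'_def[abs_def] \<beta>n_def[abs_def] \<beta>n'_def[abs_def] by (intro c1_poly_cutoff q r)+
  have dn: "(\<alpha>n n has_real_derivative \<alpha>n' n t) (at t)" "(\<beta>n n has_real_derivative \<beta>n' n t) (at t)" for n t
    unfolding \<alpha>n_def[abs_def] \<alpha>n'_def \<beta>n_def[abs_def] \<beta>n'_def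
    using DERIV_mult[OF q(2)[of n t] cutoff_deriv[of R t UNIV]] DERIV_mult[OF r(2)[of n t] cutoff_deriv[of R t UNIV]]
    by (simp_all add: add.commute mult.commute)
  have test: "sector c s k (\<alpha>n n) (\<beta>n n) \<in> test_spinors" for n
    unfolding \<alpha>n_def[abs_def] \<beta>n_def[abs_def] cutoff_def by (rule sector_test_spinor[OF q(1) r(1)])
  define d1 d2 where "d1 = sector_dirac1 \<gamma> s k \<beta> \<beta>'" and "d2 = sector_dirac2 \<gamma> s \<alpha> \<alpha>'"
  define d1n d2n where "d1n n = sector_dirac1 \<gamma> s k (\<beta>n n) (\<beta>n' n)" and "d2n n = sector_dirac2 \<gamma> s (\<alpha>n n) (\<alpha>n' n)" for n
  have D: "magnetic_dirac e A (sector c s k (\<alpha>n n) (\<beta>n n)) = sector c s k (d1n n) (d2n n)" for n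
    unfolding d1n_def d2n_def by (rule ext, rule magnetic_dirac_sector) (rule dn)+
  have memn: "(sec s k (\<alpha>n n) (\<beta>n n), sec s k (d1n n) (d2n n)) \<in> cls_graph dirac_graph" for n
    unfolding mem_cls_graph_dirac using test[of n] D[of n] by auto
  note cc = c1D(2,3)[OF \<alpha>] c1D(2,3)[OF \<beta>] c1D(2,3)[OF c1n(1)] c1D(2,3)[OF c1n(2)]
  have ccd: "ccont d1" "ccont d2" "ccont (d1n n)" "ccont (d2n n)" for n
    unfolding d1_def d2_def d1n_def d2n_def by (intro ccont_sector_dirac1 ccont_sector_dirac2 cc)+
  have z: "\<alpha>n n t = 0" "\<beta>n n t = 0" "\<alpha>n' n t = 0" "\<beta>n' n t = 0" if "t \<ge> R + 1" for n t
    using cutoff_props[of R t] that by (auto simp: \<alpha>n_def \<beta>n_def \<alpha>n'_def \<beta>n'_def)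
  \<comment> \<open>\<open>K\<close> turns a uniform bound on \<open>t <= R + 1\<close> into a norm
    bound. \<open>K'\<close> bounds the coefficients there: \<open>2 (k + 1)\<close> for
    \<open>\<beta>\<close>, three times \<open>R + 1\<close> for the terms carrying
    \<open>t\<close>, and the final 3 for \<open>sector_dirac2\<close>.\<close>
  define K where "K = sqrt (pi * ((R + 1) * ((R + 1) ^ k + (R + 1) ^ (k + 1))))"
  define K' where "K' = 2 * (real k + 1) + 3 * (R + 1) + 3"
  have ab: "\<bar>\<alpha> t - \<alpha>n n t\<bar> \<le> \<epsilon> n" "\<bar>\<beta> t - \<beta>n n t\<bar> \<le> \<epsilon> n" "\<bar>\<alpha>' t - \<alpha>n' n t\<bar> \<le> \<epsilon> n" "\<bar>\<beta>' t - \<beta>n' n t\<bar> \<le> \<epsilon> n"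
    if "t \<ge> 0" for n t
    using q(4,5)[OF that] r(4,5)[OF that] by (simp_all add: \<alpha>n_def \<beta>n_def \<alpha>n'_def \<beta>n'_def)
  have sg: "\<bar>sgn_sector s\<bar> = 1" by (simp add: sgn_sector_def)
  have db: "\<bar>d1 t - d1n n t\<bar> \<le> K' * \<epsilon> n" "\<bar>d2 t - d2n n t\<bar> \<le> K' * \<epsilon> n" if t: "t \<ge> 0" "t \<le> R + 1" for n t
  proof -
    let ?a = "field_strength \<gamma> t"
    have a: "0 \<le> ?a" "?a \<le> 1" using field_strength_bounds[OF \<gamma>(1) t(1)] by auto
    have tri: "\<bar>- sgn_sector s * x - y\<bar> \<le> \<bar>x\<bar> + \<bar>y\<bar>" for x y
      using abs_triangle_ineq4[of "- sgn_sector s * x" y] sg by (simp add: abs_mult)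
    have "d1 t - d1n n t = - sgn_sector s * (2 * (real k + 1) * (\<beta> t - \<beta>n n t) + 2 * t * (\<beta>' t - \<beta>n' n t)) - ?a * t * (\<beta> t - \<beta>n n t)"
      by (simp add: d1_def d1n_def sector_dirac1_def algebra_simps)
    also have "\<bar>\<dots>\<bar> \<le> \<bar>2 * (real k + 1) * (\<beta> t - \<beta>n n t) + 2 * t * (\<beta>' t - \<beta>n' n t)\<bar> + \<bar>?a * t * (\<beta> t - \<beta>n n t)\<bar>"
      by (rule tri)
    also have "\<dots> \<le> 2 * (real k + 1) * \<bar>\<beta> t - \<beta>n n t\<bar> + 2 * t * \<bar>\<beta>' t - \<beta>n' n t\<bar> + ?a * t * \<bar>\<beta> t - \<beta>n n t\<bar>"
      using abs_triangle_ineq[of "2 * (real k + 1) * (\<beta> t - \<beta>n n t)" "2 * t * (\<beta>' t - \<beta>n' n t)"] t a by (simp add: abs_mult)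
    also have "\<dots> \<le> 2 * (real k + 1) * \<epsilon> n + 2 * (R + 1) * \<epsilon> n + (1 * (R + 1)) * \<epsilon> n"
      using ab[OF t(1), of n] t a R(1) by (intro add_mono mult_mono) auto
    also have "\<dots> \<le> K' * \<epsilon> n" using \<epsilon>[of n] by (simp add: K'_def algebra_simps)
    finally show "\<bar>d1 t - d1n n t\<bar> \<le> K' * \<epsilon> n" .
    have tri2: "\<bar>sgn_sector s * (2 * x) - ?a * y\<bar> \<le> 2 * \<bar>x\<bar> + ?a * \<bar>y\<bar>" for x y
      using abs_triangle_ineq4[of "sgn_sector s * (2 * x)" "?a * y"] sg a by (simp add: abs_mult)
    have "d2 t - d2n n t = sgn_sector s * (2 * (\<alpha>' t - \<alpha>n' n t)) - ?a * (\<alpha> t - \<alpha>n n t)"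
      by (simp add: d2_def d2n_def sector_dirac2_def algebra_simps)
    also have "\<bar>\<dots>\<bar> \<le> 2 * \<bar>\<alpha>' t - \<alpha>n' n t\<bar> + ?a * \<bar>\<alpha> t - \<alpha>n n t\<bar>"
      by (rule tri2)
    also have "\<dots> \<le> 2 * \<epsilon> n + 1 * \<epsilon> n" using ab[OF t(1), of n] a by (intro add_mono mult_mono) auto
    also have "\<dots> \<le> K' * \<epsilon> n"
    proof -
      have "3 \<le> K'" using R by (simp add: K'_def)
      then have "3 * \<epsilon> n \<le> K' * \<epsilon> n" using \<epsilon>[of n] by (intro mult_right_mono) auto
      then show ?thesis by simp
    qed
    finally show "\<bar>d2 t - d2n n t\<bar> \<le> K' * \<epsilon> n" .
  qed
  have "(\<lambda>n. sec s k (\<alpha>n n) (\<beta>n n)) \<longlonglongrightarrow> sec s k \<alpha> \<beta>"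
  proof (rule tendsto_of_norm_le_inverse)
    fix n
    show "norm (sec s k \<alpha> \<beta> - sec s k (\<alpha>n n) (\<beta>n n)) \<le> K * inverse (real (Suc n))"
      unfolding sec_diff[OF cc(1,3,5,7)] K_def \<epsilon>_def[symmetric]
      using R \<epsilon>[of n] ab z by (intro sector_norm_bound[OF c] ccont_diff cc) (auto intro: less_imp_le)
  qed
  moreover have "(\<lambda>n. sec s k (d1n n) (d2n n)) \<longlonglongrightarrow> sec s k d1 d2"
  proof (rule tendsto_of_norm_le_inverse)
    fix n
    have z': "d1 t - d1n n t = 0" "d2 t - d2n n t = 0" if "t \<ge> R + 1" for t
      using z[OF that, of n] R(2-5)[of t] that by (auto simp: d1_def d1n_def d2_def d2n_def sector_dirac1_def sector_dirac2_def)
    have "norm (sec s k d1 d2 - sec s k (d1n n) (d2n n)) \<le> K * (K' * \<epsilon> n)"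
      unfolding sec_diff[OF ccd] K_def
      using R \<epsilon>[of n] db z' by (intro sector_norm_bound[OF c] ccont_diff ccd) (auto simp: K'_def)
    then show "norm (sec s k d1 d2 - sec s k (d1n n) (d2n n)) \<le> (K * K') * inverse (real (Suc n))"
      by (simp add: \<epsilon>_def mult.assoc)
  qed
  ultimately have "(\<lambda>n. (sec s k (\<alpha>n n) (\<beta>n n), sec s k (d1n n) (d2n n))) \<longlonglongrightarrow> (sec s k \<alpha> \<beta>, sec s k d1 d2)"
    by (rule tendsto_Pair)
  then show ?thesis using memn unfolding closure_sequential d1_def[symmetric] d2_def[symmetric]
    by (intro exI[of _ "\<lambda>n. (sec s k (\<alpha>n n) (\<beta>n n), sec s k (d1n n) (d2n n))"] conjI allI)
qed

end

section \<open>The range of the Dirac operator in a sector\<close>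

lemma integral_has_real_derivative_atLeast:
  fixes f :: "real \<Rightarrow> real"
  assumes f: "continuous_on {0..} f" and t: "t \<ge> 0"
  shows "((\<lambda>u. integral {0..u} f) has_real_derivative f t) (at t within {0..})"
proof -
  have "((\<lambda>u. integral {0..u} f) has_real_derivative f t) (at t within {0..t + 1})"
    using t by (intro integral_has_real_derivative continuous_on_subset[OF f]) auto
  moreover have "at t within {0..t + 1} = at t within {0..}"
    using t by (intro at_within_nhd[of t "{..<t + 1}"]) auto
  ultimately show ?thesis by simp
qed

lemma continuous_on_of_derivative:
  fixes f :: "real \<Rightarrow> real"
  assumes "\<And>t. t \<ge> 0 \<Longrightarrow> (f has_real_derivative f' t) (at t within {0..})"
  shows "continuous_on {0..} f"
  by (rule DERIV_continuous_on[of _ _ f']) (use assms in auto)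

lemma integral_zero_on_interval:
  fixes f :: "real \<Rightarrow> real"
  assumes "\<And>u. a \<le> u \<Longrightarrow> u \<le> b \<Longrightarrow> f u = 0"
  shows "integral {a..b} f = 0"
  using integral_cong[of "{a..b}" f "\<lambda>_. 0"] assms by simp

lemma integral_initial_eq:
  fixes f :: "real \<Rightarrow> real"
  assumes f: "continuous_on {0..} f" and R: "0 \<le> R" "R \<le> t" and z: "\<And>u. u \<ge> R \<Longrightarrow> f u = 0"
  shows "integral {0..t} f = integral {0..R} f"
proof -
  have "integral {0..R} f + integral {R..t} f = integral {0..t} f"
    using R by (intro Henstock_Kurzweil_Integration.integral_combine integrable_continuous_interval continuous_on_subset[OF f]) auto
  moreover have "integral {R..t} f = 0" by (rule integral_zero_on_interval) (use z in auto)
  ultimately show ?thesis by simp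
qed

text \<open>Compactly supported sources, moved to infinity to show that the solvability condition of
  the first-order equation for \<open>\<beta>\<close> is not an obstruction in the closure.\<close>

definition tent :: "nat \<Rightarrow> real \<Rightarrow> real" where
  "tent n t = max 0 (1 - \<bar>t - (real n + 1)\<bar>)"

lemma tent_props:
  "ccont (tent n)" "0 \<le> tent n t" "tent n t \<le> 1" "t \<le> real n \<Longrightarrow> tent n t = 0" "t \<ge> real n + 2 \<Longrightarrow> tent n t = 0"
  "real n + 1/2 \<le> t \<Longrightarrow> t \<le> real n + 3/2 \<Longrightarrow> tent n t \<ge> 1/2"
proof -
  have "continuous_on {0..} (tent n)" unfolding tent_def[abs_def] by (intro continuous_intros)
  moreover have z: "tent n t = 0" if "t \<ge> real n + 2" for t using that by (auto simp: tent_def)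
  ultimately show "ccont (tent n)" unfolding ccont_def by blast
  show "t \<ge> real n + 2 \<Longrightarrow> tent n t = 0" by (rule z)
qed (auto simp: tent_def abs_if)

context magnetic_dirac_setting
begin

section \<open>Integrating factors and solutions of the radial equations\<close>

text \<open>As a radial function on the plane, in \<open>t = |p|^2\<close>, its Laplacian is the
  magnetic field away from the origin; the factors \<open>exp H\<close> and \<open>exp (- H)\<close>
  are those of Aharonov and Casher, which turn zero modes into holomorphic or antiholomorphic
  functions.\<close>

definition H :: "real \<Rightarrow> real" where
  "H t = integral {0..t} (\<lambda>u. field_strength \<gamma> u / 2)"

lemma H_deriv: "t \<ge> 0 \<Longrightarrow> (H has_real_derivative field_strength \<gamma> t / 2) (at t within {0..})"
  unfolding H_def[abs_def]
  by (intro integral_has_real_derivative_atLeast continuous_intros continuous_on_field_strength) auto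

lemma continuous_on_H: "continuous_on {0..} H"
  using H_deriv by (rule continuous_on_of_derivative)

lemma H_mono:
  assumes "0 \<le> t" "t \<le> u"
  shows "H t \<le> H u"
  unfolding H_def
proof (rule integral_subset_le)
  show "(\<lambda>u. field_strength \<gamma> u / 2) integrable_on {0..t}" "(\<lambda>u. field_strength \<gamma> u / 2) integrable_on {0..u}"
    by (intro integrable_continuous_interval continuous_intros continuous_on_subset[OF continuous_on_field_strength]; force)+
qed (use assms field_strength_bounds[OF \<gamma>(1)] in \<open>auto intro: less_imp_le\<close>)

text \<open>Since \<open>\<gamma> < 1\<close>, \<open>field_strength \<gamma> u\<close> is at least
  \<open>1 / (1 + sqrt u)\<close>. This crude growth of \<open>H\<close> already makes
  \<open>exp H\<close> beat every polynomial.\<close>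

lemma H_ge: "n \<ge> 1 \<Longrightarrow> H (real n) \<ge> sqrt (real n) / 4"
proof -
  assume n: "n \<ge> 1"
  have "integral {0..real n} (\<lambda>u. 1 / (2 * (1 + sqrt (real n)))) \<le> H (real n)"
    unfolding H_def
  proof (rule integral_le)
    show "(\<lambda>u. field_strength \<gamma> u / 2) integrable_on {0..real n}"
      by (intro integrable_continuous_interval continuous_intros continuous_on_subset[OF continuous_on_field_strength]) auto
    fix u assume u: "u \<in> {0..real n}"
    then have "1 + sqrt u \<le> 1 + sqrt (real n)" and "1 + sqrt u \<ge> 1" by auto
    moreover have "(1 + sqrt u) powr \<gamma> \<le> 1 + sqrt u"
      using powr_mono[of \<gamma> 1 "1 + sqrt u"] \<gamma> \<open>1 + sqrt u \<ge> 1\<close>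
      by (metis less_eq_real_def powr_one zero_le_one order_trans)
    ultimately have "(1 + sqrt u) powr \<gamma> \<le> 1 + sqrt (real n)" by linarith
    then have "inverse (1 + sqrt (real n)) \<le> inverse ((1 + sqrt u) powr \<gamma>)"
      using \<open>1 + sqrt u \<ge> 1\<close> by (intro le_imp_inverse_le) (metis powr_gt_zero not_one_le_zero)+
    moreover have "1 / (2 * (1 + sqrt (real n))) = inverse (1 + sqrt (real n)) / 2"
      by (simp only: divide_inverse inverse_mult_distrib mult_1_left mult.commute)
    ultimately show "1 / (2 * (1 + sqrt (real n))) \<le> field_strength \<gamma> u / 2"
      by (simp add: field_strength_def powr_minus)
  qed auto
  moreover have "sqrt (real n) / 4 \<le> real n / (2 * (1 + sqrt (real n)))"
  proof -
    have "sqrt (real n) \<ge> 1" using n by simp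
    then have "sqrt (real n) \<le> real n"
      using mult_left_mono[of 1 "sqrt (real n)" "sqrt (real n)"] by simp
    moreover have "sqrt (real n) * (2 * (1 + sqrt (real n))) = 2 * sqrt (real n) + 2 * (sqrt (real n) * sqrt (real n))"
      by (simp only: distrib_left mult_ac mult_1_right)
    moreover have "sqrt (real n) * sqrt (real n) = real n" by simp
    ultimately have "sqrt (real n) * (2 * (1 + sqrt (real n))) \<le> 4 * real n" by linarith
    moreover have "1 + sqrt (real n) > 0" by (simp add: add_pos_nonneg)
    ultimately show ?thesis by (simp add: field_simps)
  qed
  moreover have "integral {0..real n} (\<lambda>u. 1 / (2 * (1 + sqrt (real n)))) = real n / (2 * (1 + sqrt (real n)))"
    by simp
  ultimately show ?thesis by linarith
qed

lemma polynomial_times_exp_H: "(\<lambda>n. (real n + 2) ^ j * exp (- H (real n))) \<longlonglongrightarrow> 0"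
proof -
  let ?x = "\<lambda>n::nat. sqrt (real n) / 4"
  have "filterlim (\<lambda>n::nat. (1/4) * sqrt (real n)) at_top sequentially"
    by (intro filterlim_tendsto_pos_mult_at_top[OF tendsto_const]
        filterlim_compose[OF sqrt_at_top filterlim_real_sequentially]) simp
  then have "filterlim ?x at_top sequentially" by simp
  from filterlim_compose[OF tendsto_power_div_exp_0 this]
  have "(\<lambda>n. ?x n ^ (2 * j) / exp (?x n)) \<longlonglongrightarrow> 0" by simp
  then have "(\<lambda>n. 48 ^ j * (?x n ^ (2 * j) / exp (?x n))) \<longlonglongrightarrow> 48 ^ j * 0" by (intro tendsto_intros)
  then have lim: "(\<lambda>n. 48 ^ j * (?x n ^ (2 * j) / exp (?x n))) \<longlonglongrightarrow> 0" by simp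
  have "norm ((real n + 2) ^ j * exp (- H (real n))) \<le> 48 ^ j * (?x n ^ (2 * j) / exp (?x n))" if n: "n \<ge> 1" for n
  proof -
    \<comment> \<open>The right-hand side equals \<open>3 n\<close>, because \<open>?x n\<close>
      squared is \<open>n / 16\<close>.\<close>
    have "(real n + 2) \<le> 48 * (?x n)\<^sup>2" using n by (simp add: power_divide)
    then have "(real n + 2) ^ j \<le> (48 * (?x n)\<^sup>2) ^ j" by (intro power_mono) auto
    then have 1: "(real n + 2) ^ j \<le> 48 ^ j * ?x n ^ (2 * j)" by (simp add: power_mult_distrib power_mult)
    have "exp (- H (real n)) \<le> exp (- ?x n)" using H_ge[OF n] by simp
    with 1 have "(real n + 2) ^ j * exp (- H (real n)) \<le> (48 ^ j * ?x n ^ (2 * j)) * exp (- ?x n)"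
      by (intro mult_mono) auto
    moreover have "(48 ^ j * ?x n ^ (2 * j)) * exp (- ?x n) = 48 ^ j * (?x n ^ (2 * j) / exp (?x n))"
      by (simp only: exp_minus divide_inverse mult.assoc)
    moreover have "norm ((real n + 2) ^ j * exp (- H (real n))) = (real n + 2) ^ j * exp (- H (real n))"
      by (simp only: real_norm_def, rule abs_of_nonneg) auto
    ultimately show ?thesis by simp
  qed
  then have "\<forall>\<^sub>F n in sequentially. norm ((real n + 2) ^ j * exp (- H (real n))) \<le> 48 ^ j * (?x n ^ (2 * j) / exp (?x n))"
    by (intro eventually_sequentiallyI[of 1])
  from Lim_null_comparison[OF this lim] show ?thesis .
qed

lemma sgn_sector_square: "sgn_sector s * sgn_sector s = 1" "sgn_sector s * (sgn_sector s * x) = x"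
  by (simp_all add: sgn_sector_def)

lemma H_exp_deriv:
  assumes "t \<ge> 0"
  shows "((\<lambda>t. exp (\<sigma> * H t)) has_real_derivative \<sigma> * (field_strength \<gamma> t / 2) * exp (\<sigma> * H t)) (at t within {0..})"
  using H_deriv[OF assms] by (auto intro!: derivative_eq_intros)

lemma continuous_on_exp_H: "continuous_on {0..} (\<lambda>t. exp (\<sigma> * H t))"
  by (intro continuous_intros continuous_on_H)

text \<open>The equation says that \<open>exp (- \<sigma> H) \<alpha>\<close> has derivative
  \<open>\<sigma> / 2 * exp (- \<sigma> H) G\<close>. Subtracting \<open>w R\<close> makes the
  solution vanish beyond the support of \<open>G\<close>, and nothing is demanded at 0, so every
  source is attained. The solution is displayed explicitly because the approximation of the zero
  mode evaluates it.\<close>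

lemma sector_dirac2_solve:
  fixes s :: bool
  assumes G: "ccont G" and R: "R \<ge> 0" "\<And>t. t \<ge> R \<Longrightarrow> G t = 0"
  defines "\<sigma> \<equiv> sgn_sector s"
  defines "w \<equiv> \<lambda>t. integral {0..t} (\<lambda>u. \<sigma> / 2 * (exp (- \<sigma> * H u) * G u))"
  shows "\<exists>\<alpha>'. c1 (\<lambda>t. exp (\<sigma> * H t) * (w t - w R)) \<alpha>' \<and>
    (\<forall>t\<ge>0. sector_dirac2 \<gamma> s (\<lambda>t. exp (\<sigma> * H t) * (w t - w R)) \<alpha>' t = G t)"
proof -
  have ss: "\<sigma> * \<sigma> = 1" "\<sigma> * (\<sigma> * x) = x" for x by (simp_all add: \<sigma>_def sgn_sector_square)
  let ?g = "\<lambda>u. \<sigma> / 2 * (exp (- \<sigma> * H u) * G u)"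
  define \<alpha> where "\<alpha> t = exp (\<sigma> * H t) * (w t - w R)" for t
  define \<alpha>' where "\<alpha>' t = \<sigma> / 2 * G t + \<sigma> * (field_strength \<gamma> t / 2) * \<alpha> t" for t
  have gc: "continuous_on {0..} ?g" by (intro continuous_intros continuous_on_exp_H ccontD[OF G])
  have wd: "(w has_real_derivative ?g t) (at t within {0..})" if "t \<ge> 0" for t
    unfolding w_def by (rule integral_has_real_derivative_atLeast[OF gc that])
  have "(\<alpha> has_real_derivative \<alpha>' t) (at t within {0..})" if "t \<ge> 0" for t
  proof -
    have "((\<lambda>t. exp (\<sigma> * H t) * (w t - w R)) has_real_derivative
       \<sigma> * (field_strength \<gamma> t / 2) * exp (\<sigma> * H t) * (w t - w R) + (?g t - 0) * exp (\<sigma> * H t)) (at t within {0..})"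
      by (rule DERIV_mult[OF H_exp_deriv[OF that] DERIV_diff[OF wd[OF that] DERIV_const]])
    moreover have "\<sigma> * (field_strength \<gamma> t / 2) * exp (\<sigma> * H t) * (w t - w R) + (?g t - 0) * exp (\<sigma> * H t) = \<alpha>' t"
    proof -
      have "(?g t - 0) * exp (\<sigma> * H t) = \<sigma> / 2 * G t * (exp (- \<sigma> * H t) * exp (\<sigma> * H t))"
        by (simp only: diff_zero mult_ac)
      also have "exp (- \<sigma> * H t) * exp (\<sigma> * H t) = 1" by (simp flip: exp_add)
      finally have "(?g t - 0) * exp (\<sigma> * H t) = \<sigma> / 2 * G t * 1" .
      then show ?thesis by (simp only: \<alpha>'_def \<alpha>_def mult.assoc mult_1_right add.commute)
    qed
    ultimately show ?thesis by (simp add: \<alpha>_def[abs_def])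
  qed
  moreover have ca: "ccont \<alpha>" unfolding ccont_def
  proof
    show "continuous_on {0..} \<alpha>" by (rule continuous_on_of_derivative[of _ \<alpha>']) fact
    show "\<exists>R. \<forall>t\<ge>R. \<alpha> t = 0"
    proof (intro exI[of _ R] allI impI)
      fix t assume "t \<ge> R"
      then have "w t = w R" unfolding w_def by (intro integral_initial_eq[OF gc R(1)]) (auto simp: R)
      then show "\<alpha> t = 0" by (simp add: \<alpha>_def)
    qed
  qed
  moreover have "ccont \<alpha>'" unfolding \<alpha>'_def[abs_def]
    by (intro ccont_add ccont_mult ca G continuous_intros continuous_on_field_strength) auto
  ultimately have "c1 \<alpha> \<alpha>'" by (simp add: c1_def)
  moreover have "sector_dirac2 \<gamma> s \<alpha> \<alpha>' t = G t" for t
    unfolding sector_dirac2_def \<alpha>'_def \<sigma>_def[symmetric]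
    by (simp add: algebra_simps ss)
  ultimately show ?thesis unfolding \<alpha>_def[abs_def] by blast
qed

text \<open>The equation says that \<open>y = t^(k+1) exp (\<sigma> H) \<beta>\<close> has
  derivative \<open>- \<sigma> / 2 * t^k exp (\<sigma> H) F\<close>. Integrating from 0, the moment
  condition makes \<open>y\<close> vanish for large \<open>t\<close>; \<open>F\<close> being 0 up to
  \<open>\<delta>\<close> makes \<open>y\<close> vanish near 0, where it is divided by a power of
  \<open>t\<close>.\<close>

lemma sector_dirac1_solve:
  assumes F: "ccont F" and \<delta>: "\<delta> > 0" "\<And>t. 0 \<le> t \<Longrightarrow> t \<le> \<delta> \<Longrightarrow> F t = 0"
    and int: "integral {0..} (\<lambda>u. u ^ k * exp (sgn_sector s * H u) * F u) = 0"
  shows "\<exists>\<beta> \<beta>'. c1 \<beta> \<beta>' \<and> (\<forall>t\<ge>0. sector_dirac1 \<gamma> s k \<beta> \<beta>' t = F t)"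
proof -
  define \<sigma> where "\<sigma> = sgn_sector s"
  have ss: "\<sigma> * \<sigma> = 1" "\<sigma> * (\<sigma> * x) = x" for x by (simp_all add: \<sigma>_def sgn_sector_square)
  let ?g = "\<lambda>u. (- \<sigma> / 2) * (u ^ k * exp (\<sigma> * H u) * F u)"
  define y where "y t = integral {0..t} ?g" for t
  obtain R where R: "R > 0" "\<And>t. t \<ge> R \<Longrightarrow> F t = 0" using ccont_bound[OF F] by blast
  have cg0: "ccont (\<lambda>u. u ^ k * exp (\<sigma> * H u) * F u)" by (intro ccont_mult continuous_intros continuous_on_exp_H F)
  have gc: "continuous_on {0..} ?g" by (intro continuous_intros ccontD[OF cg0])
  have yd: "(y has_real_derivative ?g t) (at t within {0..})" if "t \<ge> 0" for t
    unfolding y_def[abs_def] by (rule integral_has_real_derivative_atLeast[OF gc that])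
  have cy: "continuous_on {0..} y" using yd by (rule continuous_on_of_derivative)
  have y0: "y t = 0" if "t \<le> \<delta>" for t
    unfolding y_def by (rule integral_zero_on_interval) (use \<delta> that in auto)
  have yR: "y t = 0" if "t \<ge> R" for t
  proof -
    have "integral {0..} (\<lambda>u. u ^ k * exp (\<sigma> * H u) * F u) = integral {0..t} (\<lambda>u. u ^ k * exp (\<sigma> * H u) * F u)"
      using R that by (intro ccont_integral_eq[OF cg0]) auto
    then have "integral {0..t} (\<lambda>u. u ^ k * exp (\<sigma> * H u) * F u) = 0" using int by (simp add: \<sigma>_def)
    then show ?thesis by (simp add: y_def)
  qed
  define \<beta> where "\<beta> t = y t * exp (- \<sigma> * H t) / t ^ (k + 1)" for t
  define \<beta>' where "\<beta>' t = (- \<sigma> / 2) * (F t / t) - \<sigma> * (field_strength \<gamma> t / 2) * \<beta> t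
      - (real k + 1) * (y t * exp (- \<sigma> * H t) / t ^ (k + 2))" for t
  have zero: "\<beta> t = 0" "\<beta>' t = 0" if "0 \<le> t" "t \<le> \<delta>" for t
    using that y0 \<delta>(2) by (auto simp: \<beta>_def \<beta>'_def)
  \<comment> \<open>For numerators that vanish up to \<open>\<delta>\<close>, the denominator
    \<open>t\<close> may be replaced by \<open>max \<delta> t\<close>, which is never 0, and
    continuity becomes evident.\<close>
  have mx: "N t / t ^ j = N t / max \<delta> t ^ j" if "t \<ge> 0" "\<And>u. 0 \<le> u \<Longrightarrow> u \<le> \<delta> \<Longrightarrow> N u = 0" for N :: "real \<Rightarrow> real" and j t
    using that by (cases "t \<le> \<delta>") auto
  have cb: "continuous_on {0..} \<beta>"
  proof -
    have "continuous_on {0..} (\<lambda>t. y t * exp (- \<sigma> * H t) / max \<delta> t ^ (k + 1))"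
      using \<delta> by (intro continuous_intros cy continuous_on_exp_H) auto
    then show ?thesis
      by (rule continuous_on_eq) (use mx[of _ "\<lambda>t. y t * exp (- \<sigma> * H t)" "k + 1"] y0 in \<open>auto simp: \<beta>_def\<close>)
  qed
  have cb': "continuous_on {0..} \<beta>'"
  proof -
    have "continuous_on {0..} (\<lambda>t. (- \<sigma> / 2) * (F t / max \<delta> t ^ 1) - \<sigma> * (field_strength \<gamma> t / 2) * \<beta> t
      - (real k + 1) * (y t * exp (- \<sigma> * H t) / max \<delta> t ^ (k + 2)))"
    proof -
      have 1: "continuous_on {0..} (\<lambda>t. F t / max \<delta> t ^ 1)"
        using \<delta> by (intro continuous_intros ccontD[OF F]) auto
      have 2: "continuous_on {0..} (\<lambda>t. y t * exp (- \<sigma> * H t) / max \<delta> t ^ (k + 2))"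
        using \<delta> by (intro continuous_intros cy continuous_on_exp_H) auto
      have 3: "continuous_on {0..} (\<lambda>t. field_strength \<gamma> t / 2)"
        by (intro continuous_intros continuous_on_field_strength) simp
      show ?thesis
        by (intro continuous_on_diff continuous_on_mult_left continuous_on_mult 1 2 3 cb continuous_on_const)
    qed
    then show ?thesis
    proof (rule continuous_on_eq)
      fix t :: real assume t: "t \<in> {0..}"
      show "(- \<sigma> / 2) * (F t / max \<delta> t ^ 1) - \<sigma> * (field_strength \<gamma> t / 2) * \<beta> t
      - (real k + 1) * (y t * exp (- \<sigma> * H t) / max \<delta> t ^ (k + 2)) = \<beta>' t"
        using t by (cases "t \<le> \<delta>") (auto simp: \<beta>'_def y0 \<delta>(2) max_absorb2)
    qed
  qed
  have bd: "(\<beta> has_real_derivative \<beta>' t) (at t within {0..})" if t: "t \<ge> 0" for t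
  proof (cases "t = 0")
    case True
    have "((\<lambda>t. 0) has_real_derivative 0) (at t within {0..<\<delta>})" by simp
    then have "(\<beta> has_real_derivative 0) (at t within {0..<\<delta>})"
      by (rule has_field_derivative_transform_within[where d = 1]) (use zero True \<delta> in auto)
    moreover have "at t within {0..<\<delta>} = at t within {0..}"
      using True \<delta> by (intro at_within_nhd[of t "{..<\<delta>}"]) auto
    ultimately show ?thesis using zero(2)[of t] True \<delta> by simp
  next
    case False
    then have t0: "t > 0" using t by simp
    have E: "exp (- \<sigma> * H t) * exp (\<sigma> * H t) = 1" by (simp flip: exp_add)
    have p: "((\<lambda>t. t ^ (k + 1)) has_real_derivative (real k + 1) * t ^ k) (at t within {0..})"
      using DERIV_pow[of "k + 1" t "{0..}"] by (simp add: add.commute)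
    have "(\<beta> has_real_derivative ((?g t * exp (- \<sigma> * H t) + (- \<sigma> * (field_strength \<gamma> t / 2) * exp (- \<sigma> * H t)) * y t) * t ^ (k + 1)
        - (y t * exp (- \<sigma> * H t)) * ((real k + 1) * t ^ k)) / (t ^ (k + 1) * t ^ (k + 1))) (at t within {0..})"
      unfolding \<beta>_def[abs_def]
      by (rule DERIV_divide[OF DERIV_mult[OF yd[OF t] H_exp_deriv[OF t]] p]) (use t0 in simp)
    moreover have "((?g t * exp (- \<sigma> * H t) + (- \<sigma> * (field_strength \<gamma> t / 2) * exp (- \<sigma> * H t)) * y t) * t ^ (k + 1)
        - (y t * exp (- \<sigma> * H t)) * ((real k + 1) * t ^ k)) / (t ^ (k + 1) * t ^ (k + 1)) = \<beta>' t"
    proof -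
      have "?g t * exp (- \<sigma> * H t) = (- \<sigma> / 2) * (t ^ k * F t)" using E by (simp add: mult_ac)
      then show ?thesis unfolding \<beta>'_def \<beta>_def using t0
        by (simp add: field_simps power_add power2_eq_square)
    qed
    ultimately show ?thesis by simp
  qed
  have zR: "\<beta> t = 0" "\<beta>' t = 0" if "t \<ge> R" for t using yR[OF that] R(2)[OF that] by (simp_all add: \<beta>_def \<beta>'_def)
  have "c1 \<beta> \<beta>'" unfolding c1_def ccont_def using bd cb cb' zR by blast
  moreover have "sector_dirac1 \<gamma> s k \<beta> \<beta>' t = F t" if t: "t \<ge> 0" for t
  proof (cases "t = 0")
    case True then show ?thesis using zero[of 0] \<delta> by (simp add: sector_dirac1_def)
  next
    case False
    have "t * \<beta>' t = (- \<sigma> / 2) * F t - \<sigma> * (field_strength \<gamma> t / 2) * t * \<beta> t - (real k + 1) * \<beta> t"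
      using False by (simp add: \<beta>'_def \<beta>_def field_simps)
    then have "sector_dirac1 \<gamma> s k \<beta> \<beta>' t = - \<sigma> * (2 * (real k + 1) * \<beta> t + 2 * ((- \<sigma> / 2) * F t - \<sigma> * (field_strength \<gamma> t / 2) * t * \<beta> t - (real k + 1) * \<beta> t)) - field_strength \<gamma> t * t * \<beta> t"
      by (simp add: sector_dirac1_def \<sigma>_def mult.assoc)
    then show ?thesis using ss by (simp add: algebra_simps)
  qed
  ultimately show ?thesis by blast
qed

section \<open>The closed relation of a sector\<close>

definition sector_graph :: "bool \<Rightarrow> nat \<Rightarrow> (l2 \<times> l2) set" where
  "sector_graph s k = closure {(sec s k \<alpha> \<beta>, sec s k (sector_dirac1 \<gamma> s k \<beta> \<beta>') (sector_dirac2 \<gamma> s \<alpha> \<alpha>')) |\<alpha> \<alpha>' \<beta> \<beta>'. c1 \<alpha> \<alpha>' \<and> c1 \<beta> \<beta>'}"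

text \<open>A real subspace only: the profiles are real, and \<open>mult_i\<close> leads out of it.
  Complex multiples return in \<open>eigenvectors_complete\<close>, where the span of all
  eigenvectors is seen to be invariant under \<open>mult_i\<close>.\<close>

definition sector_space :: "bool \<Rightarrow> nat \<Rightarrow> l2 set" where
  "sector_space s k = closure {sec s k \<alpha> \<beta> |\<alpha> \<beta>. ccont \<alpha> \<and> ccont \<beta>}"

lemma sector_graphI: "c1 \<alpha> \<alpha>' \<Longrightarrow> c1 \<beta> \<beta>' \<Longrightarrow>
  (sec s k \<alpha> \<beta>, sec s k (sector_dirac1 \<gamma> s k \<beta> \<beta>') (sector_dirac2 \<gamma> s \<alpha> \<alpha>')) \<in> sector_graph s k"
  unfolding sector_graph_def by (rule subsetD[OF closure_subset]) blast

lemma sector_graph_subset: "sector_graph s k \<subseteq> \<T>"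
  unfolding sector_graph_def by (intro closure_minimal closed_closure) (auto intro: sector_mem_closure)

lemma subspace_sector_space: "subspace (sector_space s k)"
  unfolding sector_space_def
proof (rule subspace_closure, rule subspaceI)
  have "sec s k (\<lambda>t. 0) (\<lambda>t. 0) = 0"
    using sec_scaleR[of "\<lambda>t. 0" "\<lambda>t. 0" 0 s k] by simp
  then show "0 \<in> {sec s k \<alpha> \<beta> |\<alpha> \<beta>. ccont \<alpha> \<and> ccont \<beta>}" by (auto intro!: exI[of _ "\<lambda>t. 0"])
next
  fix x y assume "x \<in> {sec s k \<alpha> \<beta> |\<alpha> \<beta>. ccont \<alpha> \<and> ccont \<beta>}" "y \<in> {sec s k \<alpha> \<beta> |\<alpha> \<beta>. ccont \<alpha> \<and> ccont \<beta>}"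
  then show "x + y \<in> {sec s k \<alpha> \<beta> |\<alpha> \<beta>. ccont \<alpha> \<and> ccont \<beta>}"
    using sec_add ccont_add by blast
next
  fix r x assume "x \<in> {sec s k \<alpha> \<beta> |\<alpha> \<beta>. ccont \<alpha> \<and> ccont \<beta>}"
  then show "r *\<^sub>R x \<in> {sec s k \<alpha> \<beta> |\<alpha> \<beta>. ccont \<alpha> \<and> ccont \<beta>}"
    using sec_scaleR ccont_cmult by blast
qed

lemma subspace_sector_graph: "subspace (sector_graph s k)"
  unfolding sector_graph_def
proof (rule subspace_closure, rule subspaceI)
  let ?G = "{(sec s k \<alpha> \<beta>, sec s k (sector_dirac1 \<gamma> s k \<beta> \<beta>') (sector_dirac2 \<gamma> s \<alpha> \<alpha>')) |\<alpha> \<alpha>' \<beta> \<beta>'. c1 \<alpha> \<alpha>' \<and> c1 \<beta> \<beta>'}"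
  have scale: "r *\<^sub>R x \<in> ?G" if "x \<in> ?G" for r :: real and x
  proof -
    obtain \<alpha> \<alpha>' \<beta> \<beta>' where x: "x = (sec s k \<alpha> \<beta>, sec s k (sector_dirac1 \<gamma> s k \<beta> \<beta>') (sector_dirac2 \<gamma> s \<alpha> \<alpha>'))" "c1 \<alpha> \<alpha>'" "c1 \<beta> \<beta>'"
      using \<open>x \<in> ?G\<close> by blast
    have "(\<lambda>t. r * sector_dirac1 \<gamma> s k \<beta> \<beta>' t) = sector_dirac1 \<gamma> s k (\<lambda>t. r * \<beta> t) (\<lambda>t. r * \<beta>' t)"
      "(\<lambda>t. r * sector_dirac2 \<gamma> s \<alpha> \<alpha>' t) = sector_dirac2 \<gamma> s (\<lambda>t. r * \<alpha> t) (\<lambda>t. r * \<alpha>' t)"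
      by (auto simp: fun_eq_iff sector_dirac1_def sector_dirac2_def algebra_simps)
    then have "r *\<^sub>R x = (sec s k (\<lambda>t. r * \<alpha> t) (\<lambda>t. r * \<beta> t), sec s k (sector_dirac1 \<gamma> s k (\<lambda>t. r * \<beta> t) (\<lambda>t. r * \<beta>' t)) (sector_dirac2 \<gamma> s (\<lambda>t. r * \<alpha> t) (\<lambda>t. r * \<alpha>' t)))"
      using x c1D(2,3)[OF x(2)] c1D(2,3)[OF x(3)] by (simp add: sec_scaleR ccont_sector_dirac1 ccont_sector_dirac2)
    then show ?thesis using c1_cmult[OF x(2), of r] c1_cmult[OF x(3), of r] by blast
  qed
  then show "r *\<^sub>R x \<in> ?G" if "x \<in> ?G" for r x using that by blast
  have "(sec s k (\<lambda>t. 0) (\<lambda>t. 0), sec s k (sector_dirac1 \<gamma> s k (\<lambda>t. 0) (\<lambda>t. 0)) (sector_dirac2 \<gamma> s (\<lambda>t. 0) (\<lambda>t. 0))) \<in> ?G"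
    using c1_0 by blast
  from scale[OF this, of 0] show "0 \<in> ?G" by (simp only: scaleR_zero_left)
  fix x y assume "x \<in> ?G" "y \<in> ?G"
  then obtain \<alpha> \<alpha>' \<beta> \<beta>' \<mu> \<mu>' \<nu> \<nu>' where x: "x = (sec s k \<alpha> \<beta>, sec s k (sector_dirac1 \<gamma> s k \<beta> \<beta>') (sector_dirac2 \<gamma> s \<alpha> \<alpha>'))" "c1 \<alpha> \<alpha>'" "c1 \<beta> \<beta>'"
    and y: "y = (sec s k \<mu> \<nu>, sec s k (sector_dirac1 \<gamma> s k \<nu> \<nu>') (sector_dirac2 \<gamma> s \<mu> \<mu>'))" "c1 \<mu> \<mu>'" "c1 \<nu> \<nu>'"
    by blast
  have "(\<lambda>t. sector_dirac1 \<gamma> s k \<beta> \<beta>' t + sector_dirac1 \<gamma> s k \<nu> \<nu>' t) = sector_dirac1 \<gamma> s k (\<lambda>t. \<beta> t + \<nu> t) (\<lambda>t. \<beta>' t + \<nu>' t)"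
      "(\<lambda>t. sector_dirac2 \<gamma> s \<alpha> \<alpha>' t + sector_dirac2 \<gamma> s \<mu> \<mu>' t) = sector_dirac2 \<gamma> s (\<lambda>t. \<alpha> t + \<mu> t) (\<lambda>t. \<alpha>' t + \<mu>' t)"
      by (auto simp: fun_eq_iff sector_dirac1_def sector_dirac2_def algebra_simps)
  then have "x + y = (sec s k (\<lambda>t. \<alpha> t + \<mu> t) (\<lambda>t. \<beta> t + \<nu> t), sec s k (sector_dirac1 \<gamma> s k (\<lambda>t. \<beta> t + \<nu> t) (\<lambda>t. \<beta>' t + \<nu>' t)) (sector_dirac2 \<gamma> s (\<lambda>t. \<alpha> t + \<mu> t) (\<lambda>t. \<alpha>' t + \<mu>' t)))"
    using x y c1D(2,3)[OF x(2)] c1D(2,3)[OF x(3)] c1D(2,3)[OF y(2)] c1D(2,3)[OF y(3)]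
    by (simp add: sec_add ccont_sector_dirac1 ccont_sector_dirac2)
  then show "x + y \<in> ?G" using c1_add[OF x(2) y(2)] c1_add[OF x(3) y(3)] by blast
qed

lemma sector_graph_space: "sector_graph s k \<subseteq> sector_space s k \<times> sector_space s k"
  unfolding sector_graph_def
proof (rule closure_minimal)
  show "closed (sector_space s k \<times> sector_space s k)" by (intro closed_Times) (auto simp: sector_space_def)
  have "sec s k \<alpha> \<beta> \<in> sector_space s k" if "ccont \<alpha>" "ccont \<beta>" for \<alpha> \<beta>
    unfolding sector_space_def using that by (intro subsetD[OF closure_subset]) blast
  then show "{(sec s k \<alpha> \<beta>, sec s k (sector_dirac1 \<gamma> s k \<beta> \<beta>') (sector_dirac2 \<gamma> s \<alpha> \<alpha>')) |\<alpha> \<alpha>' \<beta> \<beta>'. c1 \<alpha> \<alpha>' \<and> c1 \<beta> \<beta>'}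
    \<subseteq> sector_space s k \<times> sector_space s k"
    by (auto intro!: ccont_sector_dirac1 ccont_sector_dirac2 dest: c1D(2,3))
qed

lemma sector_graph_domain: "sector_space s k \<subseteq> closure (Domain (sector_graph s k))"
  unfolding sector_space_def
proof (rule closure_minimal)
  show "{sec s k \<alpha> \<beta> |\<alpha> \<beta>. ccont \<alpha> \<and> ccont \<beta>} \<subseteq> closure (Domain (sector_graph s k))"
  proof clarify
    fix \<alpha> \<beta> assume cc: "ccont \<alpha>" "ccont \<beta>"
    obtain R1 R2 where R12: "R1 > 0" "\<And>t. t \<ge> R1 \<Longrightarrow> \<alpha> t = 0" "R2 > 0" "\<And>t. t \<ge> R2 \<Longrightarrow> \<beta> t = 0"
      using ccont_bound[OF cc(1)] ccont_bound[OF cc(2)] by metis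
    define R where "R = max R1 R2"
    have R: "R \<ge> 0" "\<And>t. t \<ge> R \<Longrightarrow> \<alpha> t = 0" "\<And>t. t \<ge> R \<Longrightarrow> \<beta> t = 0" using R12 by (auto simp: R_def)
    define \<epsilon> where "\<epsilon> n = inverse (real (Suc n))" for n
    have \<epsilon>: "\<epsilon> n > 0" for n by (simp add: \<epsilon>_def)
    have "\<forall>n. \<exists>q. real_polynomial_function q \<and> (\<forall>t\<ge>0. \<bar>\<alpha> t - q t * cutoff R t\<bar> \<le> \<epsilon> n)"
      using ccont_poly_approx[OF cc(1) R(2,1) \<epsilon>] by metis
    then obtain q where q: "\<And>n. real_polynomial_function (q n)" "\<And>n t. t \<ge> 0 \<Longrightarrow> \<bar>\<alpha> t - q n t * cutoff R t\<bar> \<le> \<epsilon> n" by metis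
    have "\<forall>n. \<exists>q. real_polynomial_function q \<and> (\<forall>t\<ge>0. \<bar>\<beta> t - q t * cutoff R t\<bar> \<le> \<epsilon> n)"
      using ccont_poly_approx[OF cc(2) R(3,1) \<epsilon>] by metis
    then obtain r where r: "\<And>n. real_polynomial_function (r n)" "\<And>n t. t \<ge> 0 \<Longrightarrow> \<bar>\<beta> t - r n t * cutoff R t\<bar> \<le> \<epsilon> n" by metis
    define \<alpha>n \<beta>n where "\<alpha>n n t = q n t * cutoff R t" and "\<beta>n n t = r n t * cutoff R t" for n t
    have ex: "\<exists>f'. c1 (\<lambda>t. p t * cutoff R t) f'" if p: "real_polynomial_function p" for p
    proof -
      obtain p' where "real_polynomial_function p'" "\<And>x. (p has_real_derivative p' x) (at x)"
        using has_real_derivative_polynomial_function[OF p] by metis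
      then show ?thesis using c1_poly_cutoff[OF p] polynomial_continuous by blast
    qed
    have dom: "sec s k (\<alpha>n n) (\<beta>n n) \<in> Domain (sector_graph s k)" for n
      using ex[OF q(1)[of n]] ex[OF r(1)[of n]] sector_graphI unfolding \<alpha>n_def[abs_def] \<beta>n_def[abs_def] by blast
    have cn: "ccont (\<alpha>n n)" "ccont (\<beta>n n)" for n
      using ex[OF q(1)[of n]] ex[OF r(1)[of n]] c1D(2) unfolding \<alpha>n_def[abs_def] \<beta>n_def[abs_def] by blast+
    define K where "K = sqrt (pi * ((R + 1) * ((R + 1) ^ k + (R + 1) ^ (k + 1))))"
    have "(\<lambda>n. sec s k (\<alpha>n n) (\<beta>n n)) \<longlonglongrightarrow> sec s k \<alpha> \<beta>"
    proof (rule tendsto_of_norm_le_inverse)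
      fix n
      show "norm (sec s k \<alpha> \<beta> - sec s k (\<alpha>n n) (\<beta>n n)) \<le> K * inverse (real (Suc n))"
        unfolding sec_diff[OF cc cn] K_def \<epsilon>_def[symmetric]
        using R \<epsilon>[of n] q(2) r(2) cutoff_props(2)[of R]
        by (intro sector_norm_bound[OF c] ccont_diff cc cn) (auto simp: \<alpha>n_def \<beta>n_def intro: less_imp_le)
    qed
    then show "sec s k \<alpha> \<beta> \<in> closure (Domain (sector_graph s k))"
      using dom unfolding closure_sequential by (intro exI[of _ "\<lambda>n. sec s k (\<alpha>n n) (\<beta>n n)"]) auto
  qed
qed simp

end

section \<open>Vectors orthogonal to range and kernel\<close>

text \<open>The ramp rises from 0 at \<open>1 / n\<close> to 1 at \<open>2 / n\<close>. It produces
  sources that vanish near 0, as \<open>sector_dirac1_solve\<close> requires, and alters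
  \<open>F\<close> only on a shrinking interval.\<close>

lemma ccont_tendsto_cut:
  assumes F: "ccont F"
  defines "\<theta> \<equiv> \<lambda>(n::nat) t::real. max 0 (min 1 (real n * t - 1))"
  shows "ccont (\<lambda>t. \<theta> n t * F t)" "n \<ge> 1 \<Longrightarrow> t \<le> 1 / real n \<Longrightarrow> \<theta> n t * F t = 0"
    "n \<ge> 1 \<Longrightarrow> t \<ge> 2 / real n \<Longrightarrow> \<theta> n t * F t = F t" "\<bar>F t - \<theta> n t * F t\<bar> \<le> \<bar>F t\<bar>"
proof -
  show "ccont (\<lambda>t. \<theta> n t * F t)" unfolding \<theta>_def by (intro ccont_mult F continuous_intros)
  show "\<theta> n t * F t = 0" if "n \<ge> 1" "t \<le> 1 / real n"
  proof -
    have "real n * t \<le> 1" using that by (simp add: field_simps)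
    then show ?thesis by (simp add: \<theta>_def)
  qed
  show "\<theta> n t * F t = F t" if "n \<ge> 1" "t \<ge> 2 / real n"
  proof -
    have "real n * t \<ge> 2" using that by (simp add: field_simps)
    then show ?thesis by (simp add: \<theta>_def)
  qed
  have "0 \<le> \<theta> n t" "\<theta> n t \<le> 1" by (auto simp: \<theta>_def)
  then have "\<bar>1 - \<theta> n t\<bar> * \<bar>F t\<bar> \<le> 1 * \<bar>F t\<bar>" by (intro mult_right_mono) auto
  moreover have "F t - \<theta> n t * F t = (1 - \<theta> n t) * F t" by (simp add: algebra_simps)
  ultimately show "\<bar>F t - \<theta> n t * F t\<bar> \<le> \<bar>F t\<bar>" by (simp add: abs_mult)
qed

lemma ccont_bounded:
  assumes "ccont f"
  obtains M where "M \<ge> 0" "\<And>t. t \<ge> 0 \<Longrightarrow> \<bar>f t\<bar> \<le> M"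
proof -
  obtain R where R: "R > 0" "\<And>t. t \<ge> R \<Longrightarrow> f t = 0" using ccont_bound[OF assms] by blast
  have "bounded (f ` {0..R})"
    by (intro compact_imp_bounded compact_continuous_image continuous_on_subset[OF ccontD[OF assms]]) auto
  then obtain M where M: "\<And>t. 0 \<le> t \<Longrightarrow> t \<le> R \<Longrightarrow> \<bar>f t\<bar> \<le> M"
    unfolding bounded_iff by (metis atLeastAtMost_iff imageI real_norm_def)
  show thesis
  proof (rule that[of "max 0 M"])
    fix t :: real assume "t \<ge> 0"
    then show "\<bar>f t\<bar> \<le> max 0 M" using M[of t] R(2)[of t] by (cases "t \<le> R") auto
  qed simp
qed

lemma ccont_integral_cut_tendsto:
  assumes F: "ccont F" and w: "continuous_on {0..} w"
  shows "(\<lambda>n. integral {0..} (\<lambda>u. w u * (max 0 (min 1 (real n * u - 1)) * F u))) \<longlonglongrightarrow> integral {0..} (\<lambda>u. w u * F u)"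
proof -
  define Fn where "Fn n t = max 0 (min 1 (real n * t - 1)) * F t" for n :: nat and t
  note Fn = ccont_tendsto_cut[OF F, folded Fn_def]
  have cw: "ccont (\<lambda>u. w u * F u)" by (intro ccont_mult F w)
  obtain M where M: "M \<ge> 0" "\<And>t. t \<ge> 0 \<Longrightarrow> \<bar>w t * F t\<bar> \<le> M" using ccont_bounded[OF cw] by blast
  have "\<bar>integral {0..} (\<lambda>u. w u * Fn n u) - integral {0..} (\<lambda>u. w u * F u)\<bar> \<le> M * (2 / real n)" if n: "n \<ge> 1" for n
  proof -
    have c: "ccont (\<lambda>u. w u * (F u - Fn n u))" by (intro ccont_mult ccont_diff F w Fn)
    have "integral {0..} (\<lambda>u. w u * F u) - integral {0..} (\<lambda>u. w u * Fn n u) = integral {0..} (\<lambda>u. w u * F u - w u * Fn n u)"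
      by (intro Henstock_Kurzweil_Integration.integral_diff[symmetric] ccont_integrable ccont_mult F w Fn)
    also have "\<dots> = integral {0..} (\<lambda>u. w u * (F u - Fn n u))" by (simp add: algebra_simps)
    also have "\<dots> = integral {0..2 / real n} (\<lambda>u. w u * (F u - Fn n u))"
      using Fn(3)[OF n] by (intro ccont_integral_eq[OF c]) auto
    also have "norm \<dots> \<le> M * (2 / real n - 0)"
    proof (rule integral_bound)
      show "continuous_on {0..2 / real n} (\<lambda>u. w u * (F u - Fn n u))"
        by (rule continuous_on_subset[OF ccontD[OF c]]) auto
      fix t assume "t \<in> {0..2 / real n}"
      then have "norm (w t * (F t - Fn n t)) \<le> \<bar>w t * F t\<bar>"
        using Fn(4)[of t n] by (simp add: abs_mult mult_left_mono)
      also have "\<dots> \<le> M" using M(2) \<open>t \<in> _\<close> by simp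
      finally show "norm (w t * (F t - Fn n t)) \<le> M" .
    qed (use n in auto)
    finally show ?thesis by (simp add: abs_minus_commute)
  qed
  then have "\<forall>\<^sub>F n in sequentially. norm (integral {0..} (\<lambda>u. w u * Fn n u) - integral {0..} (\<lambda>u. w u * F u)) \<le> M * (2 / real n)"
    by (intro eventually_sequentiallyI[of 1]) simp
  moreover have "(\<lambda>n. M * (2 / real n)) \<longlonglongrightarrow> 0"
    using tendsto_mult_right_zero[OF lim_const_over_n[of 2], of M] by simp
  ultimately have "(\<lambda>n. integral {0..} (\<lambda>u. w u * Fn n u) - integral {0..} (\<lambda>u. w u * F u)) \<longlonglongrightarrow> 0"
    by (rule Lim_null_comparison)
  then show ?thesis unfolding Fn_def by (rule LIM_zero_cancel)
qed

context magnetic_dirac_setting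
begin

lemma sec_cut_tendsto:
  assumes F: "ccont F"
  shows "(\<lambda>n. sec s k (\<lambda>t. max 0 (min 1 (real n * t - 1)) * F t) (\<lambda>t. 0)) \<longlonglongrightarrow> sec s k F (\<lambda>t. 0)"
proof -
  define Fn where "Fn n t = max 0 (min 1 (real n * t - 1)) * F t" for n :: nat and t
  note Fn = ccont_tendsto_cut[OF F, folded Fn_def]
  obtain M where M: "M \<ge> 0" "\<And>t. t \<ge> 0 \<Longrightarrow> \<bar>F t\<bar> \<le> M" using ccont_bounded[OF F] by blast
  have b: "norm (sec s k F (\<lambda>t. 0) - sec s k (Fn n) (\<lambda>t. 0)) \<le> sqrt (pi * (2 / real n * ((2 / real n) ^ k + (2 / real n) ^ (k + 1)))) * M" if n: "n \<ge> 1" for n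
    unfolding sec_diff[OF F ccont_0 Fn(1) ccont_0]
  proof (rule sector_norm_bound[OF c])
    show "ccont (\<lambda>t. F t - Fn n t)" by (intro ccont_diff F Fn)
    show "\<bar>F t - Fn n t\<bar> \<le> M" if "0 \<le> t" for t using Fn(4)[of t n] M(2)[OF that] by linarith
  qed (use M Fn(3)[OF n] in auto)
  have "(\<lambda>n. sqrt (pi * (2 / real n * ((2 / real n) ^ k + (2 / real n) ^ (k + 1)))) * M) \<longlonglongrightarrow> sqrt (pi * (0 * (0 ^ k + 0 ^ (k + 1)))) * M"
    by (intro tendsto_intros lim_const_over_n)
  then have 0: "(\<lambda>n. sqrt (pi * (2 / real n * ((2 / real n) ^ k + (2 / real n) ^ (k + 1)))) * M) \<longlonglongrightarrow> 0" by simp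
  have "\<forall>\<^sub>F n in sequentially. norm (sec s k (Fn n) (\<lambda>t. 0) - sec s k F (\<lambda>t. 0)) \<le> sqrt (pi * (2 / real n * ((2 / real n) ^ k + (2 / real n) ^ (k + 1)))) * M"
    using b by (intro eventually_sequentiallyI[of 1]) (simp add: norm_minus_commute)
  from Lim_null_comparison[OF this 0] show ?thesis unfolding Fn_def by (rule LIM_zero_cancel)
qed

text \<open>On the middle interval of length 1 the tent is at least \<open>1/2\<close>, the power of
  \<open>u\<close> is at least 1, and \<open>H\<close> has grown past its value at
  \<open>n\<close>.\<close>

lemma tent_integral_ge:
  assumes "n \<ge> 1"
  shows "exp (H (real n)) / 2 \<le> integral {0..} (\<lambda>u. u ^ k * exp (H u) * tent n u)"
proof -
  let ?f = "\<lambda>u. u ^ k * exp (H u) * tent n u"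
  have cf: "ccont ?f" using continuous_on_exp_H[of 1] by (intro ccont_mult tent_props continuous_intros continuous_on_H)
  have i: "?f integrable_on {a..b}" if "0 \<le> a" for a b
    by (intro integrable_continuous_interval continuous_on_subset[OF ccontD[OF cf]]) (use that in auto)
  have "exp (H (real n)) / 2 = integral {real n + 1/2..real n + 3/2} (\<lambda>u. exp (H (real n)) / 2)" by simp
  also have "\<dots> \<le> integral {real n + 1/2..real n + 3/2} ?f"
  proof (rule integral_le)
    fix u assume u: "u \<in> {real n + 1/2..real n + 3/2}"
    have "1 * (exp (H (real n)) * (1/2)) \<le> u ^ k * (exp (H u) * tent n u)"
      using u assms tent_props(6)[of n u] H_mono[of "real n" u]
      by (intro mult_mono one_le_power) auto
    then show "exp (H (real n)) / 2 \<le> ?f u" by (simp add: mult.assoc)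
  qed (use i in auto)
  also have "\<dots> \<le> integral {0..} ?f"
    by (intro integral_subset_le i ccont_integrable cf) (auto simp: tent_props(2))
  finally show ?thesis .
qed

lemma tent_norm_le:
  "norm (sec s k (tent n) (\<lambda>t. 0)) \<le> sqrt (2 * pi) * (real n + 2) ^ (k + 2)"
  "norm (sec s k (\<lambda>t. 0) (tent n)) \<le> sqrt (2 * pi) * (real n + 2) ^ (k + 2)"
proof -
  have tent_abs: "\<bar>tent n t\<bar> \<le> 1" for t using tent_props(2,3)[of n t] by (simp add: abs_if)
  let ?R = "real n + 2"
  have "?R * (?R ^ k + ?R ^ (k + 1)) \<le> 2 * ?R ^ (k + 2)"
  proof -
    have "?R ^ (k + 1) \<le> ?R ^ (k + 2)" by (intro power_increasing) auto
    then show ?thesis by (simp add: algebra_simps)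
  qed
  also have "\<dots> \<le> 2 * (?R ^ (k + 2) * ?R ^ (k + 2))"
    using one_le_power[of ?R "k + 2"] by simp
  finally have "pi * (?R * (?R ^ k + ?R ^ (k + 1))) \<le> (2 * pi) * (?R ^ (k + 2))\<^sup>2"
    by (simp add: power2_eq_square)
  then have "sqrt (pi * (?R * (?R ^ k + ?R ^ (k + 1)))) \<le> sqrt ((2 * pi) * (?R ^ (k + 2))\<^sup>2)" by (rule real_sqrt_le_mono)
  then have b: "sqrt (pi * (?R * (?R ^ k + ?R ^ (k + 1)))) * 1 \<le> sqrt (2 * pi) * ?R ^ (k + 2)"
    by (simp add: real_sqrt_mult)
  have "norm (sec s k (tent n) (\<lambda>t. 0)) \<le> sqrt (pi * (?R * (?R ^ k + ?R ^ (k + 1)))) * 1"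
    by (rule sector_norm_bound[OF c]) (auto simp: tent_props(1,5) tent_abs)
  with b show "norm (sec s k (tent n) (\<lambda>t. 0)) \<le> sqrt (2 * pi) * (real n + 2) ^ (k + 2)" by linarith
  have "norm (sec s k (\<lambda>t. 0) (tent n)) \<le> sqrt (pi * (?R * (?R ^ k + ?R ^ (k + 1)))) * 1"
    by (rule sector_norm_bound[OF c]) (auto simp: tent_props(1,5) tent_abs)
  with b show "norm (sec s k (\<lambda>t. 0) (tent n)) \<le> sqrt (2 * pi) * (real n + 2) ^ (k + 2)" by linarith
qed

lemma sec_scale1: "ccont F \<Longrightarrow> sec s k (\<lambda>t. r * F t) (\<lambda>t. 0) = r *\<^sub>R sec s k F (\<lambda>t. 0)"
  using sec_scaleR[of F "\<lambda>t. 0" r s k] by simp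

lemma sec_scale2: "ccont F \<Longrightarrow> sec s k (\<lambda>t. 0) (\<lambda>t. r * F t) = r *\<^sub>R sec s k (\<lambda>t. 0) F"
  using sec_scaleR[of "\<lambda>t. 0" F r s k] by simp

text \<open>All sources in the second slot are in the range, so \<open>v\<close> is orthogonal to
  that slot. In the first slot the range contains the sources supported away from 0 on which the
  moment \<open>l\<close> vanishes; hence \<open>v\<close> acts there as a multiple \<open>C\<close>
  of \<open>l\<close>, and by cutting off near 0 this extends to all profiles. For
  \<open>s = True\<close> boundedness of \<open>v\<close> forces \<open>C = 0\<close>. For
  \<open>s = False\<close> the moment does not vanish on the kernel, whereas \<open>v\<close>
  does.\<close>

lemma sector_range_orthogonal:
  assumes cpt: "\<And>X Y :: nat \<Rightarrow> l2. (\<And>n. (X n, Y n) \<in> sector_graph s k \<and> norm (X n) \<le> 1 \<and> norm (Y n) \<le> 1) \<Longrightarrow>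
                \<exists>r l. strict_mono (r :: nat \<Rightarrow> nat) \<and> (\<lambda>n. X (r n)) \<longlonglongrightarrow> l"
    and ran: "\<And>x y. (x, y) \<in> sector_graph s k \<Longrightarrow> v \<bullet> y = 0"
    and ker: "\<And>z. (z, 0) \<in> sector_graph s k \<Longrightarrow> v \<bullet> z = 0"
    and v: "v \<in> sector_space s k"
  shows "v = 0"
proof -
  define \<sigma> where "\<sigma> = sgn_sector s"
  define l where "l F = integral {0..} (\<lambda>u. u ^ k * exp (\<sigma> * H u) * F u)" for F
  have cl: "ccont (\<lambda>u. u ^ k * exp (\<sigma> * H u) * F u)" if "ccont F" for F
    by (intro ccont_mult continuous_intros continuous_on_exp_H that)
  have v2: "v \<bullet> sec s k (\<lambda>t. 0) G = 0" if G: "ccont G" for G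
  proof -
    obtain R where R: "R > 0" "\<And>t. t \<ge> R \<Longrightarrow> G t = 0" using ccont_bound[OF G] by blast
    obtain \<alpha> \<alpha>' where a: "c1 \<alpha> \<alpha>'" "\<And>t. t \<ge> 0 \<Longrightarrow> sector_dirac2 \<gamma> s \<alpha> \<alpha>' t = G t"
      using sector_dirac2_solve[OF G less_imp_le[OF R(1)] R(2), of s] by blast
    have "sec s k (\<lambda>t. 0) G = sec s k (sector_dirac1 \<gamma> s k (\<lambda>t. 0) (\<lambda>t. 0)) (sector_dirac2 \<gamma> s \<alpha> \<alpha>')"
      by (rule sec_cong) (simp_all add: a sector_dirac1_def)
    then show ?thesis using ran[OF sector_graphI[OF a(1) c1_0]] by simp
  qed
  have v10: "v \<bullet> sec s k F (\<lambda>t. 0) = 0" if F: "ccont F" "\<And>t. 0 \<le> t \<Longrightarrow> t \<le> \<delta> \<Longrightarrow> F t = 0" "\<delta> > 0" "l F = 0" for F \<delta>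
  proof -
    obtain \<beta> \<beta>' where b: "c1 \<beta> \<beta>'" "\<And>t. t \<ge> 0 \<Longrightarrow> sector_dirac1 \<gamma> s k \<beta> \<beta>' t = F t"
      using sector_dirac1_solve[OF F(1,3,2), of k s] F(4) by (auto simp: l_def \<sigma>_def)
    have "sec s k F (\<lambda>t. 0) = sec s k (sector_dirac1 \<gamma> s k \<beta> \<beta>') (sector_dirac2 \<gamma> s (\<lambda>t. 0) (\<lambda>t. 0))"
      by (rule sec_cong) (simp_all add: b sector_dirac2_def)
    then show ?thesis using ran[OF sector_graphI[OF c1_0 b(1)]] by simp
  qed
  have l_pos: "l (tent n) > 0" if "n \<ge> 1" for n
  proof (cases s)
    case True
    have "0 < exp (H (real n)) / 2" by simp
    also note tent_integral_ge[OF that, of k]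
    finally show ?thesis using True by (simp add: l_def \<sigma>_def sgn_sector_def)
  next
    case False
    let ?f = "\<lambda>u. u ^ k * exp (\<sigma> * H u) * tent n u"
    have cf: "ccont ?f" by (intro cl tent_props)
    have i: "?f integrable_on {a..b}" if "0 \<le> a" for a b
      by (intro integrable_continuous_interval continuous_on_subset[OF ccontD[OF cf]]) (use that in auto)
    have "0 < integral {real n + 1/2..real n + 3/2} (\<lambda>u. exp (- H (real n + 2)) / 2)" by simp
    also have "\<dots> \<le> integral {real n + 1/2..real n + 3/2} ?f"
    proof (rule integral_le)
      fix u assume u: "u \<in> {real n + 1/2..real n + 3/2}"
      have "1 * (exp (- H (real n + 2)) * (1/2)) \<le> u ^ k * (exp (- H u) * tent n u)"
        using u that tent_props(6)[of n u] H_mono[of u "real n + 2"]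
        by (intro mult_mono one_le_power) auto
      then show "exp (- H (real n + 2)) / 2 \<le> ?f u" using False by (simp add: mult.assoc \<sigma>_def sgn_sector_def)
    qed (use i in auto)
    also have "\<dots> \<le> l (tent n)" unfolding l_def
      by (intro integral_subset_le i ccont_integrable cf) (auto simp: tent_props(2))
    finally show ?thesis .
  qed
  \<comment> \<open>The ratio of \<open>v\<close> to \<open>l\<close>, measured on
    \<open>tent 1\<close>: it vanishes on \<open>[0, 1]\<close>, so combinations with it still
    satisfy the support condition near 0.\<close>
  define C where "C = v \<bullet> sec s k (tent 1) (\<lambda>t. 0) / l (tent 1)"
  have lin0: "v \<bullet> sec s k F (\<lambda>t. 0) = C * l F" if F: "ccont F" "\<And>t. 0 \<le> t \<Longrightarrow> t \<le> \<delta> \<Longrightarrow> F t = 0" "\<delta> > 0" for F \<delta>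
  proof -
    define r where "r = l F / l (tent 1)"
    have cr: "ccont (\<lambda>t. r * tent 1 t)" by (intro ccont_cmult tent_props)
    have "v \<bullet> sec s k (\<lambda>t. F t - r * tent 1 t) (\<lambda>t. 0) = 0"
    proof (rule v10[of _ "min \<delta> 1"])
      have "l (\<lambda>t. F t - r * tent 1 t) = integral {0..} (\<lambda>u. u ^ k * exp (\<sigma> * H u) * F u - r * (u ^ k * exp (\<sigma> * H u) * tent 1 u))"
        unfolding l_def by (intro arg_cong[where f = "integral _"] ext) (simp add: algebra_simps)
      also have "\<dots> = l F - r * l (tent 1)"
        unfolding l_def by (subst Henstock_Kurzweil_Integration.integral_diff)
          (auto intro!: ccont_integrable ccont_cmult cl F tent_props(1))
      also have "\<dots> = 0" using l_pos[of 1] by (simp add: r_def)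
      finally show "l (\<lambda>t. F t - r * tent 1 t) = 0" .
    qed (use F in \<open>auto intro!: ccont_diff cr simp: tent_props simp del: One_nat_def\<close>)
    moreover have "sec s k (\<lambda>t. F t - r * tent 1 t) (\<lambda>t. 0) = sec s k F (\<lambda>t. 0) - r *\<^sub>R sec s k (tent 1) (\<lambda>t. 0)"
      using sec_diff[OF F(1) ccont_0 cr ccont_0, of s k] by (simp add: sec_scale1 tent_props)
    ultimately show ?thesis using l_pos[of 1] by (simp add: inner_diff_right C_def r_def)
  qed
  \<comment> \<open>Cutting off a neighbourhood of 0 changes neither side in the limit, which
    removes the support condition.\<close>
  have lin: "v \<bullet> sec s k F (\<lambda>t. 0) = C * l F" if F: "ccont F" for F
  proof -
    define Fn where "Fn n t = max 0 (min 1 (real n * t - 1)) * F t" for n :: nat and t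
    note Fn = ccont_tendsto_cut[OF F, folded Fn_def]
    have 1: "(\<lambda>n. v \<bullet> sec s k (Fn n) (\<lambda>t. 0)) \<longlonglongrightarrow> v \<bullet> sec s k F (\<lambda>t. 0)"
      using sec_cut_tendsto[OF F, of s k] unfolding Fn_def[symmetric] by (intro tendsto_intros)
    have "(\<lambda>n. l (Fn n)) \<longlonglongrightarrow> l F"
      unfolding l_def Fn_def using ccont_integral_cut_tendsto[OF F, of "\<lambda>u. u ^ k * exp (\<sigma> * H u)"]
      by (simp add: continuous_on_exp_H continuous_on_mult continuous_on_power)
    then have 2: "(\<lambda>n. C * l (Fn n)) \<longlonglongrightarrow> C * l F" by (intro tendsto_intros)
    have "\<forall>\<^sub>F n in sequentially. v \<bullet> sec s k (Fn n) (\<lambda>t. 0) = C * l (Fn n)"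
    proof (rule eventually_sequentiallyI[of 1])
      fix n :: nat assume n: "1 \<le> n"
      show "v \<bullet> sec s k (Fn n) (\<lambda>t. 0) = C * l (Fn n)"
        using Fn(2)[OF n] n by (intro lin0[of _ "1 / real n"] Fn) auto
    qed
    then show ?thesis using LIMSEQ_unique[OF 1] 2 by (simp add: tendsto_cong)
  qed
  have C0: "C = 0"
  proof (cases s)
    case True \<comment> \<open>\<open>l\<close> is not bounded: test with tents, on which it grows like \<open>exp H\<close>.\<close>
    have b: "\<bar>C\<bar> \<le> (2 * norm v * sqrt (2 * pi)) * ((real n + 2) ^ (k + 2) * exp (- H (real n)))" if n: "n \<ge> 1" for n
    proof -
      have "\<bar>C\<bar> * l (tent n) = \<bar>v \<bullet> sec s k (tent n) (\<lambda>t. 0)\<bar>"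
        using l_pos[OF n] lin[OF tent_props(1), of n] by (simp add: abs_mult)
      also have "\<dots> \<le> norm v * norm (sec s k (tent n) (\<lambda>t. 0))" by (rule Cauchy_Schwarz_ineq2)
      also have "\<dots> \<le> norm v * (sqrt (2 * pi) * (real n + 2) ^ (k + 2))" by (intro mult_left_mono tent_norm_le) auto
      finally have 1: "\<bar>C\<bar> * l (tent n) \<le> norm v * (sqrt (2 * pi) * (real n + 2) ^ (k + 2))" .
      have "\<bar>C\<bar> * (exp (H (real n)) / 2) \<le> \<bar>C\<bar> * l (tent n)"
        using tent_integral_ge[OF n, of k] True by (intro mult_left_mono) (auto simp: l_def \<sigma>_def sgn_sector_def)
      with 1 have "\<bar>C\<bar> * (exp (H (real n)) / 2) \<le> norm v * (sqrt (2 * pi) * (real n + 2) ^ (k + 2))" by linarith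
      then have "\<bar>C\<bar> * (exp (H (real n)) / 2) * (2 * exp (- H (real n))) \<le> norm v * (sqrt (2 * pi) * (real n + 2) ^ (k + 2)) * (2 * exp (- H (real n)))"
        by (intro mult_right_mono) auto
      moreover have "\<bar>C\<bar> * (exp (H (real n)) / 2) * (2 * exp (- H (real n))) = \<bar>C\<bar>"
      proof -
        have "exp (H (real n)) / 2 * (2 * exp (- H (real n))) = 1" by (simp flip: exp_add)
        then show ?thesis by (simp only: mult.assoc mult_1_right)
      qed
      moreover have "norm v * (sqrt (2 * pi) * (real n + 2) ^ (k + 2)) * (2 * exp (- H (real n)))
        = (2 * norm v * sqrt (2 * pi)) * ((real n + 2) ^ (k + 2) * exp (- H (real n)))" by (simp only: mult_ac)
      ultimately show ?thesis by (simp only:)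
    qed
    have "(\<lambda>n. (2 * norm v * sqrt (2 * pi)) * ((real n + 2) ^ (k + 2) * exp (- H (real n)))) \<longlonglongrightarrow> (2 * norm v * sqrt (2 * pi)) * 0"
      by (intro tendsto_intros polynomial_times_exp_H)
    then have "\<bar>C\<bar> \<le> (2 * norm v * sqrt (2 * pi)) * 0"
      by (rule LIMSEQ_le_const) (use b in blast)
    then show ?thesis by simp
  next
    case False \<comment> \<open>\<open>l\<close> is the pairing with the zero mode \<open>exp (- H)\<close>, which is a limit of compactly supported fields.\<close>
    then have \<sigma>: "\<sigma> = - 1" by (simp add: \<sigma>_def sgn_sector_def)
    define L where "L n = integral {0..} (\<lambda>u. exp (H u) * tent n u)" for n
    have Lge: "exp (H (real n)) / 2 \<le> L n" if "n \<ge> 1" for n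
      using tent_integral_ge[OF that, of 0] by (simp add: L_def)
    \<comment> \<open>With the factor \<open>2 / L n\<close> the solution \<open>\<alpha> n\<close>
      equals \<open>exp (- H)\<close> exactly for \<open>0 <= t <= n\<close>, while
      \<open>G n\<close> tends to 0 in norm because \<open>L n\<close> is at least
      \<open>exp (H n) / 2\<close>.\<close>
    define G where "G n t = 2 / L n * tent n t" for n t
    have cG: "ccont (G n)" for n unfolding G_def[abs_def] by (intro ccont_cmult tent_props)
    define w where "w n t = integral {0..t} (\<lambda>u. \<sigma> / 2 * (exp (- \<sigma> * H u) * G n u))" for n t
    define \<alpha> where "\<alpha> n t = exp (\<sigma> * H t) * (w n t - w n (real n + 2))" for n t
    have Gz: "G n t = 0" if "t \<ge> real n + 2" for n t using that by (simp add: G_def tent_props)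
    have "\<exists>\<alpha>'. c1 (\<alpha> n) \<alpha>' \<and> (\<forall>t\<ge>0. sector_dirac2 \<gamma> s (\<alpha> n) \<alpha>' t = G n t)" for n
      using sector_dirac2_solve[OF cG[of n], of "real n + 2" s] Gz
      unfolding \<alpha>_def[abs_def] w_def[abs_def] \<sigma>_def by simp
    then obtain \<alpha>' where a: "\<And>n. c1 (\<alpha> n) (\<alpha>' n)" "\<And>n t. t \<ge> 0 \<Longrightarrow> sector_dirac2 \<gamma> s (\<alpha> n) (\<alpha>' n) t = G n t" by metis
    have ca: "ccont (\<alpha> n)" for n using c1D(2)[OF a(1)] .
    have mem: "(sec s k (\<alpha> n) (\<lambda>t. 0), sec s k (\<lambda>t. 0) (G n)) \<in> sector_graph s k" for n
    proof -
      have "sec s k (\<lambda>t. 0) (G n) = sec s k (sector_dirac1 \<gamma> s k (\<lambda>t. 0) (\<lambda>t. 0)) (sector_dirac2 \<gamma> s (\<alpha> n) (\<alpha>' n))"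
        by (rule sec_cong) (simp_all add: a sector_dirac1_def)
      then show ?thesis using sector_graphI[OF a(1) c1_0] by metis
    qed
    have wn: "w n t - w n (real n + 2) \<in> {0..1}" "t \<le> real n \<Longrightarrow> w n t - w n (real n + 2) = 1" if n: "n \<ge> 1" and t: "t \<ge> 0" for n t
    proof -
      let ?h = "\<lambda>u. exp (H u) * tent n u"
      have ch: "ccont ?h" using continuous_on_exp_H[of 1] by (intro ccont_mult tent_props) simp
      have Lp: "L n > 0" using Lge[OF n] exp_gt_zero[of "H (real n)"] by linarith
      have wI: "w n t = - integral {0..t} ?h / L n" for t
      proof -
        have "w n t = integral {0..t} (\<lambda>u. (- 1 / L n) * ?h u)"
          unfolding w_def G_def \<sigma> by (intro arg_cong[where f = "integral _"] ext) (simp add: mult_ac)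
        then show ?thesis by simp
      qed
      have "L n = integral {0..real n + 2} ?h" unfolding L_def
        by (intro ccont_integral_eq[OF ch]) (auto simp: tent_props)
      then have wR: "w n (real n + 2) = - 1" using Lp wI[of "real n + 2"] by simp
      have df: "w n t - w n (real n + 2) = 1 - integral {0..t} ?h / L n" using wR wI[of t] by simp
      have i: "?h integrable_on {0..t}" by (intro integrable_continuous_interval continuous_on_subset[OF ccontD[OF ch]]) auto
      have "0 \<le> integral {0..t} ?h" using i by (intro integral_nonneg) (auto simp: tent_props)
      moreover have "integral {0..t} ?h \<le> L n" unfolding L_def
        by (intro integral_subset_le i ccont_integrable ch) (auto simp: tent_props(2))
      ultimately show "w n t - w n (real n + 2) \<in> {0..1}" using Lp by (simp add: df)
      show "w n t - w n (real n + 2) = 1" if "t \<le> real n"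
      proof -
        have "integral {0..t} ?h = 0" by (rule integral_zero_on_interval) (use that in \<open>auto simp: tent_props\<close>)
        then show ?thesis by (simp add: df)
      qed
    qed
    have nsq: "(norm (sec s k (\<alpha> n) (\<lambda>t. 0)))\<^sup>2 = pi * integral {0..} (\<lambda>t. t ^ k * (\<alpha> n t)\<^sup>2)" for n
      using sec_norm[OF ca ccont_0, of s k n] by simp
    have cas: "ccont (\<lambda>t. t ^ k * (\<alpha> n t)\<^sup>2)" for n by (intro ccont_mult ccont_power2 ca continuous_intros)
    \<comment> \<open>A lower bound for the squared norms, taken from \<open>t <= 1\<close>, where
      each \<open>\<alpha> n\<close> with \<open>n >= 1\<close> coincides with the zero
      mode.\<close>
    define c0 where "c0 = pi * integral {0..1} (\<lambda>t. t ^ k * (exp (- H t))\<^sup>2)"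
    have ce: "continuous_on {0..1} (\<lambda>t. t ^ k * (exp (- H t))\<^sup>2)"
      by (intro continuous_intros continuous_on_subset[OF continuous_on_H]) auto
    have c0: "c0 > 0"
    proof -
      have "0 < integral {1/2..1} (\<lambda>t::real. (1/2) ^ k * (exp (- H 1))\<^sup>2)" by simp
      also have "\<dots> \<le> integral {1/2..1} (\<lambda>t. t ^ k * (exp (- H t))\<^sup>2)"
      proof (rule integral_le)
        show "(\<lambda>t. t ^ k * (exp (- H t))\<^sup>2) integrable_on {1/2..1}"
          by (intro integrable_continuous_interval continuous_on_subset[OF ce]) auto
        fix t :: real assume "t \<in> {1/2..1}"
        then show "(1/2) ^ k * (exp (- H 1))\<^sup>2 \<le> t ^ k * (exp (- H t))\<^sup>2"
          using H_mono[of t 1] by (intro mult_mono power_mono) auto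
      qed auto
      also have "\<dots> \<le> integral {0..1} (\<lambda>t. t ^ k * (exp (- H t))\<^sup>2)"
        by (intro integral_subset_le integrable_continuous_interval ce continuous_on_subset[OF ce]) auto
      finally show ?thesis by (simp add: c0_def)
    qed
    have nge: "(norm (sec s k (\<alpha> n) (\<lambda>t. 0)))\<^sup>2 \<ge> c0" if n: "n \<ge> 1" for n
    proof -
      have "integral {0..1} (\<lambda>t. t ^ k * (exp (- H t))\<^sup>2) = integral {0..1} (\<lambda>t. t ^ k * (\<alpha> n t)\<^sup>2)"
        using wn(2)[OF n] n by (intro integral_cong) (auto simp: \<alpha>_def \<sigma>)
      also have "\<dots> \<le> integral {0..} (\<lambda>t. t ^ k * (\<alpha> n t)\<^sup>2)"
        by (intro integral_subset_le ccont_integrable cas integrable_continuous_interval continuous_on_subset[OF ccontD[OF cas]]) auto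
      finally show ?thesis by (simp add: nsq c0_def)
    qed
    \<comment> \<open>As \<open>\<alpha> n\<close> is \<open>exp (- H)\<close> times a factor
      between 0 and 1, its square is at most \<open>exp (- H) * \<alpha> n\<close>, the integrand of
      the moment.\<close>
    have lge: "l (\<alpha> n) \<ge> (norm (sec s k (\<alpha> n) (\<lambda>t. 0)))\<^sup>2 / pi" if n: "n \<ge> 1" for n
    proof -
      have "integral {0..} (\<lambda>t. t ^ k * (\<alpha> n t)\<^sup>2) \<le> l (\<alpha> n)" unfolding l_def
      proof (rule integral_le)
        fix t :: real assume t: "t \<in> {0..}"
        define W where "W = w n t - w n (real n + 2)"
        have W: "0 \<le> W" "W \<le> 1" using wn(1)[OF n, of t] t by (auto simp: W_def)
        have "\<alpha> n t = exp (\<sigma> * H t) * W" by (simp add: \<alpha>_def W_def)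
        moreover have "(exp (\<sigma> * H t) * W)\<^sup>2 \<le> exp (\<sigma> * H t) * (exp (\<sigma> * H t) * W)"
        proof -
          have "(exp (\<sigma> * H t) * exp (\<sigma> * H t)) * (W * W) \<le> (exp (\<sigma> * H t) * exp (\<sigma> * H t)) * W"
            using W by (intro mult_left_mono mult_left_le) auto
          then show ?thesis by (simp only: power2_eq_square mult_ac)
        qed
        ultimately show "t ^ k * (\<alpha> n t)\<^sup>2 \<le> t ^ k * exp (\<sigma> * H t) * \<alpha> n t"
          using t by (simp add: mult_left_mono mult.assoc)
      qed (intro ccont_integrable cas cl ca)+
      then show ?thesis by (simp add: nsq)
    qed
    define N where "N n = norm (sec s k (\<alpha> n) (\<lambda>t. 0))" for n
    have Nge: "N n \<ge> sqrt c0" if "n \<ge> 1" for n using nge[OF that] by (simp add: N_def real_le_rsqrt real_sqrt_le_iff sqrt_le_D real_le_lsqrt)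
    define y where "y n = norm (sec s k (\<lambda>t. 0) (G n))" for n
    have y0: "y \<longlonglongrightarrow> 0"
    proof -
      have "norm (y n) \<le> (4 * sqrt (2 * pi)) * ((real n + 2) ^ (k + 2) * exp (- H (real n)))" if n: "n \<ge> 1" for n
      proof -
        have Lp: "L n > 0" using Lge[OF n] exp_gt_zero[of "H (real n)"] by linarith
        have "2 / L n \<le> 4 * exp (- H (real n))" using Lge[OF n] Lp by (simp add: exp_minus field_simps)
        moreover have "y n = 2 / L n * norm (sec s k (\<lambda>t. 0) (tent n))"
        proof -
          have "sec s k (\<lambda>t. 0) (G n) = (2 / L n) *\<^sub>R sec s k (\<lambda>t. 0) (tent n)"
            unfolding G_def[abs_def] by (rule sec_scale2) (rule tent_props)
          then show ?thesis using Lp by (simp add: y_def)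
        qed
        ultimately have "y n \<le> (4 * exp (- H (real n))) * (sqrt (2 * pi) * (real n + 2) ^ (k + 2))"
          using tent_norm_le(2)[of s k n] Lp by (simp only:) (intro mult_mono; simp)
        moreover have "(4 * exp (- H (real n))) * (sqrt (2 * pi) * (real n + 2) ^ (k + 2))
          = (4 * sqrt (2 * pi)) * ((real n + 2) ^ (k + 2) * exp (- H (real n)))" by (simp only: mult_ac)
        moreover have "norm (y n) = y n" by (simp add: y_def)
        ultimately show ?thesis by (simp only:)
      qed
      then have "\<forall>\<^sub>F n in sequentially. norm (y n) \<le> (4 * sqrt (2 * pi)) * ((real n + 2) ^ (k + 2) * exp (- H (real n)))"
        by (intro eventually_sequentiallyI[of 1])
      moreover have "(\<lambda>n. (4 * sqrt (2 * pi)) * ((real n + 2) ^ (k + 2) * exp (- H (real n)))) \<longlonglongrightarrow> 0"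
        using tendsto_mult_right_zero[OF polynomial_times_exp_H] by blast
      ultimately show ?thesis by (rule Lim_null_comparison)
    qed
    then have "\<forall>\<^sub>F n in sequentially. y n < sqrt c0" using c0 order_tendstoD(2)[of y 0 sequentially "sqrt c0"] by simp
    then obtain n0 where n0: "\<And>n. n \<ge> n0 \<Longrightarrow> y n < sqrt c0" by (auto simp: eventually_sequentially)
    \<comment> \<open>A shift to indices that are at least 1 and beyond \<open>n0\<close>, so that
      the normalized images \<open>Y\<close> have norm at most 1 throughout.\<close>
    define m where "m n = n + n0 + 1" for n
    have m: "m n \<ge> 1" "m n \<ge> n0" for n by (simp_all add: m_def)
    define X Y where "X n = (1 / N (m n)) *\<^sub>R sec s k (\<alpha> (m n)) (\<lambda>t. 0)" and "Y n = (1 / N (m n)) *\<^sub>R sec s k (\<lambda>t. 0) (G (m n))" for n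
    have Np: "N (m n) > 0" for n using Nge[OF m(1)[of n]] c0 by (meson less_le_trans real_sqrt_gt_zero)
    have XY: "(X n, Y n) \<in> sector_graph s k" for n
      using subspace_scale[OF subspace_sector_graph mem[of "m n"], of "1 / N (m n)"] by (simp add: X_def Y_def)
    have nX: "norm (X n) = 1" for n using Np[of n] by (simp add: X_def N_def)
    have nY: "norm (Y n) = y (m n) / N (m n)" for n using Np[of n] by (simp add: Y_def y_def)
    have nY1: "norm (Y n) \<le> 1" for n
      using n0[OF m(2)[of n]] Nge[OF m(1)[of n]] Np[of n] by (simp add: nY)
    obtain r x where r: "strict_mono (r :: nat \<Rightarrow> nat)" "(\<lambda>n. X (r n)) \<longlonglongrightarrow> x"
      using cpt[of X Y] XY nX nY1 by (metis order_refl)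
    have "Y \<longlonglongrightarrow> 0"
    proof (rule Lim_null_comparison)
      show "\<forall>\<^sub>F n in sequentially. norm (Y n) \<le> y (n + (n0 + 1)) / sqrt c0"
      proof (intro always_eventually allI)
        fix n
        have "y (m n) / N (m n) \<le> y (m n) / sqrt c0"
          using Nge[OF m(1)[of n]] c0 Np[of n] by (intro divide_left_mono mult_pos_pos) (auto simp: y_def)
        then show "norm (Y n) \<le> y (n + (n0 + 1)) / sqrt c0" by (simp add: nY m_def add.assoc)
      qed
      show "(\<lambda>n. y (n + (n0 + 1)) / sqrt c0) \<longlonglongrightarrow> 0"
        using LIMSEQ_ignore_initial_segment[OF y0, of "n0 + 1"] tendsto_divide_zero by blast
    qed
    then have "(\<lambda>n. Y (r n)) \<longlonglongrightarrow> 0" using LIMSEQ_subseq_LIMSEQ[OF _ r(1), of Y 0] by (simp add: o_def)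
    with r(2) have "(\<lambda>n. (X (r n), Y (r n))) \<longlonglongrightarrow> (x, 0)" by (rule tendsto_Pair)
    then have "(x, 0) \<in> sector_graph s k"
      using closed_sequentially[of "sector_graph s k" "\<lambda>n. (X (r n), Y (r n))"] XY by (simp add: sector_graph_def)
    then have vx: "v \<bullet> x = 0" by (rule ker)
    \<comment> \<open>The pairings with \<open>X n\<close> stay above a fixed multiple of the
      modulus of \<open>C\<close>, although the limit \<open>x\<close> lies in the kernel, to which
      \<open>v\<close> is orthogonal.\<close>
    have "\<bar>C\<bar> * (sqrt c0 / pi) \<le> \<bar>v \<bullet> X n\<bar>" for n
    proof -
      have "v \<bullet> X n = C * l (\<alpha> (m n)) / N (m n)" by (simp add: X_def lin ca)
      moreover have "l (\<alpha> (m n)) / N (m n) \<ge> N (m n) / pi"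
        using lge[OF m(1)[of n]] Np[of n] by (simp add: N_def[symmetric] field_simps power2_eq_square)
      moreover have "N (m n) / pi \<ge> sqrt c0 / pi" using Nge[OF m(1)[of n]] by (simp add: divide_right_mono)
      ultimately have 1: "v \<bullet> X n = C * (l (\<alpha> (m n)) / N (m n))" and 2: "sqrt c0 / pi \<le> \<bar>l (\<alpha> (m n)) / N (m n)\<bar>"
        by (simp, linarith)
      show ?thesis unfolding 1 abs_mult[of C] using 2 by (rule mult_left_mono) simp
    qed
    moreover have "(\<lambda>n. \<bar>v \<bullet> X (r n)\<bar>) \<longlonglongrightarrow> \<bar>v \<bullet> x\<bar>" by (intro tendsto_intros r)
    ultimately have "\<bar>C\<bar> * (sqrt c0 / pi) \<le> \<bar>v \<bullet> x\<bar>" by (intro LIMSEQ_le_const) auto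
    then show ?thesis using vx c0 pi_gt_zero by (force simp: mult_le_0_iff divide_le_0_iff)
  qed
  have "v \<bullet> y = 0" if "y \<in> sector_space s k" for y
    using that unfolding sector_space_def
  proof (rule orthogonal_closure[rotated])
    fix y assume "y \<in> {sec s k \<alpha> \<beta> |\<alpha> \<beta>. ccont \<alpha> \<and> ccont \<beta>}"
    then obtain \<alpha> \<beta> where y: "y = sec s k \<alpha> \<beta>" "ccont \<alpha>" "ccont \<beta>" by blast
    have "y = sec s k \<alpha> (\<lambda>t. 0) + sec s k (\<lambda>t. 0) \<beta>" using sec_add[OF y(2) ccont_0 ccont_0 y(3)] y by simp
    then show "v \<bullet> y = 0" using lin[OF y(2)] v2[OF y(3)] C0 by (simp add: inner_add_right)
  qed
  then have "v \<bullet> v = 0" using v by blast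
  then show ?thesis by simp
qed

end

section \<open>Compactness in a sector\<close>

lemma ccont_integral_tail:
  assumes f: "ccont f" and R: "R \<ge> 0"
  shows "integral {0..} f = integral {0..R} f + integral {R..} f" "f integrable_on {0..R}" "f integrable_on {R..}"
proof -
  obtain S where S: "S > 0" "\<And>t. t \<ge> S \<Longrightarrow> f t = 0" using ccont_bound[OF f] by blast
  define T where "T = max R S"
  have T: "T \<ge> R" "T \<ge> 0" "\<And>t. t \<ge> T \<Longrightarrow> f t = 0" using R S by (auto simp: T_def)
  have i: "f integrable_on {a..b}" if "a \<ge> 0" for a b
    by (intro integrable_continuous_interval continuous_on_subset[OF ccontD[OF f]]) (use that in auto)
  show "f integrable_on {0..R}" using i[of 0 R] by simp
  have "(f has_integral integral {R..T} f) {R..T}" using i[of R T] R by (simp add: integrable_integral)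
  then have "((\<lambda>t. if t \<in> {R..T} then f t else 0) has_integral integral {R..T} f) UNIV"
    by (subst has_integral_restrict_UNIV)
  moreover have "(\<lambda>t. if t \<in> {R..T} then f t else 0) = (\<lambda>t. if t \<in> {R..} then f t else 0)"
    using T by (auto simp: fun_eq_iff)
  ultimately have "((\<lambda>t. if t \<in> {R..} then f t else 0) has_integral integral {R..T} f) UNIV" by simp
  then have h: "(f has_integral integral {R..T} f) {R..}" by (subst (asm) has_integral_restrict_UNIV)
  then show "f integrable_on {R..}" by (rule has_integral_integrable)
  have "integral {0..} f = integral {0..T} f" using T by (intro ccont_integral_eq[OF f]) auto
  also have "\<dots> = integral {0..R} f + integral {R..T} f"
    using T R i[of 0 T] by (intro Henstock_Kurzweil_Integration.integral_combine[symmetric]) auto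
  finally show "integral {0..} f = integral {0..R} f + integral {R..} f" using integral_unique[OF h] by simp
qed

text \<open>Pointwise bounds and equicontinuity at positive \<open>t\<close> give a subsequence that
  converges at the rationals and then at every \<open>t > 0\<close>; domination by \<open>G\<close>
  turns this into convergence of the weighted integrals over \<open>[0, R]\<close>, and the tails
  are uniformly small. The factor \<open>t^i\<close> is present because for \<open>\<beta>\<close>
  the controlled derivative is that of \<open>t^(k+1) \<beta>\<close>.\<close>

lemma rellich_subsequence:
  fixes f :: "nat \<Rightarrow> real \<Rightarrow> real"
  assumes f: "\<And>n. ccont (f n)"
    and equi: "\<And>t \<epsilon>. t > 0 \<Longrightarrow> \<epsilon> > 0 \<Longrightarrow> \<exists>\<delta>>0. \<forall>n s. s > 0 \<longrightarrow> \<bar>s - t\<bar> < \<delta> \<longrightarrow> \<bar>s ^ i * f n s - t ^ i * f n t\<bar> \<le> \<epsilon>"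
    and G: "\<And>n t. t > 0 \<Longrightarrow> t ^ j * (f n t)\<^sup>2 \<le> G t" "\<And>R. G integrable_on {0..R}"
    and tail: "\<And>\<epsilon>. \<epsilon> > 0 \<Longrightarrow> \<exists>R>0. \<forall>n. integral {R..} (\<lambda>t. t ^ j * (f n t)\<^sup>2) \<le> \<epsilon>"
  obtains r where "strict_mono (r :: nat \<Rightarrow> nat)"
    "\<And>\<epsilon>. \<epsilon> > 0 \<Longrightarrow> \<exists>N. \<forall>m\<ge>N. \<forall>n\<ge>N. integral {0..} (\<lambda>t. t ^ j * (f (r m) t - f (r n) t)\<^sup>2) < \<epsilon>"
proof -
  have pb: "\<bar>t ^ i * f n t\<bar> \<le> t ^ i * sqrt (G t / t ^ j)" if t: "t > 0" for t n
  proof -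
    have "(f n t)\<^sup>2 \<le> G t / t ^ j" using G(1)[OF t, of n] t by (simp add: field_simps)
    then have "\<bar>f n t\<bar> \<le> sqrt (G t / t ^ j)" by (metis real_sqrt_abs real_sqrt_le_mono)
    then show ?thesis using t by (simp add: abs_mult)
  qed
  \<comment> \<open>Dividing by the pointwise bound makes all functions bounded by 1, the form in
    which the diagonal selection is applied; the summand 1 avoids division by 0.\<close>
  define M where "M t = t ^ i * sqrt (G t / t ^ j) + 1" for t
  define g where "g n t = t ^ i * f n t / M t" for n t
  have Mp: "M t \<ge> 1" if t: "t > 0" for t using pb[OF t, of 0] by (simp add: M_def)
  have gb: "norm (g n t) \<le> 1" if t: "t > 0" for n t
    using pb[OF t, of n] Mp[OF t] by (simp add: g_def abs_mult M_def field_simps)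
  obtain r where r: "strict_mono (r :: nat \<Rightarrow> nat)" "\<And>q. q \<in> \<rat> \<inter> {0<..} \<Longrightarrow> \<exists>l. (\<lambda>n. g (r n) q) \<longlonglongrightarrow> l"
  proof (rule function_convergent_subsequence[of "\<rat> \<inter> {0<..}" g 1])
    show "countable (\<rat> \<inter> {0::real<..})" using countable_rat by blast
  qed (use gb in auto)
  have Cauchy: "Cauchy (\<lambda>n. t ^ i * f (r n) t)" if t: "t > 0" for t
  proof (rule CauchyI)
    fix \<epsilon> :: real assume \<epsilon>: "\<epsilon> > 0"
    obtain \<delta> where \<delta>: "\<delta> > 0" "\<And>n s. s > 0 \<Longrightarrow> \<bar>s - t\<bar> < \<delta> \<Longrightarrow> \<bar>s ^ i * f n s - t ^ i * f n t\<bar> \<le> \<epsilon> / 4"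
      using equi[OF t, of "\<epsilon> / 4"] \<epsilon> by auto
    obtain q where q: "q \<in> \<rat>" "t < q" "q < t + \<delta>" using Rats_dense_in_real[of t "t + \<delta>"] \<delta> by auto
    then have q0: "q > 0" using t by simp
    obtain l where "(\<lambda>n. g (r n) q) \<longlonglongrightarrow> l" using r(2)[of q] q q0 by auto
    then have "(\<lambda>n. M q * g (r n) q) \<longlonglongrightarrow> M q * l" by (intro tendsto_intros)
    then have "(\<lambda>n. q ^ i * f (r n) q) \<longlonglongrightarrow> M q * l" using Mp[OF q0] by (simp add: g_def)
    then have "Cauchy (\<lambda>n. q ^ i * f (r n) q)" using convergent_Cauchy convergent_def by blast
    then obtain N where N: "\<And>m n. m \<ge> N \<Longrightarrow> n \<ge> N \<Longrightarrow> norm (q ^ i * f (r m) q - q ^ i * f (r n) q) < \<epsilon> / 4"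
      using CauchyD[of _ "\<epsilon> / 4"] \<epsilon> by (metis zero_less_divide_iff zero_less_numeral)
    have "norm (t ^ i * f (r m) t - t ^ i * f (r n) t) < \<epsilon>" if "m \<ge> N" "n \<ge> N" for m n
      using N[OF that] \<delta>(2)[OF q0, of "r m"] \<delta>(2)[OF q0, of "r n"] q \<epsilon> by (simp add: abs_if split: if_splits)
    then show "\<exists>M. \<forall>m\<ge>M. \<forall>n\<ge>M. norm (t ^ i * f (r m) t - t ^ i * f (r n) t) < \<epsilon>" by blast
  qed
  have ex: "\<exists>l. (\<lambda>n. f (r n) t) \<longlonglongrightarrow> l" if t: "t > 0" for t
  proof -
    obtain l where "(\<lambda>n. t ^ i * f (r n) t) \<longlonglongrightarrow> l" using Cauchy_convergent[OF Cauchy[OF t]] convergent_def by blast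
    then have "(\<lambda>n. t ^ i * f (r n) t / t ^ i) \<longlonglongrightarrow> l / t ^ i" using t by (intro tendsto_intros) auto
    then show ?thesis using t by auto
  qed
  have cd: "ccont (\<lambda>t. t ^ j * (f m t - f n t)\<^sup>2)" for m n
    by (intro ccont_mult ccont_power2 ccont_diff f continuous_intros)
  have cs: "ccont (\<lambda>t. t ^ j * (f m t)\<^sup>2)" for m by (intro ccont_mult ccont_power2 f continuous_intros)
  have sq: "(a - b)\<^sup>2 \<le> 2 * a\<^sup>2 + 2 * b\<^sup>2" for a b :: real
    using sum_squares_bound[of a "- b"] by (simp add: power2_diff)
  have sqj: "t ^ j * (f m t - f n t)\<^sup>2 \<le> 2 * (t ^ j * (f m t)\<^sup>2) + 2 * (t ^ j * (f n t)\<^sup>2)" if "t \<ge> 0" for t m n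
    using mult_left_mono[OF sq[of "f m t" "f n t"], of "t ^ j"] that by (simp add: algebra_simps)
  have "\<exists>N. \<forall>m\<ge>N. \<forall>n\<ge>N. integral {0..} (\<lambda>t. t ^ j * (f (r m) t - f (r n) t)\<^sup>2) < \<epsilon>" if \<epsilon>: "\<epsilon> > 0" for \<epsilon>
  proof (rule ccontr)
    assume "\<not> ?thesis"
    then have "\<forall>N. \<exists>m n. m \<ge> N \<and> n \<ge> N \<and> \<epsilon> \<le> integral {0..} (\<lambda>t. t ^ j * (f (r m) t - f (r n) t)\<^sup>2)"
      by (auto simp: not_less)
    then obtain m n where mn: "\<And>N. m N \<ge> N" "\<And>N. n N \<ge> N"
      "\<And>N. \<epsilon> \<le> integral {0..} (\<lambda>t. t ^ j * (f (r (m N)) t - f (r (n N)) t)\<^sup>2)" by metis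
    \<comment> \<open>As \<open>(a - b)^2 <= 2 a^2 + 2 b^2\<close>, two tails of size
      \<open>\<epsilon> / 16\<close> contribute at most \<open>\<epsilon> / 4\<close>, so
      \<open>3 \<epsilon> / 4\<close> must remain on \<open>[0, R]\<close>.\<close>
    obtain R where R: "R > 0" "\<And>n. integral {R..} (\<lambda>t. t ^ j * (f n t)\<^sup>2) \<le> \<epsilon> / 16"
      using tail[of "\<epsilon> / 16"] \<epsilon> by auto
    let ?d = "\<lambda>N t. t ^ j * (f (r (m N)) t - f (r (n N)) t)\<^sup>2"
    have low: "3 * \<epsilon> / 4 \<le> integral {0..R} (?d N)" for N
    proof -
      have "integral {R..} (?d N) \<le> integral {R..} (\<lambda>t. 2 * (t ^ j * (f (r (m N)) t)\<^sup>2) + 2 * (t ^ j * (f (r (n N)) t)\<^sup>2))"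
      proof (rule integral_le)
        show "?d N integrable_on {R..}" using ccont_integral_tail(3)[OF cd] R by simp
        show "(\<lambda>t. 2 * (t ^ j * (f (r (m N)) t)\<^sup>2) + 2 * (t ^ j * (f (r (n N)) t)\<^sup>2)) integrable_on {R..}"
          using ccont_integral_tail(3)[OF ccont_add[OF ccont_cmult[OF cs] ccont_cmult[OF cs]]] R by simp
      qed (use sqj R in auto)
      also have "\<dots> = 2 * integral {R..} (\<lambda>t. t ^ j * (f (r (m N)) t)\<^sup>2) + 2 * integral {R..} (\<lambda>t. t ^ j * (f (r (n N)) t)\<^sup>2)"
        using ccont_integral_tail(3)[OF ccont_cmult[OF cs]] ccont_integral_tail(3)[OF cs] R
        by (subst Henstock_Kurzweil_Integration.integral_add) auto
      also have "\<dots> \<le> \<epsilon> / 4" using R(2)[of "r (m N)"] R(2)[of "r (n N)"] by simp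
      finally have "integral {R..} (?d N) \<le> \<epsilon> / 4" .
      moreover have "integral {0..} (?d N) = integral {0..R} (?d N) + integral {R..} (?d N)"
        using ccont_integral_tail(1)[OF cd] R by simp
      ultimately show ?thesis using mn(3)[of N] by simp
    qed
    \<comment> \<open>The bound \<open>G\<close> says nothing at \<open>t = 0\<close>; setting the
      integrand to 0 there does not change the integral.\<close>
    let ?z = "\<lambda>N t. if t = 0 then 0 else ?d N t"
    have eq0: "integral {0..R} (?z N) = integral {0..R} (?d N)" for N
      by (rule integral_spike[of "{0}"]) auto
    have "(\<lambda>N. integral {0..R} (?z N)) \<longlonglongrightarrow> integral {0..R} (\<lambda>t. 0)"
    proof (rule dominated_convergence(2))
      fix N
      have "(\<lambda>t. t ^ j * (f (r (m N)) t - f (r (n N)) t)\<^sup>2) integrable_on {0..R}"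
        by (rule ccont_integral_tail(2)[OF cd less_imp_le[OF R(1)]])
      then show "?z N integrable_on {0..R}" by (rule integrable_spike[where S = "{0}"]) auto
    next
      show "(\<lambda>t. \<bar>4 * G t\<bar> ) integrable_on {0..R}"
      proof -
        have "(\<lambda>t. 4 * G t) integrable_on {0..R}" using integrable_cmul[OF G(2), of 4 R] by simp
        then have "(\<lambda>t. if t = 0 then 0 else 4 * G t) integrable_on {0..R}" by (rule integrable_spike[where S = "{0}"]) auto
        then have "(\<lambda>t. if t = 0 then 0 else 4 * G t) absolutely_integrable_on {0..R}"
          using G(1) by (intro nonnegative_absolutely_integrable_1) (auto intro: order_trans[rotated, OF G(1)])
        then have "(\<lambda>t. \<bar>if t = 0 then 0 else 4 * G t\<bar>) integrable_on {0..R}"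
          unfolding absolutely_integrable_on_def by simp
        then show ?thesis by (rule integrable_spike[where S = "{0}"]) auto
      qed
    next
      fix N t assume t: "t \<in> {0..R}"
      show "norm (?z N t) \<le> \<bar>4 * G t\<bar>"
      proof (cases "t = 0")
        case False
        then have "t > 0" using t by simp
        then have "?d N t \<le> 4 * G t" using sqj[of t "r (m N)" "r (n N)"] G(1)[of t "r (m N)"] G(1)[of t "r (n N)"] by linarith
        moreover have "0 \<le> ?d N t" using t by simp
        ultimately show ?thesis using False by simp
      qed simp
    next
      fix t assume t: "t \<in> {0..R}"
      show "(\<lambda>N. ?z N t) \<longlonglongrightarrow> 0"
        proof (cases "t = 0")
          case False
          then obtain l where l: "(\<lambda>n. f (r n) t) \<longlonglongrightarrow> l" using ex[of t] t by auto
          have "filterlim m at_top sequentially" "filterlim n at_top sequentially"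
            using mn by (auto intro!: filterlim_at_top_mono[OF filterlim_ident] always_eventually)
          then have "(\<lambda>N. f (r (m N)) t) \<longlonglongrightarrow> l" "(\<lambda>N. f (r (n N)) t) \<longlonglongrightarrow> l"
            using filterlim_compose[OF l] by blast+
          then have "(\<lambda>N. ?d N t) \<longlonglongrightarrow> t ^ j * (l - l)\<^sup>2" by (intro tendsto_intros)
          then show ?thesis using False by simp
        qed simp
    qed
    then have "(\<lambda>N. integral {0..R} (?d N)) \<longlonglongrightarrow> 0" unfolding eq0 by simp
    then have "3 * \<epsilon> / 4 \<le> 0" by (rule LIMSEQ_le_const) (use low in blast)
    then show False using \<epsilon> by simp
  qed
  then show thesis using that r(1) by blast
qed

text \<open>Young's inequality \<open>|g'| <= \<eta> g'^2 + 1 / \<eta>\<close> is integrated, with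
  \<open>g'^2\<close> bounded by the energy density. The free parameter \<open>\<eta>\<close> does
  the work of Cauchy-Schwarz.\<close>

lemma equicontinuity_estimate:
  fixes g g' e :: "real \<Rightarrow> real"
  assumes ab: "a \<le> b" and g: "\<And>u. a \<le> u \<Longrightarrow> u \<le> b \<Longrightarrow> (g has_real_derivative g' u) (at u)"
    and e: "e integrable_on {a..b}" "integral {a..b} e \<le> C" "\<And>u. a \<le> u \<Longrightarrow> u \<le> b \<Longrightarrow> (g' u)\<^sup>2 \<le> w * e u"
    and w: "w \<ge> 0" and \<eta>: "\<eta> > 0"
  shows "\<bar>g b - g a\<bar> \<le> \<eta> * w * C + (b - a) / \<eta>"
proof -
  have hi: "(g' has_integral (g b - g a)) {a..b}"
    using g by (intro fundamental_theorem_of_calculus[OF ab])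
      (auto simp: has_real_derivative_iff_has_vector_derivative[symmetric] intro: has_field_derivative_at_within)
  have i: "(\<lambda>u. \<eta> * w * e u + 1 / \<eta>) integrable_on {a..b}"
    by (rule integrable_add[OF integrable_on_mult_right[OF e(1)]]) auto
  have pt: "\<bar>g' u\<bar> \<le> \<eta> * w * e u + 1 / \<eta>" if u: "u \<in> {a..b}" for u
  proof -
    have "0 \<le> (sqrt \<eta> * \<bar>g' u\<bar> - 1 / sqrt \<eta>)\<^sup>2" by simp
    also have "\<dots> = \<eta> * (g' u)\<^sup>2 + 1 / \<eta> - 2 * \<bar>g' u\<bar>" using \<eta> by (simp add: power2_diff power_mult_distrib power_divide)
    also have "\<eta> * (g' u)\<^sup>2 \<le> \<eta> * (w * e u)" using e(3)[of u] u \<eta> by (intro mult_left_mono) auto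
    finally show ?thesis by (simp add: mult.assoc) 
  qed
  have I: "integral {a..b} (\<lambda>u. \<eta> * w * e u + 1 / \<eta>) = \<eta> * w * integral {a..b} e + (b - a) / \<eta>"
    using ab by (subst Henstock_Kurzweil_Integration.integral_add[OF integrable_on_mult_right[OF e(1)]]) auto
  have "norm (integral {a..b} g') \<le> integral {a..b} (\<lambda>u. \<eta> * w * e u + 1 / \<eta>)"
    using hi pt by (intro integral_norm_bound_integral i) (auto simp: has_integral_integrable)
  then have "\<bar>g b - g a\<bar> \<le> \<eta> * w * integral {a..b} e + (b - a) / \<eta>"
    unfolding I using integral_unique[OF hi] by simp
  also have "\<dots> \<le> \<eta> * w * C + (b - a) / \<eta>" using e(2) w \<eta> by (intro add_right_mono mult_left_mono) auto
  finally show ?thesis .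
qed

lemma two_sided_equicontinuity:
  fixes g g' e :: "nat \<Rightarrow> real \<Rightarrow> real"
  assumes g: "\<And>n u. u > 0 \<Longrightarrow> (g n has_real_derivative g' n u) (at u)"
    and e: "\<And>n. ccont (e n)" "\<And>n u. u \<ge> 0 \<Longrightarrow> e n u \<ge> 0" "\<And>n. integral {0..} (e n) \<le> C"
    and w: "w \<ge> 0" "\<And>n u. t / 2 \<le> u \<Longrightarrow> u \<le> 2 * t \<Longrightarrow> (g' n u)\<^sup>2 \<le> w * e n u"
    and t: "t > 0" and \<epsilon>: "\<epsilon> > 0"
  shows "\<exists>\<delta>>0. \<forall>n s. s > 0 \<longrightarrow> \<bar>s - t\<bar> < \<delta> \<longrightarrow> \<bar>g n s - g n t\<bar> \<le> \<epsilon>"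
proof -
  have C0: "C \<ge> 0"
    using order_trans[OF integral_nonneg[OF ccont_integrable[OF e(1)[of 0]]] e(3)] e(2) by simp
  \<comment> \<open>This makes the energy term at most \<open>\<epsilon> / 2\<close>; the added 1
    covers the case \<open>w * C = 0\<close>. The choice of \<open>\<delta>\<close> settles the
    other half and keeps both points between \<open>t / 2\<close> and \<open>2 t\<close>.\<close>
  define \<eta> where "\<eta> = \<epsilon> / (2 * (w * C + 1))"
  have p: "w * C + 1 > 0" using w C0 by (simp add: add_nonneg_pos)
  have \<eta>: "\<eta> > 0" using \<epsilon> p by (simp add: \<eta>_def)
  define \<delta> where "\<delta> = min (t / 2) (\<eta> * \<epsilon> / 2)"
  have main: "\<bar>g n b - g n a\<bar> \<le> \<epsilon>" if ab: "a \<le> b" "t / 2 \<le> a" "b \<le> 2 * t" "b - a \<le> \<delta>" for n a b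
  proof -
    have i: "e n integrable_on {a..b}"
      by (intro integrable_continuous_interval continuous_on_subset[OF ccontD[OF e(1)]]) (use ab t in auto)
    have "integral {a..b} (e n) \<le> integral {0..} (e n)"
      using ab t by (intro integral_subset_le i ccont_integrable e(1)) (auto intro!: e(2))
    then have "\<bar>g n b - g n a\<bar> \<le> \<eta> * w * C + (b - a) / \<eta>"
      using ab t e(3)[of n] by (intro equicontinuity_estimate[where e = "e n" and g' = "g' n"] g i w \<eta>) auto
    also have "\<eta> * w * C \<le> \<epsilon> / 2"
    proof -
      have "\<eta> * (w * C) \<le> \<eta> * (w * C + 1)" using \<eta> by (intro mult_left_mono) auto
      also have "\<dots> = \<epsilon> / 2"
      proof -
        have "\<epsilon> / (2 * D) * D = \<epsilon> / 2" if "D > 0" for D using that by (simp add: field_simps)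
        then show ?thesis unfolding \<eta>_def using p by blast
      qed
      finally show ?thesis by (simp add: mult.assoc)
    qed
    also have "(b - a) / \<eta> \<le> (\<eta> * \<epsilon> / 2) / \<eta>" using ab \<eta> by (intro divide_right_mono) (auto simp: \<delta>_def)
    also have "(\<eta> * \<epsilon> / 2) / \<eta> = \<epsilon> / 2" using \<eta> by simp
    finally show ?thesis by simp
  qed
  show ?thesis
  proof (intro exI[of _ \<delta>] conjI allI impI)
    show "\<delta> > 0" using t \<eta> \<epsilon> by (simp add: \<delta>_def)
    fix n s assume s: "s > 0" "\<bar>s - t\<bar> < \<delta>"
    have "\<delta> \<le> t / 2" by (simp add: \<delta>_def)
    then show "\<bar>g n s - g n t\<bar> \<le> \<epsilon>"
      using main[of t s n] main[of s t n] s t by (cases "s \<le> t") (auto simp: abs_minus_commute)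
  qed
qed

lemma integrable_inverse_sqrt:
  "(\<lambda>t::real. B * (1 + t powr (- 1/2))) integrable_on {0..R}"
proof (cases "R \<ge> 0")
  case True
  have "(\<lambda>t::real. t powr (- 1/2)) integrable_on {0..R}"
    using has_integral_powr_from_0[of "- 1/2" R] True by (auto simp: has_integral_integrable)
  then show ?thesis by (intro integrable_on_mult_right integrable_add) auto
qed (simp add: integrable_on_empty)

text \<open>This is \<open>t\<close> times the derivative of the field strength; the derivative itself is unbounded at \<open>0\<close>.\<close>

definition scaled_field_deriv :: "real \<Rightarrow> real \<Rightarrow> real" where
  "scaled_field_deriv \<gamma> t = - (\<gamma> / 2) * (sqrt t * (1 + sqrt t) powr (- \<gamma> - 1))"

lemma field_strength_deriv:
  assumes "t > 0"
  shows "(field_strength \<gamma> has_real_derivative scaled_field_deriv \<gamma> t / t) (at t)"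
proof -
  have p: "1 + sqrt t > 0" using assms by (simp add: add_pos_pos)
  have "((\<lambda>t. 1 + sqrt t) has_real_derivative inverse (sqrt t) / 2) (at t)"
    using assms by (auto intro!: derivative_eq_intros)
  from DERIV_fun_powr[OF this p, of "- \<gamma>"]
  have "((\<lambda>t. (1 + sqrt t) powr (- \<gamma>)) has_real_derivative - \<gamma> * (1 + sqrt t) powr (- \<gamma> - 1) * (inverse (sqrt t) / 2)) (at t)"
    by simp
  moreover have "- \<gamma> * (1 + sqrt t) powr (- \<gamma> - 1) * (inverse (sqrt t) / 2) = scaled_field_deriv \<gamma> t / t"
  proof -
    have "inverse (sqrt t) = sqrt t / t" using assms by (simp add: inverse_eq_divide real_div_sqrt field_simps)
    then show ?thesis by (simp add: scaled_field_deriv_def mult_ac)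
  qed
  ultimately show ?thesis by (simp add: field_strength_def[abs_def])
qed

lemma scaled_field_deriv_bound:
  assumes "0 < \<gamma>" "\<gamma> < 1" "t \<ge> 0"
  shows "\<bar>scaled_field_deriv \<gamma> t\<bar> \<le> 1"
proof -
  have p: "1 + sqrt t > 0" using assms by (simp add: add_pos_nonneg)
  have "sqrt t * (1 + sqrt t) powr (- \<gamma> - 1) \<le> (1 + sqrt t) powr 1 * (1 + sqrt t) powr (- \<gamma> - 1)"
    using p by (intro mult_right_mono) auto
  also have "\<dots> = field_strength \<gamma> t" by (subst powr_add[symmetric]) (simp add: field_strength_def)
  also have "\<dots> \<le> 1" using field_strength_bounds assms by blast
  finally have 1: "sqrt t * (1 + sqrt t) powr (- \<gamma> - 1) \<le> 1" .
  have 0: "0 \<le> sqrt t * (1 + sqrt t) powr (- \<gamma> - 1)" using assms by simp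
  have "\<bar>scaled_field_deriv \<gamma> t\<bar> = (\<gamma> / 2) * (sqrt t * (1 + sqrt t) powr (- \<gamma> - 1))"
    unfolding scaled_field_deriv_def abs_mult using 0 assms by simp
  also have "\<dots> \<le> 1 * 1" using 0 1 assms by (intro mult_mono) auto
  finally show ?thesis by simp
qed

lemma continuous_on_scaled_field_deriv: "continuous_on {0..} (scaled_field_deriv \<gamma>)"
  unfolding scaled_field_deriv_def[abs_def] by (intro continuous_intros) (auto simp: add_nonneg_eq_0_iff)

section \<open>Confining weight and energy identities\<close>

text \<open>For \<open>t >= 1\<close> one has \<open>1 + sqrt t <= 2 sqrt t\<close>, so the weight
  is at least \<open>t (4 t) powr (- \<gamma>)\<close>, hence at least
  \<open>t powr (1 - \<gamma>) / 4\<close>. The radius \<open>R\<close> solves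
  \<open>R powr (1 - \<gamma>) = 4 |M| + 1\<close>.\<close>

lemma weight_unbounded:
  assumes "0 < \<gamma>" "\<gamma> < 1"
  shows "\<exists>R>0. \<forall>t\<ge>R. M \<le> t * (field_strength \<gamma> t)\<^sup>2"
proof -
  define R where "R = (4 * \<bar>M\<bar> + 1) powr (1 / (1 - \<gamma>))"
  have R: "4 * M \<le> t powr (1 - \<gamma>)" if "t \<ge> R" for t
  proof -
    have "R powr (1 - \<gamma>) = 4 * \<bar>M\<bar> + 1" using assms by (simp add: R_def powr_powr)
    moreover have "R powr (1 - \<gamma>) \<le> t powr (1 - \<gamma>)" using that assms by (intro powr_mono2) (auto simp: R_def)
    ultimately show ?thesis by linarith
  qed
  have "M \<le> t * (field_strength \<gamma> t)\<^sup>2" if t: "t \<ge> max R 1" for t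
  proof -
    have t1: "t \<ge> 1" using t by simp
    have p: "1 + sqrt t > 0" using t1 by (simp add: add_pos_nonneg)
    have "1 + sqrt t \<le> 2 * sqrt t" using t1 by simp
    then have "(1 + sqrt t)\<^sup>2 \<le> (2 * sqrt t)\<^sup>2" using p by (intro power_mono) auto
    then have "(1 + sqrt t)\<^sup>2 \<le> 4 * t" using t1 by (simp add: power_mult_distrib)
    then have "(4 * t) powr (- \<gamma>) \<le> ((1 + sqrt t)\<^sup>2) powr (- \<gamma>)" using p assms by (intro powr_mono2') auto
    also have "\<dots> = (field_strength \<gamma> t)\<^sup>2" using p by (simp add: field_strength_def power2_eq_square powr_mult)
    finally have 1: "(4 * t) powr (- \<gamma>) \<le> (field_strength \<gamma> t)\<^sup>2" .
    have "(1/4) * t powr (1 - \<gamma>) \<le> t * (4 * t) powr (- \<gamma>)"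
    proof -
      have "4 powr (- 1) \<le> (4::real) powr (- \<gamma>)" using assms by (intro powr_mono) auto
      then have "(1/4) * t powr (1 - \<gamma>) \<le> 4 powr (- \<gamma>) * t powr (1 - \<gamma>)"
        by (intro mult_right_mono) (simp_all add: powr_minus)
      moreover have "t * (4 * t) powr (- \<gamma>) = 4 powr (- \<gamma>) * t powr (1 - \<gamma>)"
        using t1 by (simp add: powr_mult powr_diff powr_minus divide_inverse mult_ac)
      ultimately show ?thesis by linarith
    qed
    also have "\<dots> \<le> t * (field_strength \<gamma> t)\<^sup>2" using 1 t1 by (intro mult_left_mono) auto
    finally show ?thesis using R[of t] t by simp
  qed
  then show ?thesis by (intro exI[of _ "max R 1"]) auto
qed

text \<open>Chebyshev's inequality for the weight \<open>W\<close>: where it exceeds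
  \<open>M\<close>, the mass of \<open>f\<close> is at most \<open>1 / M\<close> of the weighted
  mass.\<close>

lemma tail_estimate:
  assumes f: "ccont f" "\<And>t. t \<ge> 0 \<Longrightarrow> f t \<ge> 0" and W: "continuous_on {0..} W" "\<And>t. t \<ge> 0 \<Longrightarrow> W t \<ge> 0"
    and b: "integral {0..} (\<lambda>t. W t * f t) \<le> C" and R: "R > 0" "\<And>t. t \<ge> R \<Longrightarrow> M \<le> W t" and M: "M > 0"
  shows "integral {R..} f \<le> C / M"
proof -
  have c: "ccont (\<lambda>t. W t * f t)" by (intro ccont_mult f W)
  have "M * integral {R..} f = integral {R..} (\<lambda>t. M * f t)" by simp
  also have "\<dots> \<le> integral {R..} (\<lambda>t. W t * f t)"
    using ccont_integral_tail(3)[OF ccont_cmult[OF f(1)], of R M] ccont_integral_tail(3)[OF c, of R] R f(2)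
    by (intro integral_le) (auto intro: mult_right_mono)
  also have "\<dots> \<le> integral {0..} (\<lambda>t. W t * f t)"
    using ccont_integral_tail(3)[OF c, of R] R f W by (intro integral_subset_le ccont_integrable c) auto
  finally show ?thesis using b M by (simp add: field_simps)
qed

lemma integral_derivative_zero:
  fixes \<Phi> :: "real \<Rightarrow> real"
  assumes \<Phi>: "continuous_on {0..} \<Phi>" "\<Phi> 0 = 0" "\<And>t. t \<ge> R \<Longrightarrow> \<Phi> t = 0"
    and d: "\<And>t. t > 0 \<Longrightarrow> (\<Phi> has_real_derivative \<Phi>' t) (at t)" and c: "ccont \<Phi>'"
  shows "integral {0..} \<Phi>' = 0"
proof -
  obtain S where S: "S > 0" "\<And>t. t \<ge> S \<Longrightarrow> \<Phi>' t = 0" using ccont_bound[OF c] by blast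
  define T where "T = max R S"
  have T: "T \<ge> R" "T \<ge> S" "T \<ge> 0" using S by (auto simp: T_def)
  have "(\<Phi>' has_integral (\<Phi> T - \<Phi> 0)) {0..T}"
    using T d by (intro fundamental_theorem_of_calculus_interior continuous_on_subset[OF \<Phi>(1)])
      (auto simp: has_real_derivative_iff_has_vector_derivative[symmetric])
  then have "integral {0..T} \<Phi>' = 0" using \<Phi>(2) \<Phi>(3)[OF T(1)] by (simp add: integral_unique)
  then show ?thesis using ccont_integral_eq[OF c T(3)] S T by auto
qed

text \<open>The intended \<open>\<Psi>\<close> is the exact derivative of a compactly supported
  function and drops out after integration.\<close>

lemma energy_from_identity:
  assumes c: "ccont E" "ccont P" "ccont \<Psi>" "ccont Q" and z: "integral {0..} \<Psi> = 0"
    and le: "\<And>t. t \<ge> 0 \<Longrightarrow> E t \<le> P t - \<Psi> t + z * Q t"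
  shows "integral {0..} E \<le> integral {0..} P + z * integral {0..} Q"
proof -
  note i = ccont_integrable[OF c(1)] ccont_integrable[OF c(2)] ccont_integrable[OF c(3)] ccont_integrable[OF c(4)]
  have "integral {0..} E \<le> integral {0..} (\<lambda>t. P t - \<Psi> t + z * Q t)"
    using le c by (intro integral_le ccont_integrable ccont_add ccont_diff ccont_cmult) auto
  also have "\<dots> = integral {0..} (\<lambda>t. P t - \<Psi> t) + integral {0..} (\<lambda>t. z * Q t)"
    using c by (intro Henstock_Kurzweil_Integration.integral_add ccont_integrable ccont_diff ccont_cmult)
  also have "integral {0..} (\<lambda>t. P t - \<Psi> t) = integral {0..} P - integral {0..} \<Psi>"
    by (intro Henstock_Kurzweil_Integration.integral_diff i)
  finally show ?thesis using z by simp
qed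

lemma bounded_sgn_mult: "\<bar>x\<bar> \<le> z \<Longrightarrow> q \<ge> 0 \<Longrightarrow> - (sgn_sector s * x * q) \<le> z * q"
proof -
  assume x: "\<bar>x\<bar> \<le> z" "q \<ge> 0"
  have "- (sgn_sector s * x) \<le> z" using x by (auto simp: sgn_sector_def abs_le_iff)
  then have "- (sgn_sector s * x) * q \<le> z * q" using x by (intro mult_right_mono)
  then show ?thesis by simp
qed

context magnetic_dirac_setting
begin

text \<open>Expand the square of \<open>2 \<sigma> \<alpha>' - a \<alpha>\<close> with weight
  \<open>t^(k+1)\<close>, where \<open>a\<close> is \<open>field_strength\<close>. Up to
  \<open>2 \<sigma> m t^k \<alpha>^2\<close> the cross term is the derivative of
  \<open>\<Phi> = -2 \<sigma> a t^(k+1) \<alpha>^2\<close>, which integrates to 0. Here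
  \<open>m = t a' + (k + 1) a\<close> is bounded by \<open>k + 2\<close>, so the term of indefinite
  sign is absorbed by the norm of \<open>\<alpha>\<close>.\<close>

lemma alpha_energy:
  assumes \<alpha>: "c1 \<alpha> \<alpha>'"
  shows "integral {0..} (\<lambda>t. 4 * (t ^ (k + 1) * (\<alpha>' t)\<^sup>2) + t * (field_strength \<gamma> t)\<^sup>2 * (t ^ k * (\<alpha> t)\<^sup>2))
    \<le> integral {0..} (\<lambda>t. t ^ (k + 1) * (sector_dirac2 \<gamma> s \<alpha> \<alpha>' t)\<^sup>2) + 2 * (real k + 2) * integral {0..} (\<lambda>t. t ^ k * (\<alpha> t)\<^sup>2)"
proof -
  let ?a = "field_strength \<gamma>" and ?\<sigma> = "sgn_sector s"
  note ca = c1D(2)[OF \<alpha>] and ca' = c1D(3)[OF \<alpha>]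
  note cI = ccont_add ccont_diff ccont_cmult ccont_power2 ca ca' ccont_sector_dirac2
  define m where "m t = scaled_field_deriv \<gamma> t + (real k + 1) * ?a t" for t
  define \<Phi> where "\<Phi> t = - 2 * ?\<sigma> * (?a t * t ^ (k + 1) * (\<alpha> t)\<^sup>2)" for t
  define \<Phi>' where "\<Phi>' t = - 2 * ?\<sigma> * (m t * t ^ k * (\<alpha> t)\<^sup>2 + ?a t * t ^ (k + 1) * (2 * (\<alpha>' t * \<alpha> t)))" for t
  have cm: "continuous_on {0..} m" unfolding m_def[abs_def]
    by (intro continuous_intros continuous_on_scaled_field_deriv continuous_on_field_strength)
  have c\<Phi>: "ccont \<Phi>" unfolding \<Phi>_def[abs_def] by (intro ccont_cmult ccont_mult ccont_power2 ca continuous_intros continuous_on_field_strength)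
  have c\<Phi>': "ccont \<Phi>'" unfolding \<Phi>'_def[abs_def]
    by (intro ccont_cmult ccont_add ccont_mult ccont_power2 ca ca' continuous_intros cm continuous_on_field_strength ccontD)
  obtain R where R: "\<And>t. t \<ge> R \<Longrightarrow> \<Phi> t = 0" using ccont_bound[OF c\<Phi>] by blast
  have zero: "integral {0..} \<Phi>' = 0"
  proof (rule integral_derivative_zero[OF ccontD[OF c\<Phi>] _ R _ c\<Phi>'])
    fix t :: real assume t: "t > 0"
    have p: "((\<lambda>t. t ^ (k + 1)) has_real_derivative (real k + 1) * t ^ k) (at t)"
      using DERIV_pow[of "k + 1" t UNIV] by (simp add: add.commute)
    have q: "((\<lambda>t. (\<alpha> t)\<^sup>2) has_real_derivative 2 * (\<alpha>' t * \<alpha> t)) (at t)"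
      using DERIV_power[OF c1D_at[OF \<alpha> t], of 2] by simp
    have D: "(\<Phi> has_real_derivative - 2 * ?\<sigma> * ((scaled_field_deriv \<gamma> t / t * t ^ (k + 1) + (real k + 1) * t ^ k * ?a t) * (\<alpha> t)\<^sup>2 + 2 * (\<alpha>' t * \<alpha> t) * (?a t * t ^ (k + 1)))) (at t)"
      unfolding \<Phi>_def[abs_def] by (intro DERIV_cmult DERIV_mult field_strength_deriv t p q)
    have e: "scaled_field_deriv \<gamma> t / t * t ^ (k + 1) = scaled_field_deriv \<gamma> t * t ^ k" using t by simp
    show "(\<Phi> has_real_derivative \<Phi>' t) (at t)"
      by (rule DERIV_cong[OF D], simp only: e) (simp add: \<Phi>'_def m_def algebra_simps)
  qed (simp add: \<Phi>_def)
  show ?thesis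
  proof (rule energy_from_identity[OF _ _ c\<Phi>' _ zero])
    fix t :: real assume t: "t \<ge> 0"
    have "\<bar>?a t\<bar> \<le> 1" using field_strength_bounds[OF \<gamma>(1) t] by simp
    then have "\<bar>m t\<bar> \<le> 1 + (real k + 1) * 1"
      unfolding m_def using scaled_field_deriv_bound[OF \<gamma> t]
      by (intro order_trans[OF abs_triangle_ineq] add_mono) (auto simp: abs_mult)
    then have "- (?\<sigma> * m t * (t ^ k * (\<alpha> t)\<^sup>2)) \<le> (real k + 2) * (t ^ k * (\<alpha> t)\<^sup>2)"
      using t by (intro bounded_sgn_mult) auto
    moreover have "4 * (t ^ (k + 1) * (\<alpha>' t)\<^sup>2) + t * (?a t)\<^sup>2 * (t ^ k * (\<alpha> t)\<^sup>2)
       = t ^ (k + 1) * (sector_dirac2 \<gamma> s \<alpha> \<alpha>' t)\<^sup>2 - \<Phi>' t + 2 * (- (?\<sigma> * m t * (t ^ k * (\<alpha> t)\<^sup>2)))"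
      by (simp add: sector_dirac2_def \<Phi>'_def power2_eq_square algebra_simps sgn_sector_square)
    ultimately show "4 * (t ^ (k + 1) * (\<alpha>' t)\<^sup>2) + t * (?a t)\<^sup>2 * (t ^ k * (\<alpha> t)\<^sup>2)
      \<le> t ^ (k + 1) * (sector_dirac2 \<gamma> s \<alpha> \<alpha>' t)\<^sup>2 - \<Phi>' t + 2 * (real k + 2) * (t ^ k * (\<alpha> t)\<^sup>2)" by linarith
  qed (intro cI ccont_mult continuous_intros continuous_on_field_strength)+
qed

text \<open>The same expansion with \<open>(k + 1) \<beta> + t \<beta>'\<close>, that is
  \<open>t^(-k)\<close> times the derivative of \<open>t^(k+1) \<beta>\<close>, as the derivative
  term. Now \<open>\<Phi> = 2 \<sigma> a t^(k+2) \<beta>^2\<close>, and the remainder has the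
  coefficient \<open>m = k a - t a'\<close>, bounded by \<open>k + 1\<close>.\<close>

lemma beta_energy:
  assumes \<beta>: "c1 \<beta> \<beta>'"
  shows "integral {0..} (\<lambda>t. 4 * (t ^ k * ((real k + 1) * \<beta> t + t * \<beta>' t)\<^sup>2) + t * (field_strength \<gamma> t)\<^sup>2 * (t ^ (k + 1) * (\<beta> t)\<^sup>2))
    \<le> integral {0..} (\<lambda>t. t ^ k * (sector_dirac1 \<gamma> s k \<beta> \<beta>' t)\<^sup>2) + 2 * (real k + 1) * integral {0..} (\<lambda>t. t ^ (k + 1) * (\<beta> t)\<^sup>2)"
proof -
  let ?a = "field_strength \<gamma>" and ?\<sigma> = "sgn_sector s"
  note cb = c1D(2)[OF \<beta>] and cb' = c1D(3)[OF \<beta>]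
  note cI = ccont_add ccont_diff ccont_cmult ccont_power2 cb cb' ccont_sector_dirac1
  define m where "m t = real k * ?a t - scaled_field_deriv \<gamma> t" for t
  define \<Phi> where "\<Phi> t = 2 * ?\<sigma> * (?a t * t ^ (k + 2) * (\<beta> t)\<^sup>2)" for t
  define \<Phi>' where "\<Phi>' t = 2 * ?\<sigma> * ((scaled_field_deriv \<gamma> t + (real k + 2) * ?a t) * t ^ (k + 1) * (\<beta> t)\<^sup>2 + ?a t * t ^ (k + 2) * (2 * (\<beta>' t * \<beta> t)))" for t
  have c\<Phi>: "ccont \<Phi>" unfolding \<Phi>_def[abs_def] by (intro ccont_cmult ccont_mult ccont_power2 cb continuous_intros continuous_on_field_strength)
  have c\<Phi>': "ccont \<Phi>'" unfolding \<Phi>'_def[abs_def]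
    by (intro ccont_cmult ccont_add ccont_mult ccont_power2 cb cb' continuous_intros continuous_on_scaled_field_deriv continuous_on_field_strength ccontD)
  obtain R where R: "\<And>t. t \<ge> R \<Longrightarrow> \<Phi> t = 0" using ccont_bound[OF c\<Phi>] by blast
  have zero: "integral {0..} \<Phi>' = 0"
  proof (rule integral_derivative_zero[OF ccontD[OF c\<Phi>] _ R _ c\<Phi>'])
    fix t :: real assume t: "t > 0"
    have p: "((\<lambda>t. t ^ (k + 2)) has_real_derivative (real k + 2) * t ^ (k + 1)) (at t)"
      using DERIV_pow[of "k + 2" t UNIV] by (simp add: add.commute)
    have q: "((\<lambda>t. (\<beta> t)\<^sup>2) has_real_derivative 2 * (\<beta>' t * \<beta> t)) (at t)"
      using DERIV_power[OF c1D_at[OF \<beta> t], of 2] by simp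
    have D: "(\<Phi> has_real_derivative 2 * ?\<sigma> * ((scaled_field_deriv \<gamma> t / t * t ^ (k + 2) + (real k + 2) * t ^ (k + 1) * ?a t) * (\<beta> t)\<^sup>2 + 2 * (\<beta>' t * \<beta> t) * (?a t * t ^ (k + 2)))) (at t)"
      unfolding \<Phi>_def[abs_def] by (intro DERIV_cmult DERIV_mult field_strength_deriv t p q)
    have e: "scaled_field_deriv \<gamma> t / t * t ^ (k + 2) = scaled_field_deriv \<gamma> t * t ^ (k + 1)" using t by simp
    show "(\<Phi> has_real_derivative \<Phi>' t) (at t)"
      by (rule DERIV_cong[OF D], simp only: e) (simp add: \<Phi>'_def algebra_simps)
  qed (simp add: \<Phi>_def)
  show ?thesis
  proof (rule energy_from_identity[OF _ _ c\<Phi>' _ zero])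
    fix t :: real assume t: "t \<ge> 0"
    have "\<bar>?a t\<bar> \<le> 1" using field_strength_bounds[OF \<gamma>(1) t] by simp
    then have "\<bar>m t\<bar> \<le> real k * 1 + 1"
      unfolding m_def using scaled_field_deriv_bound[OF \<gamma> t]
      by (intro order_trans[OF abs_triangle_ineq4] add_mono) (auto simp: abs_mult intro: mult_left_le)
    then have "- (?\<sigma> * m t * (t ^ (k + 1) * (\<beta> t)\<^sup>2)) \<le> (real k + 1) * (t ^ (k + 1) * (\<beta> t)\<^sup>2)"
      using t by (intro bounded_sgn_mult) auto
    moreover have "4 * (t ^ k * ((real k + 1) * \<beta> t + t * \<beta>' t)\<^sup>2) + t * (?a t)\<^sup>2 * (t ^ (k + 1) * (\<beta> t)\<^sup>2)
       = t ^ k * (sector_dirac1 \<gamma> s k \<beta> \<beta>' t)\<^sup>2 - \<Phi>' t + 2 * (- (?\<sigma> * m t * (t ^ (k + 1) * (\<beta> t)\<^sup>2)))"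
      by (simp add: sector_dirac1_def \<Phi>'_def m_def power2_eq_square algebra_simps sgn_sector_square)
    ultimately show "4 * (t ^ k * ((real k + 1) * \<beta> t + t * \<beta>' t)\<^sup>2) + t * (?a t)\<^sup>2 * (t ^ (k + 1) * (\<beta> t)\<^sup>2)
      \<le> t ^ k * (sector_dirac1 \<gamma> s k \<beta> \<beta>' t)\<^sup>2 - \<Phi>' t + 2 * (real k + 1) * (t ^ (k + 1) * (\<beta> t)\<^sup>2)" by linarith
  qed (intro cI ccont_mult continuous_intros continuous_on_field_strength)+
qed

section \<open>Pointwise bounds and convergent subsequences\<close>

text \<open>For \<open>t >= 1\<close> integrate the derivative of \<open>t^(k+1) \<alpha>^2\<close>
  from 0. Near 0 this would lose a full power of \<open>t\<close>, so
  \<open>t^(k+1/2) \<alpha>^2\<close> is integrated back from 1: its derivative is at least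
  \<open>-2 t^(k+1) \<alpha>'^2\<close>, and the loss is only \<open>t^(-1/2)\<close>, which is
  integrable. The constant adds \<open>(k + 2) K + C\<close>, the bound at 1, and \<open>2 C\<close>
  from the integral.\<close>

lemma alpha_pointwise:
  assumes \<alpha>: "c1 \<alpha> \<alpha>'" and K: "integral {0..} (\<lambda>t. t ^ k * (\<alpha> t)\<^sup>2) \<le> K" and C: "integral {0..} (\<lambda>t. t ^ (k + 1) * (\<alpha>' t)\<^sup>2) \<le> C"
    and t: "t > 0"
  shows "t ^ k * (\<alpha> t)\<^sup>2 \<le> ((real k + 2) * K + 3 * C) * (1 + t powr (- 1/2))"
proof -
  note ca = c1D(2)[OF \<alpha>] and ca' = c1D(3)[OF \<alpha>]
  let ?f = "\<lambda>t. t ^ k * (\<alpha> t)\<^sup>2" and ?e = "\<lambda>t. t ^ (k + 1) * (\<alpha>' t)\<^sup>2"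
  have cf: "ccont ?f" and ce: "ccont ?e" by (intro ccont_mult ccont_power2 ca ca' continuous_intros)+
  have if': "?f integrable_on {a..b}" and ie: "?e integrable_on {a..b}" if "0 \<le> a" for a b
    by (intro integrable_continuous_interval continuous_on_subset[OF ccontD[OF cf]] continuous_on_subset[OF ccontD[OF ce]]; use that in force)+
  have fK: "integral {a..b} ?f \<le> K" and eC: "integral {a..b} ?e \<le> C" if "0 \<le> a" for a b
    using that integral_subset_le[OF _ if'[OF that] ccont_integrable[OF cf], of b] integral_subset_le[OF _ ie[OF that] ccont_integrable[OF ce], of b] K C
    by (auto intro: order_trans)
  have K0: "K \<ge> 0" and C0: "C \<ge> 0"
    using K C integral_nonneg[OF ccont_integrable[OF cf]] integral_nonneg[OF ccont_integrable[OF ce]] by auto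
  have d2: "((\<lambda>t. (\<alpha> t)\<^sup>2) has_real_derivative 2 * (\<alpha>' u * \<alpha> u)) (at u)" if "u > 0" for u
    using DERIV_power[OF c1D_at[OF \<alpha> that], of 2] by simp
  have p: "((\<lambda>t. t ^ (k + 1)) has_real_derivative (real k + 1) * u ^ k) (at u)" for u :: real
    using DERIV_pow[of "k + 1" u UNIV] by (simp add: add.commute)
  have step1: "t ^ (k + 1) * (\<alpha> t)\<^sup>2 \<le> (real k + 2) * K + t * C" if t: "t > 0" for t
  proof -
    let ?h' = "\<lambda>u. (real k + 1) * u ^ k * (\<alpha> u)\<^sup>2 + 2 * (\<alpha>' u * \<alpha> u) * u ^ (k + 1)"
    have "(?h' has_integral (t ^ (k + 1) * (\<alpha> t)\<^sup>2 - 0 ^ (k + 1) * (\<alpha> 0)\<^sup>2)) {0..t}"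
    proof (rule fundamental_theorem_of_calculus_interior)
      show "continuous_on {0..t} (\<lambda>u. u ^ (k + 1) * (\<alpha> u)\<^sup>2)"
        by (intro continuous_intros continuous_on_subset[OF ccontD[OF ca]]) auto
      fix u assume "u \<in> {0<..<t}"
      then show "((\<lambda>u. u ^ (k + 1) * (\<alpha> u)\<^sup>2) has_vector_derivative ?h' u) (at u)"
        unfolding has_real_derivative_iff_has_vector_derivative[symmetric] by (intro DERIV_mult p d2) simp
    qed (use t in simp)
    then have hi: "(?h' has_integral (t ^ (k + 1) * (\<alpha> t)\<^sup>2)) {0..t}" by simp
    have i1: "(\<lambda>u. (real k + 2) * ?f u) integrable_on {0..t}" and i2: "(\<lambda>u. t * ?e u) integrable_on {0..t}"
      using if'[of 0 t] ie[of 0 t] by (intro integrable_on_mult_right; simp)+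
    have "integral {0..t} ?h' \<le> integral {0..t} (\<lambda>u. (real k + 2) * ?f u + t * ?e u)"
    proof (rule integral_le)
      show "?h' integrable_on {0..t}" using hi by (rule has_integral_integrable)
      show "(\<lambda>u. (real k + 2) * ?f u + t * ?e u) integrable_on {0..t}" by (rule integrable_add[OF i1 i2])
      fix u assume u: "u \<in> {0..t}"
      have "0 \<le> u ^ k * (\<alpha> u - u * \<alpha>' u)\<^sup>2" using u by simp
      then have "2 * (\<alpha>' u * \<alpha> u) * u ^ (k + 1) \<le> ?f u + u * ?e u"
        by (simp add: power2_eq_square algebra_simps)
      moreover have "u * ?e u \<le> t * ?e u" using u by (intro mult_right_mono) auto
      ultimately show "?h' u \<le> (real k + 2) * ?f u + t * ?e u" by (simp add: algebra_simps)
    qed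
    also have "\<dots> = (real k + 2) * integral {0..t} ?f + t * integral {0..t} ?e"
      using Henstock_Kurzweil_Integration.integral_add[OF i1 i2] by simp
    also have "\<dots> \<le> (real k + 2) * K + t * C" using fK[of 0 t] eC[of 0 t] t by (intro add_mono mult_left_mono) auto
    finally show ?thesis using integral_unique[OF hi] by simp
  qed
  let ?B = "(real k + 2) * K + 3 * C"
  have B0: "?B \<ge> 0" using K0 C0 by simp
  show ?thesis
  proof (cases "t \<ge> 1")
    case True
    have "t * ?f t \<le> (real k + 2) * K + t * C" using step1[OF t] by (simp add: mult_ac)
    also have "\<dots> \<le> t * ((real k + 2) * K) + t * C" using True K0 mult_right_mono[of 1 t "(real k + 2) * K"] by simp
    also have "\<dots> \<le> t * ?B" using t C0 by (simp add: algebra_simps)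
    finally have "?f t \<le> ?B" using t by simp
    also have "\<dots> \<le> ?B * (1 + t powr (- 1/2))" using B0 mult_left_mono[of 1 "1 + t powr (- 1/2)" ?B] by simp
    finally show ?thesis .
  next
    case False
    let ?\<psi> = "\<lambda>u. u ^ (k + 1) * (\<alpha> u)\<^sup>2 / sqrt u"
    let ?\<psi>' = "\<lambda>u. u ^ k / sqrt u * ((real k + 1/2) * (\<alpha> u)\<^sup>2 + 2 * u * (\<alpha>' u * \<alpha> u))"
    have hi: "(?\<psi>' has_integral (?\<psi> 1 - ?\<psi> t)) {t..1}"
    proof (rule fundamental_theorem_of_calculus)
      show "t \<le> 1" using False by simp
      fix u assume "u \<in> {t..1}"
      then have u: "u > 0" using t by simp
      have sq: "(sqrt has_real_derivative inverse (sqrt u) / 2) (at u)" using u by (rule DERIV_real_sqrt)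
      have "(?\<psi> has_real_derivative (((real k + 1) * u ^ k * (\<alpha> u)\<^sup>2 + 2 * (\<alpha>' u * \<alpha> u) * u ^ (k + 1)) * sqrt u
          - u ^ (k + 1) * (\<alpha> u)\<^sup>2 * (inverse (sqrt u) / 2)) / (sqrt u * sqrt u)) (at u)"
        using u by (intro DERIV_divide DERIV_mult p d2 sq) auto
      moreover have "(((real k + 1) * u ^ k * (\<alpha> u)\<^sup>2 + 2 * (\<alpha>' u * \<alpha> u) * u ^ (k + 1)) * sqrt u
          - u ^ (k + 1) * (\<alpha> u)\<^sup>2 * (inverse (sqrt u) / 2)) / (sqrt u * sqrt u) = ?\<psi>' u"
      proof -
        define r where "r = sqrt u"
        have r: "r > 0" "u = r * r" using u by (simp_all add: r_def)
        show ?thesis unfolding r_def[symmetric] r(2) using r(1)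
          by (simp add: field_simps power2_eq_square)
      qed
      ultimately have "(?\<psi> has_real_derivative ?\<psi>' u) (at u)" by simp
      then show "(?\<psi> has_vector_derivative ?\<psi>' u) (at u within {t..1})"
        unfolding has_real_derivative_iff_has_vector_derivative[symmetric] by (rule has_field_derivative_at_within)
    qed
    have i2: "(\<lambda>u. - 2 * ?e u) integrable_on {t..1}" using ie[of t 1] t by (intro integrable_on_mult_right) simp
    have "integral {t..1} (\<lambda>u. - 2 * ?e u) \<le> integral {t..1} ?\<psi>'"
    proof (rule integral_le[OF i2 has_integral_integrable[OF hi]])
      fix u assume u: "u \<in> {t..1}"
      then have u0: "u > 0" using t by simp
      define r where "r = sqrt u"
      have r: "r > 0" "u = r * r" "r \<le> 1" using u u0 by (simp_all add: r_def)
      define m where "m = real k + 1/2"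
      have m: "m \<ge> 1/2" by (simp add: m_def)
      \<comment> \<open>Completing the square with \<open>m = k + 1/2\<close>; as
        \<open>m >= 1/2\<close>, the factor 2 works for all \<open>k\<close>.\<close>
      have "0 \<le> (m * \<alpha> u + u * \<alpha>' u)\<^sup>2 / m" using m by simp
      also have "\<dots> = m * (\<alpha> u)\<^sup>2 + 2 * u * (\<alpha>' u * \<alpha> u) + u\<^sup>2 * (\<alpha>' u)\<^sup>2 / m"
        using m by (simp add: power2_eq_square field_simps)
      also have "u\<^sup>2 * (\<alpha>' u)\<^sup>2 / m \<le> u\<^sup>2 * (\<alpha>' u)\<^sup>2 / (1/2)"
        using m by (intro divide_left_mono) auto
      finally have "- 2 * (u\<^sup>2 * (\<alpha>' u)\<^sup>2) \<le> m * (\<alpha> u)\<^sup>2 + 2 * u * (\<alpha>' u * \<alpha> u)" by simp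
      then have "u ^ k / r * (- 2 * (u\<^sup>2 * (\<alpha>' u)\<^sup>2)) \<le> u ^ k / r * (m * (\<alpha> u)\<^sup>2 + 2 * u * (\<alpha>' u * \<alpha> u))"
        using u0 r by (intro mult_left_mono) auto
      moreover have "u ^ k / r * (- 2 * (u\<^sup>2 * (\<alpha>' u)\<^sup>2)) = r * (- 2 * ?e u)"
        using r(1) by (simp add: r(2) power2_eq_square field_simps)
      moreover have "1 * (- 2 * ?e u) \<le> r * (- 2 * ?e u)" using r u0 by (intro mult_right_mono_neg) auto
      ultimately show "- 2 * ?e u \<le> ?\<psi>' u" by (simp add: m_def r_def)
    qed
    then have "- 2 * integral {t..1} ?e \<le> ?\<psi> 1 - ?\<psi> t" using integral_unique[OF hi] by simp
    moreover have "integral {t..1} ?e \<le> C" using eC[of t 1] t by simp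
    moreover have "?\<psi> 1 \<le> (real k + 2) * K + C" using step1[of 1] by simp
    ultimately have psi: "?\<psi> t \<le> ?B" by linarith
    have f\<psi>: "?f t = ?\<psi> t * t powr (- 1/2)"
    proof -
      have e: "t powr (- 1/2) = inverse (sqrt t)" using t by (simp add: powr_minus powr_half_sqrt)
      have "sqrt t * sqrt t = t" using t by simp
      then have "t ^ (k + 1) * inverse (sqrt t) * inverse (sqrt t) = t ^ k"
        using t by (simp add: field_simps)
      then show ?thesis unfolding e by (auto simp: divide_inverse mult_ac)
    qed
    have "?f t \<le> ?B * t powr (- 1/2)" unfolding f\<psi> by (rule mult_right_mono[OF psi]) simp
    also have "\<dots> \<le> ?B * (1 + t powr (- 1/2))" using B0 by (intro mult_left_mono) auto
    finally show ?thesis .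
  qed
qed

text \<open>The function \<open>t^(k+3/2) \<beta>^2\<close> vanishes at 0, and completing the square
  bounds its derivative on \<open>[0, t]\<close> by \<open>2 sqrt t\<close> times the energy
  density. Dividing the integrated bound by \<open>sqrt t\<close> finishes.\<close>

lemma beta_pointwise:
  assumes \<beta>: "c1 \<beta> \<beta>'" and C: "integral {0..} (\<lambda>t. t ^ k * ((real k + 1) * \<beta> t + t * \<beta>' t)\<^sup>2) \<le> C" and t: "t > 0"
  shows "t ^ (k + 1) * (\<beta> t)\<^sup>2 \<le> 2 * C"
proof -
  note cb = c1D(2)[OF \<beta>] and cb' = c1D(3)[OF \<beta>]
  define q where "q t = (real k + 1) * \<beta> t + t * \<beta>' t" for t
  let ?e = "\<lambda>t. t ^ k * (q t)\<^sup>2"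
  have ce: "ccont ?e" unfolding q_def by (intro ccont_mult ccont_power2 ccont_add ccont_cmult cb cb' continuous_intros)
  have ie: "?e integrable_on {0..t}"
    by (intro integrable_continuous_interval continuous_on_subset[OF ccontD[OF ce]]) auto
  have eC: "integral {0..t} ?e \<le> C"
    using integral_subset_le[OF _ ie ccont_integrable[OF ce]] C by (auto simp: q_def intro: order_trans)
  let ?\<psi> = "\<lambda>u. u ^ (k + 1) * sqrt u * (\<beta> u)\<^sup>2"
  let ?\<psi>' = "\<lambda>u. u ^ k * sqrt u * (2 * (\<beta> u * q u) - (real k + 1/2) * (\<beta> u)\<^sup>2)"
  have "(?\<psi>' has_integral (?\<psi> t - ?\<psi> 0)) {0..t}"
  proof (rule fundamental_theorem_of_calculus_interior)
    show "continuous_on {0..t} ?\<psi>" by (intro continuous_intros continuous_on_subset[OF ccontD[OF cb]]) auto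
    fix u assume "u \<in> {0<..<t}"
    then have u: "u > 0" by simp
    have d2: "((\<lambda>t. (\<beta> t)\<^sup>2) has_real_derivative 2 * (\<beta>' u * \<beta> u)) (at u)"
      using DERIV_power[OF c1D_at[OF \<beta> u], of 2] by simp
    have p: "((\<lambda>t. t ^ (k + 1)) has_real_derivative (real k + 1) * u ^ k) (at u)"
      using DERIV_pow[of "k + 1" u UNIV] by (simp add: add.commute)
    have sq: "(sqrt has_real_derivative inverse (sqrt u) / 2) (at u)" using u by (rule DERIV_real_sqrt)
    have "(?\<psi> has_real_derivative ((real k + 1) * u ^ k * sqrt u + inverse (sqrt u) / 2 * u ^ (k + 1)) * (\<beta> u)\<^sup>2 + 2 * (\<beta>' u * \<beta> u) * (u ^ (k + 1) * sqrt u)) (at u)"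
      by (intro DERIV_mult p d2 sq)
    moreover have "((real k + 1) * u ^ k * sqrt u + inverse (sqrt u) / 2 * u ^ (k + 1)) * (\<beta> u)\<^sup>2 + 2 * (\<beta>' u * \<beta> u) * (u ^ (k + 1) * sqrt u) = ?\<psi>' u"
    proof -
      define r where "r = sqrt u"
      have r: "r > 0" "u = r * r" using u by (simp_all add: r_def)
      have "inverse r / 2 * u ^ (k + 1) = u ^ k * r / 2" using r by (simp add: field_simps)
      then show ?thesis unfolding r_def[symmetric] q_def
        by (simp add: power2_eq_square algebra_simps)
    qed
    ultimately show "(?\<psi> has_vector_derivative ?\<psi>' u) (at u)"
      unfolding has_real_derivative_iff_has_vector_derivative[symmetric] by simp
  qed (use t in simp)
  then have hi: "(?\<psi>' has_integral ?\<psi> t) {0..t}" by simp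
  have i2: "(\<lambda>u. (2 * sqrt t) * ?e u) integrable_on {0..t}" by (rule integrable_on_mult_right[OF ie])
  have "integral {0..t} ?\<psi>' \<le> integral {0..t} (\<lambda>u. (2 * sqrt t) * ?e u)"
  proof (rule integral_le[OF has_integral_integrable[OF hi] i2])
    fix u assume u: "u \<in> {0..t}"
    define m where "m = real k + 1/2"
    have m: "m \<ge> 1/2" by (simp add: m_def)
    have "0 \<le> (m * \<beta> u - q u)\<^sup>2 / m" using m by simp
    also have "\<dots> = m * (\<beta> u)\<^sup>2 - 2 * (\<beta> u * q u) + (q u)\<^sup>2 / m" using m by (simp add: power2_eq_square field_simps)
    also have "(q u)\<^sup>2 / m \<le> (q u)\<^sup>2 / (1/2)" using m by (intro divide_left_mono) auto
    finally have "2 * (\<beta> u * q u) - m * (\<beta> u)\<^sup>2 \<le> 2 * (q u)\<^sup>2" by simp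
    then have "u ^ k * sqrt u * (2 * (\<beta> u * q u) - m * (\<beta> u)\<^sup>2) \<le> u ^ k * sqrt t * (2 * (q u)\<^sup>2)"
      using u by (intro order_trans[OF mult_left_mono[of _ "2 * (q u)\<^sup>2"] mult_right_mono] mult_left_mono) auto
    then show "?\<psi>' u \<le> (2 * sqrt t) * ?e u" by (simp add: m_def mult_ac)
  qed
  then have "?\<psi> t \<le> 2 * sqrt t * integral {0..t} ?e" using integral_unique[OF hi] by simp
  also have "\<dots> \<le> 2 * sqrt t * C" using eC t by (intro mult_left_mono) auto
  finally have "sqrt t * (t ^ (k + 1) * (\<beta> t)\<^sup>2) \<le> sqrt t * (2 * C)" by (simp add: mult_ac)
  then show ?thesis using t by (simp only: mult_le_cancel_left_pos real_sqrt_gt_zero)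
qed

lemma alpha_compact:
  assumes \<alpha>: "\<And>n. c1 (\<alpha> n) (\<alpha>' n)"
    and K: "\<And>n. integral {0..} (\<lambda>t. t ^ k * (\<alpha> n t)\<^sup>2) \<le> K"
    and D: "\<And>n. integral {0..} (\<lambda>t. t ^ (k + 1) * (sector_dirac2 \<gamma> s (\<alpha> n) (\<alpha>' n) t)\<^sup>2) \<le> K"
  shows "\<exists>r. strict_mono (r :: nat \<Rightarrow> nat) \<and>
    (\<forall>\<epsilon>>0. \<exists>N. \<forall>m\<ge>N. \<forall>n\<ge>N. integral {0..} (\<lambda>t. t ^ k * (\<alpha> (r m) t - \<alpha> (r n) t)\<^sup>2) < \<epsilon>)"
proof -
  note ca = c1D(2)[OF \<alpha>] and ca' = c1D(3)[OF \<alpha>]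
  let ?W = "\<lambda>t. t * (field_strength \<gamma> t)\<^sup>2"
  define C where "C = K + 2 * (real k + 2) * K"
  have cf: "ccont (\<lambda>t. t ^ k * (\<alpha> n t)\<^sup>2)" and ce: "ccont (\<lambda>t. t ^ (k + 1) * (\<alpha>' n t)\<^sup>2)" for n
    by (intro ccont_mult ccont_power2 ca ca' continuous_intros)+
  have cW: "continuous_on {0..} ?W" by (intro continuous_intros continuous_on_field_strength)
  have W0: "?W t \<ge> 0" if "t \<ge> 0" for t using that by simp
  have E: "4 * integral {0..} (\<lambda>t. t ^ (k + 1) * (\<alpha>' n t)\<^sup>2) + integral {0..} (\<lambda>t. ?W t * (t ^ k * (\<alpha> n t)\<^sup>2)) \<le> C" for n
  proof -
    have k0: "0 \<le> 2 * (real k + 2)" by simp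
    have "integral {0..} (\<lambda>t. 4 * (t ^ (k + 1) * (\<alpha>' n t)\<^sup>2) + ?W t * (t ^ k * (\<alpha> n t)\<^sup>2)) \<le> K + 2 * (real k + 2) * K"
      using alpha_energy[OF \<alpha>, of k n s] D[of n] mult_left_mono[OF K[of n] k0] by linarith
    moreover have "integral {0..} (\<lambda>t. 4 * (t ^ (k + 1) * (\<alpha>' n t)\<^sup>2) + ?W t * (t ^ k * (\<alpha> n t)\<^sup>2))
      = integral {0..} (\<lambda>t. 4 * (t ^ (k + 1) * (\<alpha>' n t)\<^sup>2)) + integral {0..} (\<lambda>t. ?W t * (t ^ k * (\<alpha> n t)\<^sup>2))"
      by (intro Henstock_Kurzweil_Integration.integral_add ccont_integrable ccont_cmult ce ccont_mult[OF cW] cf)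
    ultimately show ?thesis by (simp add: C_def)
  qed
  have nn: "0 \<le> integral {0..} (\<lambda>t. t ^ (k + 1) * (\<alpha>' n t)\<^sup>2)" "0 \<le> integral {0..} (\<lambda>t. ?W t * (t ^ k * (\<alpha> n t)\<^sup>2))" for n
    by (intro integral_nonneg ccont_integrable ce ccont_mult[OF cW] cf; simp)+
  have e1: "integral {0..} (\<lambda>t. t ^ (k + 1) * (\<alpha>' n t)\<^sup>2) \<le> C" and e2: "integral {0..} (\<lambda>t. ?W t * (t ^ k * (\<alpha> n t)\<^sup>2)) \<le> C" for n
    using E[of n] nn[of n] by linarith+
  have C0: "C \<ge> 0" using e1[of 0] nn(1)[of 0] by linarith
  have "\<exists>r. strict_mono (r :: nat \<Rightarrow> nat) \<and> (\<forall>\<epsilon>>0. \<exists>N. \<forall>m\<ge>N. \<forall>n\<ge>N. integral {0..} (\<lambda>t. t ^ k * (\<alpha> (r m) t - \<alpha> (r n) t)\<^sup>2) < \<epsilon>)"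
  proof (rule rellich_subsequence[of \<alpha> 0 k "\<lambda>t. ((real k + 2) * K + 3 * C) * (1 + t powr (- 1/2))"])
    fix t \<epsilon> :: real assume t: "t > 0" "\<epsilon> > 0"
    have "\<exists>\<delta>>0. \<forall>n s. s > 0 \<longrightarrow> \<bar>s - t\<bar> < \<delta> \<longrightarrow> \<bar>\<alpha> n s - \<alpha> n t\<bar> \<le> \<epsilon>"
    \<comment> \<open>On the window \<open>u >= t / 2\<close> holds, so the factor
      \<open>(2 / t * u)^(k+1)\<close> is at least 1 and converts the plain derivative into the
      energy density.\<close>
    proof (rule two_sided_equicontinuity[where e = "\<lambda>n t. t ^ (k + 1) * (\<alpha>' n t)\<^sup>2" and w = "(2 / t) ^ (k + 1)"])
      fix n u assume u: "t / 2 \<le> u" "u \<le> 2 * t"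
      have "1 \<le> (2 / t * u) ^ (k + 1)" using u t by (intro one_le_power) (simp add: field_simps)
      then have "1 * (\<alpha>' n u)\<^sup>2 \<le> (2 / t * u) ^ (k + 1) * (\<alpha>' n u)\<^sup>2" by (intro mult_right_mono) auto
      then show "(\<alpha>' n u)\<^sup>2 \<le> (2 / t) ^ (k + 1) * (u ^ (k + 1) * (\<alpha>' n u)\<^sup>2)"
        by (simp only: power_mult_distrib mult.assoc mult_1_left)
    qed (use t e1 ce c1D_at[OF \<alpha>] in auto)
    then show "\<exists>\<delta>>0. \<forall>n s. s > 0 \<longrightarrow> \<bar>s - t\<bar> < \<delta> \<longrightarrow> \<bar>s ^ 0 * \<alpha> n s - t ^ 0 * \<alpha> n t\<bar> \<le> \<epsilon>" by simp
  next
    fix \<epsilon> :: real assume \<epsilon>: "\<epsilon> > 0"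
    define M where "M = C / \<epsilon> + 1"
    have M: "M > 0" using C0 \<epsilon> by (simp add: M_def add_nonneg_pos)
    obtain R where R: "R > 0" "\<And>t. t \<ge> R \<Longrightarrow> M \<le> ?W t" using weight_unbounded[OF \<gamma>, of M] by auto
    have "integral {R..} (\<lambda>t. t ^ k * (\<alpha> n t)\<^sup>2) \<le> C / M" for n
      by (rule tail_estimate[OF cf _ cW W0 e2 R M]) simp_all
    moreover have "C / M \<le> \<epsilon>"
    proof -
      have "C \<le> \<epsilon> * M" using \<epsilon> by (simp add: M_def algebra_simps)
      then show ?thesis using M by (simp add: field_simps)
    qed
    ultimately show "\<exists>R>0. \<forall>n. integral {R..} (\<lambda>t. t ^ k * (\<alpha> n t)\<^sup>2) \<le> \<epsilon>" using R(1) order_trans by blast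
  next
    show "\<And>n t. 0 < t \<Longrightarrow> t ^ k * (\<alpha> n t)\<^sup>2 \<le> ((real k + 2) * K + 3 * C) * (1 + t powr (- 1 / 2))"
      by (rule alpha_pointwise[OF \<alpha> K e1])
  qed (use ca integrable_inverse_sqrt in blast)+
  then show ?thesis .
qed

lemma beta_compact:
  assumes \<beta>: "\<And>n. c1 (\<beta> n) (\<beta>' n)"
    and K: "\<And>n. integral {0..} (\<lambda>t. t ^ (k + 1) * (\<beta> n t)\<^sup>2) \<le> K"
    and D: "\<And>n. integral {0..} (\<lambda>t. t ^ k * (sector_dirac1 \<gamma> s k (\<beta> n) (\<beta>' n) t)\<^sup>2) \<le> K"
  shows "\<exists>r. strict_mono (r :: nat \<Rightarrow> nat) \<and>
    (\<forall>\<epsilon>>0. \<exists>N. \<forall>m\<ge>N. \<forall>n\<ge>N. integral {0..} (\<lambda>t. t ^ (k + 1) * (\<beta> (r m) t - \<beta> (r n) t)\<^sup>2) < \<epsilon>)"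
proof -
  note cb = c1D(2)[OF \<beta>] and cb' = c1D(3)[OF \<beta>]
  let ?W = "\<lambda>t. t * (field_strength \<gamma> t)\<^sup>2"
  define q where "q n t = (real k + 1) * \<beta> n t + t * \<beta>' n t" for n t
  define C where "C = K + 2 * (real k + 1) * K"
  have cf: "ccont (\<lambda>t. t ^ (k + 1) * (\<beta> n t)\<^sup>2)" and ce: "ccont (\<lambda>t. t ^ k * (q n t)\<^sup>2)" for n
    unfolding q_def by (intro ccont_mult ccont_power2 ccont_add ccont_cmult cb cb' continuous_intros)+
  have cW: "continuous_on {0..} ?W" by (intro continuous_intros continuous_on_field_strength)
  have W0: "?W t \<ge> 0" if "t \<ge> 0" for t using that by simp
  have E: "4 * integral {0..} (\<lambda>t. t ^ k * (q n t)\<^sup>2) + integral {0..} (\<lambda>t. ?W t * (t ^ (k + 1) * (\<beta> n t)\<^sup>2)) \<le> C" for n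
  proof -
    have k0: "0 \<le> 2 * (real k + 1)" by simp
    have "integral {0..} (\<lambda>t. 4 * (t ^ k * (q n t)\<^sup>2) + ?W t * (t ^ (k + 1) * (\<beta> n t)\<^sup>2)) \<le> K + 2 * (real k + 1) * K"
      using beta_energy[OF \<beta>, of k n s] D[of n] mult_left_mono[OF K[of n] k0]
      unfolding q_def by linarith
    moreover have "integral {0..} (\<lambda>t. 4 * (t ^ k * (q n t)\<^sup>2) + ?W t * (t ^ (k + 1) * (\<beta> n t)\<^sup>2))
      = integral {0..} (\<lambda>t. 4 * (t ^ k * (q n t)\<^sup>2)) + integral {0..} (\<lambda>t. ?W t * (t ^ (k + 1) * (\<beta> n t)\<^sup>2))"
      by (intro Henstock_Kurzweil_Integration.integral_add ccont_integrable ccont_cmult ce ccont_mult[OF cW] cf)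
    ultimately show ?thesis by (simp add: C_def)
  qed
  have nn: "0 \<le> integral {0..} (\<lambda>t. t ^ k * (q n t)\<^sup>2)" "0 \<le> integral {0..} (\<lambda>t. ?W t * (t ^ (k + 1) * (\<beta> n t)\<^sup>2))" for n
    by (intro integral_nonneg ccont_integrable ce ccont_mult[OF cW] cf; simp)+
  have e1: "integral {0..} (\<lambda>t. t ^ k * (q n t)\<^sup>2) \<le> C" and e2: "integral {0..} (\<lambda>t. ?W t * (t ^ (k + 1) * (\<beta> n t)\<^sup>2)) \<le> C" for n
    using E[of n] nn[of n] by linarith+
  have C0: "C \<ge> 0" using e1[of 0] nn(1)[of 0] by linarith
  have "\<exists>r. strict_mono (r :: nat \<Rightarrow> nat) \<and> (\<forall>\<epsilon>>0. \<exists>N. \<forall>m\<ge>N. \<forall>n\<ge>N. integral {0..} (\<lambda>t. t ^ (k + 1) * (\<beta> (r m) t - \<beta> (r n) t)\<^sup>2) < \<epsilon>)"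
  \<comment> \<open>The exponent \<open>k + 1\<close> in the equicontinuity condition: the
    derivative of \<open>t^(k+1) \<beta>\<close> is \<open>t^k q\<close>, which the energy
    controls.\<close>
  proof (rule rellich_subsequence[of \<beta> "k + 1" "k + 1" "\<lambda>t. 2 * C"])
    fix t \<epsilon> :: real assume t: "t > 0" "\<epsilon> > 0"
    show "\<exists>\<delta>>0. \<forall>n s. s > 0 \<longrightarrow> \<bar>s - t\<bar> < \<delta> \<longrightarrow> \<bar>s ^ (k + 1) * \<beta> n s - t ^ (k + 1) * \<beta> n t\<bar> \<le> \<epsilon>"
    proof (rule two_sided_equicontinuity[where e = "\<lambda>n t. t ^ k * (q n t)\<^sup>2" and w = "(2 * t) ^ k" and g = "\<lambda>n t. t ^ (k + 1) * \<beta> n t" and g' = "\<lambda>n t. t ^ k * q n t"])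
      fix n u assume u: "t / 2 \<le> u" "u \<le> 2 * t"
      have u0: "u \<ge> 0" using u t by simp
      have "u ^ k * (u ^ k * (q n u)\<^sup>2) \<le> (2 * t) ^ k * (u ^ k * (q n u)\<^sup>2)"
        using u u0 by (intro mult_right_mono power_mono) auto
      then show "(u ^ k * q n u)\<^sup>2 \<le> (2 * t) ^ k * (u ^ k * (q n u)\<^sup>2)" by (simp add: power2_eq_square mult_ac)
    next
      fix n and u :: real assume u: "u > 0"
      have p: "((\<lambda>t. t ^ (k + 1)) has_real_derivative (real k + 1) * u ^ k) (at u)"
        using DERIV_pow[of "k + 1" u UNIV] by (simp add: add.commute)
      have "((\<lambda>t. t ^ (k + 1) * \<beta> n t) has_real_derivative (real k + 1) * u ^ k * \<beta> n u + \<beta>' n u * u ^ (k + 1)) (at u)"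
        by (intro DERIV_mult p c1D_at[OF \<beta> u])
      then show "((\<lambda>t. t ^ (k + 1) * \<beta> n t) has_real_derivative u ^ k * q n u) (at u)"
        by (simp add: q_def algebra_simps)
    qed (use t e1 ce in auto)
  next
    fix \<epsilon> :: real assume \<epsilon>: "\<epsilon> > 0"
    define M where "M = C / \<epsilon> + 1"
    have M: "M > 0" using C0 \<epsilon> by (simp add: M_def add_nonneg_pos)
    obtain R where R: "R > 0" "\<And>t. t \<ge> R \<Longrightarrow> M \<le> ?W t" using weight_unbounded[OF \<gamma>, of M] by auto
    have "integral {R..} (\<lambda>t. t ^ (k + 1) * (\<beta> n t)\<^sup>2) \<le> C / M" for n
      by (rule tail_estimate[OF cf _ cW W0 e2 R M]) simp_all
    moreover have "C / M \<le> \<epsilon>"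
    proof -
      have "C \<le> \<epsilon> * M" using \<epsilon> by (simp add: M_def algebra_simps)
      then show ?thesis using M by (simp add: field_simps)
    qed
    ultimately show "\<exists>R>0. \<forall>n. integral {R..} (\<lambda>t. t ^ (k + 1) * (\<beta> n t)\<^sup>2) \<le> \<epsilon>" using R(1) order_trans by blast
  next
    show "\<And>n t. 0 < t \<Longrightarrow> t ^ (k + 1) * (\<beta> n t)\<^sup>2 \<le> 2 * C"
      using beta_pointwise[OF \<beta>] e1 unfolding q_def by blast
  next
    show "\<And>R::real. (\<lambda>t. 2 * C) integrable_on {0..R}" by (rule integrable_continuous_interval) simp
  qed (use cb in blast)+
  then show ?thesis .
qed

lemma sec_norm_split:
  assumes "ccont \<alpha>" "ccont \<beta>"
  shows "(norm (sec s k \<alpha> \<beta>))\<^sup>2 = pi * (integral {0..} (\<lambda>t. t ^ k * (\<alpha> t)\<^sup>2) + integral {0..} (\<lambda>t. t ^ (k + 1) * (\<beta> t)\<^sup>2))"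
    "0 \<le> integral {0..} (\<lambda>t. t ^ k * (\<alpha> t)\<^sup>2)" "0 \<le> integral {0..} (\<lambda>t. t ^ (k + 1) * (\<beta> t)\<^sup>2)"
proof -
  have c: "ccont (\<lambda>t. t ^ k * (\<alpha> t)\<^sup>2)" "ccont (\<lambda>t. t ^ (k + 1) * (\<beta> t)\<^sup>2)"
    by (intro ccont_mult ccont_power2 assms continuous_intros)+
  show "(norm (sec s k \<alpha> \<beta>))\<^sup>2 = pi * (integral {0..} (\<lambda>t. t ^ k * (\<alpha> t)\<^sup>2) + integral {0..} (\<lambda>t. t ^ (k + 1) * (\<beta> t)\<^sup>2))"
    using sec_norm[OF assms] Henstock_Kurzweil_Integration.integral_add[OF ccont_integrable[OF c(1)] ccont_integrable[OF c(2)]] by simp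
  show "0 \<le> integral {0..} (\<lambda>t. t ^ k * (\<alpha> t)\<^sup>2)" "0 \<le> integral {0..} (\<lambda>t. t ^ (k + 1) * (\<beta> t)\<^sup>2)"
    by (intro integral_nonneg ccont_integrable c; simp)+
qed

lemma sec_norm_components:
  assumes "ccont \<alpha>" "ccont \<beta>" "norm (sec s k \<alpha> \<beta>) \<le> 2"
  shows "integral {0..} (\<lambda>t. t ^ k * (\<alpha> t)\<^sup>2) \<le> 4" "integral {0..} (\<lambda>t. t ^ (k + 1) * (\<beta> t)\<^sup>2) \<le> 4"
proof -
  let ?a = "integral {0..} (\<lambda>t. t ^ k * (\<alpha> t)\<^sup>2)" and ?b = "integral {0..} (\<lambda>t. t ^ (k + 1) * (\<beta> t)\<^sup>2)"
  have "(norm (sec s k \<alpha> \<beta>))\<^sup>2 \<le> 2\<^sup>2" using assms(3) by (intro power_mono) auto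
  then have 1: "pi * (?a + ?b) \<le> 4" using sec_norm_split(1)[OF assms(1,2)] by simp
  have "1 * (?a + ?b) \<le> pi * (?a + ?b)" using sec_norm_split(2,3)[OF assms(1,2), of k] pi_ge_two
    by (intro mult_right_mono) auto
  with 1 have "?a + ?b \<le> 4" by simp
  then show "?a \<le> 4" "?b \<le> 4" using sec_norm_split(2,3)[OF assms(1,2), of k] by linarith+
qed

text \<open>Elements of the closed relation are replaced by profiles within
  \<open>1 / (n + 1)\<close>, at the cost of raising the norm bound from 1 to 2, so to 4 for the
  squares. A subsequence for \<open>\<alpha>\<close> and a further one for \<open>\<beta>\<close>
  make the fields Cauchy.\<close>

lemma sector_graph_compact:
  fixes X Y :: "nat \<Rightarrow> l2"
  assumes XY: "\<And>n. (X n, Y n) \<in> sector_graph s k \<and> norm (X n) \<le> 1 \<and> norm (Y n) \<le> 1"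
  shows "\<exists>r l. strict_mono (r :: nat \<Rightarrow> nat) \<and> (\<lambda>n. X (r n)) \<longlonglongrightarrow> l"
proof -
  have "\<exists>\<alpha> \<alpha>' \<beta> \<beta>'. c1 \<alpha> \<alpha>' \<and> c1 \<beta> \<beta>' \<and> norm (X n - sec s k \<alpha> \<beta>) \<le> inverse (real (Suc n)) \<and>
      norm (sec s k \<alpha> \<beta>) \<le> 2 \<and> norm (sec s k (sector_dirac1 \<gamma> s k \<beta> \<beta>') (sector_dirac2 \<gamma> s \<alpha> \<alpha>')) \<le> 2" for n
  proof -
    have "(X n, Y n) \<in> sector_graph s k" using XY by blast
    then obtain \<alpha> \<alpha>' \<beta> \<beta>' where c: "c1 \<alpha> \<alpha>'" "c1 \<beta> \<beta>'"
      and d: "dist (sec s k \<alpha> \<beta>, sec s k (sector_dirac1 \<gamma> s k \<beta> \<beta>') (sector_dirac2 \<gamma> s \<alpha> \<alpha>')) (X n, Y n) < inverse (real (Suc n))"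
      unfolding sector_graph_def closure_approachable by (auto dest!: spec[of _ "inverse (real (Suc n))"])
    have i1: "inverse (real (Suc n)) \<le> 1" by (simp add: field_simps)
    have "dist (sec s k \<alpha> \<beta>) (X n) < inverse (real (Suc n))"
      using le_less_trans[OF dist_fst_le d] by simp
    then have 1: "norm (X n - sec s k \<alpha> \<beta>) < inverse (real (Suc n))" by (simp add: dist_norm norm_minus_commute)
    have "dist (sec s k (sector_dirac1 \<gamma> s k \<beta> \<beta>') (sector_dirac2 \<gamma> s \<alpha> \<alpha>')) (Y n) < inverse (real (Suc n))"
      using le_less_trans[OF dist_snd_le d] by simp
    then have 2: "norm (Y n - sec s k (sector_dirac1 \<gamma> s k \<beta> \<beta>') (sector_dirac2 \<gamma> s \<alpha> \<alpha>')) < inverse (real (Suc n))"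
      by (simp add: dist_norm norm_minus_commute)
    have "norm (sec s k \<alpha> \<beta>) \<le> norm (X n) + norm (X n - sec s k \<alpha> \<beta>)" 
      using norm_triangle_sub[of "sec s k \<alpha> \<beta>" "X n"] by (simp add: norm_minus_commute)
    moreover have "norm (sec s k (sector_dirac1 \<gamma> s k \<beta> \<beta>') (sector_dirac2 \<gamma> s \<alpha> \<alpha>')) \<le> norm (Y n) + norm (Y n - sec s k (sector_dirac1 \<gamma> s k \<beta> \<beta>') (sector_dirac2 \<gamma> s \<alpha> \<alpha>'))"
      using norm_triangle_sub[of "sec s k (sector_dirac1 \<gamma> s k \<beta> \<beta>') (sector_dirac2 \<gamma> s \<alpha> \<alpha>')" "Y n"] by (simp add: norm_minus_commute)
    ultimately show ?thesis using c 1 2 XY[of n] i1 by (intro exI conjI) (assumption | linarith)+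
  qed
  then obtain \<alpha> \<alpha>' \<beta> \<beta>' where c: "\<And>n. c1 (\<alpha> n) (\<alpha>' n)" "\<And>n. c1 (\<beta> n) (\<beta>' n)"
    and X: "\<And>n. norm (X n - sec s k (\<alpha> n) (\<beta> n)) \<le> inverse (real (Suc n))"
    and b: "\<And>n. norm (sec s k (\<alpha> n) (\<beta> n)) \<le> 2" "\<And>n. norm (sec s k (sector_dirac1 \<gamma> s k (\<beta> n) (\<beta>' n)) (sector_dirac2 \<gamma> s (\<alpha> n) (\<alpha>' n))) \<le> 2"
    by metis
  note ca = c1D(2,3)[OF c(1)] and cb = c1D(2,3)[OF c(2)]
  have k1: "integral {0..} (\<lambda>t. t ^ k * (\<alpha> n t)\<^sup>2) \<le> 4" "integral {0..} (\<lambda>t. t ^ (k + 1) * (\<beta> n t)\<^sup>2) \<le> 4" for n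
    using sec_norm_components[OF ca(1) cb(1) b(1)] by blast+
  have k2: "integral {0..} (\<lambda>t. t ^ k * (sector_dirac1 \<gamma> s k (\<beta> n) (\<beta>' n) t)\<^sup>2) \<le> 4"
    "integral {0..} (\<lambda>t. t ^ (k + 1) * (sector_dirac2 \<gamma> s (\<alpha> n) (\<alpha>' n) t)\<^sup>2) \<le> 4" for n
    using sec_norm_components[OF ccont_sector_dirac1[OF cb] ccont_sector_dirac2[OF ca] b(2)] by blast+
  have "\<exists>r. strict_mono (r :: nat \<Rightarrow> nat) \<and>
    (\<forall>\<epsilon>>0. \<exists>N. \<forall>m\<ge>N. \<forall>n\<ge>N. integral {0..} (\<lambda>t. t ^ k * (\<alpha> (r m) t - \<alpha> (r n) t)\<^sup>2) < \<epsilon>)"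
    by (rule alpha_compact[OF c(1) k1(1) k2(2)])
  then obtain r where r: "strict_mono (r :: nat \<Rightarrow> nat)"
    "\<forall>\<epsilon>>0. \<exists>N. \<forall>m\<ge>N. \<forall>n\<ge>N. integral {0..} (\<lambda>t. t ^ k * (\<alpha> (r m) t - \<alpha> (r n) t)\<^sup>2) < \<epsilon>"
    by (elim exE conjE)
  have "\<exists>q. strict_mono (q :: nat \<Rightarrow> nat) \<and>
    (\<forall>\<epsilon>>0. \<exists>N. \<forall>m\<ge>N. \<forall>n\<ge>N. integral {0..} (\<lambda>t. t ^ (k + 1) * (\<beta> (r (q m)) t - \<beta> (r (q n)) t)\<^sup>2) < \<epsilon>)"
    by (rule beta_compact[OF c(2) k1(2) k2(1)])
  then obtain q where q: "strict_mono (q :: nat \<Rightarrow> nat)"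
    "\<forall>\<epsilon>>0. \<exists>N. \<forall>m\<ge>N. \<forall>n\<ge>N. integral {0..} (\<lambda>t. t ^ (k + 1) * (\<beta> (r (q m)) t - \<beta> (r (q n)) t)\<^sup>2) < \<epsilon>"
    by (elim exE conjE)
  define p where "p n = r (q n)" for n
  have p: "strict_mono p" using strict_mono_compose[OF r(1) q(1)] by (simp add: p_def[abs_def])
  define x where "x n = sec s k (\<alpha> (p n)) (\<beta> (p n))" for n
  have "Cauchy x"
  proof (rule CauchyI)
    fix \<epsilon> :: real assume \<epsilon>: "\<epsilon> > 0"
    define \<eta> where "\<eta> = \<epsilon>\<^sup>2 / (2 * pi)"
    have \<eta>: "\<eta> > 0" using \<epsilon> by (simp add: \<eta>_def)
    obtain N1 where N1: "\<And>m n. m \<ge> N1 \<Longrightarrow> n \<ge> N1 \<Longrightarrow> integral {0..} (\<lambda>t. t ^ k * (\<alpha> (r m) t - \<alpha> (r n) t)\<^sup>2) < \<eta>"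
      using r(2) \<eta> by meson
    obtain N2 where N2: "\<And>m n. m \<ge> N2 \<Longrightarrow> n \<ge> N2 \<Longrightarrow> integral {0..} (\<lambda>t. t ^ (k + 1) * (\<beta> (r (q m)) t - \<beta> (r (q n)) t)\<^sup>2) < \<eta>"
      using q(2) \<eta> by meson
    have "norm (x m - x n) < \<epsilon>" if mn: "m \<ge> max N1 N2" "n \<ge> max N1 N2" for m n
    proof -
      have "q m \<ge> N1" "q n \<ge> N1" using mn seq_suble[OF q(1), of m] seq_suble[OF q(1), of n] by linarith+
      note 1 = N1[OF this]
      have "x m - x n = sec s k (\<lambda>t. \<alpha> (p m) t - \<alpha> (p n) t) (\<lambda>t. \<beta> (p m) t - \<beta> (p n) t)"
        unfolding x_def by (rule sec_diff[OF ca(1) cb(1) ca(1) cb(1)])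
      then have "(norm (x m - x n))\<^sup>2 = pi * (integral {0..} (\<lambda>t. t ^ k * (\<alpha> (p m) t - \<alpha> (p n) t)\<^sup>2) + integral {0..} (\<lambda>t. t ^ (k + 1) * (\<beta> (p m) t - \<beta> (p n) t)\<^sup>2))"
        using sec_norm_split(1)[OF ccont_diff[OF ca(1) ca(1)] ccont_diff[OF cb(1) cb(1)]] by simp
      also have "\<dots> < pi * (\<eta> + \<eta>)"
        using 1 N2[of m n] mn by (intro mult_strict_left_mono add_strict_mono) (auto simp: p_def)
      also have "\<dots> = \<epsilon>\<^sup>2" by (simp add: \<eta>_def field_simps)
      finally show ?thesis using \<epsilon> by (simp add: power_less_imp_less_base)
    qed
    then show "\<exists>M. \<forall>m\<ge>M. \<forall>n\<ge>M. norm (x m - x n) < \<epsilon>" by blast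
  qed
  then obtain l where l: "x \<longlonglongrightarrow> l" using Cauchy_convergent convergent_def by blast
  have "(\<lambda>n. X n - sec s k (\<alpha> n) (\<beta> n)) \<longlonglongrightarrow> 0"
  proof (rule Lim_null_comparison[OF _ LIMSEQ_inverse_real_of_nat])
    show "\<forall>\<^sub>F n in sequentially. norm (X n - sec s k (\<alpha> n) (\<beta> n)) \<le> inverse (real (Suc n))"
      by (rule always_eventually, rule allI, rule X)
  qed
  from LIMSEQ_subseq_LIMSEQ[OF this p] have "(\<lambda>n. X (p n) - x n) \<longlonglongrightarrow> 0" by (simp add: o_def x_def)
  from tendsto_add[OF this l] have "(\<lambda>n. X (p n)) \<longlonglongrightarrow> l" by simp
  then show ?thesis using p by blast
qed

text \<open>The abstract spectral theorem in one sector. Density of range plus kernel is obtained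
  through orthogonality, from \<open>sector_range_orthogonal\<close>, which itself relies on
  compactness to reach the zero mode.\<close>

theorem sector_space_eigenvectors: "sector_space s k \<subseteq> closure (span (eigenvectors \<T>))"
proof -
  have sub: "(x, y) \<in> \<T>" if "(x, y) \<in> sector_graph s k" for x y using that sector_graph_subset by blast
  let ?R = "{y + z |x y z. (x, y) \<in> sector_graph s k \<and> (z, 0) \<in> sector_graph s k}"
  have cl: "closed (sector_graph s k)" "closed (sector_space s k)" by (simp_all add: sector_graph_def sector_space_def)
  have "sector_space s k \<subseteq> closure ?R"
  proof (rule orthogonal_complement_trivial_dense[OF subspace_sector_space cl(2)])
    show "subspace ?R"
    proof (rule subspaceI)
      have 0: "(0, 0) \<in> sector_graph s k" using subspace_0[OF subspace_sector_graph[of s k]] by (simp add: zero_prod_def)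
      then show "0 \<in> ?R" by force
      fix u v assume "u \<in> ?R" "v \<in> ?R"
      then obtain x y z x' y' z' where "u = y + z" "(x, y) \<in> sector_graph s k" "(z, 0) \<in> sector_graph s k"
        "v = y' + z'" "(x', y') \<in> sector_graph s k" "(z', 0) \<in> sector_graph s k" by blast
      moreover from this have "(x + x', y + y') \<in> sector_graph s k" "(z + z', 0) \<in> sector_graph s k"
        using subspace_add[OF subspace_sector_graph[of s k], of "(x, y)" "(x', y')"] subspace_add[OF subspace_sector_graph[of s k], of "(z, 0)" "(z', 0)"] by auto
      moreover have "u + v = (y + y') + (z + z')" using calculation by simp
      ultimately show "u + v \<in> ?R" by blast
    next
      fix a :: real and u assume "u \<in> ?R"
      then obtain x y z where "u = y + z" "(x, y) \<in> sector_graph s k" "(z, 0) \<in> sector_graph s k" by blast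
      moreover from this have "(a *\<^sub>R x, a *\<^sub>R y) \<in> sector_graph s k" "(a *\<^sub>R z, 0) \<in> sector_graph s k"
        using subspace_scale[OF subspace_sector_graph[of s k], of "(x, y)" a] subspace_scale[OF subspace_sector_graph[of s k], of "(z, 0)" a] by auto
      moreover have "a *\<^sub>R u = a *\<^sub>R y + a *\<^sub>R z" using calculation by (simp add: scaleR_add_right)
      ultimately show "a *\<^sub>R u \<in> ?R" by blast
    qed
    show "?R \<subseteq> sector_space s k"
      using sector_graph_space[of s k] subspace_add[OF subspace_sector_space] by blast
    fix v assume v: "v \<in> sector_space s k" "\<And>y. y \<in> ?R \<Longrightarrow> v \<bullet> y = 0"
    have 0: "(0, 0) \<in> sector_graph s k" using subspace_0[OF subspace_sector_graph[of s k]] by (simp add: zero_prod_def)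
    show "v = 0"
    proof (rule sector_range_orthogonal[OF sector_graph_compact _ _ v(1)])
      fix x y assume "(x, y) \<in> sector_graph s k"
      then have "y + 0 \<in> ?R" using 0 by blast
      then show "v \<bullet> y = 0" using v(2) by force
    next
      fix z assume "(z, 0) \<in> sector_graph s k"
      then have "0 + z \<in> ?R" using 0 by blast
      then show "v \<bullet> z = 0" using v(2) by force
    qed
  qed
  then have "sector_space s k \<subseteq> closure (span (eigenvectors (sector_graph s k)))"
    using closure_symmetric_relation[OF dirac_graph_symmetric] sub
    by (intro symmetric_relation_spectral[OF subspace_sector_graph cl(1) subspace_sector_space cl(2) sector_graph_space]
        sector_graph_compact sector_graph_domain) blast+
  also have "\<dots> \<subseteq> closure (span (eigenvectors \<T>))"
    using sub by (intro closure_mono span_mono) (auto simp: eigenvectors_def)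
  finally show ?thesis .
qed

end

section \<open>Approximate eigenfunctions far away from the origin\<close>

lemma ccont_of_positive:
  fixes f :: "real \<Rightarrow> real"
  assumes "continuous_on {0<..} f" and \<delta>: "\<delta> > 0" "\<And>t. 0 \<le> t \<Longrightarrow> t \<le> \<delta> \<Longrightarrow> f t = 0" and R: "\<And>t. t \<ge> R \<Longrightarrow> f t = 0"
  shows "ccont f"
proof -
  have "continuous_on {0..\<delta>} f \<longleftrightarrow> continuous_on {0..\<delta>} (\<lambda>t. 0 :: real)"
    by (rule continuous_on_cong) (auto simp: \<delta>)
  then have 1: "continuous_on {0..\<delta>} f" by simp
  have 2: "continuous_on {\<delta>..} f" using \<delta> by (intro continuous_on_subset[OF assms(1)]) auto
  have "{0..} = {0..\<delta>} \<union> {\<delta>..}" using \<delta> by auto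
  then have "continuous_on {0..} f" using continuous_on_closed_Un[OF _ _ 1 2] by simp
  then show ?thesis using R by (auto simp: ccont_def)
qed

text \<open>Roots and real powers of \<open>t\<close> are differentiated at positive
  \<open>t\<close> only; a function that vanishes near 0 extends trivially.\<close>

lemma c1_of_positive:
  fixes f :: "real \<Rightarrow> real"
  assumes d: "\<And>t. t > 0 \<Longrightarrow> (f has_real_derivative f' t) (at t)" and c: "continuous_on {0<..} f'"
    and \<delta>: "\<delta> > 0" "\<And>t. 0 \<le> t \<Longrightarrow> t \<le> \<delta> \<Longrightarrow> f t = 0" "\<And>t. 0 \<le> t \<Longrightarrow> t \<le> \<delta> \<Longrightarrow> f' t = 0"
    and R: "\<And>t. t \<ge> R \<Longrightarrow> f t = 0" "\<And>t. t \<ge> R \<Longrightarrow> f' t = 0"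
  shows "c1 f f'"
proof -
  have "continuous_on {0<..} f" using d DERIV_isCont by (intro continuous_at_imp_continuous_on) auto
  then have "ccont f" "ccont f'" using ccont_of_positive[OF _ \<delta>(1,2) R(1)] ccont_of_positive[OF c \<delta>(1,3) R(2)] by auto
  moreover have "(f has_real_derivative f' t) (at t within {0..})" if "t \<ge> 0" for t
  proof (cases "t = 0")
    case False
    then show ?thesis using d[of t] that by (auto intro: has_field_derivative_at_within)
  next
    case True
    have "((\<lambda>t. 0) has_real_derivative 0) (at t within {0..<\<delta>})" by simp
    then have "(f has_real_derivative 0) (at t within {0..<\<delta>})"
      by (rule has_field_derivative_transform_within[where d = 1]) (use \<delta> True in auto)
    moreover have "at t within {0..<\<delta>} = at t within {0..}"
      using True \<delta> by (intro at_within_nhd[of t "{..<\<delta>}"]) auto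
    ultimately show ?thesis using \<delta>(3)[of 0] True \<delta>(1) by simp
  qed
  ultimately show ?thesis by (simp add: c1_def)
qed

lemma max_0_power2_deriv: "((\<lambda>u::real. (max 0 u)\<^sup>2) has_real_derivative 2 * max 0 u) (at u)"
proof -
  consider "u > 0" | "u < 0" | "u = 0" by linarith
  then show ?thesis
  proof cases
    case 1
    have "((\<lambda>u::real. u\<^sup>2) has_real_derivative 2 * max 0 u) (at u)" using 1 by (auto intro!: derivative_eq_intros)
    then show ?thesis
      by (rule has_field_derivative_transform_within_open[where S = "{0<..}"]) (use 1 in auto)
  next
    case 2
    have "((\<lambda>u::real. 0) has_real_derivative 2 * max 0 u) (at u)" using 2 by simp
    then show ?thesis
      by (rule has_field_derivative_transform_within_open[where S = "{..<0}"]) (use 2 in auto)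
  next
    case 3
    have "((\<lambda>h::real. (max 0 h)\<^sup>2 / h) \<longlongrightarrow> 0) (at 0)"
    proof (rule Lim_null_comparison)
      show "\<forall>\<^sub>F h in at 0. norm ((max 0 h)\<^sup>2 / h) \<le> \<bar>h :: real\<bar>"
        by (intro always_eventually allI) (auto simp: max_def power2_eq_square)
      show "((\<lambda>h::real. \<bar>h\<bar>) \<longlongrightarrow> 0) (at 0)" by (rule tendsto_eq_intros | simp)+
    qed
    then show ?thesis using 3 by (simp add: has_field_derivative_iff)
  qed
qed

text \<open>The envelope of a wave packet in the radius \<open>r\<close>, with centre
  \<open>L\<close> and half width \<open>R\<close>. Squaring the positive part makes it once
  continuously differentiable, which suits \<open>c1\<close>.\<close>

definition hump :: "real \<Rightarrow> real \<Rightarrow> real \<Rightarrow> real" where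
  "hump L R r = (max 0 (1 - ((r - L) / R)\<^sup>2))\<^sup>2"

definition hump' :: "real \<Rightarrow> real \<Rightarrow> real \<Rightarrow> real" where
  "hump' L R r = - 4 * ((r - L) / R\<^sup>2) * max 0 (1 - ((r - L) / R)\<^sup>2)"

lemma hump_deriv:
  assumes "R > 0"
  shows "(hump L R has_real_derivative hump' L R r) (at r)"
proof -
  have "((\<lambda>r. 1 - ((r - L) / R)\<^sup>2) has_real_derivative - 2 * ((r - L) / R\<^sup>2)) (at r)"
    using assms by (auto intro!: derivative_eq_intros simp: power2_eq_square field_simps)
  from DERIV_chain2[OF max_0_power2_deriv this]
  have "(hump L R has_real_derivative 2 * max 0 (1 - ((r - L) / R)\<^sup>2) * (- 2 * ((r - L) / R\<^sup>2))) (at r)"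
    by (simp only: hump_def[abs_def])
  moreover have "2 * m * (- 2 * d) = - 4 * d * m" for m d :: real by simp
  ultimately show ?thesis unfolding hump'_def by (simp only:)
qed

lemma hump_props:
  assumes "R > 0"
  shows "\<bar>r - L\<bar> \<ge> R \<Longrightarrow> hump L R r = 0" "\<bar>r - L\<bar> \<ge> R \<Longrightarrow> hump' L R r = 0"
    "(hump' L R r)\<^sup>2 \<le> 16 / R\<^sup>2" "\<bar>r - L\<bar> \<le> R / 2 \<Longrightarrow> (hump L R r)\<^sup>2 \<ge> 1 / 4"
proof -
  define x where "x = (r - L) / R"
  have x: "\<bar>r - L\<bar> = R * \<bar>x\<bar>" using assms by (simp add: x_def abs_mult)
  have h: "hump L R r = (max 0 (1 - x\<^sup>2))\<^sup>2" "hump' L R r = - (4 / R) * (x * max 0 (1 - x\<^sup>2))"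
    unfolding hump_def hump'_def x_def by (simp_all only: power2_eq_square[of R] divide_inverse inverse_mult_distrib) (simp add: mult.assoc mult.left_commute)
  have z: "max 0 (1 - x\<^sup>2) = 0" if "\<bar>r - L\<bar> \<ge> R"
  proof -
    have "\<bar>x\<bar> \<ge> 1" using that x assms by simp
    then have "x\<^sup>2 \<ge> 1" by (metis one_le_power power2_abs)
    then show ?thesis by simp
  qed
  then show "\<bar>r - L\<bar> \<ge> R \<Longrightarrow> hump L R r = 0" "\<bar>r - L\<bar> \<ge> R \<Longrightarrow> hump' L R r = 0" by (simp_all add: h)
  have "\<bar>x * max 0 (1 - x\<^sup>2)\<bar> \<le> 1"
  proof (cases "\<bar>x\<bar> \<le> 1")
    case True
    have "\<bar>x\<bar> * \<bar>max 0 (1 - x\<^sup>2)\<bar> \<le> 1 * 1" using True by (intro mult_mono) auto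
    then show ?thesis by (simp add: abs_mult)
  next
    case False
    then have "\<bar>r - L\<bar> \<ge> R" using x assms by simp
    then show ?thesis using z by simp
  qed
  then have "(x * max 0 (1 - x\<^sup>2))\<^sup>2 \<le> 1" by (simp add: abs_square_le_1)
  then have "(4 / R)\<^sup>2 * (x * max 0 (1 - x\<^sup>2))\<^sup>2 \<le> (4 / R)\<^sup>2 * 1" by (intro mult_left_mono) auto
  then show "(hump' L R r)\<^sup>2 \<le> 16 / R\<^sup>2" by (simp add: h power_mult_distrib power_divide)
  assume "\<bar>r - L\<bar> \<le> R / 2"
  then have "\<bar>x\<bar> \<le> 1/2" using x assms by simp
  then have "\<bar>x\<bar>\<^sup>2 \<le> (1/2)\<^sup>2" by (intro power_mono) auto
  then have "x\<^sup>2 \<le> 1 / 4" by (simp add: power_divide)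
  then have "3/4 \<le> max 0 (1 - x\<^sup>2)" by linarith
  then have "(3/4) ^ 4 \<le> (max 0 (1 - x\<^sup>2)) ^ 4" by (rule power_mono) simp
  moreover have "(max 0 (1 - x\<^sup>2)) ^ 4 = (hump L R r)\<^sup>2" by (simp add: h flip: power_mult)
  ultimately show "(hump L R r)\<^sup>2 \<ge> 1 / 4" by (simp add: power4_eq_xxxx)
qed

lemma continuous_on_hump: "R > 0 \<Longrightarrow> continuous_on S (hump L R)" "R > 0 \<Longrightarrow> continuous_on S (hump' L R)"
  unfolding hump_def[abs_def] hump'_def[abs_def] by (intro continuous_intros; simp)+

lemma powr_sqrt_deriv:
  fixes X X1 :: "real \<Rightarrow> real"
  assumes X: "\<And>r. (X has_real_derivative X1 r) (at r)" and t: "t > 0"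
  shows "((\<lambda>t. t powr p * X (sqrt t)) has_real_derivative p * t powr (p - 1) * X (sqrt t) + t powr p * (X1 (sqrt t) * (inverse (sqrt t) / 2))) (at t)"
proof -
  have 1: "((\<lambda>t. t powr p) has_real_derivative p * t powr (p - 1)) (at t)"
    using DERIV_fun_powr[OF DERIV_ident t, of p] by simp
  have 2: "((\<lambda>t. X (sqrt t)) has_real_derivative X1 (sqrt t) * (inverse (sqrt t) / 2)) (at t)"
    by (rule DERIV_chain2[OF X DERIV_real_sqrt[OF t]])
  show ?thesis using DERIV_mult[OF 1 2] by (simp add: mult_ac)
qed

text \<open>The function is the flux through the disc of radius \<open>r\<close> divided by
  \<open>2 * pi\<close>, and its derivative is \<open>r\<close> times the field. On
  \<open>[L/2, 2 L]\<close> this is at most a multiple of \<open>L powr (1 - \<gamma>)\<close>,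
  which becomes small after the later division by \<open>r\<close>.\<close>

lemma flux_lipschitz:
  fixes \<gamma> :: real
  assumes \<gamma>: "0 < \<gamma>" "\<gamma> < 1" and L: "L > 0" and R: "0 < R" "R \<le> L / 2" and r: "\<bar>r - L\<bar> \<le> R"
  shows "\<bar>r\<^sup>2 * (1 + r) powr (- \<gamma>) - L\<^sup>2 * (1 + L) powr (- \<gamma>)\<bar> \<le> R * (4 * L * (L / 2) powr (- \<gamma>))"
proof -
  let ?f = "\<lambda>r. r\<^sup>2 * (1 + r) powr (- \<gamma>)" and ?f' = "\<lambda>r. 2 * r * (1 + r) powr (- \<gamma>) + (- \<gamma> * (1 + r) powr (- \<gamma> - 1)) * r\<^sup>2"
  have d: "(?f has_real_derivative ?f' u) (at u)" if "u > 0" for u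
  proof -
    have "((\<lambda>r. (1 + r) powr (- \<gamma>)) has_real_derivative - \<gamma> * (1 + u) powr (- \<gamma> - 1)) (at u)"
      using DERIV_fun_powr[of "\<lambda>r. 1 + r" 1 u "- \<gamma>"] that by (auto intro!: derivative_eq_intros)
    moreover have "((\<lambda>r. r\<^sup>2) has_real_derivative 2 * u) (at u)" by (auto intro!: derivative_eq_intros)
    ultimately show ?thesis using DERIV_mult by blast
  qed
  have b: "\<bar>?f' u\<bar> \<le> 4 * L * (L / 2) powr (- \<gamma>)" if u: "L / 2 \<le> u" "u \<le> 2 * L" for u
  proof -
    have u0: "u > 0" using u L by simp
    have "(1 + u) powr (- \<gamma> - 1) * u\<^sup>2 = (1 + u) powr (- \<gamma>) * (u * (u / (1 + u)))"
      using u0 by (simp add: powr_diff power2_eq_square)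
    moreover have "u * (u / (1 + u)) \<le> u" using u0 by (simp add: field_simps)
    then have "(1 + u) powr (- \<gamma>) * (u * (u / (1 + u))) \<le> (1 + u) powr (- \<gamma>) * u" by (rule mult_left_mono) simp
    ultimately have 1: "0 \<le> (1 + u) powr (- \<gamma> - 1) * u\<^sup>2" "(1 + u) powr (- \<gamma> - 1) * u\<^sup>2 \<le> (1 + u) powr (- \<gamma>) * u"
      using u0 by (simp, linarith)
    have "\<gamma> * ((1 + u) powr (- \<gamma> - 1) * u\<^sup>2) \<le> 1 * ((1 + u) powr (- \<gamma>) * u)"
      using 1 \<gamma> by (intro mult_mono[OF less_imp_le 1(2)]) simp_all
    moreover have "0 \<le> \<gamma> * ((1 + u) powr (- \<gamma> - 1) * u\<^sup>2)" using 1 \<gamma> by simp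
    moreover have "?f' u = 2 * ((1 + u) powr (- \<gamma>) * u) - \<gamma> * ((1 + u) powr (- \<gamma> - 1) * u\<^sup>2)" by simp
    moreover have "0 \<le> (1 + u) powr (- \<gamma>) * u" using u0 by simp
    ultimately have "\<bar>?f' u\<bar> \<le> 2 * ((1 + u) powr (- \<gamma>) * u)" by linarith
    also have "\<dots> \<le> 2 * ((L / 2) powr (- \<gamma>) * (2 * L))"
      using u L \<gamma> by (intro mult_left_mono mult_mono powr_mono2') auto
    also have "\<dots> = 4 * L * (L / 2) powr (- \<gamma>)" by simp
    finally show ?thesis .
  qed
  have main: "\<bar>?f v - ?f u\<bar> \<le> R * (4 * L * (L / 2) powr (- \<gamma>))" if uv: "u < v" "L / 2 \<le> u" "v \<le> 2 * L" "v - u \<le> R" for u v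
  proof -
    have "(?f has_real_derivative ?f' w) (at w)" if "u \<le> w" for w using d[of w] uv that L by linarith
    from MVT2[OF uv(1) this]
    obtain \<xi> where xi: "u < \<xi>" "\<xi> < v" "?f v - ?f u = (v - u) * ?f' \<xi>" by blast
    have "\<bar>?f v - ?f u\<bar> = (v - u) * \<bar>?f' \<xi>\<bar>" unfolding xi(3) abs_mult using uv by simp
    also have "\<dots> \<le> R * (4 * L * (L / 2) powr (- \<gamma>))"
      using uv xi b[of \<xi>] R by (intro mult_mono) auto
    finally show ?thesis .
  qed
  have "R * (4 * L * (L / 2) powr (- \<gamma>)) \<ge> 0" using R L by simp
  then show ?thesis
    using main[of L r] main[of r L] r R by (cases "r < L"; cases "r = L") (auto simp: abs_minus_commute)
qed

context magnetic_dirac_setting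
begin

text \<open>In the sector \<open>False\<close>, writing \<open>\<alpha> = t^p Q\<close> and
  \<open>\<beta> = t^q P\<close> turns the operator into
  \<open>(P' + \<omega> P, - Q' + \<omega> Q)\<close> in the variable \<open>r\<close>. For an
  envelope times \<open>cos (\<kappa> r)\<close> and \<open>sin (\<kappa> r)\<close> the main part
  is \<open>\<kappa>\<close> times the pair \<open>(Q, P)\<close>; what remains involves the
  derivative of the envelope and \<open>\<omega>\<close> times the envelope. The width
  \<open>R\<close> is fixed to control the former, and only then is the centre \<open>L\<close>
  moved out to control the latter.\<close>

lemma weyl_pair:
  assumes \<epsilon>: "\<epsilon> > 0"
  shows "\<exists>x y. (x, y) \<in> \<T> \<and> norm (y - \<kappa> *\<^sub>R x) < \<epsilon> * norm x"
proof -
  \<comment> \<open>Makes \<open>128 / R\<close> equal to \<open>\<epsilon>^2 / 8 * (R / 4)\<close>: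
    \<open>128 / R\<close> bounds the integral of the envelope's derivative (\<open>up\<close>), and
    \<open>R / 4\<close> is a lower bound for that of the envelope (\<open>low\<close>).\<close>
  define R where "R = 64 / \<epsilon>"
  have R: "R > 0" using \<epsilon> by (simp add: R_def)
  have "((\<lambda>L. 2 / L + 8 * R * (L / 2) powr (- \<gamma>)) \<longlongrightarrow> 0 + 8 * R * 0) at_top"
  proof (intro tendsto_intros)
    show "((\<lambda>L::real. 2 / L) \<longlongrightarrow> 0) at_top" by (rule tendsto_divide_0[OF tendsto_const filterlim_at_top_imp_at_infinity[OF filterlim_ident]])
    have "filterlim (\<lambda>L::real. L * (1/2)) at_top at_top"
      by (rule filterlim_at_top_mult_tendsto_pos[OF tendsto_const _ filterlim_ident]) simp
    then have "filterlim (\<lambda>L::real. L / 2) at_top at_top" by simp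
    then show "((\<lambda>L::real. (L / 2) powr (- \<gamma>)) \<longlongrightarrow> 0) at_top"
      using \<gamma> by (intro tendsto_neg_powr) auto
  qed
  then have "\<forall>\<^sub>F L in at_top. 2 / L + 8 * R * (L / 2) powr (- \<gamma>) < \<epsilon> / 4"
    using \<epsilon> by (intro order_tendstoD(2)) auto
  then obtain L0 where L0: "\<And>L. L \<ge> L0 \<Longrightarrow> 2 / L + 8 * R * (L / 2) powr (- \<gamma>) < \<epsilon> / 4"
    by (auto simp: eventually_at_top_linorder)
  define L where "L = max L0 (2 * R)"
  have L: "L > 0" "R \<le> L / 2" "2 / L + 8 * R * (L / 2) powr (- \<gamma>) < \<epsilon> / 4"
    using R L0[of L] by (auto simp: L_def)
  define \<phi> where "\<phi> = L\<^sup>2 * (1 + L) powr (- \<gamma>)"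
  define k where "k = nat \<lfloor>\<phi>\<rfloor>" \<comment> \<open>makes \<open>(k + 1/2) / r\<close> cancel the potential near \<open>r = L\<close>\<close>
  have \<phi>0: "\<phi> \<ge> 0" by (simp add: \<phi>_def)
  have k: "\<bar>real k + 1/2 - \<phi>\<bar> \<le> 1"
  proof -
    have "real k = of_int \<lfloor>\<phi>\<rfloor>" using \<phi>0 by (simp add: k_def)
    then show ?thesis using floor_correct[of \<phi>] by linarith
  qed
  \<comment> \<open>The centrifugal term minus the potential, the zero-order part left once the
    powers of \<open>t\<close> are split off. It is \<open>k + 1/2\<close> minus the flux over
    \<open>2 * pi\<close>, divided by \<open>r\<close>; the choice of \<open>k\<close> makes it
    small at \<open>L\<close>, and \<open>flux_lipschitz\<close> near \<open>L\<close>.\<close>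
  define \<omega> where "\<omega> r = (real k + 1/2) / r - r * (1 + r) powr (- \<gamma>)" for r
  have \<omega>: "\<bar>\<omega> r\<bar> \<le> \<epsilon> / 4" if r: "\<bar>r - L\<bar> \<le> R" for r
  proof -
    have r0: "r \<ge> L / 2" using r L by linarith
    then have rp: "r > 0" using L by simp
    have "\<omega> r = ((real k + 1/2 - \<phi>) - (r\<^sup>2 * (1 + r) powr (- \<gamma>) - L\<^sup>2 * (1 + L) powr (- \<gamma>))) / r"
      using rp by (simp add: \<omega>_def \<phi>_def field_simps power2_eq_square)
    also have "\<bar>\<dots>\<bar> \<le> (1 + R * (4 * L * (L / 2) powr (- \<gamma>))) / r"
    proof -
      have "\<bar>(real k + 1/2 - \<phi>) - (r\<^sup>2 * (1 + r) powr (- \<gamma>) - L\<^sup>2 * (1 + L) powr (- \<gamma>))\<bar> \<le> 1 + R * (4 * L * (L / 2) powr (- \<gamma>))"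
        by (rule order_trans[OF abs_triangle_ineq4 add_mono[OF k flux_lipschitz[OF \<gamma> L(1) R L(2) r]]])
      then show ?thesis using rp by (simp only: abs_divide abs_of_pos divide_right_mono less_imp_le)
    qed
    also have "\<dots> \<le> (1 + R * (4 * L * (L / 2) powr (- \<gamma>))) / (L / 2)"
      using r0 L rp R by (intro divide_left_mono) auto
    also have "\<dots> = 2 / L + 8 * R * (L / 2) powr (- \<gamma>)" using L by (simp add: field_simps)
    finally show ?thesis using L by linarith
  qed
  let ?\<chi> = "hump L R" and ?\<chi>1 = "hump' L R"
  define Q Q1 P P1 where "Q r = ?\<chi> r * cos (\<kappa> * r)" and "Q1 r = ?\<chi>1 r * cos (\<kappa> * r) - \<kappa> * (?\<chi> r * sin (\<kappa> * r))"
    and "P r = ?\<chi> r * sin (\<kappa> * r)" and "P1 r = ?\<chi>1 r * sin (\<kappa> * r) + \<kappa> * (?\<chi> r * cos (\<kappa> * r))" for r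
  have dQ: "(Q has_real_derivative Q1 r) (at r)" and dP: "(P has_real_derivative P1 r) (at r)" for r
    unfolding Q_def[abs_def] Q1_def P_def[abs_def] P1_def
    by (auto intro!: derivative_eq_intros hump_deriv[OF R])
  have cQ: "continuous_on S Q" "continuous_on S Q1" "continuous_on S P" "continuous_on S P1" for S
    unfolding Q_def[abs_def] Q1_def[abs_def] P_def[abs_def] P1_def[abs_def] by (intro continuous_intros continuous_on_hump R)+
  \<comment> \<open>The powers remove the weights \<open>t ^ k\<close> and \<open>t ^ (k + 1)\<close> of the norm, so that \<open>Q\<close> and \<open>P\<close> are measured by \<open>dr\<close>.\<close>
  define p q where "p = - real k / 2 - 1/4" and "q = - real k / 2 - 3/4"
  define \<alpha> \<alpha>' \<beta> \<beta>' where "\<alpha> t = t powr p * Q (sqrt t)" and "\<alpha>' t = p * t powr (p - 1) * Q (sqrt t) + t powr p * (Q1 (sqrt t) * (inverse (sqrt t) / 2))"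
    and "\<beta> t = t powr q * P (sqrt t)" and "\<beta>' t = q * t powr (q - 1) * P (sqrt t) + t powr q * (P1 (sqrt t) * (inverse (sqrt t) / 2))" for t
  define \<delta> where "\<delta> = (L - R)\<^sup>2"
  define T where "T = (L + R)\<^sup>2"
  have LR: "L - R > 0" using L R by simp
  have \<delta>: "\<delta> > 0" using LR by (simp add: \<delta>_def)
  have out: "\<bar>sqrt t - L\<bar> \<ge> R" if "t \<le> \<delta> \<or> T \<le> t" for t
  proof -
    have "t \<le> \<delta> \<Longrightarrow> sqrt t \<le> L - R" using LR real_sqrt_le_mono[of t \<delta>] by (simp add: \<delta>_def)
    moreover have "T \<le> t \<Longrightarrow> L + R \<le> sqrt t" using L R real_sqrt_le_mono[of T t] by (simp add: T_def)
    ultimately show ?thesis using that by linarith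
  qed
  have zero: "?\<chi> (sqrt t) = 0" "?\<chi>1 (sqrt t) = 0" "Q (sqrt t) = 0" "Q1 (sqrt t) = 0" "P (sqrt t) = 0" "P1 (sqrt t) = 0" if "t \<le> \<delta> \<or> T \<le> t" for t
    using hump_props(1,2)[OF R out[OF that]] by (simp_all add: Q_def Q1_def P_def P1_def)
  have cs: "continuous_on {0<..} (\<lambda>t. X (sqrt t))" if "\<And>S. continuous_on S X" for X :: "real \<Rightarrow> real"
    by (rule continuous_on_compose2[OF that[of UNIV]]) (auto intro!: continuous_intros)
  have c1\<alpha>: "c1 \<alpha> \<alpha>'"
  proof (rule c1_of_positive)
    show "(\<alpha> has_real_derivative \<alpha>' t) (at t)" if "t > 0" for t
      unfolding \<alpha>_def[abs_def] \<alpha>'_def by (rule powr_sqrt_deriv[OF dQ that])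
    show "continuous_on {0<..} \<alpha>'" unfolding \<alpha>'_def[abs_def]
      by (intro continuous_intros cs cQ) auto
    show "\<alpha> t = 0" "\<alpha>' t = 0" if "0 \<le> t" "t \<le> \<delta>" for t using zero[of t] that by (simp_all add: \<alpha>_def \<alpha>'_def)
    show "\<alpha> t = 0" "\<alpha>' t = 0" if "T \<le> t" for t using zero[of t] that by (simp_all add: \<alpha>_def \<alpha>'_def)
  qed (rule \<delta>)
  have c1\<beta>: "c1 \<beta> \<beta>'"
  proof (rule c1_of_positive)
    show "(\<beta> has_real_derivative \<beta>' t) (at t)" if "t > 0" for t
      unfolding \<beta>_def[abs_def] \<beta>'_def by (rule powr_sqrt_deriv[OF dP that])
    show "continuous_on {0<..} \<beta>'" unfolding \<beta>'_def[abs_def]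
      by (intro continuous_intros cs cQ) auto
    show "\<beta> t = 0" "\<beta>' t = 0" if "0 \<le> t" "t \<le> \<delta>" for t using zero[of t] that by (simp_all add: \<beta>_def \<beta>'_def)
    show "\<beta> t = 0" "\<beta>' t = 0" if "T \<le> t" for t using zero[of t] that by (simp_all add: \<beta>_def \<beta>'_def)
  qed (rule \<delta>)
  note ca = c1D(2,3)[OF c1\<alpha>] and cb = c1D(2,3)[OF c1\<beta>]
  let ?d1 = "sector_dirac1 \<gamma> False k \<beta> \<beta>'" and ?d2 = "sector_dirac2 \<gamma> False \<alpha> \<alpha>'"
  define x y where "x = sec False k \<alpha> \<beta>" and "y = sec False k ?d1 ?d2"
  have xy: "(x, y) \<in> \<T>" unfolding x_def y_def by (rule sector_mem_closure[OF c1\<alpha> c1\<beta>])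
  note cd = ccont_sector_dirac1[OF cb, of \<gamma> False k] ccont_sector_dirac2[OF ca, of \<gamma> False]
  have w: "t ^ k * (t powr p)\<^sup>2 = 1 / sqrt t" "t ^ (k + 1) * (t powr q)\<^sup>2 = 1 / sqrt t" if t: "t > 0" for t
  proof -
    have "t ^ k * (t powr p)\<^sup>2 = t powr (real k + (p + p))" "t ^ (k + 1) * (t powr q)\<^sup>2 = t powr (real (k + 1) + (q + q))"
      using t by (simp_all only: powr_add powr_realpow power2_eq_square)
    moreover have "real k + (p + p) = - (1/2)" "real (k + 1) + (q + q) = - (1/2)" by (simp_all add: p_def q_def field_simps)
    ultimately show "t ^ k * (t powr p)\<^sup>2 = 1 / sqrt t" "t ^ (k + 1) * (t powr q)\<^sup>2 = 1 / sqrt t"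
      using t by (simp_all only: powr_minus powr_half_sqrt[OF less_imp_le[OF t]] inverse_eq_divide)
  qed
  define F0 F1 where "F0 t = (?\<chi> (sqrt t))\<^sup>2 / sqrt t" and "F1 t = (?\<chi>1 (sqrt t))\<^sup>2 / sqrt t" for t
  have cF: "ccont F0" "ccont F1"
    unfolding F0_def[abs_def] F1_def[abs_def]
    by (rule ccont_of_positive[where \<delta> = \<delta> and R = T], intro continuous_intros cs continuous_on_hump R, (use \<delta> zero in auto)[4])+
  have nx: "(norm x)\<^sup>2 = pi * integral {0..} F0"
  proof -
    have "(norm x)\<^sup>2 = pi * integral {0..} (\<lambda>t. t ^ k * (\<alpha> t)\<^sup>2 + t ^ (k + 1) * (\<beta> t)\<^sup>2)"
      unfolding x_def by (rule sec_norm[OF ca(1) cb(1)])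
    also have "integral {0..} (\<lambda>t. t ^ k * (\<alpha> t)\<^sup>2 + t ^ (k + 1) * (\<beta> t)\<^sup>2) = integral {0..} F0"
    proof (rule integral_cong)
      fix t :: real assume "t \<in> {0..}"
      show "t ^ k * (\<alpha> t)\<^sup>2 + t ^ (k + 1) * (\<beta> t)\<^sup>2 = F0 t"
      proof (cases "t = 0")
        case True then show ?thesis using zero[of 0] \<delta> by (simp add: \<alpha>_def \<beta>_def F0_def)
      next
        case False
        then have t: "t > 0" using \<open>t \<in> _\<close> by simp
        have "t ^ k * (\<alpha> t)\<^sup>2 + t ^ (k + 1) * (\<beta> t)\<^sup>2 = t ^ k * (t powr p)\<^sup>2 * (Q (sqrt t))\<^sup>2 + t ^ (k + 1) * (t powr q)\<^sup>2 * (P (sqrt t))\<^sup>2"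
          by (simp only: \<alpha>_def \<beta>_def power_mult_distrib mult.assoc)
        also have "\<dots> = ((Q (sqrt t))\<^sup>2 + (P (sqrt t))\<^sup>2) / sqrt t" unfolding w[OF t] by (simp add: add_divide_distrib)
        also have "(Q (sqrt t))\<^sup>2 + (P (sqrt t))\<^sup>2 = (?\<chi> (sqrt t))\<^sup>2 * ((cos (\<kappa> * sqrt t))\<^sup>2 + (sin (\<kappa> * sqrt t))\<^sup>2)"
          by (simp only: Q_def P_def power_mult_distrib distrib_left)
        finally show ?thesis by (simp add: F0_def)
      qed
    qed
    finally show ?thesis .
  qed
  have ny: "(norm (y - \<kappa> *\<^sub>R x))\<^sup>2 \<le> pi * (2 * integral {0..} F1 + 2 * (\<epsilon> / 4)\<^sup>2 * integral {0..} F0)"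
  proof -
    have ck: "ccont (\<lambda>t. ?d1 t - \<kappa> * \<alpha> t)" "ccont (\<lambda>t. ?d2 t - \<kappa> * \<beta> t)"
      by (intro ccont_diff ccont_cmult cd ca cb)+
    have "y - \<kappa> *\<^sub>R x = sec False k (\<lambda>t. ?d1 t - \<kappa> * \<alpha> t) (\<lambda>t. ?d2 t - \<kappa> * \<beta> t)"
      unfolding x_def y_def sec_scaleR[OF ca(1) cb(1)]
      by (rule sec_diff) (intro cd ccont_cmult ca cb)+
    then have "(norm (y - \<kappa> *\<^sub>R x))\<^sup>2 = pi * integral {0..} (\<lambda>t. t ^ k * (?d1 t - \<kappa> * \<alpha> t)\<^sup>2 + t ^ (k + 1) * (?d2 t - \<kappa> * \<beta> t)\<^sup>2)"
      using sec_norm[OF ck] by simp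
    also have "\<dots> \<le> pi * integral {0..} (\<lambda>t. 2 * F1 t + 2 * (\<epsilon> / 4)\<^sup>2 * F0 t)"
    proof (intro mult_left_mono integral_le ccont_integrable)
      show "ccont (\<lambda>t. t ^ k * (?d1 t - \<kappa> * \<alpha> t)\<^sup>2 + t ^ (k + 1) * (?d2 t - \<kappa> * \<beta> t)\<^sup>2)"
        by (intro ccont_add ccont_mult ccont_power2 ck continuous_intros)
      show "ccont (\<lambda>t. 2 * F1 t + 2 * (\<epsilon> / 4)\<^sup>2 * F0 t)" by (intro ccont_add ccont_cmult cF)
      fix t :: real assume "t \<in> {0..}"
      show "t ^ k * (?d1 t - \<kappa> * \<alpha> t)\<^sup>2 + t ^ (k + 1) * (?d2 t - \<kappa> * \<beta> t)\<^sup>2 \<le> 2 * F1 t + 2 * (\<epsilon> / 4)\<^sup>2 * F0 t"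
      proof (cases "t \<le> \<delta> \<or> T \<le> t")
        case True
        then show ?thesis using zero[OF True]
          by (simp add: \<alpha>_def \<beta>_def \<alpha>'_def \<beta>'_def sector_dirac1_def sector_dirac2_def F0_def F1_def)
      next
        case False
        then have t: "t > 0" using \<delta> by simp
        define r where "r = sqrt t"
        have r: "r > 0" "t = r * r" using t by (simp_all add: r_def)
        have r2: "r * r powr z = r powr (z + 1)" for z using r by (simp add: powr_add)
        have fs: "field_strength \<gamma> t = (1 + r) powr (- \<gamma>)" by (simp add: field_strength_def r_def)
        have tp: "t powr (p - 1) = t powr q / r" "t powr (q - 1) = t powr q / (r * r)" "t powr p = t powr q * r"
        proof -
          have h: "t powr (1/2) = r" using t by (simp add: powr_half_sqrt r_def)
          have "t powr (p - 1) = t powr (q - 1/2)" "t powr p = t powr (q + 1/2)" by (rule arg_cong[of _ _ "(powr) t"]; simp add: p_def q_def)+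
          then show "t powr (p - 1) = t powr q / r" "t powr p = t powr q * r" by (simp_all only: powr_diff powr_add h)
          show "t powr (q - 1) = t powr q / (r * r)" using t r by (simp add: powr_diff)
        qed
        obtain W where W: "t powr q = W" by blast
        have d2: "?d2 t - \<kappa> * \<beta> t = t powr q * (- Q1 r + \<omega> r * Q r - \<kappa> * P r)"
          unfolding sector_dirac2_def \<alpha>'_def \<alpha>_def \<beta>_def fs \<omega>_def r_def[symmetric] tp W
          using r(1) by (simp add: sgn_sector_def p_def field_simps)
        have d1: "?d1 t - \<kappa> * \<alpha> t = t powr p * (P1 r + \<omega> r * P r - \<kappa> * Q r)"
          unfolding sector_dirac1_def \<beta>'_def \<alpha>_def \<beta>_def fs \<omega>_def r_def[symmetric] tp W
          using r(1) by (simp add: sgn_sector_def r(2) q_def field_simps)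
        have "\<bar>sqrt t - L\<bar> \<le> R"
        proof -
          have "sqrt \<delta> \<le> sqrt t" "sqrt t \<le> sqrt T" using False by (simp_all add: real_sqrt_le_iff)
          then show ?thesis using LR L R by (simp add: \<delta>_def T_def abs_le_iff)
        qed
        then have om: "\<bar>\<omega> r\<bar> \<le> \<epsilon> / 4" using \<omega> by (simp add: r_def)
        let ?c = "cos (\<kappa> * r)" and ?s = "sin (\<kappa> * r)"
        have e1: "P1 r + \<omega> r * P r - \<kappa> * Q r = (?\<chi>1 r + \<omega> r * ?\<chi> r) * ?s" by (simp add: P1_def P_def Q_def algebra_simps)
        have e2: "- Q1 r + \<omega> r * Q r - \<kappa> * P r = (- ?\<chi>1 r + \<omega> r * ?\<chi> r) * ?c" by (simp add: Q1_def P_def Q_def algebra_simps)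
        have "t ^ k * (?d1 t - \<kappa> * \<alpha> t)\<^sup>2 + t ^ (k + 1) * (?d2 t - \<kappa> * \<beta> t)\<^sup>2
          = t ^ k * (t powr p)\<^sup>2 * ((?\<chi>1 r + \<omega> r * ?\<chi> r) * ?s)\<^sup>2 + t ^ (k + 1) * (t powr q)\<^sup>2 * ((- ?\<chi>1 r + \<omega> r * ?\<chi> r) * ?c)\<^sup>2"
          unfolding d1 d2 e1 e2 by (simp only: power_mult_distrib mult.assoc)
        also have "\<dots> = (((?\<chi>1 r + \<omega> r * ?\<chi> r) * ?s)\<^sup>2 + ((- ?\<chi>1 r + \<omega> r * ?\<chi> r) * ?c)\<^sup>2) / r"
          unfolding w[OF t] by (simp add: add_divide_distrib r_def)
        also have "\<dots> \<le> (2 * (?\<chi>1 r)\<^sup>2 + 2 * ((\<epsilon> / 4)\<^sup>2 * (?\<chi> r)\<^sup>2)) / r"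
        proof (intro divide_right_mono)
          have s: "(a + b)\<^sup>2 \<le> 2 * a\<^sup>2 + 2 * b\<^sup>2" for a b :: real using sum_squares_bound[of a b] by (simp add: power2_sum)
          let ?S = "2 * (?\<chi>1 r)\<^sup>2 + 2 * (\<omega> r * ?\<chi> r)\<^sup>2"
          have "((?\<chi>1 r + \<omega> r * ?\<chi> r) * ?s)\<^sup>2 + ((- ?\<chi>1 r + \<omega> r * ?\<chi> r) * ?c)\<^sup>2 \<le> ?S * ?s\<^sup>2 + ?S * ?c\<^sup>2"
            unfolding power_mult_distrib[of _ ?s] power_mult_distrib[of _ ?c]
            using s[of "?\<chi>1 r" "\<omega> r * ?\<chi> r"] s[of "- ?\<chi>1 r" "\<omega> r * ?\<chi> r"] by (intro add_mono mult_right_mono) auto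
          also have "\<dots> = ?S * (?s\<^sup>2 + ?c\<^sup>2)" by (simp only: distrib_left)
          also have "\<dots> = ?S" by simp
          also have "(\<omega> r * ?\<chi> r)\<^sup>2 \<le> (\<epsilon> / 4)\<^sup>2 * (?\<chi> r)\<^sup>2"
            unfolding power_mult_distrib using om \<epsilon> by (intro mult_right_mono) (auto simp: abs_le_square_iff[symmetric])
          finally show "((?\<chi>1 r + \<omega> r * ?\<chi> r) * ?s)\<^sup>2 + ((- ?\<chi>1 r + \<omega> r * ?\<chi> r) * ?c)\<^sup>2 \<le> 2 * (?\<chi>1 r)\<^sup>2 + 2 * ((\<epsilon> / 4)\<^sup>2 * (?\<chi> r)\<^sup>2)" by simp
        qed (use r in simp)
        also have "\<dots> = 2 * F1 t + 2 * (\<epsilon> / 4)\<^sup>2 * F0 t" by (simp add: F0_def F1_def r_def add_divide_distrib)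
        finally show ?thesis .
      qed
    qed simp
    also have "integral {0..} (\<lambda>t. 2 * F1 t + 2 * (\<epsilon> / 4)\<^sup>2 * F0 t) = 2 * integral {0..} F1 + 2 * (\<epsilon> / 4)\<^sup>2 * integral {0..} F0"
      using Henstock_Kurzweil_Integration.integral_add[OF ccont_integrable[OF ccont_cmult[OF cF(2)]] ccont_integrable[OF ccont_cmult[OF cF(1)]], of 2 "2 * (\<epsilon> / 4)\<^sup>2"] by simp
    finally show ?thesis .
  qed
  \<comment> \<open>The interval of \<open>t\<close> has length \<open>2 L R\<close>, and on it the
    integrand is at least \<open>(1/4) / (2 L)\<close>.\<close>
  have low: "R / 4 \<le> integral {0..} F0"
  proof -
    let ?a = "(L - R / 2)\<^sup>2" and ?b = "(L + R / 2)\<^sup>2"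
    have ab: "?a \<le> ?b" using L R by (intro power_mono) auto
    have i: "F0 integrable_on {?a..?b}"
      by (intro integrable_continuous_interval continuous_on_subset[OF ccontD[OF cF(1)]]) (auto intro: order_trans[OF zero_le_power2])
    have "R / 4 = integral {?a..?b} (\<lambda>t. 1 / (8 * L))" using ab L by (simp add: power2_eq_square field_simps)
    also have "\<dots> \<le> integral {?a..?b} F0"
    proof (rule integral_le[OF _ i])
      fix t assume t: "t \<in> {?a..?b}"
      have s: "L - R / 2 \<le> sqrt t" "sqrt t \<le> L + R / 2"
        using t L R real_sqrt_le_mono[of ?a t] real_sqrt_le_mono[of t ?b] by auto
      then have "\<bar>sqrt t - L\<bar> \<le> R / 2" unfolding abs_le_iff by linarith
      then have "1 / 4 \<le> (?\<chi> (sqrt t))\<^sup>2" by (rule hump_props(4)[OF R])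
      moreover have "sqrt t > 0" using s L R by linarith
      moreover have "sqrt t \<le> 2 * L" using s L by linarith
      ultimately have "(1 / 4) / (2 * L) \<le> (?\<chi> (sqrt t))\<^sup>2 / sqrt t" by (intro frac_le) auto
      then show "1 / (8 * L) \<le> F0 t" by (simp add: F0_def)
    qed (rule integrable_const_ivl)
    also have "\<dots> \<le> integral {0..} F0"
    proof (rule integral_subset_le[OF _ i ccont_integrable[OF cF(1)]])
      show "{?a..?b} \<subseteq> {0..}" by (auto intro: order_trans[OF zero_le_power2])
    qed (auto simp: F0_def)
    finally show ?thesis .
  qed
  \<comment> \<open>The support in \<open>t\<close> has length \<open>4 L R\<close>, and there the
    integrand is at most \<open>(16 / R^2) / (L / 2)\<close>.\<close>
  have up: "integral {0..} F1 \<le> 128 / R"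
  proof -
    have \<delta>T: "\<delta> \<le> T" unfolding \<delta>_def T_def using L R by (intro power_mono) auto
    have i: "F1 integrable_on {a..b}" if "a \<ge> 0" for a b
      by (intro integrable_continuous_interval continuous_on_subset[OF ccontD[OF cF(2)]]) (use that in auto)
    have "integral {0..} F1 = integral {0..T} F1"
      using zero(2) \<delta> \<delta>T by (intro ccont_integral_eq[OF cF(2)]) (auto simp: F1_def)
    also have "\<dots> = integral {0..\<delta>} F1 + integral {\<delta>..T} F1"
      using \<delta> \<delta>T i[of 0 T] by (intro Henstock_Kurzweil_Integration.integral_combine[symmetric]) auto
    also have "integral {0..\<delta>} F1 = 0" by (rule integral_zero_on_interval) (use zero(2) in \<open>auto simp: F1_def\<close>)
    also have "integral {\<delta>..T} F1 \<le> integral {\<delta>..T} (\<lambda>t. (16 / R\<^sup>2) / (L / 2))"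
    proof (rule integral_le)
      show "F1 integrable_on {\<delta>..T}" using \<delta> by (intro i) simp
      fix t assume t: "t \<in> {\<delta>..T}"
      have "L - R \<le> sqrt t" using t LR real_sqrt_le_mono[of \<delta> t] by (simp add: \<delta>_def)
      then have "L / 2 \<le> sqrt t" using L by linarith
      then show "F1 t \<le> (16 / R\<^sup>2) / (L / 2)" unfolding F1_def
        using hump_props(3)[OF R] L by (intro frac_le) auto
    qed (rule integrable_const_ivl)
    also have "\<dots> = 128 / R" using \<delta>T L R by (simp add: \<delta>_def T_def power2_eq_square field_simps)
    finally show ?thesis by simp
  qed
  have Rs: "128 / R \<le> (\<epsilon>\<^sup>2 / 8) * (R / 4)"
    using \<epsilon> by (simp add: R_def field_simps power2_eq_square)
  have F0p: "integral {0..} F0 > 0" using low R by linarith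
  have "2 * integral {0..} F1 \<le> (\<epsilon>\<^sup>2 / 4) * integral {0..} F0"
  proof -
    have "(\<epsilon>\<^sup>2 / 8) * (R / 4) \<le> (\<epsilon>\<^sup>2 / 8) * integral {0..} F0" using low by (intro mult_left_mono) auto
    then show ?thesis using up Rs by linarith
  qed
  moreover have "2 * (\<epsilon> / 4)\<^sup>2 * integral {0..} F0 \<le> (\<epsilon>\<^sup>2 / 4) * integral {0..} F0"
    using F0p by (intro mult_right_mono) (auto simp: power_divide)
  ultimately have "2 * integral {0..} F1 + 2 * (\<epsilon> / 4)\<^sup>2 * integral {0..} F0 \<le> (\<epsilon>\<^sup>2 / 2) * integral {0..} F0" by linarith
  also have "\<dots> < \<epsilon>\<^sup>2 * integral {0..} F0" using F0p \<epsilon> by (intro mult_strict_right_mono) auto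
  finally have "pi * (2 * integral {0..} F1 + 2 * (\<epsilon> / 4)\<^sup>2 * integral {0..} F0) < pi * (\<epsilon>\<^sup>2 * integral {0..} F0)"
    by (intro mult_strict_left_mono) auto
  also have "\<dots> = (\<epsilon> * norm x)\<^sup>2" by (simp add: power_mult_distrib nx)
  finally have "(norm (y - \<kappa> *\<^sub>R x))\<^sup>2 < (\<epsilon> * norm x)\<^sup>2" using ny by linarith
  then have "norm (y - \<kappa> *\<^sub>R x) < \<epsilon> * norm x" by (rule power_less_imp_less_base) (use \<epsilon> in simp)
  then show ?thesis using xy by blast
qed

end

section \<open>The eigenfunctions are complete\<close>

text \<open>Weierstrass on \<open>S\<close> extends vanishing from polynomials to continuous
  functions; the functions \<open>max 0 (1 - n * infdist p F)\<close> decrease to the indicator of a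
  closed set \<open>F\<close>; a Dynkin class argument reaches all Borel sets, so the signed density
  \<open>k\<close> is 0 almost everywhere.\<close>

lemma polynomial_moments_zero_imp_AE_zero:
  fixes k :: "'a::euclidean_space \<Rightarrow> real"
  assumes k: "integrable lborel k" and S: "compact S" "\<And>p. p \<notin> S \<Longrightarrow> k p = 0"
    and moments: "\<And>P. real_polynomial_function P \<Longrightarrow> (LINT p|lborel. P p * k p) = 0"
  shows "AE p in lborel. k p = 0"
proof -
  have km[measurable]: "k \<in> borel_measurable borel" using k by (simp add: borel_measurable_integrable)
  have int: "integrable lborel (\<lambda>p. f p * k p)" if f: "continuous_on UNIV f" for f :: "'a \<Rightarrow> real"
  proof -
    have fm[measurable]: "f \<in> borel_measurable borel" by (rule borel_measurable_continuous_onI[OF f])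
    have "bounded (f ` S)" using S f by (intro compact_imp_bounded compact_continuous_image continuous_on_subset[OF f]) auto
    then obtain M where M: "\<And>p. p \<in> S \<Longrightarrow> \<bar>f p\<bar> \<le> M" unfolding bounded_iff by auto
    show ?thesis
    proof (rule Bochner_Integration.integrable_bound)
      show "integrable lborel (\<lambda>p. M * k p)" using k by simp
      have "\<bar>f p * k p\<bar> \<le> \<bar>M * k p\<bar>" for p
        using M[of p] S(2)[of p] by (cases "p \<in> S") (auto simp: abs_mult intro!: mult_right_mono)
      then show "AE p in lborel. norm (f p * k p) \<le> norm (M * k p)" by simp
    qed simp
  qed
  define I where "I = (LINT p|lborel. \<bar>k p\<bar>)"
  have I: "I \<ge> 0" unfolding I_def by (rule integral_nonneg_AE) simp
  have cont: "(LINT p|lborel. f p * k p) = 0" if f: "continuous_on UNIV f" for f :: "'a \<Rightarrow> real"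
  proof (rule ccontr)
    let ?x = "LINT p|lborel. f p * k p"
    assume "?x \<noteq> 0"
    define \<epsilon> where "\<epsilon> = \<bar>?x\<bar> / (I + 1)"
    have \<epsilon>: "\<epsilon> > 0" using \<open>?x \<noteq> 0\<close> I by (simp add: \<epsilon>_def)
    obtain P where P: "real_polynomial_function P" "\<And>p. p \<in> S \<Longrightarrow> \<bar>f p - P p\<bar> < \<epsilon>"
      using Stone_Weierstrass_real_polynomial_function[OF S(1) continuous_on_subset[OF f] \<epsilon>] by auto
    have cP: "continuous_on UNIV P"
      using P(1) by (intro continuous_at_imp_continuous_on ballI continuous_real_polymonial_function)
    have "?x = (LINT p|lborel. f p * k p) - (LINT p|lborel. P p * k p)" using moments[OF P(1)] by simp
    also have "\<dots> = (LINT p|lborel. f p * k p - P p * k p)"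
      by (rule Bochner_Integration.integral_diff[symmetric, OF int[OF f] int[OF cP]])
    also have "\<bar>\<dots>\<bar> \<le> (LINT p|lborel. \<epsilon> * \<bar>k p\<bar>)"
    proof -
      have "norm (LINT p|lborel. f p * k p - P p * k p) \<le> (LINT p|lborel. \<epsilon> * \<bar>k p\<bar>)"
      proof (rule Bochner_Integration.integral_norm_bound_integral)
        show "integrable lborel (\<lambda>p. f p * k p - P p * k p)" "integrable lborel (\<lambda>p. \<epsilon> * \<bar>k p\<bar>)"
          using int[OF f] int[OF cP] k by simp_all
        show "norm (f p * k p - P p * k p) \<le> \<epsilon> * \<bar>k p\<bar>" for p
          using P(2)[of p] S(2)[of p]
          by (cases "p \<in> S") (auto simp: abs_mult simp flip: left_diff_distrib intro!: mult_right_mono)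
      qed
      then show ?thesis by simp
    qed
    also have "\<dots> = \<bar>?x\<bar> * (I / (I + 1))" by (simp add: I_def \<epsilon>_def)
    also have "\<dots> < \<bar>?x\<bar> * 1" using I \<open>?x \<noteq> 0\<close> by (intro mult_strict_left_mono) auto
    finally show False by simp
  qed
  have closed: "(LINT p:F|lborel. k p) = 0" if F: "closed F" for F
  proof (cases "F = {}")
    case False
    let ?f = "\<lambda>n p. max 0 (1 - real n * infdist p F)"
    have "(\<lambda>n. LINT p|lborel. ?f n p * k p) \<longlonglongrightarrow> (LINT p|lborel. indicator F p *\<^sub>R k p)"
    proof (rule integral_dominated_convergence)
      show "(\<lambda>p. indicator F p *\<^sub>R k p) \<in> borel_measurable lborel"
        using borel_closed[OF F] by measurable
      have "continuous_on UNIV (?f n)" for n by (intro continuous_intros)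
      then have [measurable]: "?f n \<in> borel_measurable borel" for n by (rule borel_measurable_continuous_onI)
      show "(\<lambda>p. ?f n p * k p) \<in> borel_measurable lborel" for n by measurable
      show "integrable lborel (\<lambda>p. \<bar>k p\<bar>)" using k by simp
      have "norm (?f n p * k p) \<le> \<bar>k p\<bar>" for n p
        using infdist_nonneg[of p F] by (simp add: abs_mult mult_left_le_one_le)
      then show "AE p in lborel. norm (?f n p * k p) \<le> \<bar>k p\<bar>" for n by simp
      have "(\<lambda>n. ?f n p) \<longlonglongrightarrow> indicator F p" for p
      proof (cases "p \<in> F")
        case False
        then have d: "infdist p F > 0" using F \<open>F \<noteq> {}\<close> by (simp add: infdist_pos_not_in_closed)
        obtain N where N: "1 / infdist p F \<le> real N" using real_arch_simple by blast
        have "?f n p = 0" if "n \<ge> N" for n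
        proof -
          have "1 / infdist p F \<le> real n" using N that by linarith
          then have "1 \<le> real n * infdist p F" using d by (simp add: field_simps)
          then show ?thesis by simp
        qed
        then have "\<forall>\<^sub>F n in sequentially. ?f n p = 0" by (auto simp: eventually_sequentially)
        then show ?thesis using False by (simp add: tendsto_eventually)
      qed simp
      then have "(\<lambda>n. ?f n p * k p) \<longlonglongrightarrow> indicator F p * k p" for p by (intro tendsto_mult tendsto_const)
      then show "AE p in lborel. (\<lambda>n. ?f n p * k p) \<longlonglongrightarrow> indicator F p *\<^sub>R k p" by simp
    qed
    moreover have "(LINT p|lborel. ?f n p * k p) = 0" for n by (intro cont continuous_intros)
    ultimately show ?thesis by (simp add: set_lebesgue_integral_def LIMSEQ_const_iff)
  qed (simp add: set_lebesgue_integral_def)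
  have si: "set_integrable lborel A k" if "A \<in> sets borel" for A
    unfolding set_integrable_def using that k by (intro integrable_mult_indicator) auto
  have borel: "(LINT p:A|lborel. k p) = 0" if "A \<in> sets borel" for A
  proof -
    have "Int_stable (Collect closed :: 'a set set)" "Collect closed \<subseteq> Pow (UNIV :: 'a set)" "A \<in> sigma_sets UNIV (Collect closed)"
      using that by (auto simp: Int_stable_def borel_eq_closed)
    then show ?thesis
    proof (induction rule: sigma_sets_induct_disjoint)
      case (basic A) then show ?case using closed by simp
    next
      case empty show ?case by (simp add: set_lebesgue_integral_def)
    next
      case (compl A)
      have A: "A \<in> sets borel" using compl.hyps by (simp add: borel_eq_closed)
      have "(LINT p:UNIV|lborel. k p) = (LINT p:A|lborel. k p) + (LINT p:UNIV - A|lborel. k p)"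
        using A set_integral_Un[of A "UNIV - A" lborel k] si[of A] si[of "UNIV - A"] by auto
      then show ?case using compl.IH closed[of UNIV] by simp
    next
      case (union A)
      have A: "A i \<in> sets borel" for i using union.hyps(2) by (auto simp: borel_eq_closed)
      have "(LINT p:(\<Union>i. A i)|lborel. k p) = (\<Sum>i. LINT p:A i|lborel. k p)"
        using A union.hyps(1) by (intro lebesgue_integral_countable_add si sets.countable_UN) (auto simp: disjoint_family_on_def)
      then show ?case using union.IH by simp
    qed
  qed
  show ?thesis
    by (rule density_unique_real[OF k]) (use borel in \<open>auto simp: set_lebesgue_integral_def\<close>)
qed

lemma closure_span_mult_i:
  assumes "\<And>x. x \<in> B \<Longrightarrow> mult_i x \<in> B" "x \<in> closure (span B)"
  shows "mult_i x \<in> closure (span B)"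
proof -
  have "mult_i x \<in> span B" if "x \<in> span B" for x
  proof -
    have "mult_i ` span B = span (mult_i ` B)" by (rule linear_span_image[OF linear_mult_i, symmetric])
    also have "\<dots> \<subseteq> span B" using assms(1) by (intro span_mono) auto
    finally show ?thesis using that by blast
  qed
  then have "mult_i ` closure (span B) \<subseteq> closure (span B)"
    by (intro image_closure_subset continuous_on_mult_i closed_closure) (auto intro!: subsetD[OF closure_subset])
  then show ?thesis using assms(2) by blast
qed

context magnetic_dirac_setting
begin

lemma power_mult_cnj_power:
  shows "b \<le> a \<Longrightarrow> zc p ^ a * cnj (zc p) ^ b = zc p ^ (a - b) * of_real (((norm p)\<^sup>2) ^ b)"
    "a \<le> b \<Longrightarrow> zc p ^ a * cnj (zc p) ^ b = cnj (zc p) ^ (b - a) * of_real (((norm p)\<^sup>2) ^ a)"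
proof -
  have h: "zc p ^ n * cnj (zc p) ^ n = of_real (((norm p)\<^sup>2) ^ n)" for n
    unfolding power_mult_distrib[symmetric] zc_mult_cnj by simp
  show "zc p ^ a * cnj (zc p) ^ b = zc p ^ (a - b) * of_real (((norm p)\<^sup>2) ^ b)" if "b \<le> a"
    using that power_add[of "zc p" "a - b" b] h[of b] by (simp add: mult.assoc)
  show "zc p ^ a * cnj (zc p) ^ b = cnj (zc p) ^ (b - a) * of_real (((norm p)\<^sup>2) ^ a)" if "a \<le> b"
    using that power_add[of "cnj (zc p)" "b - a" a] h[of a] by (simp add: mult_ac)
qed

text \<open>A vector \<open>g\<close> orthogonal to all eigenvectors is orthogonal to every sector,
  hence to all cut off monomials in \<open>zc\<close> and its conjugate, in either component. These
  generate all polynomials in the coordinates, so each cut off component of \<open>g\<close> has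
  vanishing moments.\<close>

lemma eigenvectors_complete: "closure (span (eigenvectors \<T>)) = UNIV"
proof -
  define W where "W = closure (span (eigenvectors \<T>))"
  have W: "subspace W" "closed W" by (simp_all add: W_def subspace_closure subspace_span)
  have WJ: "mult_i x \<in> W" if "x \<in> W" for x
    unfolding W_def
  proof (rule closure_span_mult_i)
    fix x assume "x \<in> eigenvectors \<T>"
    then obtain \<mu> :: real where "(x, \<mu> *\<^sub>R x) \<in> \<T>" by (auto simp: eigenvectors_def)
    then have "(mult_i x, mult_i (\<mu> *\<^sub>R x)) \<in> \<T>" by (rule closure_mult_i[rotated]) (rule dirac_graph_mult_i)
    then show "mult_i x \<in> eigenvectors \<T>" by (auto simp: eigenvectors_def linear_scale[OF linear_mult_i])
  qed (use that in \<open>simp add: W_def\<close>)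
  have secW: "sec s k \<alpha> \<beta> \<in> W" if "ccont \<alpha>" "ccont \<beta>" for s k \<alpha> \<beta>
    unfolding W_def by (rule subsetD[OF sector_space_eigenvectors[of s k]])
      (use that in \<open>auto simp: sector_space_def intro!: subsetD[OF closure_subset]\<close>)
  have "v \<in> W" for v
  proof -
    obtain m where m: "m \<in> W" "\<And>y. y \<in> W \<Longrightarrow> (v - m) \<bullet> y = 0" using orthogonal_projection[OF W] by metis
    obtain g where g: "g \<in> l2_space" "v - m = cls g" by (metis l2_cases)
    have perp: "cls g \<bullet> y = 0" if "y \<in> W" for y using m(2)[OF that] g(2) by simp
    \<comment> \<open>Natural \<open>R\<close> suffice: the null sets are countable in number, and
      every point lies inside one of the discs.\<close>
    have AE1: "AE p in lborel. cutoff (real R) ((norm p)\<^sup>2) *\<^sub>R g p $ i = 0" for R :: nat and i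
    proof -
      let ?\<eta> = "\<lambda>p :: real^2. cutoff (real R) ((norm p)\<^sup>2)"
      let ?S = "cball 0 (sqrt (real R + 1)) :: (real^2) set"
      define F :: "(real^2 \<Rightarrow> complex) \<Rightarrow> spinor_field" where "F P p = axis i (P p * of_real (?\<eta> p))" for P p
      have \<eta>c: "continuous_on UNIV ?\<eta>" by (intro continuous_on_compose2[OF continuous_on_cutoff(1)[of UNIV]] continuous_intros) auto
      have \<eta>0: "?\<eta> p = 0" if "p \<notin> ?S" for p
      proof -
        have "sqrt (real R + 1) \<le> norm p" using that by simp
        then have "(sqrt (real R + 1))\<^sup>2 \<le> (norm p)\<^sup>2" by (intro power_mono) auto
        then show ?thesis by (simp add: cutoff_props)
      qed
      have Fl2: "F P \<in> l2_space" if "continuous_on UNIV P" for P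
      proof (rule continuous_bounded_support_l2)
        have cc: "continuous_on UNIV (\<lambda>p. P p * of_real (?\<eta> p))" by (intro continuous_intros that \<eta>c)
        show "continuous_on UNIV (F P)"
          unfolding F_def[abs_def] axis_def
          by (rule continuous_on_complex2; cases "i = 1"; cases "i = 2") (use cc in simp_all)
        have "F P p = 0" if "p \<notin> ?S" for p using \<eta>0[OF that] by (simp add: F_def axis_def vec_eq_iff)
        then have "{p. F P p \<noteq> 0} \<subseteq> ?S" by blast
        then show "bounded {p. F P p \<noteq> 0}" by (rule bounded_subset[OF bounded_cball])
      qed
      have zcc: "continuous_on UNIV zc" by (rule linear_continuous_on[OF bounded_linear_zc])
      let ?m = "\<lambda>a b p. zc p ^ a * cnj (zc p) ^ b"
      have mc: "continuous_on UNIV (?m a b)" for a b by (intro continuous_intros zcc)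
      \<comment> \<open>Multipliers whose product with every monomial stays in \<open>W\<close>
        after cutting off. Quantifying over \<open>a\<close> and \<open>b\<close> makes the set
        stable under multiplication by \<open>zc\<close> and its conjugate, hence by the
        coordinates, so the induction over real polynomials can pass through products.\<close>
      define \<G> where "\<G> = {P. continuous_on UNIV P \<and> (\<forall>a b. cls (F (\<lambda>p. P p * ?m a b p)) \<in> W)}"
      have Fscale: "cls (F (\<lambda>p. z * P p)) \<in> W" if "continuous_on UNIV P" "cls (F P) \<in> W" for z P
      proof -
        have "F (\<lambda>p. z * P p) = (\<lambda>p. z *s F P p)" by (auto simp: F_def axis_def vec_eq_iff)
        then have "cls (F (\<lambda>p. z * P p)) = Re z *\<^sub>R cls (F P) + Im z *\<^sub>R mult_i (cls (F P))"
          by (simp add: cls_mult_complex Fl2 that)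
        then show ?thesis using WJ[OF that(2)] that(2) by (simp add: subspace_add subspace_scale W)
      qed
      have \<eta>cc: "ccont (\<lambda>t. t ^ n * cutoff (real R) t)" for n
        by (rule ccont_mult) (auto simp: ccont_def cutoff_props continuous_on_cutoff intro!: continuous_intros exI[of _ "real R + 1"])
      have "cls (F (?m a b)) \<in> W" for a b
      proof (cases "i = 1")
        case True
        show ?thesis
        \<comment> \<open>The smaller exponent becomes a power of \<open>|p|^2\<close>, and the sign
          of \<open>a - b\<close> selects the sector. When the profile sits in the second slot the
          index is lower by one, as that slot carries the exponent \<open>k + 1\<close>.\<close>
        proof (cases "b \<le> a")
          case le: True
          have "F (?m a b) = sector c True (a - b) (\<lambda>t. t ^ b * cutoff (real R) t) (\<lambda>t. 0)"
            by (auto simp: fun_eq_iff F_def vec_eq_iff forall_2 sector_nth axis_def True power_mult_cnj_power(1)[OF le])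
          then show ?thesis using secW[OF \<eta>cc ccont_0] by simp
        next
          case False
          then have le: "a \<le> b" and s: "Suc (b - Suc a) = b - a" by auto
          have "F (?m a b) = sector c False (b - a - 1) (\<lambda>t. 0) (\<lambda>t. t ^ a * cutoff (real R) t)"
            using s by (auto simp: fun_eq_iff F_def vec_eq_iff forall_2 sector_nth axis_def True power_mult_cnj_power(2)[OF le] simp flip: power_Suc)
          then show ?thesis using secW[OF ccont_0 \<eta>cc] by simp
        qed
      next
        case False
        then have i: "i = 2" using exhaust_2 by blast
        have "cls (F (\<lambda>p. c * ?m a b p)) \<in> W"
        proof (cases "a \<le> b")
          case le: True
          have "F (\<lambda>p. c * ?m a b p) = sector c False (b - a) (\<lambda>t. t ^ a * cutoff (real R) t) (\<lambda>t. 0)"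
            by (auto simp: fun_eq_iff F_def vec_eq_iff forall_2 sector_nth axis_def i power_mult_cnj_power(2)[OF le])
          then show ?thesis using secW[OF \<eta>cc ccont_0] by simp
        next
          case False
          then have le: "b \<le> a" and s: "Suc (a - Suc b) = a - b" by auto
          have "F (\<lambda>p. c * ?m a b p) = sector c True (a - b - 1) (\<lambda>t. 0) (\<lambda>t. t ^ b * cutoff (real R) t)"
            using s by (auto simp: fun_eq_iff F_def vec_eq_iff forall_2 sector_nth axis_def i power_mult_cnj_power(1)[OF le] simp flip: power_Suc)
          then show ?thesis using secW[OF ccont_0 \<eta>cc] by simp
        qed
        \<comment> \<open>The second component of a sector carries the phase \<open>c\<close>. It is
          divided out by a complex scalar, which is allowed because \<open>W\<close> is invariant
          under \<open>mult_i\<close>.\<close>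
        then have "cls (F (\<lambda>p. inverse c * (c * ?m a b p))) \<in> W"
          by (rule Fscale[rotated]) (intro continuous_intros zcc)
        moreover have "inverse c * (c * w) = w" for w
        using c left_inverse[of c] by (metis mult.assoc mult_1 norm_zero zero_neq_one)
        ultimately show ?thesis by simp
      qed
      then have one: "(\<lambda>p. 1) \<in> \<G>" by (simp add: \<G>_def)
      have add: "(\<lambda>p. P p + Q p) \<in> \<G>" if "P \<in> \<G>" "Q \<in> \<G>" for P Q
      proof -
        have cPQ: "continuous_on UNIV P" "continuous_on UNIV Q" using that by (auto simp: \<G>_def)
        have "cls (F (\<lambda>p. (P p + Q p) * ?m a b p)) = cls (F (\<lambda>p. P p * ?m a b p)) + cls (F (\<lambda>p. Q p * ?m a b p))" for a b
        proof -
          have "F (\<lambda>p. (P p + Q p) * ?m a b p) = (\<lambda>p. F (\<lambda>p. P p * ?m a b p) p + F (\<lambda>p. Q p * ?m a b p) p)"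
            by (auto simp: fun_eq_iff F_def vec_eq_iff axis_def distrib_right)
          then show ?thesis by (simp only:) (intro cls_ops(1)[symmetric] Fl2 continuous_on_mult mc cPQ)
        qed
        then show ?thesis using that cPQ by (auto simp: \<G>_def subspace_add[OF W(1)] intro!: continuous_intros)
      qed
      have scale: "(\<lambda>p. z * P p) \<in> \<G>" if "P \<in> \<G>" for z P
      proof -
        have cP: "continuous_on UNIV P" using that by (auto simp: \<G>_def)
        have "cls (F (\<lambda>p. z * P p * ?m a b p)) \<in> W" for a b
          unfolding mult.assoc by (rule Fscale) (use that cP in \<open>auto simp: \<G>_def intro!: continuous_on_mult mc\<close>)
        then show ?thesis using cP by (auto simp: \<G>_def intro!: continuous_intros)
      qed
      have z: "(\<lambda>p. zc p * P p) \<in> \<G>" "(\<lambda>p. cnj (zc p) * P p) \<in> \<G>" if "P \<in> \<G>" for P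
      proof -
        have cP: "continuous_on UNIV P" using that by (auto simp: \<G>_def)
        have 1: "zc p * P p * ?m a b p = P p * ?m (Suc a) b p" "cnj (zc p) * P p * ?m a b p = P p * ?m a (Suc b) p" for a b p
          by (simp_all add: mult_ac)
        have 2: "cls (F (\<lambda>p. P p * ?m a b p)) \<in> W" for a b using that by (simp add: \<G>_def)
        have 3: "continuous_on UNIV (\<lambda>p. zc p * P p)" "continuous_on UNIV (\<lambda>p. cnj (zc p) * P p)"
          by (intro continuous_intros zcc cP)+
        show "(\<lambda>p. zc p * P p) \<in> \<G>" "(\<lambda>p. cnj (zc p) * P p) \<in> \<G>"
          unfolding \<G>_def mem_Collect_eq 1 using 2 3 by blast+
      qed
      have coord: "(\<lambda>p. of_real (x * p $ 1 + y * p $ 2) * P p) \<in> \<G>" if "P \<in> \<G>" for x y P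
      proof -
        have "(\<lambda>p. Complex (x/2) (- y/2) * (zc p * P p) + Complex (x/2) (y/2) * (cnj (zc p) * P p)) \<in> \<G>"
          by (intro add scale z that)
        moreover have "Complex (x/2) (- y/2) * (zc p * w) + Complex (x/2) (y/2) * (cnj (zc p) * w) = of_real (x * p $ 1 + y * p $ 2) * w" for p w
        proof -
          have "Complex (x/2) (- y/2) * zc p + Complex (x/2) (y/2) * cnj (zc p) = of_real (x * p $ 1 + y * p $ 2)"
            by (simp add: zc_def complex_eq_iff)
          then show ?thesis by (simp only: mult.assoc[symmetric] distrib_right[symmetric])
        qed
        ultimately show ?thesis by simp
      qed
      have "\<forall>P\<in>\<G>. (\<lambda>p. of_real (Q p) * P p) \<in> \<G>" if "real_polynomial_function Q" for Q :: "real^2 \<Rightarrow> real"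
        using that
      proof (induction rule: real_polynomial_function.induct)
        case (linear f)
        have f: "f p = f (axis 1 1) * p $ 1 + f (axis 2 1) * p $ 2" for p
        proof -
          have "p = p $ 1 *\<^sub>R axis 1 1 + p $ 2 *\<^sub>R axis 2 1" by (simp add: vec_eq_iff forall_2 axis_def)
          then have "f p = f (p $ 1 *\<^sub>R axis 1 1 + p $ 2 *\<^sub>R axis 2 1)" by simp
          also have "\<dots> = f (axis 1 1) * p $ 1 + f (axis 2 1) * p $ 2"
            using linear by (simp add: linear_simps mult.commute)
          finally show ?thesis .
        qed
        show ?case using coord[of _ "f (axis 1 1)" "f (axis 2 1)"] by (simp flip: f)
      next
        case (const x) then show ?case using scale by blast
      next
        case (add f h)
        then show ?case using \<open>\<And>Q P. P \<in> \<G> \<Longrightarrow> Q \<in> \<G> \<Longrightarrow> (\<lambda>p. P p + Q p) \<in> \<G>\<close> by (simp add: distrib_right)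
      next
        case (mult f h)
        then show ?case by (simp add: mult.assoc)
      qed
      then have poly\<G>: "(\<lambda>p. of_real (Q p)) \<in> \<G>" if "real_polynomial_function Q" for Q :: "real^2 \<Rightarrow> real"
        using that one by fastforce
      have polyW: "cls (F (\<lambda>p. z * of_real (Q p))) \<in> W \<and> F (\<lambda>p. z * of_real (Q p)) \<in> l2_space"
        if "real_polynomial_function Q" for z and Q :: "real^2 \<Rightarrow> real"
      proof -
        have 1: "(\<lambda>p. z * of_real (Q p)) \<in> \<G>" by (intro scale poly\<G> that)
        then have "\<forall>a b. cls (F (\<lambda>p. z * of_real (Q p) * ?m a b p)) \<in> W" by (simp add: \<G>_def)
        from this[rule_format, of 0 0] 1 show ?thesis by (simp add: \<G>_def Fl2)
      qed
      \<comment> \<open>Taking \<open>z = 1\<close> and \<open>z = \<i>\<close> separates the real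
        and imaginary parts of the component.\<close>
      have AEz: "AE p in lborel. ?\<eta> p * (g p $ i \<bullet> z) = 0" for z :: complex
      proof (rule polynomial_moments_zero_imp_AE_zero[where S = ?S])
        have eq: "g p \<bullet> F (\<lambda>p. z * of_real (Q p)) p = Q p * (?\<eta> p * (g p $ i \<bullet> z))" for Q p
          by (simp add: F_def inner_axis inner_complex_def algebra_simps)
        have c1: "real_polynomial_function (\<lambda>p::real^2. 1)" by blast
        show "integrable lborel (\<lambda>p. ?\<eta> p * (g p $ i \<bullet> z))"
          using l2_inner_integrable[OF g(1) conjunct2[OF polyW[OF c1]], of z] by (simp add: eq[where Q = "\<lambda>p. 1", simplified])
        show "compact ?S" by simp
        show "?\<eta> p * (g p $ i \<bullet> z) = 0" if "p \<notin> ?S" for p using \<eta>0[OF that] by simp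
        show "(LINT p|lborel. Q p * (?\<eta> p * (g p $ i \<bullet> z))) = 0" if "real_polynomial_function Q" for Q
          using perp[of "cls (F (\<lambda>p. z * of_real (Q p)))"] polyW[OF that, of z] by (simp add: cls_ops g eq)
      qed
      show ?thesis
        using AEz[of 1] AEz[of \<i>] by eventually_elim (auto simp: inner_complex_def complex_eq_iff)
    qed
    have "AE p in lborel. \<forall>R :: nat. \<forall>i. cutoff (real R) ((norm p)\<^sup>2) *\<^sub>R g p $ i = 0"
      unfolding AE_all_countable using AE1 by blast
    then have "AE p in lborel. g p = 0"
    proof eventually_elim
      case (elim p)
      obtain R where "(norm p)\<^sup>2 \<le> real R" using real_arch_simple by blast
      then have "cutoff (real R) ((norm p)\<^sup>2) > 0" by (intro cutoff_props) simp
      then have "g p $ i = 0" for i using elim[rule_format, of R i] by simp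
      then show ?case by (simp add: vec_eq_iff)
    qed
    then have "cls g = cls (\<lambda>p. 0)" using g by (simp add: cls_eq_iff)
    then have "v - m = 0" unfolding g(2) zero_l2_def .
    then have "v = m" by simp
    then show ?thesis using m by simp
  qed
  then show ?thesis by (auto simp: W_def)
qed

end

theorem theorem3p4:
  fixes \<gamma> :: real and e :: "2 \<Rightarrow> complex^2^2"
  assumes "clifford_matrices e"
    and "0 < \<gamma>" and "\<gamma> < 1"
  shows "has_pure_point_spectrum (magnetic_dirac_operator e (potential \<gamma>)) \<and>
    closure (eigenvalues (magnetic_dirac_operator e (potential \<gamma>))) = \<real>"
proof -
  obtain c where "magnetic_dirac_setting \<gamma> e c" using clifford_matrices_setting[OF assms] by blast
  then interpret magnetic_dirac_setting \<gamma> e c .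
  show ?thesis
    unfolding magnetic_dirac_operator_def dirac_graph_def[symmetric]
  proof (rule pure_point_dense_criterion[OF dirac_graph_l2 dirac_graph_subspace dirac_graph_mult_i])
    show "closure (span (eigenvectors (closure (cls_graph dirac_graph)))) = UNIV"
      by (rule eigenvectors_complete)
    show "y \<bullet> x' = x \<bullet> y'" if "(x, y) \<in> cls_graph dirac_graph" "(x', y') \<in> cls_graph dirac_graph" for x y x' y'
      using that by (rule dirac_graph_symmetric)
    show "\<exists>x y. (x, y) \<in> \<T> \<and> norm (y - \<kappa> *\<^sub>R x) < \<epsilon> * norm x" if "\<epsilon> > 0" for \<kappa> \<epsilon>
      using that by (rule weyl_pair)
  qed
qed

end
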